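(* Let $\vec u\in H^1_0(\Omega)^d$ satisfy $(\boldsymbol\sigma(\boldsymbol\varepsilon(\vec u)),\boldsymbol\varepsilon(\vec v))=(\vec f,\vec v)$ for all $\vec v\in H^1_0(\Omega)^d$, and let $\vec u_h\in H^1_0(\Omega)^d\cap[\mathbb P_p(\mathcal T_h)]^d$ satisfy $(\boldsymbol\sigma(\boldsymbol\varepsilon(\vec u_h)),\boldsymbol\varepsilon(\vec v_h))=(\vec f,\vec v_h)$ for all $\vec v_h\in H^1_0(\Omega)^d\cap[\mathbb P_p(\mathcal T_h)]^d$. Let $\boldsymbol\sigma_h:=\sum_{a\in\mathcal V_h}\boldsymbol\sigma_h^a$, where $\boldsymbol\sigma_h^a$ is the (zero-extended) stress component of the solution of the local patch problem on $\omega_a$ with data $\mathbf G=\psi_a\boldsymbol\sigma(\boldsymbol\varepsilon(\vec u_h))$ and $\vec g=-\psi_a\vec f+\boldsymbol\sigma(\boldsymbol\varepsilon(\vec u_h))\nabla\psi_a$. Then $$\|\vec u-\vec u_h\|_{\rm en}\le\sqrt2\,C_{\rm gro}C_{\rm mon}^{-3}\Big(\sum_{T\in\mathcal T_h}\Big(\frac{h_T}{\pi}\|\vec f+\nabla\cdot\boldsymbol\sigma_h\|_T+\|\boldsymbol\sigma_h-\boldsymbol\sigma(\boldsymbol\varepsilon(\vec u_h))\|_T\Big)^2\Big)^{1/2}.$$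
   Context: Let $\Omega\subset\mathbb R^d$, $d\in\{2,3\}$, be a bounded, simply connected polyhedral domain and $\vec f\in L^2(\Omega)^d$. For tensors, $\boldsymbol\tau:\boldsymbol\eta=\mathrm{tr}(\boldsymbol\tau^T\boldsymbol\eta)$ and $|\boldsymbol\tau|^2=\boldsymbol\tau:\boldsymbol\tau$. The map $\boldsymbol\sigma:\mathbb R^{d\times d}_{\rm sym}\to\mathbb R^{d\times d}_{\rm sym}$ is continuous with $\boldsymbol\sigma(\mathbf 0)=\mathbf 0$, and there are $C_{\rm gro},C_{\rm mon}>0$ with $|\boldsymbol\sigma(\boldsymbol\tau)|\le C_{\rm gro}|\boldsymbol\tau|$ and $(\boldsymbol\sigma(\boldsymbol\tau)-\boldsymbol\sigma(\boldsymbol\eta)):(\boldsymbol\tau-\boldsymbol\eta)\ge C_{\rm mon}^2|\boldsymbol\tau-\boldsymbol\eta|^2$ for all symmetric $\boldsymbol\tau,\boldsymbol\eta$. $\boldsymbol\varepsilon(\vec v)=\frac12(\nabla\vec v+\nabla\vec v^T)$. $(\cdot,\cdot)_X$, $\|\cdot\|_X$ are the $L^2(X)$ inner product and norm (subscript omitted for $X=\Omega$). The energy norm is $\|\vec v\|_{\rm en}^2:=(\boldsymbol\sigma(\boldsymbol\varepsilon(\vec v)),\boldsymbol\varepsilon(\vec v))$. $H(\mathrm{div},X)$ is the space of tensor fields in $L^2(X)^{d\times d}$ whose row-wise divergence lies in $L^2(X)^d$. $\mathcal T_h$ is a conforming simplicial mesh of $\Omega$ with a uniform minimum-angle bound; $h_T$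 is the diameter of $T$; $\mathcal V_h$ is its set of vertices, split into interior vertices $\mathcal V_h^{\rm int}$ and boundary vertices $\mathcal V_h^{\rm ext}$; for $a\in\mathcal V_h$, $\mathcal T_a$ is the set of elements containing $a$, $\omega_a$ the corresponding open patch, and $\psi_a$ the continuous piecewise-linear hat function equal to $1$ at $a$ and $0$ at the other vertices. $\mathbb P_p(T)$ denotes polynomials of total degree $\le p$ on $T$ and $\mathbb P_p(\mathcal T_h)$ the broken polynomial space. The integer $p\ge2$ is fixed. Arnold–Falk–Winther patch spaces: $\boldsymbol\Sigma_T=[\mathbb P_p(T)]^{d\times d}$, $\vec V_T=[\mathbb P_{p-1}(T)]^d$, $\boldsymbol\Lambda_T=\{\boldsymbol\mu\in[\mathbb P_{p-1}(T)]^{d\times d}:\boldsymbol\mu=-\boldsymbol\mu^T\}$. $\boldsymbol\Sigma_h(\omega_a)$ is the set of $H(\mathrm{div},\omega_a)$ fields lying in $\boldsymbol\Sigma_T$ on each $T\in\mathcal T_a$; $\vec V_h(\omega_a)$, $\boldsymbol\Lambda_h(\omega_a)$ are the fields lying elementwise in $\vec V_T$, $\boldsymbol\Lambda_T$. $\vec{RM}^d$ is the space of rigid body motions. For $a\in\mathcal V_h^{\rm int}$: $\boldsymbol\Sigma_h^a=\{\boldsymbol\tau\in\boldsymbol\Sigma_h(\omega_a):\boldsymbol\tau\vec n_{\omega_a}=\vec0\text{ on }\partial\omega_a\}$, $\vec V_h^a=\{\vec v\in\vec V_h(\omega_a):(\vec v,\vec z)_{\omega_a}=0\ \forall\vec z\in\vec{RM}^d\}$;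 for $a\in\mathcal V_h^{\rm ext}$: $\boldsymbol\Sigma_h^a=\{\boldsymbol\tau\in\boldsymbol\Sigma_h(\omega_a):\boldsymbol\tau\vec n_{\omega_a}=\vec0\text{ on }\partial\omega_a\setminus\partial\Omega\}$, $\vec V_h^a=\vec V_h(\omega_a)$; always $\boldsymbol\Lambda_h^a=\boldsymbol\Lambda_h(\omega_a)$. Local patch problem with data $(\mathbf G,\vec g)$: find $(\boldsymbol\sigma_h^a,\vec r_h^a,\boldsymbol\lambda_h^a)\in\boldsymbol\Sigma_h^a\times\vec V_h^a\times\boldsymbol\Lambda_h^a$ such that for all $(\boldsymbol\tau_h,\vec v_h,\boldsymbol\mu_h)\in\boldsymbol\Sigma_h^a\times\vec V_h^a\times\boldsymbol\Lambda_h^a$: $(\boldsymbol\sigma_h^a,\boldsymbol\tau_h)_{\omega_a}+(\vec r_h^a,\nabla\cdot\boldsymbol\tau_h)_{\omega_a}+(\boldsymbol\lambda_h^a,\boldsymbol\tau_h)_{\omega_a}=(\mathbf G,\boldsymbol\tau_h)_{\omega_a}$, $(\nabla\cdot\boldsymbol\sigma_h^a,\vec v_h)_{\omega_a}=(\vec g,\vec v_h)_{\omega_a}$, $(\boldsymbol\sigma_h^a,\boldsymbol\mu_h)_{\omega_a}=0$. *)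

theory Defs
  imports "HOL-Analysis.Analysis"
begin

definition L2 :: "(real^'n) set \<Rightarrow> (real^'n \<Rightarrow> 'b::euclidean_space) \<Rightarrow> bool" where
  "L2 X f \<longleftrightarrow> f \<in> borel_measurable (lebesgue_on X)
      \<and> integrable (lebesgue_on X) (\<lambda>x. (norm (f x))\<^sup>2)"

text \<open>L2 inner product and norm; on tensors the inner product of real^'n^'n is
  the Frobenius product tau:eta and norm is |tau|.\<close>
definition ip :: "(real^'n) set \<Rightarrow> (real^'n \<Rightarrow> 'b::euclidean_space) \<Rightarrow> (real^'n \<Rightarrow> 'b) \<Rightarrow> real" where
  "ip X f g = integral\<^sup>L (lebesgue_on X) (\<lambda>x. f x \<bullet> g x)"

definition L2norm :: "(real^'n) set \<Rightarrow> (real^'n \<Rightarrow> 'b::euclidean_space) \<Rightarrow> real" where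
  "L2norm X f = sqrt (integral\<^sup>L (lebesgue_on X) (\<lambda>x. (norm (f x))\<^sup>2))"

definition pd :: "'n \<Rightarrow> (real^'n \<Rightarrow> real) \<Rightarrow> real^'n \<Rightarrow> real" where
  "pd j \<phi> x = frechet_derivative \<phi> (at x) (axis j 1)"

text \<open>C^1 functions with compact support in the open set U (density of C^infty_c makes
  weak derivatives defined with these test functions coincide with the usual ones).\<close>
definition testfun :: "(real^'n) set \<Rightarrow> (real^'n \<Rightarrow> real) \<Rightarrow> bool" where
  "testfun U \<phi> \<longleftrightarrow> (\<forall>x. \<phi> differentiable (at x)) \<and> (\<forall>j. continuous_on UNIV (pd j \<phi>))
      \<and> compact (closure {x. \<phi> x \<noteq> 0}) \<and> closure {x. \<phi> x \<noteq> 0} \<subseteq> U"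

definition has_weak_grad :: "(real^'n) set \<Rightarrow> (real^'n \<Rightarrow> real^'n) \<Rightarrow> (real^'n \<Rightarrow> real^'n^'n) \<Rightarrow> bool" where
  "has_weak_grad U u G \<longleftrightarrow> L2 U u \<and> L2 U G \<and>
     (\<forall>i j \<phi>. testfun U \<phi> \<longrightarrow>
        integral\<^sup>L (lebesgue_on U) (\<lambda>x. u x $ i * pd j \<phi> x)
        = - integral\<^sup>L (lebesgue_on U) (\<lambda>x. G x $ i $ j * \<phi> x))"

definition weak_grad :: "(real^'n) set \<Rightarrow> (real^'n \<Rightarrow> real^'n) \<Rightarrow> (real^'n \<Rightarrow> real^'n^'n)" where
  "weak_grad U u = (SOME G. has_weak_grad U u G)"

definition has_weak_grad_s :: "(real^'n) set \<Rightarrow> (real^'n \<Rightarrow> real) \<Rightarrow> (real^'n \<Rightarrow> real^'n) \<Rightarrow> bool" where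
  "has_weak_grad_s U u g \<longleftrightarrow> L2 U u \<and> L2 U g \<and>
     (\<forall>j \<phi>. testfun U \<phi> \<longrightarrow>
        integral\<^sup>L (lebesgue_on U) (\<lambda>x. u x * pd j \<phi> x)
        = - integral\<^sup>L (lebesgue_on U) (\<lambda>x. g x $ j * \<phi> x))"

definition weak_grad_s :: "(real^'n) set \<Rightarrow> (real^'n \<Rightarrow> real) \<Rightarrow> (real^'n \<Rightarrow> real^'n)" where
  "weak_grad_s U u = (SOME g. has_weak_grad_s U u g)"

definition has_weak_div :: "(real^'n) set \<Rightarrow> (real^'n \<Rightarrow> real^'n^'n) \<Rightarrow> (real^'n \<Rightarrow> real^'n) \<Rightarrow> bool" where
  "has_weak_div U \<tau> D \<longleftrightarrow> L2 U \<tau> \<and> L2 U D \<and>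
     (\<forall>i \<phi>. testfun U \<phi> \<longrightarrow>
        integral\<^sup>L (lebesgue_on U) (\<lambda>x. \<Sum>j\<in>UNIV. \<tau> x $ i $ j * pd j \<phi> x)
        = - integral\<^sup>L (lebesgue_on U) (\<lambda>x. D x $ i * \<phi> x))"

definition weak_div :: "(real^'n) set \<Rightarrow> (real^'n \<Rightarrow> real^'n^'n) \<Rightarrow> (real^'n \<Rightarrow> real^'n)" where
  "weak_div U \<tau> = (SOME D. has_weak_div U \<tau> D)"

definition Hdiv :: "(real^'n) set \<Rightarrow> (real^'n \<Rightarrow> real^'n^'n) \<Rightarrow> bool" where
  "Hdiv U \<tau> \<longleftrightarrow> L2 U \<tau> \<and> (\<exists>D. has_weak_div U \<tau> D)"

definition eps :: "(real^'n) set \<Rightarrow> (real^'n \<Rightarrow> real^'n) \<Rightarrow> real^'n \<Rightarrow> real^'n^'n" where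
  "eps U v x = (1/2) *\<^sub>R (weak_grad U v x + transpose (weak_grad U v x))"

definition H10 :: "(real^'n) set \<Rightarrow> (real^'n \<Rightarrow> real^'n) \<Rightarrow> bool" where
  "H10 U u \<longleftrightarrow> (\<exists>G. has_weak_grad U u G \<and>
     (\<exists>\<phi> :: nat \<Rightarrow> real^'n \<Rightarrow> real^'n.
        (\<forall>k i. testfun U (\<lambda>x. \<phi> k x $ i)) \<and>
        (\<lambda>k. L2norm U (\<lambda>x. \<phi> k x - u x)) \<longlonglongrightarrow> 0 \<and>
        (\<lambda>k. L2norm U (\<lambda>x. (\<chi> i j. pd j (\<lambda>y. \<phi> k y $ i) x) - G x)) \<longlonglongrightarrow> 0))"

definition poly_deg :: "nat \<Rightarrow> (real^'n \<Rightarrow> real) \<Rightarrow> bool" where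
  "poly_deg p f \<longleftrightarrow> (\<exists>c :: ('n \<Rightarrow> nat) \<Rightarrow> real.
     \<forall>x. f x = (\<Sum>\<alpha>\<in>{\<alpha>. sum \<alpha> UNIV \<le> p}. c \<alpha> * (\<Prod>i\<in>UNIV. (x $ i) ^ (\<alpha> i))))"

definition polyfun :: "nat \<Rightarrow> (real^'n \<Rightarrow> 'b::euclidean_space) \<Rightarrow> bool" where
  "polyfun p P \<longleftrightarrow> (\<forall>b\<in>Basis. poly_deg p (\<lambda>x. P x \<bullet> b))"

text \<open>a mesh element is given by its vertex set K; the element is convex hull K.
  f lies elementwise in P_p on the elements Ks.\<close>
definition pw_poly :: "nat \<Rightarrow> (real^'n) set set \<Rightarrow> (real^'n \<Rightarrow> 'b::euclidean_space) \<Rightarrow> bool" where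
  "pw_poly p Ks f \<longleftrightarrow> (\<forall>K\<in>Ks. \<exists>P. polyfun p P \<and> (\<forall>x\<in>interior (convex hull K). f x = P x))"

definition simplicial_mesh :: "(real^'n) set \<Rightarrow> (real^'n) set set \<Rightarrow> bool" where
  "simplicial_mesh \<Omega> Th \<longleftrightarrow> finite Th \<and>
     (\<forall>K\<in>Th. card K = CARD('n) + 1 \<and> \<not> affine_dependent K) \<and>
     (\<forall>K\<in>Th. \<forall>L\<in>Th. convex hull K \<inter> convex hull L = convex hull (K \<inter> L)) \<and>
     \<Union>((\<lambda>K. convex hull K) ` Th) = closure \<Omega> \<and>
     \<Omega> = interior (\<Union>((\<lambda>K. convex hull K) ` Th))"

definition vertices :: "(real^'n) set set \<Rightarrow> (real^'n) set" where
  "vertices Th = \<Union>Th"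

definition star :: "(real^'n) set set \<Rightarrow> real^'n \<Rightarrow> (real^'n) set set" where
  "star Th a = {K\<in>Th. a \<in> K}"

definition patch :: "(real^'n) set set \<Rightarrow> real^'n \<Rightarrow> (real^'n) set" where
  "patch Th a = interior (\<Union>((\<lambda>K. convex hull K) ` star Th a))"

definition bary :: "(real^'n) set \<Rightarrow> real^'n \<Rightarrow> real^'n \<Rightarrow> real" where
  "bary K a x = (THE t. \<exists>c. (\<forall>v\<in>K. 0 \<le> c v) \<and> sum c K = 1 \<and> (\<Sum>v\<in>K. c v *\<^sub>R v) = x \<and> c a = t)"

definition hat :: "(real^'n) set set \<Rightarrow> real^'n \<Rightarrow> real^'n \<Rightarrow> real" where
  "hat Th a x = (if \<exists>K\<in>Th. a \<in> K \<and> x \<in> convex hull K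
       then bary (SOME K. K \<in> Th \<and> a \<in> K \<and> x \<in> convex hull K) a x else 0)"

definition rigid_motions :: "(real^'n \<Rightarrow> real^'n) set" where
  "rigid_motions = {z. \<exists>(A::real^'n^'n) b. (\<forall>i j. A $ i $ j = - A $ j $ i) \<and> z = (\<lambda>x. b + A *v x)}"

section \<open>Arnold--Falk--Winther patch spaces\<close>

text \<open>normal trace condition tau n = 0 on the part of the patch boundary not in frontier Omega
  (all of it for interior vertices), in weak form: Green's formula against test functions
  whose support avoids the excluded part of the boundary.\<close>
definition Sigma_a :: "(real^'n) set \<Rightarrow> (real^'n) set set \<Rightarrow> nat \<Rightarrow> real^'n \<Rightarrow> (real^'n \<Rightarrow> real^'n^'n) \<Rightarrow> bool" where
  "Sigma_a \<Omega> Th p a \<tau> \<longleftrightarrow> Hdiv (patch Th a) \<tau> \<and> pw_poly p (star Th a) \<tau> \<and>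
     (\<forall>i \<phi>. testfun (if a \<in> \<Omega> then UNIV else - frontier \<Omega>) \<phi> \<longrightarrow>
        integral\<^sup>L (lebesgue_on (patch Th a)) (\<lambda>x. \<Sum>j\<in>UNIV. \<tau> x $ i $ j * pd j \<phi> x)
        + integral\<^sup>L (lebesgue_on (patch Th a)) (\<lambda>x. weak_div (patch Th a) \<tau> x $ i * \<phi> x) = 0)"

definition V_a :: "(real^'n) set \<Rightarrow> (real^'n) set set \<Rightarrow> nat \<Rightarrow> real^'n \<Rightarrow> (real^'n \<Rightarrow> real^'n) \<Rightarrow> bool" where
  "V_a \<Omega> Th p a v \<longleftrightarrow> pw_poly (p - 1) (star Th a) v \<and>
     (a \<in> \<Omega> \<longrightarrow> (\<forall>z\<in>rigid_motions. ip (patch Th a) v z = 0))"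

definition Lambda_a :: "(real^'n) set set \<Rightarrow> nat \<Rightarrow> real^'n \<Rightarrow> (real^'n \<Rightarrow> real^'n^'n) \<Rightarrow> bool" where
  "Lambda_a Th p a \<mu> \<longleftrightarrow> pw_poly (p - 1) (star Th a) \<mu> \<and>
     (\<forall>x\<in>patch Th a. transpose (\<mu> x) = - \<mu> x)"

definition patch_solution :: "(real^'n) set \<Rightarrow> (real^'n) set set \<Rightarrow> nat \<Rightarrow> real^'n
   \<Rightarrow> (real^'n \<Rightarrow> real^'n^'n) \<Rightarrow> (real^'n \<Rightarrow> real^'n)
   \<Rightarrow> (real^'n \<Rightarrow> real^'n^'n) \<Rightarrow> (real^'n \<Rightarrow> real^'n) \<Rightarrow> (real^'n \<Rightarrow> real^'n^'n) \<Rightarrow> bool" where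
  "patch_solution \<Omega> Th p a G g s r l \<longleftrightarrow>
     Sigma_a \<Omega> Th p a s \<and> V_a \<Omega> Th p a r \<and> Lambda_a Th p a l \<and>
     (\<forall>\<tau>. Sigma_a \<Omega> Th p a \<tau> \<longrightarrow>
        ip (patch Th a) s \<tau> + ip (patch Th a) r (weak_div (patch Th a) \<tau>) + ip (patch Th a) l \<tau>
        = ip (patch Th a) G \<tau>) \<and>
     (\<forall>v. V_a \<Omega> Th p a v \<longrightarrow> ip (patch Th a) (weak_div (patch Th a) s) v = ip (patch Th a) g v) \<and>
     (\<forall>\<mu>. Lambda_a Th p a \<mu> \<longrightarrow> ip (patch Th a) s \<mu> = 0)"

end

theory Submission
  imports Defs
begin

text \<open>Put \<open>e = u - u\<^sub>h\<close>. Monotonicity bounds \<open>C\<^sub>m\<^sub>o\<^sub>n\<^sup>2 \<parallel>\<epsilon>(e)\<parallel>\<^sup>2\<close> by the residual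
  \<open>(f, e) - (\<sigma>(\<epsilon>(u\<^sub>h)), \<nabla>e)\<close>, and since \<open>\<sigma>\<^sub>h\<close> lies in \<open>H(div)\<close> this equals
  \<open>(f + div \<sigma>\<^sub>h, e) + (\<sigma>\<^sub>h - \<sigma>(\<epsilon>(u\<^sub>h)), \<nabla>e)\<close>. The patch problems make \<open>f + div \<sigma>\<^sub>h\<close> orthogonal to the
  constants on every element: for an interior vertex \<open>a\<close> the divergence equation, posed only modulo
  rigid motions \<open>z\<close>, holds for all test functions because the discrete problem tested with \<open>\<psi>\<^sub>a z\<close>
  and the weak symmetry of the local stress supply the compatibility. Poincare's inequality on each
  element then gives the estimator times \<open>\<parallel>\<nabla>e\<parallel>\<close>, and \<open>\<parallel>\<nabla>e\<parallel> \<le> \<surd>2 \<parallel>\<epsilon>(e)\<parallel>\<close> is Korn's first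
  inequality. Finally \<open>C\<^sub>m\<^sub>o\<^sub>n\<^sup>2 \<le> C\<^sub>g\<^sub>r\<^sub>o\<close> absorbs the constants.

  Poincare's inequality on a simplex is proved without the Payne--Weinberger theorem. Coning from
  the vertices one at a time reduces it to a weighted inequality on an interval, with the
  Wright--Fisher energy \<open>\<Sum>\<^sub>w \<lambda>\<^sub>w (\<nabla>f \<bullet> (w - z))\<^sup>2\<close> on the right and the constant \<open>1 / (d + 1)\<close>. By
  Popoviciu's inequality the energy is at most \<open>h\<^sup>2 |\<nabla>f|\<^sup>2 / 4\<close>, so the constant is
  \<open>h\<^sup>2 / (4 (d + 1))\<close>, which is at most \<open>h\<^sup>2 / \<pi>\<^sup>2\<close> for \<open>d \<ge> 2\<close> because \<open>\<pi>\<^sup>2 \<le> 12\<close>.\<close>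

section \<open>Poincare inequality on a simplex\<close>

text \<open>The condition \<open>p \<ge> 2\<close> is what makes rigid motions usable: a hat
  function times a rigid motion is quadratic on each element and must be an admissible discrete test
  function, and a piecewise constant corrected by a rigid motion must lie in the local space of
  degree \<open>p - 1\<close>. Membership of that product in \<open>H10\<close> is the technical
  core. A hat function is only piecewise affine and its support reaches the boundary of the patch,
  so it is first cut off near zero by a C^1 function and then mollified; the cutoff has compact
  support in the domain because the hat function of an interior vertex is positive only inside the
  domain. Poincare's inequality is used in dual form, for the pairing of a mean-zero residual with
  the error. It is therefore proved for C^1 functions, and the pairing is passed to the limit along
  the test functions that define \<open>H10\<close>. The argument ends with the factor
  \<open>sqrt 2 * sqrt Cgro / Cmon\<^sup>2\<close>; monotonicity between the identity matrix and
  zero, combined with the growth bound, turns it into the stated one.\<close>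

text \<open>For a uniform point of an \<open>n\<close>-dimensional cone the relative distance from
  the apex has the density \<open>n * r ^ (n - 1)\<close> on the unit interval.\<close>

definition bavg :: "nat \<Rightarrow> (real \<Rightarrow> real) \<Rightarrow> real" where
  "bavg n F = integral {0..1} (\<lambda>r. real n * r ^ (n - 1) * F r)"

lemma bavg_integrable:
  assumes "continuous_on {0..1} F"
  shows "(\<lambda>r. real n * r ^ (n - 1) * F r) integrable_on {0..1}"
  by (intro integrable_continuous_real continuous_intros assms)

lemma bavg_add:
  assumes "continuous_on {0..1} F" "continuous_on {0..1} G"
  shows "bavg n (\<lambda>r. F r + G r) = bavg n F + bavg n G"
  unfolding bavg_def using integral_add[OF bavg_integrable[OF assms(1)] bavg_integrable[OF assms(2)]]
  by (simp add: algebra_simps)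

lemma bavg_cmult: "bavg n (\<lambda>r. c * F r) = c * bavg n F"
  unfolding bavg_def integral_mult_right[symmetric] by (simp add: algebra_simps)

lemma bavg_diff:
  assumes "continuous_on {0..1} F" "continuous_on {0..1} G"
  shows "bavg n (\<lambda>r. F r - G r) = bavg n F - bavg n G"
  unfolding bavg_def using integral_diff[OF bavg_integrable[OF assms(1)] bavg_integrable[OF assms(2)]]
  by (simp add: algebra_simps)

lemma bavg_mono:
  assumes "continuous_on {0..1} F" "continuous_on {0..1} G" "\<And>r. 0 \<le> r \<Longrightarrow> r \<le> 1 \<Longrightarrow> F r \<le> G r"
  shows "bavg n F \<le> bavg n G"
  unfolding bavg_def
  by (intro integral_le bavg_integrable assms mult_left_mono) auto

lemma bavg_sum:
  assumes "finite I" "\<And>i. i \<in> I \<Longrightarrow> continuous_on {0..1} (F i)"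
  shows "bavg n (\<lambda>r. \<Sum>i\<in>I. F i r) = (\<Sum>i\<in>I. bavg n (F i))"
  using assms
proof (induction I rule: finite_induct)
  case empty
  then show ?case by (simp add: bavg_def)
next
  case (insert i I)
  have "continuous_on {0..1} (\<lambda>r. \<Sum>i\<in>I. F i r)"
    using insert by (auto intro!: continuous_intros)
  then show ?case using insert by (simp add: bavg_add)
qed

lemma has_integral_monomial_01: "((\<lambda>r. r ^ n) has_integral (1 / real (Suc n))) {0..1::real}"
proof -
  have "((\<lambda>r. r ^ n) has_integral (1 ^ Suc n / real (Suc n) - 0 ^ Suc n / real (Suc n))) {0..1::real}"
  proof (rule fundamental_theorem_of_calculus)
    fix x :: real
    have "((\<lambda>r. r ^ Suc n / real (Suc n)) has_real_derivative x ^ n) (at x within {0..1})"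
      using DERIV_cdivide[OF DERIV_pow[of "Suc n" x], of "real (Suc n)"]
      by (simp del: of_nat_Suc power_Suc add: has_field_derivative_at_within)
    then show "((\<lambda>r. r ^ Suc n / real (Suc n)) has_vector_derivative x ^ n) (at x within {0..1})"
      by (simp add: has_real_derivative_iff_has_vector_derivative)
  qed simp
  then show ?thesis by simp
qed

lemma bavg_one: "n \<ge> 1 \<Longrightarrow> bavg n (\<lambda>r. 1) = 1"
  using has_integral_mult_right[OF has_integral_monomial_01[of "n - 1"], of "real n"]
  by (simp add: bavg_def integral_unique del: integral_mult_right)

lemma bavg_const: "n \<ge> 1 \<Longrightarrow> bavg n (\<lambda>r. c) = c"
  using bavg_cmult[of n c "\<lambda>r. 1"] bavg_one[of n] by simp

lemma bavg_id: "n \<ge> 1 \<Longrightarrow> bavg n (\<lambda>r. r) = real n / (real n + 1)"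
proof -
  assume n: "n \<ge> 1"
  then have eq: "(\<lambda>r::real. real n * r ^ (n - 1) * r) = (\<lambda>r. real n * r ^ n)"
    by (auto simp: fun_eq_iff power_eq_if)
  show ?thesis
    using has_integral_mult_right[OF has_integral_monomial_01[of n], of "real n"]
    unfolding bavg_def eq by (simp add: integral_unique add.commute del: integral_mult_right)
qed

text \<open>The linear function \<open>r - n/(n+1)\<close> is the first eigenfunction of the Jacobi operator belonging
  to the weight; dividing by it turns the inequality into a pointwise estimate against an exact
  derivative.\<close>
lemma beta_poincare:
  fixes h h' :: "real \<Rightarrow> real" and n :: nat
  assumes n: "n \<ge> 1" and h: "\<And>r. (h has_real_derivative h' r) (at r)" and h': "continuous_on UNIV h'"
  defines "r0 \<equiv> real n / (real n + 1)"
  shows "(real n + 1) * bavg n (\<lambda>r. (h r - h r0)\<^sup>2) \<le> bavg n (\<lambda>r. r * (1 - r) * (h' r)\<^sup>2)"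
proof -
  define H where "H = (\<lambda>r. h r - h r0)"
  \<comment> \<open>The weight \<open>n * r ^ n * (1 - r)\<close> has the derivative
    \<open>- n * (n + 1) * r ^ (n - 1) * (r - r0)\<close>, which is the eigenvalue equation for
    \<open>r - r0\<close> with eigenvalue \<open>n + 1\<close>. \<open>\<Phi>\<close> is the
    corresponding Picone flux; it vanishes at both ends of the interval.\<close>
  define \<Phi> where "\<Phi> = (\<lambda>r. real n * r ^ n * (1 - r) * ((H r)\<^sup>2 / (r - r0)))"
  define D where "D = (\<lambda>r. - (real n * (real n + 1) * r ^ (n - 1) * (r - r0)) * ((H r)\<^sup>2 / (r - r0))
       + real n * r ^ n * (1 - r) * (2 * H r * h' r / (r - r0) - (H r)\<^sup>2 / (r - r0)\<^sup>2))"
  have r0: "0 < r0" "r0 < 1" "r0 * (real n + 1) = n" using n by (auto simp: r0_def field_simps)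
  have pn: "r ^ n = r * r ^ (n - 1)" for r :: real using n by (simp add: power_eq_if)
  have conth: "continuous_on UNIV h"
    using h by (meson DERIV_isCont continuous_at_imp_continuous_on)
  have dH: "(H has_real_derivative h' r) (at r)" for r
    unfolding H_def by (auto intro!: derivative_eq_intros h)
  have der: "(\<Phi> has_real_derivative D r) (at r)" if "r \<noteq> r0" for r
  proof -
    define t where "t = r - r0"
    have t: "t \<noteq> 0" using that by (simp add: t_def)
    have dt: "((\<lambda>r. r - r0) has_real_derivative 1) (at r)" by (auto intro!: derivative_eq_intros)
    have "((\<lambda>r. (H r)\<^sup>2 / (r - r0)) has_real_derivative
        ((2 * H r * h' r) * (r - r0) - (H r)\<^sup>2 * 1) / ((r - r0) * (r - r0))) (at r)"
      by (rule DERIV_divide[OF _ dt]) (use that in \<open>auto intro!: derivative_eq_intros dH\<close>)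
    moreover have "((2 * H r * h' r) * (r - r0) - (H r)\<^sup>2 * 1) / ((r - r0) * (r - r0))
        = 2 * H r * h' r / (r - r0) - (H r)\<^sup>2 / (r - r0)\<^sup>2"
      using t unfolding t_def[symmetric] by (simp add: field_simps power2_eq_square)
    ultimately have dq: "((\<lambda>r. (H r)\<^sup>2 / (r - r0)) has_real_derivative
        2 * H r * h' r / (r - r0) - (H r)\<^sup>2 / (r - r0)\<^sup>2) (at r)" by simp
    have "((\<lambda>r. real n * r ^ n * (1 - r)) has_real_derivative
        real n * (real n * r ^ (n - 1)) * (1 - r) - real n * r ^ n) (at r)"
      by (auto intro!: derivative_eq_intros simp: algebra_simps)
    from DERIV_mult'[OF this dq] have "(\<Phi> has_real_derivative
       (real n * (real n * r ^ (n - 1)) * (1 - r) - real n * r ^ n) * ((H r)\<^sup>2 / (r - r0))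
       + real n * r ^ n * (1 - r) * (2 * H r * h' r / (r - r0) - (H r)\<^sup>2 / (r - r0)\<^sup>2)) (at r)"
      unfolding \<Phi>_def by (simp add: algebra_simps)
    moreover have "real n * (real n * r ^ (n - 1)) * (1 - r) - real n * r ^ n
         = - (real n * (real n + 1) * r ^ (n - 1) * (r - r0))"
    proof -
      have "m * (m * b) * (1 - r) - m * (r * b) = - (m * (m + 1) * b * (r - r0))" if "r0 * (m + 1) = m" for m b
      proof -
        have "m * (m + 1) * b * (r - r0) = m * (m + 1) * b * r - m * b * (r0 * (m + 1))"
          by (simp add: algebra_simps)
        also have "\<dots> = m * (m + 1) * b * r - m * b * m" by (simp only: that)
        finally have e: "m * (m + 1) * b * (r - r0) = m * (m + 1) * b * r - m * b * m" .
        show ?thesis unfolding e by (simp add: algebra_simps)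
      qed
      from this[OF r0(3)] show ?thesis unfolding pn .
    qed
    ultimately show ?thesis unfolding D_def by simp
  qed
  \<comment> \<open>At \<open>r0\<close> the quotient \<open>(H r)\<^sup>2 / (r - r0)\<close> is a
    difference quotient times \<open>H r\<close>, so it tends to 0. This agrees with the value of
    \<open>\<Phi>\<close> there, since division by zero gives 0.\<close>
  have "(\<Phi> \<longlongrightarrow> real n * r0 ^ n * (1 - r0) * (h' r0 * H r0)) (at r0)"
  proof -
    have "((\<lambda>r. real n * r ^ n * (1 - r) * ((h r - h r0) / (r - r0) * H r)) \<longlongrightarrow>
          real n * r0 ^ n * (1 - r0) * (h' r0 * H r0)) (at r0)"
      using h[of r0] DERIV_isCont[OF dH[of r0]]
      by (intro tendsto_intros) (auto simp: has_field_derivative_iff isCont_def)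
    then show ?thesis by (simp add: \<Phi>_def H_def power2_eq_square)
  qed
  then have cont0: "isCont \<Phi> r0" by (simp add: isCont_def \<Phi>_def H_def)
  have cont: "continuous_on S \<Phi>" for S
  proof (rule continuous_at_imp_continuous_on, rule ballI)
    show "isCont \<Phi> r" for r using der[of r] cont0 DERIV_isCont by (cases "r = r0") auto
  qed
  \<comment> \<open>At \<open>r0\<close> itself only continuity of \<open>\<Phi>\<close> is at hand,
    so the fundamental theorem is applied on either side.\<close>
  have "(D has_integral (\<Phi> r0 - \<Phi> 0)) {0..r0}"
    by (rule fundamental_theorem_of_calculus_interior)
       (use r0 der cont in \<open>auto simp: has_real_derivative_iff_has_vector_derivative[symmetric]\<close>)
  moreover have "(D has_integral (\<Phi> 1 - \<Phi> r0)) {r0..1}"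
    by (rule fundamental_theorem_of_calculus_interior)
       (use r0 der cont in \<open>auto simp: has_real_derivative_iff_has_vector_derivative[symmetric]\<close>)
  ultimately have "(D has_integral (\<Phi> r0 - \<Phi> 0 + (\<Phi> 1 - \<Phi> r0))) {0..1}"
    using r0 by (intro has_integral_combine) auto
  moreover have "\<Phi> 0 = 0" "\<Phi> 1 = 0" using n by (auto simp: \<Phi>_def)
  ultimately have D0: "(D has_integral 0) {0..1}" by simp
  have le: "D r \<le> real n * r ^ (n - 1) * (r * (1 - r) * (h' r)\<^sup>2 - (real n + 1) * (H r)\<^sup>2)"
    if "r \<in> {0..1}" for r
  proof (cases "r = r0")
    case True
    then show ?thesis using r0 by (simp add: D_def H_def)
  next
    case False
    \<comment> \<open>Completing the square: the deficit is a nonnegative weight times the square of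
      \<open>h' r - H r / (r - r0)\<close>.\<close>
    have "real n * r ^ (n - 1) * (r * (1 - r) * (h' r)\<^sup>2 - (real n + 1) * (H r)\<^sup>2) - D r
       = real n * r ^ n * (1 - r) * (h' r - H r / (r - r0))\<^sup>2"
    proof -
      have id: "a * (x * y * k\<^sup>2 - m * z\<^sup>2) - (- (nn * m * b * t) * (z\<^sup>2 / t) + nn * (x * b) * y * (2 * z * k / t - z\<^sup>2 / t\<^sup>2))
         = nn * (x * b) * y * (k - z / t)\<^sup>2" if "t \<noteq> 0" "a = nn * b" for a b x y k m z t nn :: real
        using that by (simp add: field_simps power2_eq_square)
      show ?thesis
        unfolding D_def pn using False by (intro id) auto
    qed
    also have "\<dots> \<ge> 0" using that by (intro mult_nonneg_nonneg) auto
    finally show ?thesis by simp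
  qed
  have c1: "continuous_on {0..1} (\<lambda>r. r * (1 - r) * (h' r)\<^sup>2)" "continuous_on {0..1} (\<lambda>r. (H r)\<^sup>2)"
    using h' conth unfolding H_def by (auto intro!: continuous_intros elim: continuous_on_subset)
  have "0 \<le> bavg n (\<lambda>r. r * (1 - r) * (h' r)\<^sup>2 - (real n + 1) * (H r)\<^sup>2)"
    unfolding bavg_def
    by (rule has_integral_le[OF D0 integrable_integral]; (intro bavg_integrable continuous_intros c1 le)?)
  also have "\<dots> = bavg n (\<lambda>r. r * (1 - r) * (h' r)\<^sup>2) - (real n + 1) * bavg n (\<lambda>r. (H r)\<^sup>2)"
    using c1 by (subst bavg_diff) (auto intro!: continuous_intros simp: bavg_cmult)
  finally show ?thesis by (simp add: H_def)
qed

text \<open>The mean is the best constant in mean square. This turns \<open>beta_poincare\<close>,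
  which is centred at the value \<open>h r0\<close>, into a bound for the variance.\<close>

lemma bavg_variance_le:
  assumes n: "n \<ge> 1" and h: "continuous_on {0..1} h"
  shows "bavg n (\<lambda>r. (h r)\<^sup>2) - (bavg n h)\<^sup>2 \<le> bavg n (\<lambda>r. (h r - c)\<^sup>2)"
proof -
  have "bavg n (\<lambda>r. (h r - c)\<^sup>2) = bavg n (\<lambda>r. (h r)\<^sup>2 - (2 * c * h r - c\<^sup>2))"
    by (simp add: power2_eq_square algebra_simps)
  also have "\<dots> = bavg n (\<lambda>r. (h r)\<^sup>2) - (2 * c * bavg n h - c\<^sup>2)"
    using h n by (simp add: bavg_diff bavg_cmult bavg_const continuous_intros)
  moreover have "0 \<le> (bavg n h - c)\<^sup>2" by simp
  ultimately show ?thesis by (simp add: power2_eq_square algebra_simps)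
qed

lemma bavg_beta_poincare:
  fixes h h' :: "real \<Rightarrow> real"
  assumes n: "n \<ge> 1" and h: "\<And>r. (h has_real_derivative h' r) (at r)" and h': "continuous_on UNIV h'"
  shows "bavg n (\<lambda>r. (h r)\<^sup>2) - (bavg n h)\<^sup>2 \<le> bavg n (\<lambda>r. r * (1 - r) * (h' r)\<^sup>2) / (real n + 1)"
proof -
  have "continuous_on {0..1} h"
    using h by (meson DERIV_isCont continuous_at_imp_continuous_on)
  from bavg_variance_le[OF n this, of "h (real n / (real n + 1))"]
  have "bavg n (\<lambda>r. (h r)\<^sup>2) - (bavg n h)\<^sup>2 \<le> bavg n (\<lambda>r. (h r - h (real n / (real n + 1)))\<^sup>2)" .
  also have "\<dots> \<le> bavg n (\<lambda>r. r * (1 - r) * (h' r)\<^sup>2) / (real n + 1)"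
    using beta_poincare[OF assms] by (simp add: pos_le_divide_eq mult.commute)
  finally show ?thesis .
qed

text \<open>Jensen's inequality for the weight with one more factor \<open>r\<close>, whose mass is
  \<open>n / (n + 1)\<close>. In the induction over cones this mass converts the constant
  \<open>1 / n\<close> of the base into \<open>1 / (n + 1)\<close>.\<close>

lemma bavg_jensen:
  assumes n: "n \<ge> 1" and k: "continuous_on {0..1} k"
  shows "(real n + 1) / real n * (bavg n (\<lambda>r. r * k r))\<^sup>2 \<le> bavg n (\<lambda>r. r * (k r)\<^sup>2)"
proof -
  define b where "b = bavg n (\<lambda>r. r * k r)"
  \<comment> \<open>The mean of \<open>k\<close> for the normalised weight, which is the optimal
    shift in the square below.\<close>
  define c where "c = b * (real n + 1) / real n"
  have "0 = bavg n (\<lambda>r. 0)" by (simp add: bavg_def)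
  also have "\<dots> \<le> bavg n (\<lambda>r. r * (k r - c)\<^sup>2)"
    using k by (intro bavg_mono) (auto intro!: continuous_intros)
  also have "\<dots> = bavg n (\<lambda>r. r * (k r)\<^sup>2 - (2 * c * (r * k r) - c\<^sup>2 * r))"
    by (simp add: power2_eq_square algebra_simps)
  also have "\<dots> = bavg n (\<lambda>r. r * (k r)\<^sup>2) - (2 * c * b - c\<^sup>2 * (real n / (real n + 1)))"
    unfolding b_def using k n by (simp add: bavg_diff bavg_cmult bavg_id continuous_intros)
  also have "2 * c * b - c\<^sup>2 * (real n / (real n + 1)) = (real n + 1) / real n * b\<^sup>2"
  proof -
    have "2 * (b * (m + 1) / m) * b - (b * (m + 1) / m)\<^sup>2 * (m / (m + 1)) = (m + 1) / m * b\<^sup>2"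
      if "m > 0" for m :: real
    proof -
      have "m + 1 \<noteq> 0" "m \<noteq> 0" using that by auto
      then show ?thesis by (simp add: divide_simps) (simp add: algebra_simps power2_eq_square)
    qed
    then show ?thesis using n by (simp add: c_def)
  qed
  finally show ?thesis by (simp add: b_def)
qed

section \<open>Mean values over simplices as iterated cone averages\<close>

lemma continuous_on_bavg_param:
  fixes F :: "'a::euclidean_space \<Rightarrow> real \<Rightarrow> real"
  assumes "continuous_on UNIV (\<lambda>(y, r). F y r)"
  shows "continuous_on UNIV (\<lambda>y. bavg n (F y))"
proof -
  have "continuous_on (UNIV \<times> cbox 0 1) (\<lambda>(y, r). real n * r ^ (n - 1) * F y r)"
    using continuous_on_subset[OF assms, of "UNIV \<times> cbox 0 1"]
    by (auto simp: split_beta intro!: continuous_intros)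
  from integral_continuous_on_param[OF this] show ?thesis by (simp add: bavg_def cbox_interval)
qed

lemma continuous_on_comp2:
  assumes "continuous_on UNIV f" "continuous_on S g"
  shows "continuous_on S (\<lambda>x. f (g x))"
  using continuous_on_compose2[OF assms(1) assms(2)] by auto

lemma continuous_on_bavg_cone:
  fixes f :: "'a::euclidean_space \<Rightarrow> real"
  assumes "continuous_on UNIV f"
  shows "continuous_on UNIV (\<lambda>y. bavg n (\<lambda>r. f (v + r *\<^sub>R (y - v))))"
  by (rule continuous_on_bavg_param)
     (auto simp: split_beta intro!: continuous_intros continuous_on_comp2[OF assms])

text \<open>The mean value over the simplex with the listed vertices, built up by repeatedly taking cones.\<close>
fun avg :: "'a::euclidean_space list \<Rightarrow> ('a \<Rightarrow> real) \<Rightarrow> real" where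
  "avg [] f = 0"
| "avg [v] f = f v"
| "avg (v # w # vs) f = avg (w # vs) (\<lambda>y. bavg (Suc (length vs)) (\<lambda>r. f (v + r *\<^sub>R (y - v))))"

lemma avg_add:
  assumes "continuous_on UNIV f" "continuous_on UNIV g"
  shows "avg vs (\<lambda>x. f x + g x) = avg vs f + avg vs g"
  using assms
proof (induction vs f arbitrary: g rule: avg.induct)
  case (3 v w vs f)
  have "bavg n (\<lambda>r. f (v + r *\<^sub>R (y - v)) + g (v + r *\<^sub>R (y - v)))
      = bavg n (\<lambda>r. f (v + r *\<^sub>R (y - v))) + bavg n (\<lambda>r. g (v + r *\<^sub>R (y - v)))" for y n
    by (rule bavg_add) (auto intro!: continuous_intros continuous_on_comp2[OF "3.prems"(1)] continuous_on_comp2[OF "3.prems"(2)])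
  then show ?case
    using 3 by (simp add: continuous_on_bavg_cone)
qed auto

lemma avg_cmult: "avg vs (\<lambda>x. c * f x) = c * avg vs f"
  by (induction vs f rule: avg.induct) (auto simp: bavg_cmult)

lemma avg_const: "vs \<noteq> [] \<Longrightarrow> avg vs (\<lambda>x. c) = c"
  by (induction vs "\<lambda>x::'a. c" rule: avg.induct) (auto simp: bavg_const)

text \<open>The comparison may be confined to a convex set \<open>S\<close> containing the vertices,
  since every cone segment used by \<open>avg\<close> stays in it.\<close>

lemma avg_mono:
  assumes "continuous_on UNIV f" "continuous_on UNIV g" "\<And>x. x \<in> S \<Longrightarrow> f x \<le> g x" "convex S" "set vs \<subseteq> S"
  shows "avg vs f \<le> avg vs g"
  using assms
proof (induction vs f arbitrary: g rule: avg.induct)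
  case (3 v w vs f)
  have "bavg (Suc (length vs)) (\<lambda>r. f (v + r *\<^sub>R (y - v))) \<le> bavg (Suc (length vs)) (\<lambda>r. g (v + r *\<^sub>R (y - v)))" if "y \<in> S" for y
  proof (rule bavg_mono)
    fix r :: real assume r: "0 \<le> r" "r \<le> 1"
    have "v + r *\<^sub>R (y - v) = (1 - r) *\<^sub>R v + r *\<^sub>R y" by (simp add: algebra_simps)
    also have "\<dots> \<in> S" using 3 that r by (intro convexD) auto
    finally show "f (v + r *\<^sub>R (y - v)) \<le> g (v + r *\<^sub>R (y - v))" by (rule "3.prems")
  qed (auto intro!: continuous_intros continuous_on_comp2[OF "3.prems"(1)] continuous_on_comp2[OF "3.prems"(2)])
  with 3 show ?case
    by (auto intro!: "3.IH" continuous_on_bavg_cone)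
qed auto

lemma avg_diff:
  assumes "continuous_on UNIV f" "continuous_on UNIV g"
  shows "avg vs (\<lambda>x. f x - g x) = avg vs f - avg vs g"
  using avg_add[OF assms(1), of "\<lambda>x. (-1) * g x" vs] assms(2) avg_cmult[of vs "-1" g]
  by (simp add: continuous_intros)

text \<open>Differentiation under the integral sign. The inner factor \<open>r\<close> is the
  derivative of the cone point with respect to its base point, and it is what
  \<open>bavg_jensen\<close> exploits.\<close>

lemma has_derivative_bavg_cone:
  fixes f :: "'a::euclidean_space \<Rightarrow> real" and g :: "'a \<Rightarrow> 'a"
  assumes f: "\<And>x. (f has_derivative (\<lambda>h. g x \<bullet> h)) (at x)" and g: "continuous_on UNIV g"
  shows "((\<lambda>y. bavg n (\<lambda>r. f (v + r *\<^sub>R (y - v)))) has_derivative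
      (\<lambda>h. bavg n (\<lambda>r. r * (g (v + r *\<^sub>R (y - v)) \<bullet> h)))) (at y)"
proof -
  define fx where "fx = (\<lambda>y r. (real n * r ^ (n - 1) * r) *\<^sub>R blinfun_inner_right (g (v + r *\<^sub>R (y - v))))"
  have cf: "continuous_on UNIV f"
    using f by (meson has_derivative_continuous continuous_at_imp_continuous_on)
  have "((\<lambda>y. integral (cbox 0 1) (\<lambda>r. real n * r ^ (n - 1) * f (v + r *\<^sub>R (y - v)))) has_derivative
     integral (cbox 0 1) (fx y)) (at y within UNIV)"
  proof (rule leibniz_rule)
    fix y r
    have "((\<lambda>y. f (v + r *\<^sub>R (y - v))) has_derivative (\<lambda>h. g (v + r *\<^sub>R (y - v)) \<bullet> (r *\<^sub>R h))) (at y)"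
      by (rule has_derivative_compose[OF _ f]) (auto intro!: derivative_eq_intros)
    from has_derivative_mult_right[OF this, of "real n * r ^ (n - 1)"]
    show "((\<lambda>y. real n * r ^ (n - 1) * f (v + r *\<^sub>R (y - v))) has_derivative blinfun_apply (fx y r)) (at y within UNIV)"
      by (simp add: fx_def mult.assoc scaleR_blinfun.rep_eq)
  next
    show "(\<lambda>r. real n * r ^ (n - 1) * f (v + r *\<^sub>R (y - v))) integrable_on cbox 0 1" for y
      unfolding cbox_interval
      by (rule bavg_integrable) (auto intro!: continuous_intros continuous_on_comp2[OF cf])
    show "continuous_on (UNIV \<times> cbox 0 1) (\<lambda>(y, r). fx y r)"
      unfolding fx_def split_beta
      by (intro continuous_intros continuous_on_comp2[OF g])
  qed auto
  moreover have "blinfun_apply (integral (cbox 0 1) (fx y)) = (\<lambda>h. bavg n (\<lambda>r. r * (g (v + r *\<^sub>R (y - v)) \<bullet> h)))"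
  proof
    fix h
    have "continuous_on (cbox 0 1) (fx y)"
      unfolding fx_def by (intro continuous_intros continuous_on_comp2[OF g])
    then have "fx y integrable_on cbox 0 1" by (rule integrable_continuous)
    from integral_linear[OF this bounded_bilinear.bounded_linear_left[OF bounded_bilinear_blinfun_apply], of h]
    show "blinfun_apply (integral (cbox 0 1) (fx y)) h = bavg n (\<lambda>r. r * (g (v + r *\<^sub>R (y - v)) \<bullet> h))"
      by (simp add: bavg_def fx_def o_def scaleR_blinfun.rep_eq cbox_interval mult.assoc)
  qed
  ultimately show ?thesis by (simp add: bavg_def cbox_interval)
qed

section \<open>Wright--Fisher energy and the Poincare inequality for iterated averages\<close>

text \<open>An interface to barycentric coordinates: affine functions on the whole space that are
  nonnegative on the simplex. Affinity is stated along \<open>v + r *\<^sub>R (y - v)\<close>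
  because cones are parametrised that way.\<close>

locale simplex_coords =
  fixes K :: "'a::euclidean_space set" and l :: "'a \<Rightarrow> 'a \<Rightarrow> real"
  assumes finite_K: "finite K"
    and l_affine: "\<And>w v y r. w \<in> K \<Longrightarrow> l w (v + r *\<^sub>R (y - v)) = (1 - r) * l w v + r * l w y"
    and l_cont: "\<And>w S. w \<in> K \<Longrightarrow> continuous_on S (l w)"
    and l_sum: "\<And>z. (\<Sum>w\<in>K. l w z) = 1"
    and l_rep: "\<And>z. (\<Sum>w\<in>K. l w z *\<^sub>R w) = z"
    and l_delta: "\<And>w v. w \<in> K \<Longrightarrow> v \<in> K \<Longrightarrow> l w v = (if w = v then 1 else 0)"
    and l_nonneg: "\<And>w z. w \<in> K \<Longrightarrow> z \<in> convex hull K \<Longrightarrow> 0 \<le> l w z"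
begin

text \<open>The variance of \<open>n \<bullet> V\<close> for a random vertex \<open>V\<close> with law given by the barycentric
  coordinates of \<open>z\<close>: the Wright--Fisher energy density.\<close>
definition q :: "'a \<Rightarrow> 'a \<Rightarrow> real" where
  "q z n = (\<Sum>w\<in>K. l w z * (n \<bullet> w - n \<bullet> z)\<^sup>2)"

lemma l_inner: "(\<Sum>w\<in>K. l w z * (n \<bullet> w)) = n \<bullet> z"
proof -
  have "(\<Sum>w\<in>K. l w z * (n \<bullet> w)) = n \<bullet> (\<Sum>w\<in>K. l w z *\<^sub>R w)" by (simp add: inner_sum_right)
  then show ?thesis by (simp add: l_rep)
qed

text \<open>The parallel axis formula for a variance. Shift 0 gives the behaviour along cones; the
  shift by the midrange gives the bound by the diameter.\<close>

lemma q_shift: "q z n = (\<Sum>w\<in>K. l w z * (n \<bullet> w - c)\<^sup>2) - (n \<bullet> z - c)\<^sup>2"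
proof -
  have *: "(\<Sum>w\<in>K. l w z * (n \<bullet> w - a)\<^sup>2) = (\<Sum>w\<in>K. l w z * (n \<bullet> w)\<^sup>2) - 2 * a * (n \<bullet> z) + a\<^sup>2" for a
  proof -
    have "(\<Sum>w\<in>K. l w z * (n \<bullet> w - a)\<^sup>2)
        = (\<Sum>w\<in>K. l w z * (n \<bullet> w)\<^sup>2 - 2 * a * (l w z * (n \<bullet> w)) + a\<^sup>2 * l w z)"
      by (rule sum.cong) (auto simp: power2_eq_square algebra_simps)
    also have "\<dots> = (\<Sum>w\<in>K. l w z * (n \<bullet> w)\<^sup>2) - 2 * a * (\<Sum>w\<in>K. l w z * (n \<bullet> w)) + a\<^sup>2 * (\<Sum>w\<in>K. l w z)"
      by (simp add: sum.distrib sum_subtractf sum_distrib_left)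
    finally show ?thesis by (simp add: l_inner l_sum)
  qed
  show ?thesis unfolding q_def * by (simp add: power2_eq_square algebra_simps)
qed

text \<open>The law of total variance: at the cone point the random vertex is \<open>v\<close> with
  probability \<open>1 - r\<close> and otherwise is drawn as at \<open>y\<close>.\<close>

lemma q_cone:
  assumes "v \<in> K"
  shows "q (v + r *\<^sub>R (y - v)) n = r * (1 - r) * (n \<bullet> (y - v))\<^sup>2 + r * q y n"
proof -
  have v: "(\<Sum>w\<in>K. l w v * (n \<bullet> w)\<^sup>2) = (n \<bullet> v)\<^sup>2"
  proof -
    have "(\<Sum>w\<in>K. l w v * (n \<bullet> w)\<^sup>2) = (\<Sum>w\<in>K. if w = v then (n \<bullet> v)\<^sup>2 else 0)"
      using assms by (intro sum.cong) (auto simp: l_delta)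
    then show ?thesis using assms finite_K by simp
  qed
  have "(\<Sum>w\<in>K. l w (v + r *\<^sub>R (y - v)) * (n \<bullet> w)\<^sup>2)
      = (\<Sum>w\<in>K. (1 - r) * (l w v * (n \<bullet> w)\<^sup>2) + r * (l w y * (n \<bullet> w)\<^sup>2))"
    by (rule sum.cong) (auto simp: l_affine distrib_right)
  also have "\<dots> = (1 - r) * (n \<bullet> v)\<^sup>2 + r * (\<Sum>w\<in>K. l w y * (n \<bullet> w)\<^sup>2)"
    by (simp add: sum.distrib sum_distrib_left[symmetric] v)
  finally show ?thesis
    unfolding q_shift[of _ _ 0] by (simp add: inner_simps power2_eq_square algebra_simps)
qed

lemma continuous_on_q:
  assumes "continuous_on S f" "continuous_on S g"
  shows "continuous_on S (\<lambda>x. q (f x) (g x))"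
proof -
  have "continuous_on S (\<lambda>x. l w (f x))" if "w \<in> K" for w
    by (rule continuous_on_comp2[OF l_cont[OF that] assms(1)])
  then show ?thesis unfolding q_def using assms by (auto intro!: continuous_intros)
qed

text \<open>Induction over the cones. The variance of \<open>f\<close> along each ray is bounded by
  \<open>bavg_beta_poincare\<close> with constant \<open>1 / (n + 1)\<close>, where \<open>n\<close>
  is the dimension of the current cone, and the variance of the ray mean \<open>G\<close> over the
  base by the induction hypothesis with constant \<open>1 / n\<close>. Jensen improves
  \<open>1 / n\<close> to \<open>1 / (n + 1)\<close>, so both parts carry the same constant and
  \<open>q_cone\<close> adds their energies to that of the whole cone.\<close>

lemma avg_poincare_q:
  assumes "\<And>x. (f has_derivative (\<lambda>h. g x \<bullet> h)) (at x)" "continuous_on UNIV g"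
    and "set vs \<subseteq> K" "vs \<noteq> []"
  shows "avg vs (\<lambda>x. (f x)\<^sup>2) - (avg vs f)\<^sup>2 \<le> avg vs (\<lambda>z. q z (g z)) / length vs"
  using assms
proof (induction vs f arbitrary: g rule: avg.induct)
  case (1 f)
  then show ?case by simp
next
  case (2 v f)
  have "0 \<le> q v (g v)"
    unfolding q_def using 2 l_nonneg[OF _ hull_inc[of v K convex]] by (intro sum_nonneg) auto
  then show ?case by simp
next
  case (3 v w vs f)
  let ?n = "Suc (length vs)" and ?vs = "w # vs"
  let ?c = "\<lambda>y r. v + r *\<^sub>R (y - v)"
  have v: "v \<in> K" using 3 by simp
  have cg: "continuous_on UNIV g" by fact
  have cf: "continuous_on UNIV f"
    using "3.prems"(1) by (meson has_derivative_continuous continuous_at_imp_continuous_on)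
  have cf2: "continuous_on UNIV (\<lambda>x. (f x)\<^sup>2)" using cf by (intro continuous_intros)
  define G where "G = (\<lambda>y. bavg ?n (\<lambda>r. f (?c y r)))"
  \<comment> \<open>The gradient of the ray mean \<open>G\<close>, assembled from its
    components.\<close>
  define \<gamma> where "\<gamma> = (\<lambda>y. \<Sum>b\<in>Basis. bavg ?n (\<lambda>r. r * (g (?c y r) \<bullet> b)) *\<^sub>R b)"
  have c\<gamma>b: "continuous_on UNIV (\<lambda>y. bavg ?n (\<lambda>r. r * (g (?c y r) \<bullet> b)))" for b
    by (rule continuous_on_bavg_param)
       (auto simp: split_beta intro!: continuous_intros continuous_on_comp2[OF cg])
  have c\<gamma>: "continuous_on UNIV \<gamma>" unfolding \<gamma>_def by (intro continuous_intros c\<gamma>b)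
  have \<gamma>h: "\<gamma> y \<bullet> h = bavg ?n (\<lambda>r. r * (g (?c y r) \<bullet> h))" for y h
  proof -
    have "bavg ?n (\<lambda>r. r * (g (?c y r) \<bullet> h)) = bavg ?n (\<lambda>r. \<Sum>b\<in>Basis. (b \<bullet> h) * (r * (g (?c y r) \<bullet> b)))"
    proof -
      have "r * (g (?c y r) \<bullet> h) = (\<Sum>b\<in>Basis. (b \<bullet> h) * (r * (g (?c y r) \<bullet> b)))" for r
        by (subst euclidean_inner) (simp add: sum_distrib_left mult_ac inner_commute)
      then show ?thesis by simp
    qed
    also have "\<dots> = (\<Sum>b\<in>Basis. (b \<bullet> h) * bavg ?n (\<lambda>r. r * (g (?c y r) \<bullet> b)))"
      by (subst bavg_sum) (auto simp: bavg_cmult intro!: continuous_intros continuous_on_comp2[OF cg])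
    finally show ?thesis by (simp add: \<gamma>_def inner_sum_left mult.commute)
  qed
  have dG: "(G has_derivative (\<lambda>h. \<gamma> y \<bullet> h)) (at y)" for y
    unfolding \<gamma>h unfolding G_def by (rule has_derivative_bavg_cone[OF "3.prems"(1,2)])
  have cG: "continuous_on UNIV G"
    using dG by (meson has_derivative_continuous continuous_at_imp_continuous_on)
  have IH: "avg ?vs (\<lambda>x. (G x)\<^sup>2) - (avg ?vs G)\<^sup>2 \<le> avg ?vs (\<lambda>z. q z (\<gamma> z)) / ?n"
    using "3.IH"[of \<gamma>] dG c\<gamma> "3.prems" unfolding G_def by auto
  \<comment> \<open>On a single ray: its variance plus the base energy of \<open>G\<close> is
    controlled by the energy of the full cone.\<close>
  have pt: "(bavg ?n (\<lambda>r. (f (?c y r))\<^sup>2) - (G y)\<^sup>2) + q y (\<gamma> y) / ?n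
      \<le> bavg ?n (\<lambda>r. q (?c y r) (g (?c y r))) / (real ?n + 1)" (is "?L \<le> ?R") if y: "y \<in> convex hull K" for y
  proof -
    have cgr: "continuous_on S (\<lambda>r. g (?c y r) \<bullet> m)" for m S
      by (intro continuous_intros continuous_on_comp2[OF cg])
    have 1: "bavg ?n (\<lambda>r. (f (?c y r))\<^sup>2) - (G y)\<^sup>2 \<le> bavg ?n (\<lambda>r. r * (1 - r) * (g (?c y r) \<bullet> (y - v))\<^sup>2) / (real ?n + 1)"
      unfolding G_def
    proof (rule bavg_beta_poincare)
      fix r
      have "((\<lambda>r. f (?c y r)) has_derivative (\<lambda>t. g (?c y r) \<bullet> (t *\<^sub>R (y - v)))) (at r)"
        by (rule has_derivative_compose[OF _ "3.prems"(1)]) (auto intro!: derivative_eq_intros)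
      then show "((\<lambda>r. f (?c y r)) has_real_derivative g (?c y r) \<bullet> (y - v)) (at r)"
        by (simp add: has_field_derivative_def mult.commute[of _ "g (v + r *\<^sub>R (y - v)) \<bullet> (y - v)"])
    qed (use cgr in auto)
    have "q y (\<gamma> y) / ?n = (\<Sum>u\<in>K. l u y * ((bavg ?n (\<lambda>r. r * (g (?c y r) \<bullet> (u - y))))\<^sup>2 / ?n))"
      unfolding q_def by (simp only: sum_divide_distrib \<gamma>h[symmetric] times_divide_eq_right inner_diff_right[of "\<gamma> y"])
    \<comment> \<open>Jensen separately for each vertex \<open>u\<close>; the weights
      \<open>l u y\<close> are nonnegative because \<open>y\<close> lies in the simplex.\<close>
    also have "\<dots> \<le> (\<Sum>u\<in>K. l u y * (bavg ?n (\<lambda>r. r * (g (?c y r) \<bullet> (u - y))\<^sup>2) / (real ?n + 1)))"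
    proof (intro sum_mono mult_left_mono)
      fix u
      have pos: "real ?n > 0" by simp
      have *: "a / m \<le> b / (m + 1)" if "(m + 1) / m * a \<le> b" "m > 0" for a b m :: real
        using that by (simp add: field_simps)
      show "(bavg ?n (\<lambda>r. r * (g (?c y r) \<bullet> (u - y))))\<^sup>2 / ?n \<le> bavg ?n (\<lambda>r. r * (g (?c y r) \<bullet> (u - y))\<^sup>2) / (real ?n + 1)"
        by (rule *[OF bavg_jensen pos]) (use cgr in auto)
    qed (use y l_nonneg in auto)
    also have "\<dots> = (\<Sum>u\<in>K. bavg ?n (\<lambda>r. l u y * (r * (g (?c y r) \<bullet> (u - y))\<^sup>2))) / (real ?n + 1)"
      by (simp add: bavg_cmult sum_divide_distrib)
    also have "(\<Sum>u\<in>K. bavg ?n (\<lambda>r. l u y * (r * (g (?c y r) \<bullet> (u - y))\<^sup>2)))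
        = bavg ?n (\<lambda>r. \<Sum>u\<in>K. l u y * (r * (g (?c y r) \<bullet> (u - y))\<^sup>2))"
      by (rule bavg_sum[symmetric]) (auto simp: finite_K intro!: continuous_intros cgr)
    also have "\<dots> = bavg ?n (\<lambda>r. r * q y (g (?c y r)))"
      unfolding q_def sum_distrib_left inner_diff_right by (simp only: mult.left_commute)
    finally have 2: "q y (\<gamma> y) / ?n \<le> bavg ?n (\<lambda>r. r * q y (g (?c y r))) / (real ?n + 1)" .
    have "?L \<le> (bavg ?n (\<lambda>r. r * (1 - r) * (g (?c y r) \<bullet> (y - v))\<^sup>2) + bavg ?n (\<lambda>r. r * q y (g (?c y r)))) / (real ?n + 1)"
      using 1 2 by (simp only: add_divide_distrib)
    also have "bavg ?n (\<lambda>r. r * (1 - r) * (g (?c y r) \<bullet> (y - v))\<^sup>2) + bavg ?n (\<lambda>r. r * q y (g (?c y r)))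
        = bavg ?n (\<lambda>r. q (?c y r) (g (?c y r)))"
      unfolding q_cone[OF v]
      by (rule bavg_add[symmetric]) (intro continuous_intros cgr continuous_on_q continuous_on_comp2[OF cg])+
    finally show ?thesis .
  qed
  have c1: "continuous_on UNIV (\<lambda>y. bavg ?n (\<lambda>r. (f (?c y r))\<^sup>2))"
    by (rule continuous_on_bavg_cone[OF cf2])
  have c2: "continuous_on UNIV (\<lambda>y. q y (\<gamma> y))" "continuous_on UNIV (\<lambda>z. q z (g z))"
    using c\<gamma> cg by (auto intro!: continuous_on_q continuous_intros)
  have c3: "continuous_on UNIV (\<lambda>y. bavg ?n (\<lambda>r. q (?c y r) (g (?c y r))))"
    by (rule continuous_on_bavg_cone[OF c2(2)])
  \<comment> \<open>Law of total variance: the mean of the ray variances plus the variance of the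
    ray means.\<close>
  have "avg (v # ?vs) (\<lambda>x. (f x)\<^sup>2) - (avg (v # ?vs) f)\<^sup>2
      = avg ?vs (\<lambda>y. bavg ?n (\<lambda>r. (f (?c y r))\<^sup>2) - (G y)\<^sup>2) + (avg ?vs (\<lambda>x. (G x)\<^sup>2) - (avg ?vs G)\<^sup>2)"
    using c1 cG by (simp add: avg_diff continuous_intros flip: G_def)
  also have "\<dots> \<le> avg ?vs (\<lambda>y. bavg ?n (\<lambda>r. (f (?c y r))\<^sup>2) - (G y)\<^sup>2) + avg ?vs (\<lambda>y. (1 / ?n) * q y (\<gamma> y))"
    using IH unfolding avg_cmult by simp
  also have "\<dots> = avg ?vs (\<lambda>y. (bavg ?n (\<lambda>r. (f (?c y r))\<^sup>2) - (G y)\<^sup>2) + (1 / ?n) * q y (\<gamma> y))"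
    using c1 cG c2 by (intro avg_add[symmetric] continuous_intros)
  also have "\<dots> \<le> avg ?vs (\<lambda>y. (1 / (real ?n + 1)) * bavg ?n (\<lambda>r. q (?c y r) (g (?c y r))))"
    using pt "3.prems" c1 cG c2 c3
    by (intro avg_mono[where S = "convex hull K"] continuous_intros) (auto intro: hull_inc)
  also have "\<dots> = avg (v # ?vs) (\<lambda>z. q z (g z)) / length (v # ?vs)"
    unfolding avg_cmult by simp
  finally show ?case .
qed

lemma q_le_diameter:
  assumes "z \<in> convex hull K" "K \<noteq> {}"
  shows "q z n \<le> (norm n)\<^sup>2 * (diameter (convex hull K))\<^sup>2 / 4"
proof -
  let ?h = "norm n * diameter (convex hull K)"
  define M m where "M = Max ((\<lambda>w. n \<bullet> w) ` K)" and "m = Min ((\<lambda>w. n \<bullet> w) ` K)"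
  have fin: "finite ((\<lambda>w. n \<bullet> w) ` K)" "(\<lambda>w. n \<bullet> w) ` K \<noteq> {}" using finite_K assms by auto
  have mM: "m \<le> n \<bullet> w" "n \<bullet> w \<le> M" if "w \<in> K" for w
    using fin that by (auto simp: M_def m_def)
  obtain a b where ab: "a \<in> K" "b \<in> K" "M = n \<bullet> a" "m = n \<bullet> b"
    using Max_in[OF fin] Min_in[OF fin] by (auto simp: M_def m_def)
  have "M - m = n \<bullet> (a - b)" by (simp add: ab inner_diff_right)
  also have "\<dots> \<le> norm n * norm (a - b)" by (rule norm_cauchy_schwarz)
  also have "norm (a - b) \<le> diameter (convex hull K)"
    using diameter_bounded_bound[of "convex hull K" a b] ab finite_K
    by (auto simp: dist_norm hull_inc compact_imp_bounded finite_imp_compact_convex_hull)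
  finally have width: "M - m \<le> ?h" by (simp add: mult_left_mono)
  \<comment> \<open>About the midrange every value deviates by at most half the width.\<close>
  let ?c = "(M + m) / 2"
  have "q z n \<le> (\<Sum>w\<in>K. l w z * (n \<bullet> w - ?c)\<^sup>2)" unfolding q_shift[of z n ?c] by simp
  also have "\<dots> \<le> (\<Sum>w\<in>K. l w z * (?h / 2)\<^sup>2)"
  proof (intro sum_mono mult_left_mono)
    fix w assume "w \<in> K"
    from mM[OF this] width have "\<bar>n \<bullet> w - ?c\<bar> \<le> ?h / 2" by (simp add: abs_le_iff field_simps)
    then have "\<bar>n \<bullet> w - ?c\<bar>\<^sup>2 \<le> (?h / 2)\<^sup>2" by (rule power_mono) simp
    then show "(n \<bullet> w - ?c)\<^sup>2 \<le> (?h / 2)\<^sup>2" by simp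
  qed (use l_nonneg assms in auto)
  also have "\<dots> = (?h / 2)\<^sup>2" by (simp add: l_sum flip: sum_distrib_right)
  finally show ?thesis by (simp add: power_mult_distrib power_divide)
qed

lemma avg_poincare:
  assumes "\<And>x. (f has_derivative (\<lambda>h. g x \<bullet> h)) (at x)" "continuous_on UNIV g"
    and "set vs \<subseteq> K" "length vs \<ge> 3"
  shows "avg vs (\<lambda>x. (f x)\<^sup>2) - (avg vs f)\<^sup>2 \<le> (diameter (convex hull K) / pi)\<^sup>2 * avg vs (\<lambda>x. (norm (g x))\<^sup>2)"
proof -
  let ?h = "diameter (convex hull K)"
  have ne: "vs \<noteq> []" "K \<noteq> {}" using assms by auto
  have cq: "continuous_on UNIV (\<lambda>z. q z (g z))" "continuous_on UNIV (\<lambda>x. ?h\<^sup>2 / 4 * (norm (g x))\<^sup>2)"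
    using assms(2) by (auto intro!: continuous_on_q continuous_intros)
  have nn: "0 \<le> avg vs (\<lambda>x. ?h\<^sup>2 / 4 * (norm (g x))\<^sup>2)"
    using avg_mono[OF continuous_on_const cq(2), of UNIV 0 vs] avg_const[OF ne(1), of 0] by simp
  have pi: "pi\<^sup>2 \<le> 12"
  proof -
    \<comment> \<open>\<open>tan x - x\<close> is nondecreasing, hence nonnegative at
      \<open>pi / 6\<close>. Since \<open>tan (pi / 6) = 1 / sqrt 3\<close>, this gives
      \<open>pi \<le> 6 / sqrt 3\<close>.\<close>
    have "tan 0 - 0 \<le> tan (pi / 6) - pi / 6"
    proof (rule DERIV_nonneg_imp_nondecreasing[where f = "\<lambda>x. tan x - x" and a = 0 and b = "pi / 6"])
      fix x :: real assume x: "0 \<le> x" "x \<le> pi / 6"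
      then have c: "cos x > 0" using pi_gt_zero by (intro cos_gt_zero_pi; linarith)
      have "((\<lambda>x. tan x - x) has_real_derivative inverse ((cos x)\<^sup>2) - 1) (at x)"
        using c by (auto intro!: derivative_eq_intros)
      moreover have "0 \<le> inverse ((cos x)\<^sup>2) - 1"
        using c cos_le_one[of x] by (simp add: one_le_inverse_iff power_le_one)
      ultimately show "\<exists>y. ((\<lambda>x. tan x - x) has_real_derivative y) (at x) \<and> 0 \<le> y" by blast
    qed simp
    then have "pi \<le> 6 / sqrt 3" by (simp add: tan_30)
    then have "pi\<^sup>2 \<le> (6 / sqrt 3)\<^sup>2" by (intro power_mono) auto
    then show ?thesis by (simp add: power_divide)
  qed
  have "avg vs (\<lambda>x. (f x)\<^sup>2) - (avg vs f)\<^sup>2 \<le> avg vs (\<lambda>z. q z (g z)) / length vs"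
    by (rule avg_poincare_q[OF assms(1-3) ne(1)])
  also have "\<dots> \<le> avg vs (\<lambda>x. ?h\<^sup>2 / 4 * (norm (g x))\<^sup>2) / length vs"
    using assms(3) ne q_le_diameter cq
    by (intro divide_right_mono avg_mono[where S = "convex hull K"]) (auto intro: hull_inc simp: mult.commute)
  \<comment> \<open>\<open>length vs\<close> is at least 3, while \<open>pi\<^sup>2 / 4\<close> is
    at most 3.\<close>
  also have "\<dots> \<le> avg vs (\<lambda>x. ?h\<^sup>2 / 4 * (norm (g x))\<^sup>2) / (pi\<^sup>2 / 4)"
    using assms(4) pi nn by (intro divide_left_mono mult_pos_pos) auto
  finally show ?thesis unfolding avg_cmult by (simp add: power_divide)
qed

end

section \<open>Lebesgue measure under linear bijections\<close>

lemma nn_integral_lborel_translate: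
  fixes f :: "'a::euclidean_space \<Rightarrow> ennreal"
  assumes [measurable]: "f \<in> borel_measurable borel"
  shows "(\<integral>\<^sup>+x. f (c + x) \<partial>lborel) = (\<integral>\<^sup>+x. f x \<partial>lborel)"
proof -
  have "(\<integral>\<^sup>+x. f x \<partial>lborel) = (\<integral>\<^sup>+x. f x \<partial>(distr lborel borel ((+) c)))"
    by (simp add: lborel_distr_plus)
  also have "\<dots> = (\<integral>\<^sup>+x. f (c + x) \<partial>lborel)" by (rule nn_integral_distr) auto
  finally show ?thesis ..
qed

text \<open>Uniqueness of translation-invariant measures, by the usual Fubini argument.\<close>
lemma distr_lborel_linear:
  fixes T :: "'b::euclidean_space \<Rightarrow> 'a::euclidean_space"
  assumes T: "linear T" "bij T"
  obtains c :: real where "c > 0" "distr lborel borel T = density lborel (\<lambda>_. ennreal c)"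
proof -
  have cT: "continuous_on UNIV T" using T(1) by (simp add: linear_continuous_on linear_conv_bounded_linear)
  have [measurable]: "T \<in> borel_measurable borel" by (rule borel_measurable_continuous_onI[OF cT])
  define B where "B = (ball 0 1 :: 'a set)"
  have [measurable]: "B \<in> sets borel" by (simp add: B_def)
  define g :: "'a \<Rightarrow> ennreal" where "g = indicator B"
  have [measurable]: "g \<in> borel_measurable borel" unfolding g_def by simp
  define T' where "T' = inv T"
  have TT': "T (T' x) = x" "T' (T y) = y" for x y
    using T(2) by (simp_all add: T'_def bij_def surj_f_inv_f)
  have linT': "linear T'"
  proof (rule linearI)
    show "T' (a + b) = T' a + T' b" for a b
      using TT'(2)[of "T' a + T' b"] by (simp add: linear_add[OF T(1)] TT'(1))
    show "T' (r *\<^sub>R a) = r *\<^sub>R T' a" for r a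
      using TT'(2)[of "r *\<^sub>R T' a"] by (simp add: linear_scale[OF T(1)] TT'(1))
  qed
  \<comment> \<open>Both sides evaluate the double integral of \<open>f (T b + x) * g (T b)\<close>.
    Translating in \<open>x\<close> by \<open>T b\<close> gives the right side; translating in
    \<open>b\<close> by \<open>T' x\<close> and then in \<open>x\<close> gives the left
    side.\<close>
  have key: "(\<integral>\<^sup>+b. f (T b) \<partial>lborel) * (\<integral>\<^sup>+x. g (- x) \<partial>lborel) = (\<integral>\<^sup>+x. f x \<partial>lborel) * (\<integral>\<^sup>+b. g (T b) \<partial>lborel)"
    if [measurable]: "f \<in> borel_measurable borel" for f :: "'a \<Rightarrow> ennreal"
  proof -
    have "(\<integral>\<^sup>+x. f x \<partial>lborel) * (\<integral>\<^sup>+b. g (T b) \<partial>lborel) = (\<integral>\<^sup>+b. (\<integral>\<^sup>+x. f x * g (T b) \<partial>lborel) \<partial>lborel)"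
      by (simp add: nn_integral_multc nn_integral_cmult)
    also have "\<dots> = (\<integral>\<^sup>+b. (\<integral>\<^sup>+x. f (T b + x) * g (T b) \<partial>lborel) \<partial>lborel)"
      by (subst (2) nn_integral_multc) (auto simp: nn_integral_lborel_translate nn_integral_multc)
    also have "\<dots> = (\<integral>\<^sup>+x. (\<integral>\<^sup>+b. f (T b + x) * g (T b) \<partial>lborel) \<partial>lborel)"
      by (rule lborel_pair.Fubini'[symmetric]) (simp add: borel_prod)
    also have "\<dots> = (\<integral>\<^sup>+x. (\<integral>\<^sup>+b. f (T b) * g (T b - x) \<partial>lborel) \<partial>lborel)"
    proof (rule nn_integral_cong)
      fix x
      have "(\<integral>\<^sup>+b. f (T b) * g (T b - x) \<partial>lborel) = (\<integral>\<^sup>+b. f (T (T' x + b)) * g (T (T' x + b) - x) \<partial>lborel)"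
        by (rule nn_integral_lborel_translate[symmetric]) measurable
      then show "(\<integral>\<^sup>+b. f (T b + x) * g (T b) \<partial>lborel) = (\<integral>\<^sup>+b. f (T b) * g (T b - x) \<partial>lborel)"
        by (simp add: linear_add[OF T(1)] TT' add.commute)
    qed
    also have "\<dots> = (\<integral>\<^sup>+b. (\<integral>\<^sup>+x. f (T b) * g (T b - x) \<partial>lborel) \<partial>lborel)"
      by (rule lborel_pair.Fubini') (simp add: borel_prod)
    also have "\<dots> = (\<integral>\<^sup>+b. f (T b) * (\<integral>\<^sup>+x. g (- x) \<partial>lborel) \<partial>lborel)"
    proof (rule nn_integral_cong)
      fix b
      have "(\<integral>\<^sup>+x. g (- x) \<partial>lborel) = (\<integral>\<^sup>+x. g (- ((- T b) + x)) \<partial>lborel)"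
        by (rule nn_integral_lborel_translate[symmetric]) measurable
      then show "(\<integral>\<^sup>+x. f (T b) * g (T b - x) \<partial>lborel) = f (T b) * (\<integral>\<^sup>+x. g (- x) \<partial>lborel)"
        by (simp add: nn_integral_cmult)
    qed
    also have "\<dots> = (\<integral>\<^sup>+b. f (T b) \<partial>lborel) * (\<integral>\<^sup>+x. g (- x) \<partial>lborel)"
      by (simp add: nn_integral_multc)
    finally show ?thesis ..
  qed
  have fin: "0 < emeasure lborel U \<and> emeasure lborel U < \<infinity>" if "open U" "bounded U" "0 \<in> U" for U :: "'c::euclidean_space set"
  proof -
    have "\<not> negligible U" using that open_not_negligible by blast
    then have "emeasure lborel U \<noteq> 0" using that
      by (auto simp: negligible_iff_null_sets null_sets_def emeasure_completion)
    then show ?thesis using emeasure_bounded_finite[OF that(2)] by (auto simp: zero_less_iff_neq_zero)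
  qed
  have gA: "(\<integral>\<^sup>+x. g (- x) \<partial>lborel) = emeasure lborel B"
  proof -
    have "g (- x) = g x" for x by (simp add: g_def B_def indicator_def)
    then show ?thesis by (simp add: g_def)
  qed
  have gB: "(\<integral>\<^sup>+b. g (T b) \<partial>lborel) = emeasure lborel (T -` B)"
  proof -
    have "g (T b) = indicator (T -` B) b" for b by (auto simp: g_def indicator_def)
    then show ?thesis using measurable_sets_borel[of T borel B] by simp
  qed
  have bT: "bounded (T -` B)"
  proof -
    have "T -` B = T' ` B"
    proof (intro set_eqI iffI)
      show "b \<in> T' ` B" if "b \<in> T -` B" for b using that TT'(2)[of b] by (metis imageI vimageE)
    qed (use TT' in auto)
    then show ?thesis
      by (simp add: B_def bounded_linear_image linT' linear_conv_bounded_linear[symmetric])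
  qed
  have oT: "open (T -` B)" using cT by (intro open_vimage) (auto simp: B_def)
  have z: "0 \<in> B" "0 \<in> T -` B" using T(1) by (auto simp: B_def linear_0)
  \<comment> \<open>Bounded open neighbourhoods of 0 have positive finite measure, so
    \<open>b / a\<close> is a legitimate constant.\<close>
  define a b where "a = measure lborel B" and "b = measure lborel (T -` B)"
  have A: "emeasure lborel B = ennreal a" "a > 0"
    using fin[of B] z by (auto simp: a_def B_def emeasure_eq_ennreal_measure measure_def enn2real_positive_iff)
  have B: "emeasure lborel (T -` B) = ennreal b" "b > 0"
    using fin[OF oT bT z(2)] by (auto simp: b_def emeasure_eq_ennreal_measure measure_def enn2real_positive_iff)
  have "distr lborel borel T = density lborel (\<lambda>_. ennreal (b / a))"
  proof (rule measure_eqI)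
    fix X assume "X \<in> sets (distr lborel borel T)"
    then have X[measurable]: "X \<in> sets borel" by simp
    have "(\<integral>\<^sup>+b. indicator X (T b) \<partial>lborel) = emeasure (distr lborel borel T) X"
    proof -
      have "indicator X (T b) = (indicator (T -` X) b :: ennreal)" for b by (auto simp: indicator_def)
      then show ?thesis using measurable_sets_borel[of T borel X] by (simp add: emeasure_distr)
    qed
    with key[of "indicator X"] have e: "emeasure (distr lborel borel T) X * ennreal a = emeasure lborel X * ennreal b"
      by (simp add: gA gB A B)
    have "emeasure (distr lborel borel T) X = emeasure (distr lborel borel T) X * ennreal a * ennreal (1 / a)"
      using A by (simp add: mult.assoc flip: ennreal_mult)
    also have "\<dots> = emeasure lborel X * ennreal (b / a)"
      unfolding e using A B by (simp add: mult.assoc flip: ennreal_mult)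
    finally show "emeasure (distr lborel borel T) X = emeasure (density lborel (\<lambda>_. ennreal (b / a))) X"
      by (simp add: emeasure_density nn_integral_cmult_indicator) (simp add: mult.commute)
  qed simp
  then show ?thesis using A B by (intro that[of "b / a"]) auto
qed

lemma integrable_indicator_continuous:
  fixes F :: "'a::euclidean_space \<Rightarrow> real"
  assumes "continuous_on UNIV F" "S \<in> sets borel" "bounded S"
  shows "integrable lborel (\<lambda>x. indicator S x * F x)"
proof -
  have c: "compact (closure S)" using assms by (simp add: compact_closure)
  have "compact (F ` closure S)" using compact_continuous_image[OF continuous_on_subset[OF assms(1)] c] by auto
  then obtain B where B: "\<And>x. x \<in> closure S \<Longrightarrow> norm (F x) \<le> B"
    by (meson compact_imp_bounded bounded_iff imageI)
  have [measurable]: "F \<in> borel_measurable borel" using assms(1) by (rule borel_measurable_continuous_onI)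
  have "integrable lborel (\<lambda>x. indicator S x *\<^sub>R F x)"
  proof (rule integrableI_bounded_set_indicator)
    show "AE x\<in>S in lborel. norm (F x) \<le> B" using B closure_subset[of S] by auto
    show "emeasure lborel S < \<infinity>" using assms(3) by (rule emeasure_bounded_finite)
  qed (use assms(2) in auto)
  then show ?thesis by simp
qed

section \<open>Integration over cones\<close>

text \<open>The cone over a copy of \<open>S\<close> at height 1, described by its slices. The apex
  is left out so that every slice is a scaled copy of \<open>S\<close>.\<close>

definition cone :: "'b::euclidean_space set \<Rightarrow> (real \<times> 'b) set" where
  "cone S = {(r, z). 0 < r \<and> r \<le> 1 \<and> (1 / r) *\<^sub>R z \<in> S}"

lemma cone_borel [measurable]:
  assumes [measurable]: "S \<in> sets borel"
  shows "cone S \<in> sets borel"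
proof -
  have "cone S = {p. 0 < fst p \<and> fst p \<le> 1 \<and> (1 / fst p) *\<^sub>R snd p \<in> S}" by (auto simp: cone_def)
  also have "\<dots> = {p \<in> space (borel \<Otimes>\<^sub>M borel). 0 < fst p \<and> fst p \<le> 1 \<and> (1 / fst p) *\<^sub>R snd p \<in> S}"
    by (simp add: space_pair_measure)
  also have "\<dots> \<in> sets (borel \<Otimes>\<^sub>M borel)" by measurable
  finally show ?thesis by (simp add: borel_prod[symmetric])
qed

lemma bounded_cone:
  assumes "bounded S"
  shows "bounded (cone S)"
proof -
  obtain B where B: "\<And>y. y \<in> S \<Longrightarrow> norm y \<le> B" using assms by (auto simp: bounded_iff)
  have "norm (r, z) \<le> 1 + B" if "(r, z) \<in> cone S" for r z
  proof -
    have r: "0 < r" "r \<le> 1" and "norm ((1 / r) *\<^sub>R z) \<le> B" using that B[of "(1 / r) *\<^sub>R z"] by (auto simp: cone_def)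
    moreover have "norm ((1 / r) *\<^sub>R z) = norm z / r" using r by simp
    ultimately have "norm z / r \<le> B" by simp
    then have "norm z \<le> r * B" using r by (simp add: field_simps)
    moreover have "0 \<le> B" using \<open>norm ((1 / r) *\<^sub>R z) \<le> B\<close> norm_ge_zero order_trans by blast
    ultimately have "norm z \<le> B" using r mult_left_le_one_le[of B r] by linarith
    moreover have "norm (r, z) \<le> norm r + norm z" by (rule norm_Pair_le)
    ultimately show ?thesis using r by simp
  qed
  then show ?thesis unfolding bounded_iff by (intro exI[of _ "1 + B"]) auto
qed

text \<open>The slice at height \<open>r\<close> is \<open>S\<close> scaled by \<open>r\<close>, so
  the substitution \<open>z = r *\<^sub>R y\<close> produces the factor \<open>r ^ DIM('b)\<close>.
  After exchanging the integrals this becomes the radial weight of \<open>bavg\<close>.\<close>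

lemma integral_cone:
  fixes F :: "real \<times> 'b::euclidean_space \<Rightarrow> real"
  assumes F: "continuous_on UNIV F" and S[measurable]: "S \<in> sets borel" and bS: "bounded S"
  shows "(\<integral>p. indicator (cone S) p * F p \<partial>lborel)
     = (\<integral>y. indicator S y * integral {0..1} (\<lambda>r. r ^ DIM('b) * F (r, r *\<^sub>R y)) \<partial>lborel)"
proof -
  have [measurable]: "F \<in> borel_measurable borel" using F by (rule borel_measurable_continuous_onI)
  have ball01: "AE r in lborel. r \<noteq> (0::real)" by (rule AE_lborel_singleton)
  define H where "H = (\<lambda>(r, y). indicator ({0..1} \<times> S) (r, y) * (r ^ DIM('b) * F (r, r *\<^sub>R y)))"
  have cH: "continuous_on UNIV (\<lambda>p. fst p ^ DIM('b) * F (fst p, fst p *\<^sub>R snd p))"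
    by (intro continuous_intros continuous_on_comp2[OF F])
  have "integrable lborel (\<lambda>p. indicator ({0..1} \<times> S) p * (fst p ^ DIM('b) * F (fst p, fst p *\<^sub>R snd p)))"
    by (rule integrable_indicator_continuous[OF cH]) (auto intro: bounded_Times bS simp flip: borel_prod)
  then have iH: "integrable (lborel \<Otimes>\<^sub>M lborel) H"
    unfolding lborel_prod H_def by (simp add: case_prod_beta')
  have iG: "integrable (lborel \<Otimes>\<^sub>M lborel) (\<lambda>p. indicator (cone S) p * F p)"
    unfolding lborel_prod by (rule integrable_indicator_continuous[OF F]) (auto intro: bounded_cone bS)
  have "(\<integral>p. indicator (cone S) p * F p \<partial>lborel) = (\<integral>r. (\<integral>z. indicator (cone S) (r, z) * F (r, z) \<partial>lborel) \<partial>lborel)"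
    using lborel_pair.integral_fst'[OF iG] by (simp add: lborel_prod)
  also have "\<dots> = (\<integral>r. (\<integral>y. H (r, y) \<partial>lborel) \<partial>lborel)"
  proof (rule integral_cong_AE)
    show "AE r in lborel. (\<integral>z. indicator (cone S) (r, z) * F (r, z) \<partial>lborel) = (\<integral>y. H (r, y) \<partial>lborel)"
      using ball01
    proof eventually_elim
      case (elim r)
      show ?case
      proof (cases "0 < r \<and> r \<le> 1")
        case True
        have "(\<integral>z. indicator (cone S) (r, z) * F (r, z) \<partial>lborel)
            = (\<integral>z. indicator (cone S) (r, z) * F (r, z) \<partial>(density (distr lborel borel (\<lambda>x. 0 + r *\<^sub>R x)) (\<lambda>_. ennreal (\<bar>r\<bar> ^ DIM('b)))))"
          using lborel_affine[OF elim, of "0::'b"] by simp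
        also have "\<dots> = (\<integral>y. r ^ DIM('b) * (indicator (cone S) (r, r *\<^sub>R y) * F (r, r *\<^sub>R y)) \<partial>lborel)"
          using True by (subst integral_density) (auto simp: integral_distr)
        also have "\<dots> = (\<integral>y. H (r, y) \<partial>lborel)"
          using True by (intro Bochner_Integration.integral_cong) (auto simp: H_def cone_def indicator_def)
        finally show ?thesis .
      next
        case False
        then have "indicator (cone S) (r, z) * F (r, z) = 0" "H (r, z) = 0" for z
          using elim by (auto simp: cone_def H_def)
        then show ?thesis by (simp only: Bochner_Integration.integral_zero)
      qed
    qed
    show "(\<lambda>r. \<integral>z. indicator (cone S) (r, z) * F (r, z) \<partial>lborel) \<in> borel_measurable lborel"
      by (rule borel_measurable_integrable[OF lborel_pair.integrable_fst'[OF iG]])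
    show "(\<lambda>r. \<integral>y. H (r, y) \<partial>lborel) \<in> borel_measurable lborel"
      by (rule borel_measurable_integrable[OF lborel_pair.integrable_fst'[OF iH]])
  qed
  also have "\<dots> = (\<integral>y. (\<integral>r. H (r, y) \<partial>lborel) \<partial>lborel)"
    using lborel_pair.Fubini_integral[of "\<lambda>r y. H (r, y)"] iH by simp
  also have "\<dots> = (\<integral>y. indicator S y * integral {0..1} (\<lambda>r. r ^ DIM('b) * F (r, r *\<^sub>R y)) \<partial>lborel)"
  proof (rule Bochner_Integration.integral_cong)
    fix y
    have c: "continuous_on {0..1} (\<lambda>r. r ^ DIM('b) * F (r, r *\<^sub>R y))"
      by (intro continuous_intros continuous_on_comp2[OF F])
    have "(\<integral>r. H (r, y) \<partial>lborel) = indicator S y * (\<integral>r. indicator {0..1} r * (r ^ DIM('b) * F (r, r *\<^sub>R y)) \<partial>lborel)"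
      by (subst Bochner_Integration.integral_mult_right_zero[symmetric])
         (rule Bochner_Integration.integral_cong, auto simp: H_def indicator_def)
    also have "(\<integral>r. indicator {0..1} r * (r ^ DIM('b) * F (r, r *\<^sub>R y)) \<partial>lborel) = integral {0..1} (\<lambda>r. r ^ DIM('b) * F (r, r *\<^sub>R y))"
      using set_borel_integral_eq_integral(2)[OF borel_integrable_atLeastAtMost'[OF c]]
      by (simp add: set_lebesgue_integral_def)
    finally show "(\<integral>r. H (r, y) \<partial>lborel) = indicator S y * integral {0..1} (\<lambda>r. r ^ DIM('b) * F (r, r *\<^sub>R y))" .
  qed simp
  finally show ?thesis .
qed

text \<open>The map \<open>T\<close> carries Lebesgue measure on \<open>S\<close> to a multiple of
  the mean value \<open>avg vs\<close>. The multiple stays unspecified because it cancels in the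
  Poincare inequality.\<close>

definition represents :: "'b::euclidean_space set \<Rightarrow> ('b \<Rightarrow> 'a::euclidean_space) \<Rightarrow> 'a list \<Rightarrow> bool" where
  "represents S T vs \<longleftrightarrow> (\<exists>C>0. \<forall>F. continuous_on UNIV F \<longrightarrow> (\<integral>b. indicator S b * F (T b) \<partial>lborel) = C * avg vs F)"

lemma represents_segment: "represents {0..1::real} (\<lambda>r. v + r *\<^sub>R (w - v)) [v, w]"
  unfolding represents_def
proof (intro exI[of _ 1] conjI allI impI)
  fix F :: "'a \<Rightarrow> real" assume F: "continuous_on UNIV F"
  have c: "continuous_on {0..1} (\<lambda>r. F (v + r *\<^sub>R (w - v)))"
    by (intro continuous_intros continuous_on_comp2[OF F])
  show "(\<integral>b. indicator {0..1} b * F (v + b *\<^sub>R (w - v)) \<partial>lborel) = 1 * avg [v, w] F"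
    using set_borel_integral_eq_integral(2)[OF borel_integrable_atLeastAtMost'[OF c]]
    by (simp add: set_lebesgue_integral_def bavg_def)
qed simp

text \<open>The base list \<open>w # vs\<close> has one entry more than the dimension of its
  parameter space, so the Jacobian power of \<open>integral_cone\<close> is the exponent of the
  weight in \<open>avg\<close>.\<close>

lemma represents_cone:
  fixes T :: "'b::euclidean_space \<Rightarrow> 'a::euclidean_space"
  assumes rep: "represents S T (w # vs)" and len: "length vs = DIM('b)"
    and S: "S \<in> sets borel" "bounded S"
    and T': "continuous_on UNIV T'" "\<And>r y. T' (r, r *\<^sub>R y) = v + r *\<^sub>R (T y - v)"
  shows "represents (cone S) T' (v # w # vs)"
proof -
  obtain C where C: "C > 0" "\<And>F. continuous_on UNIV F \<Longrightarrow> (\<integral>b. indicator S b * F (T b) \<partial>lborel) = C * avg (w # vs) F"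
    using rep unfolding represents_def by blast
  let ?n = "Suc (length vs)"
  show ?thesis
    unfolding represents_def
  proof (intro exI[of _ "C / ?n"] conjI allI impI)
    fix F :: "'a \<Rightarrow> real" assume F: "continuous_on UNIV F"
    have "continuous_on UNIV (\<lambda>p. F (T' p))" by (rule continuous_on_comp2[OF F T'(1)])
    from integral_cone[OF this S]
    have "(\<integral>p. indicator (cone S) p * F (T' p) \<partial>lborel)
       = (\<integral>y. indicator S y * (1 / ?n * bavg ?n (\<lambda>r. F (v + r *\<^sub>R (T y - v)))) \<partial>lborel)"
      by (simp add: T'(2) bavg_def len mult.assoc)
    also have "\<dots> = C * avg (w # vs) (\<lambda>y. 1 / ?n * bavg ?n (\<lambda>r. F (v + r *\<^sub>R (y - v))))"
      by (rule C(2)) (intro continuous_intros continuous_on_bavg_cone[OF F])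
    finally show "(\<integral>p. indicator (cone S) p * F (T' p) \<partial>lborel) = C / ?n * avg (v # w # vs) F"
      unfolding avg_cmult by simp
  qed (use C in auto)
qed

section \<open>Change of variables to a simplex\<close>

text \<open>Parameter space and target are different types of equal dimension, so surjectivity
  follows from injectivity by counting dimensions.\<close>

lemma linear_bij_same_dim:
  fixes L :: "'b::euclidean_space \<Rightarrow> 'a::euclidean_space"
  assumes "linear L" "DIM('b) = DIM('a)" "\<And>b. L b = 0 \<Longrightarrow> b = 0"
  shows "bij L"
proof -
  have "inj L" using assms linear_injective_0 by blast
  moreover have "dim (range L) = DIM('a)"
    using dim_image_eq[of L UNIV] assms \<open>inj L\<close> by (simp add: inj_on_subset)
  then have "span (range L) = UNIV" using dim_eq_full by blast
  then have "range L = UNIV" using linear_subspace_image[OF assms(1) subspace_UNIV] by (simp add: span_eq_iff[THEN iffD2])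
  ultimately show ?thesis by (simp add: bij_def)
qed

text \<open>The frontier of a convex set is null, so it is enough that the parametrised set lies
  between the interior of the simplex and the simplex.\<close>

lemma represents_imp_integral:
  fixes L :: "'b::euclidean_space \<Rightarrow> 'a::euclidean_space"
  assumes rep: "represents S (\<lambda>b. v + L b) vs" and L: "linear L" "bij L"
    and S: "S \<in> sets borel"
    and K: "convex hull K = closure (convex hull K)" "(\<lambda>b. v + L b) ` S \<subseteq> convex hull K" "interior (convex hull K) \<subseteq> (\<lambda>b. v + L b) ` S"
  shows "\<exists>C>0. \<forall>F. continuous_on UNIV F \<longrightarrow> (\<integral>x. F x \<partial>(lebesgue_on (convex hull K))) = C * avg vs F"
proof -
  obtain C where C: "C > 0" "\<And>F. continuous_on UNIV F \<Longrightarrow> (\<integral>b. indicator S b * F (v + L b) \<partial>lborel) = C * avg vs F"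
    using rep unfolding represents_def by blast
  obtain c where c: "c > 0" "distr lborel borel L = density lborel (\<lambda>_. ennreal c)"
    using distr_lborel_linear[OF L] .
  have cL: "continuous_on UNIV L" using L(1) by (simp add: linear_continuous_on linear_conv_bounded_linear)
  have [measurable]: "L \<in> borel_measurable borel" by (rule borel_measurable_continuous_onI[OF cL])
  have clK: "closed (convex hull K)" using K(1) closed_closure by metis
  have [measurable]: "convex hull K \<in> sets borel" using clK by simp
  have negl: "negligible (frontier (convex hull K))" by (rule negligible_convex_frontier) simp
  then have AEK: "AE x in lborel. x \<notin> frontier (convex hull K)"
    unfolding negligible_iff_null_sets by (intro AE_not_in) (simp add: null_sets_completion_iff)
  have [measurable]: "frontier (convex hull K) \<in> sets borel" by (simp add: borel_closed)
  have pm: "{x. x \<notin> frontier (convex hull K)} \<in> sets borel" "{x. v + x \<notin> frontier (convex hull K)} \<in> sets borel"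
    by measurable
  show ?thesis
  proof (intro exI[of _ "C / c"] conjI allI impI)
    fix F :: "'a \<Rightarrow> real" assume F: "continuous_on UNIV F"
    have [measurable]: "F \<in> borel_measurable borel" using F by (rule borel_measurable_continuous_onI)
    let ?G = "\<lambda>x. indicator (convex hull K) x * F x"
    have "(\<integral>x. F x \<partial>(lebesgue_on (convex hull K))) = (\<integral>x. ?G x \<partial>lborel)"
      by (subst integral_restrict_space) (auto simp: integral_completion)
    also have "\<dots> = (\<integral>x. ?G x \<partial>(distr lborel borel ((+) v)))" by (simp add: lborel_distr_plus)
    also have "\<dots> = (\<integral>x. ?G (v + x) \<partial>lborel)" by (rule integral_distr) auto
    finally have 1: "(\<integral>x. F x \<partial>(lebesgue_on (convex hull K))) = (\<integral>x. ?G (v + x) \<partial>lborel)" .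
    have "c * (\<integral>x. ?G (v + x) \<partial>lborel) = (\<integral>x. ?G (v + x) \<partial>density lborel (\<lambda>_. ennreal c))"
      using c(1) by (subst integral_density) auto
    also have "\<dots> = (\<integral>x. ?G (v + x) \<partial>(distr lborel borel L))" by (simp add: c)
    also have "\<dots> = (\<integral>b. ?G (v + L b) \<partial>lborel)" by (rule integral_distr) auto
    also have "\<dots> = (\<integral>b. indicator S b * F (v + L b) \<partial>lborel)"
    proof (rule integral_cong_AE)
      have "AE x in distr lborel borel ((+) v). x \<notin> frontier (convex hull K)" unfolding lborel_distr_plus by (rule AEK)
      then have "AE x in lborel. v + x \<notin> frontier (convex hull K)" by (subst (asm) AE_distr_iff) (simp_all add: pm)
      then have "AE x in density lborel (\<lambda>_. ennreal c). v + x \<notin> frontier (convex hull K)" by (subst AE_density) auto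
      then have "AE x in distr lborel borel L. v + x \<notin> frontier (convex hull K)" by (simp only: c)
      then have "AE b in lborel. v + L b \<notin> frontier (convex hull K)" by (subst (asm) AE_distr_iff) (simp_all add: pm)
      then show "AE b in lborel. ?G (v + L b) = indicator S b * F (v + L b)"
      proof eventually_elim
        case (elim b)
        have "v + L b \<in> convex hull K \<longleftrightarrow> b \<in> S"
        proof
          assume "v + L b \<in> convex hull K"
          with elim have "v + L b \<in> interior (convex hull K)" using clK by (simp add: frontier_def)
          with K(3) obtain b' where "b' \<in> S" "v + L b = v + L b'" by auto
          then show "b \<in> S" using L(2) by (metis add_left_cancel bij_def injD)
        qed (use K(2) in auto)
        then show ?case by (simp add: indicator_def)
      qed
    qed (use S in measurable)
    also have "\<dots> = C * avg vs F" by (rule C(2)[OF F])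
    finally show "(\<integral>x. F x \<partial>(lebesgue_on (convex hull K))) = C / c * avg vs F"
      using 1 c(1) by (simp add: field_simps)
  qed (use C c in auto)
qed

text \<open>Barycentric coordinates, extended affinely to the whole space, and their constant gradients.\<close>
definition bc :: "'a::euclidean_space set \<Rightarrow> 'a \<Rightarrow> 'a \<Rightarrow> real" where
  "bc K w z = (SOME u. sum u K = 1 \<and> (\<Sum>v\<in>K. u v *\<^sub>R v) = z) w"

definition bcg :: "'a::euclidean_space set \<Rightarrow> 'a \<Rightarrow> 'a" where
  "bcg K w = (\<Sum>b\<in>Basis. (bc K w b - bc K w 0) *\<^sub>R b)"

section \<open>Full-dimensional simplices and their mean values\<close>

text \<open>Affinely independent points, one more than the dimension, span the whole space affinely.
  Hence \<open>bc\<close> is determined at every point and not only in the simplex.\<close>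

locale full_simplex =
  fixes K :: "'a::euclidean_space set"
  assumes indep: "\<not> affine_dependent K" and card_K: "card K = Suc (DIM('a))"
begin

lemma finite_K: "finite K" using card_K card.infinite by fastforce

lemma coords_unique:
  assumes "sum u K = sum u' K" "(\<Sum>v\<in>K. u v *\<^sub>R v) = (\<Sum>v\<in>K. u' v *\<^sub>R v)" "v \<in> K"
  shows "u v = u' v"
proof (rule ccontr)
  assume "u v \<noteq> u' v"
  then have "\<exists>U. sum U K = 0 \<and> (\<exists>v\<in>K. U v \<noteq> 0) \<and> (\<Sum>v\<in>K. U v *\<^sub>R v) = 0"
    using assms by (intro exI[of _ "\<lambda>v. u v - u' v"]) (auto simp: sum_subtractf scaleR_diff_left)
  with indep show False by (simp add: affine_dependent_explicit_finite[OF finite_K])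
qed

lemma bc_sum: "(\<Sum>w\<in>K. bc K w z) = 1" and bc_rep: "(\<Sum>w\<in>K. bc K w z *\<^sub>R w) = z"
proof -
  have "z \<in> affine hull K" using affine_independent_span_eq[OF indep card_K] by simp
  then have "\<exists>u. sum u K = 1 \<and> (\<Sum>v\<in>K. u v *\<^sub>R v) = z"
    by (simp add: affine_hull_finite[OF finite_K])
  from someI_ex[OF this] show "(\<Sum>w\<in>K. bc K w z) = 1" "(\<Sum>w\<in>K. bc K w z *\<^sub>R w) = z"
    unfolding bc_def by auto
qed

lemma bc_eqI:
  assumes "sum u K = 1" "(\<Sum>v\<in>K. u v *\<^sub>R v) = z" "w \<in> K"
  shows "bc K w z = u w"
  by (rule coords_unique[of "\<lambda>w. bc K w z"]) (use assms in \<open>simp_all add: bc_sum bc_rep\<close>)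

lemma bc_vertex:
  assumes "w \<in> K" "v \<in> K"
  shows "bc K w v = (if w = v then 1 else 0)"
proof (rule bc_eqI)
  show "(\<Sum>w\<in>K. if w = v then 1 else 0) = (1::real)" using assms finite_K by simp
  have "(\<Sum>w\<in>K. (if w = v then 1 else 0) *\<^sub>R w) = (\<Sum>w\<in>K. if w = v then v else 0)"
    by (rule sum.cong) auto
  then show "(\<Sum>w\<in>K. (if w = v then 1 else 0) *\<^sub>R w) = v" using assms finite_K by simp
qed (use assms in auto)

lemma bc_affine:
  assumes "w \<in> K"
  shows "bc K w (v + r *\<^sub>R (y - v)) = (1 - r) * bc K w v + r * bc K w y"
proof (rule bc_eqI[OF _ _ assms])
  show "(\<Sum>w\<in>K. (1 - r) * bc K w v + r * bc K w y) = 1"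
    by (simp add: sum.distrib bc_sum flip: sum_distrib_left)
  have "(\<Sum>w\<in>K. ((1 - r) * bc K w v + r * bc K w y) *\<^sub>R w)
      = (1 - r) *\<^sub>R (\<Sum>w\<in>K. bc K w v *\<^sub>R w) + r *\<^sub>R (\<Sum>w\<in>K. bc K w y *\<^sub>R w)"
    by (simp add: scaleR_left_distrib sum.distrib scaleR_sum_right)
  then show "(\<Sum>w\<in>K. ((1 - r) * bc K w v + r * bc K w y) *\<^sub>R w) = v + r *\<^sub>R (y - v)"
    by (simp add: bc_rep algebra_simps)
qed

lemma bc_linear:
  assumes "w \<in> K"
  shows "linear (\<lambda>z. bc K w z - bc K w 0)"
proof (rule linearI)
  fix x y
  have "bc K w (x + y) = bc K w x + bc K w y - bc K w 0"
  proof (rule bc_eqI[OF _ _ assms])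
    show "(\<Sum>w\<in>K. bc K w x + bc K w y - bc K w 0) = 1"
      by (simp add: sum.distrib sum_subtractf bc_sum)
    show "(\<Sum>w\<in>K. (bc K w x + bc K w y - bc K w 0) *\<^sub>R w) = x + y"
      by (simp add: scaleR_left_distrib scaleR_diff_left sum.distrib sum_subtractf bc_rep)
  qed
  then show "bc K w (x + y) - bc K w 0 = bc K w x - bc K w 0 + (bc K w y - bc K w 0)" by simp
next
  fix r x
  show "bc K w (r *\<^sub>R x) - bc K w 0 = r *\<^sub>R (bc K w x - bc K w 0)"
    using bc_affine[OF assms, of 0 r x] by (simp add: algebra_simps)
qed

lemma bc_grad:
  assumes "w \<in> K"
  shows "bc K w z = bc K w 0 + bcg K w \<bullet> z"
proof -
  have "bc K w z - bc K w 0 = (\<Sum>b\<in>Basis. (z \<bullet> b) * (bc K w b - bc K w 0))"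
    using Linear_Algebra.linear_componentwise[OF bc_linear[OF assms], of z 1] by simp
  also have "\<dots> = bcg K w \<bullet> z"
    unfolding bcg_def inner_sum_left by (rule sum.cong) (auto simp: inner_commute)
  finally show ?thesis by simp
qed

lemma continuous_on_bc:
  assumes "w \<in> K" "continuous_on S f"
  shows "continuous_on S (\<lambda>x. bc K w (f x))"
proof -
  have *: "(\<lambda>x. bc K w (f x)) = (\<lambda>x. bc K w 0 + bcg K w \<bullet> f x)"
    by (rule ext) (rule bc_grad[OF assms(1)])
  show ?thesis by (subst *) (intro continuous_intros assms)
qed

lemma hull_bc: "convex hull K = {x. \<forall>w\<in>K. 0 \<le> bc K w x}"
proof (intro set_eqI iffI)
  fix x assume "x \<in> convex hull K"
  then obtain u where u: "\<forall>v\<in>K. 0 \<le> u v" "sum u K = 1" "(\<Sum>v\<in>K. u v *\<^sub>R v) = x"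
    unfolding convex_hull_finite[OF finite_K] by blast
  show "x \<in> {x. \<forall>w\<in>K. 0 \<le> bc K w x}"
    using u(1) by (simp add: bc_eqI[OF u(2,3)])
next
  fix x assume "x \<in> {x. \<forall>w\<in>K. 0 \<le> bc K w x}"
  then show "x \<in> convex hull K"
    unfolding convex_hull_finite[OF finite_K]
    by (intro CollectI exI[of _ "\<lambda>w. bc K w x"] conjI) (simp_all add: bc_sum bc_rep)
qed

lemma interior_hull_bc: "interior (convex hull K) = {x. \<forall>w\<in>K. 0 < bc K w x}"
proof -
  have "interior (convex hull K) = {y. \<exists>u. (\<forall>x\<in>K. 0 < u x) \<and> sum u K = 1 \<and> (\<Sum>x\<in>K. u x *\<^sub>R x) = y}"
    using interior_convex_hull_explicit_minimal[OF indep] card_K by simp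
  also have "\<dots> = {x. \<forall>w\<in>K. 0 < bc K w x}"
  proof (intro set_eqI iffI)
    fix x assume "x \<in> {y. \<exists>u. (\<forall>x\<in>K. 0 < u x) \<and> sum u K = 1 \<and> (\<Sum>x\<in>K. u x *\<^sub>R x) = y}"
    then obtain u where u: "\<forall>v\<in>K. 0 < u v" "sum u K = 1" "(\<Sum>v\<in>K. u v *\<^sub>R v) = x" by blast
    show "x \<in> {x. \<forall>w\<in>K. 0 < bc K w x}" using u(1) by (simp add: bc_eqI[OF u(2,3)])
  next
    fix x assume "x \<in> {x. \<forall>w\<in>K. 0 < bc K w x}"
    then show "x \<in> {y. \<exists>u. (\<forall>x\<in>K. 0 < u x) \<and> sum u K = 1 \<and> (\<Sum>x\<in>K. u x *\<^sub>R x) = y}"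
      by (intro CollectI exI[of _ "\<lambda>w. bc K w x"] conjI) (simp_all add: bc_sum bc_rep)
  qed
  finally show ?thesis .
qed

sublocale simplex_coords K "bc K"
  by unfold_locales
     (auto simp: finite_K bc_affine bc_sum bc_rep bc_vertex hull_bc intro!: continuous_on_bc continuous_intros)

lemma compact_hull: "compact (convex hull K)" by (simp add: finite_K finite_imp_compact_convex_hull)

lemma closure_hull: "convex hull K = closure (convex hull K)"
  by (simp add: compact_hull compact_imp_closed)

lemma lin_indep:
  assumes "(\<Sum>v\<in>K. c v *\<^sub>R v) = 0" "sum c K = 0" "v \<in> K"
  shows "c v = 0"
  using coords_unique[of c "\<lambda>_. 0" v] assms by simp

text \<open>A triangle is a cone over an edge. Each cone adds a factor to the product type of the
  parameters, which is why triangle and tetrahedron get separate lemmas.\<close>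

lemma mean_value_2:
  assumes d: "DIM('a) = 2"
  shows "\<exists>vs C. set vs = K \<and> length vs = Suc (DIM('a)) \<and> C > 0 \<and>
    (\<forall>F. continuous_on UNIV F \<longrightarrow> (\<integral>x. F x \<partial>(lebesgue_on (convex hull K))) = C * avg vs F)"
proof -
  have "card K = 3" using card_K d by simp
  then obtain u v w where K: "K = {u, v, w}" "u \<noteq> v" "v \<noteq> w" "u \<noteq> w" by (auto simp: card_3_iff)
  \<comment> \<open>In these coordinates the point has the barycentric coordinates
    \<open>1 - r\<close>, \<open>r - s\<close> and \<open>s\<close>; the parameters range over
    \<open>0 < r \<le> 1\<close> and \<open>0 \<le> s \<le> r\<close>.\<close>
  define L where "L = (\<lambda>(r::real, s::real). r *\<^sub>R (v - u) + s *\<^sub>R (w - v))"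
  have linL: "linear L" unfolding L_def by (rule linearI) (auto simp: algebra_simps)
  have Lrep: "u + L (r, s) = (1 - r) *\<^sub>R u + (r - s) *\<^sub>R v + s *\<^sub>R w" for r s
    by (simp add: L_def algebra_simps)
  have inj: "b = 0" if "L b = 0" for b
  proof -
    obtain r s where b: "b = (r, s)" by (cases b)
    define c where "c = (\<lambda>x. if x = u then - r else if x = v then r - s else s)"
    have "(\<Sum>x\<in>K. c x *\<^sub>R x) = L b" "sum c K = 0"
      unfolding K(1) using K(2-) by (simp_all add: c_def L_def b scaleR_diff_left scaleR_diff_right)
    then have s: "(\<Sum>x\<in>K. c x *\<^sub>R x) = 0" "sum c K = 0" using that by simp_all
    have "c u = 0" "c w = 0" by (rule lin_indep[OF s]; simp add: K(1))+
    then show ?thesis using K by (simp add: c_def b zero_prod_def)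
  qed
  have bijL: "bij L" by (rule linear_bij_same_dim[OF linL _ inj]) (use d in auto)
  let ?S = "cone {0..1::real}"
  have rep: "represents ?S (\<lambda>b. u + L b) [u, v, w]"
  proof (rule represents_cone[OF represents_segment])
    show "continuous_on UNIV (\<lambda>b. u + L b)"
      using linL by (auto intro!: continuous_intros simp: linear_continuous_on linear_conv_bounded_linear)
  qed (simp_all add: L_def algebra_simps)
  have sub: "(\<lambda>b. u + L b) ` ?S \<subseteq> convex hull K"
  proof
    fix x assume "x \<in> (\<lambda>b. u + L b) ` ?S"
    then obtain r s where S: "(r, s) \<in> ?S" and x: "x = (1 - r) *\<^sub>R u + (r - s) *\<^sub>R v + s *\<^sub>R w"
      using Lrep by auto
    from S have "0 < r" "r \<le> 1" "0 \<le> s" "s \<le> r"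
      by (auto simp: cone_def divide_le_eq zero_le_divide_iff)
    with x show "x \<in> convex hull K" unfolding K(1) convex_hull_3
      by (intro CollectI exI[of _ "1 - r"] exI[of _ "r - s"] exI[of _ s]) auto
  qed
  have sup: "interior (convex hull K) \<subseteq> (\<lambda>b. u + L b) ` ?S"
  proof
    fix x assume "x \<in> interior (convex hull K)"
    then have pos: "0 < bc K u x" "0 < bc K v x" "0 < bc K w x" using K interior_hull_bc by auto
    have s1: "bc K u x + bc K v x + bc K w x = 1" using bc_sum[of x] K by (simp add: add.assoc)
    have x: "bc K u x *\<^sub>R u + bc K v x *\<^sub>R v + bc K w x *\<^sub>R w = x" using bc_rep[of x] K by (simp add: add.assoc)
    show "x \<in> (\<lambda>b. u + L b) ` ?S"
    proof (rule image_eqI[of _ _ "(bc K v x + bc K w x, bc K w x)"])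
      have "1 - (bc K v x + bc K w x) = bc K u x" using s1 by simp
      then show "x = u + L (bc K v x + bc K w x, bc K w x)" unfolding Lrep by (simp add: x)
      show "(bc K v x + bc K w x, bc K w x) \<in> ?S" using pos s1 by (simp add: cone_def divide_le_eq)
    qed
  qed
  have "\<exists>C>0. \<forall>F. continuous_on UNIV F \<longrightarrow> (\<integral>x. F x \<partial>(lebesgue_on (convex hull K))) = C * avg [u, v, w] F"
    by (rule represents_imp_integral[OF rep linL bijL _ closure_hull sub sup]) (intro cone_borel borel_closed closed_atLeastAtMost)
  moreover have "set [u, v, w] = K" "length [u, v, w] = Suc (DIM('a))" using K d by simp_all
  ultimately show ?thesis by blast
qed

lemma mean_value_3:
  assumes d: "DIM('a) = 3"
  shows "\<exists>vs C. set vs = K \<and> length vs = Suc (DIM('a)) \<and> C > 0 \<and>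
    (\<forall>F. continuous_on UNIV F \<longrightarrow> (\<integral>x. F x \<partial>(lebesgue_on (convex hull K))) = C * avg vs F)"
proof -
  have "card K = Suc 3" using card_K d by simp
  then obtain u K' where K': "K = insert u K'" "u \<notin> K'" "card K' = 3"
    unfolding card_Suc_eq by blast
  obtain v w z where vwz: "K' = {v, w, z}" "v \<noteq> w" "w \<noteq> z" "v \<noteq> z"
    using K'(3) unfolding card_3_iff by blast
  have K: "K = {u, v, w, z}" using K'(1) vwz(1) by simp
  have ne: "u \<noteq> v" "v \<noteq> u" "u \<noteq> w" "w \<noteq> u" "u \<noteq> z" "z \<noteq> u" "v \<noteq> w" "w \<noteq> v" "v \<noteq> z" "z \<noteq> v" "w \<noteq> z" "z \<noteq> w"
    using K'(2) vwz by auto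
  have sumK: "(\<Sum>x\<in>K. h x) = h u + h v + h w + h z" for h :: "'a \<Rightarrow> 'c::ab_group_add"
    unfolding K by (simp add: ne add.assoc)
  \<comment> \<open>One more cone: the barycentric coordinates are \<open>1 - r\<close>,
    \<open>r - s\<close>, \<open>s - t\<close> and \<open>t\<close>.\<close>
  define L where "L = (\<lambda>(r::real, s::real, t::real). r *\<^sub>R (v - u) + s *\<^sub>R (w - v) + t *\<^sub>R (z - w))"
  have linL: "linear L" unfolding L_def by (rule linearI) (simp_all add: case_prod_beta' scaleR_add_left scaleR_add_right)
  have Lrep: "u + L (r, s, t) = (1 - r) *\<^sub>R u + (r - s) *\<^sub>R v + (s - t) *\<^sub>R w + t *\<^sub>R z" for r s t
    by (simp add: L_def algebra_simps)
  have inj: "b = 0" if "L b = 0" for b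
  proof -
    obtain r s t where b: "b = (r, s, t)" by (cases b) 
    define c where "c = (\<lambda>x. if x = u then - r else if x = v then r - s else if x = w then s - t else t)"
    have "(\<Sum>x\<in>K. c x *\<^sub>R x) = L b" "sum c K = 0"
      unfolding sumK by (simp_all add: ne c_def L_def b scaleR_diff_left scaleR_diff_right)
    then have s: "(\<Sum>x\<in>K. c x *\<^sub>R x) = 0" "sum c K = 0" using that by simp_all
    have "c u = 0" "c w = 0" "c z = 0" by (rule lin_indep[OF s]; simp add: K)+
    then show ?thesis by (simp add: ne c_def b zero_prod_def)
  qed
  have bijL: "bij L" by (rule linear_bij_same_dim[OF linL _ inj]) (use d in auto)
  let ?S = "cone (cone {0..1::real})"
  have c1: "continuous_on UNIV (\<lambda>b. v + (case b of (s, t) \<Rightarrow> s *\<^sub>R (w - v) + t *\<^sub>R (z - w)))"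
    unfolding case_prod_beta' by (intro continuous_intros)
  have "represents (cone {0..1::real}) (\<lambda>b. v + (case b of (s, t) \<Rightarrow> s *\<^sub>R (w - v) + t *\<^sub>R (z - w))) [v, w, z]"
  proof (rule represents_cone[OF represents_segment _ _ _ c1])
    show "v + (case (r, r *\<^sub>R y) of (s, t) \<Rightarrow> s *\<^sub>R (w - v) + t *\<^sub>R (z - w)) = v + r *\<^sub>R (w + y *\<^sub>R (z - w) - v)" for r y
      by (simp add: algebra_simps)
  qed simp_all
  then have rep: "represents ?S (\<lambda>b. u + L b) [u, v, w, z]"
  proof (rule represents_cone)
    show "continuous_on UNIV (\<lambda>b. u + L b)"
      using linL by (auto intro!: continuous_intros simp: linear_continuous_on linear_conv_bounded_linear)
    show "u + L (r, r *\<^sub>R y) = u + r *\<^sub>R (v + (case y of (s, t) \<Rightarrow> s *\<^sub>R (w - v) + t *\<^sub>R (z - w)) - u)" for r y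
      by (cases y) (simp add: L_def scaleR_add_right scaleR_diff_right)
    show "length [w, z] = DIM(real \<times> real)" by simp
    show "cone {0..1::real} \<in> sets borel" by (intro cone_borel borel_closed closed_atLeastAtMost)
    show "bounded (cone {0..1::real})" by (intro bounded_cone) simp
  qed
  have sub: "(\<lambda>b. u + L b) ` ?S \<subseteq> convex hull K"
  proof
    fix x assume "x \<in> (\<lambda>b. u + L b) ` ?S"
    then obtain r s t where "(r, s, t) \<in> ?S" and x: "x = (1 - r) *\<^sub>R u + (r - s) *\<^sub>R v + (s - t) *\<^sub>R w + t *\<^sub>R z"
      using Lrep by auto
    then have rs: "0 < r" "r \<le> 1" "0 < s" "s \<le> r" "0 \<le> t" "t \<le> s"
      by (auto simp: cone_def divide_le_eq zero_le_divide_iff zero_less_divide_iff)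
    define c where "c = (\<lambda>x. if x = u then 1 - r else if x = v then r - s else if x = w then s - t else t)"
    have "(\<Sum>x\<in>K. c x *\<^sub>R x) = x" "sum c K = 1" "\<forall>x\<in>K. 0 \<le> c x"
      unfolding x sumK unfolding K using rs by (simp_all add: ne c_def)
    then show "x \<in> convex hull K" unfolding convex_hull_finite[OF finite_K] by blast
  qed
  have sup: "interior (convex hull K) \<subseteq> (\<lambda>b. u + L b) ` ?S"
  proof
    fix x assume "x \<in> interior (convex hull K)"
    then have pos: "0 < bc K u x" "0 < bc K v x" "0 < bc K w x" "0 < bc K z x" unfolding interior_hull_bc by (simp_all add: K)
    have s1: "bc K u x + bc K v x + bc K w x + bc K z x = 1" using bc_sum[of x] unfolding sumK .
    have x: "bc K u x *\<^sub>R u + bc K v x *\<^sub>R v + bc K w x *\<^sub>R w + bc K z x *\<^sub>R z = x" using bc_rep[of x] unfolding sumK .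
    show "x \<in> (\<lambda>b. u + L b) ` ?S"
    proof (rule image_eqI[of _ _ "(bc K v x + bc K w x + bc K z x, bc K w x + bc K z x, bc K z x)"])
      have "1 - (bc K v x + bc K w x + bc K z x) = bc K u x" using s1 by simp
      then show "x = u + L (bc K v x + bc K w x + bc K z x, bc K w x + bc K z x, bc K z x)" unfolding Lrep by (simp add: x)
      show "(bc K v x + bc K w x + bc K z x, bc K w x + bc K z x, bc K z x) \<in> ?S"
        using pos s1 by (simp add: cone_def divide_le_eq)
    qed
  qed
  have "\<exists>C>0. \<forall>F. continuous_on UNIV F \<longrightarrow> (\<integral>x. F x \<partial>(lebesgue_on (convex hull K))) = C * avg [u, v, w, z] F"
    by (rule represents_imp_integral[OF rep linL bijL _ closure_hull sub sup]) (intro cone_borel borel_closed closed_atLeastAtMost)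
  moreover have "set [u, v, w, z] = K" "length [u, v, w, z] = Suc (DIM('a))" using K d by simp_all
  ultimately show ?thesis by blast
qed

text \<open>\<open>m\<close> is the mean value; the normalising constant \<open>C\<close> occurs on
  both sides and drops out.\<close>

theorem simplex_poincare:
  assumes d: "DIM('a) = 2 \<or> DIM('a) = 3"
    and f: "\<And>x. (f has_derivative (\<lambda>h. g x \<bullet> h)) (at x)" "continuous_on UNIV g"
  shows "\<exists>m. (\<integral>x. (f x - m)\<^sup>2 \<partial>(lebesgue_on (convex hull K)))
     \<le> (diameter (convex hull K) / pi)\<^sup>2 * (\<integral>x. (norm (g x))\<^sup>2 \<partial>(lebesgue_on (convex hull K)))"
proof -
  obtain vs C where vs: "set vs = K" "length vs = Suc (DIM('a))" "C > 0"
    and C: "\<And>F. continuous_on UNIV F \<Longrightarrow> (\<integral>x. F x \<partial>(lebesgue_on (convex hull K))) = C * avg vs F"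
    using mean_value_2 mean_value_3 d by blast
  have cf: "continuous_on UNIV f"
    using f by (meson has_derivative_continuous continuous_at_imp_continuous_on)
  let ?m = "avg vs f"
  have ne: "vs \<noteq> []" using vs by auto
  have "(f x - ?m)\<^sup>2 = (f x)\<^sup>2 - (2 * ?m * f x - ?m\<^sup>2)" for x by (simp add: power2_eq_square algebra_simps)
  then have "avg vs (\<lambda>x. (f x - ?m)\<^sup>2) = avg vs (\<lambda>x. (f x)\<^sup>2) - (2 * ?m * ?m - ?m\<^sup>2)"
    using cf ne by (simp add: avg_diff avg_cmult avg_const continuous_intros)
  also have "\<dots> = avg vs (\<lambda>x. (f x)\<^sup>2) - (avg vs f)\<^sup>2" by (simp add: power2_eq_square)
  also have "\<dots> \<le> (diameter (convex hull K) / pi)\<^sup>2 * avg vs (\<lambda>x. (norm (g x))\<^sup>2)"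
    using avg_poincare[OF f, of vs] vs d by auto
  finally have "C * avg vs (\<lambda>x. (f x - ?m)\<^sup>2) \<le> C * ((diameter (convex hull K) / pi)\<^sup>2 * avg vs (\<lambda>x. (norm (g x))\<^sup>2))"
    using vs by simp
  then show ?thesis
    using cf f(2) by (intro exI[of _ ?m]) (simp add: C continuous_intros mult.left_commute)
qed

end

section \<open>Test functions and weak derivatives\<close>

definition C1_grad :: "('a::euclidean_space \<Rightarrow> real) \<Rightarrow> ('a \<Rightarrow> 'a) \<Rightarrow> bool" where
  "C1_grad f g \<longleftrightarrow> (\<forall>x. (f has_derivative (\<lambda>h. g x \<bullet> h)) (at x)) \<and> continuous_on UNIV g"

lemma C1_grad_cont: "C1_grad f g \<Longrightarrow> continuous_on S f"
  unfolding C1_grad_def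
  by (meson has_derivative_continuous continuous_at_imp_continuous_on continuous_on_subset subset_UNIV)

lemma C1_grad_const: "C1_grad (\<lambda>x. c) (\<lambda>x. 0)"
  by (simp add: C1_grad_def)

lemma C1_grad_inner: "C1_grad (\<lambda>x. a \<bullet> x) (\<lambda>x. a)"
  by (auto simp: C1_grad_def intro!: derivative_eq_intros)

lemma C1_grad_nth: "C1_grad (\<lambda>x. x $ i) (\<lambda>x. axis i 1)"
  using C1_grad_inner[of "axis i (1::real)"] by (simp add: cart_eq_inner_axis inner_commute)

lemma C1_grad_cmult: "C1_grad f g \<Longrightarrow> C1_grad (\<lambda>x. c * f x) (\<lambda>x. c *\<^sub>R g x)"
  by (auto simp: C1_grad_def intro!: has_derivative_mult_right continuous_intros)

lemma C1_grad_add: "C1_grad f g \<Longrightarrow> C1_grad f' g' \<Longrightarrow> C1_grad (\<lambda>x. f x + f' x) (\<lambda>x. g x + g' x)"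
  unfolding C1_grad_def inner_add_left
  by (auto intro!: has_derivative_add continuous_intros)

lemma C1_grad_mult:
  assumes "C1_grad f g" "C1_grad f' g'"
  shows "C1_grad (\<lambda>x. f x * f' x) (\<lambda>x. f x *\<^sub>R g' x + f' x *\<^sub>R g x)"
  unfolding C1_grad_def
proof (intro conjI allI)
  fix x
  have "((\<lambda>x. f x * f' x) has_derivative (\<lambda>h. f x * (g' x \<bullet> h) + g x \<bullet> h * f' x)) (at x)"
    using assms unfolding C1_grad_def by (intro has_derivative_mult) auto
  then show "((\<lambda>x. f x * f' x) has_derivative (\<lambda>h. (f x *\<^sub>R g' x + f' x *\<^sub>R g x) \<bullet> h)) (at x)"
    by (simp add: inner_add_left mult.commute)
  show "continuous_on UNIV (\<lambda>x. f x *\<^sub>R g' x + f' x *\<^sub>R g x)"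
    using assms C1_grad_cont[OF assms(1)] C1_grad_cont[OF assms(2)] unfolding C1_grad_def
    by (auto intro!: continuous_intros)
qed

lemma C1_grad_compose:
  assumes "C1_grad f g" "\<And>t. (F has_real_derivative F' t) (at t)" "continuous_on UNIV F'"
  shows "C1_grad (\<lambda>x. F (f x)) (\<lambda>x. F' (f x) *\<^sub>R g x)"
  unfolding C1_grad_def
proof (intro conjI allI)
  fix x
  have "((\<lambda>x. F (f x)) has_derivative (\<lambda>h. F' (f x) * (g x \<bullet> h))) (at x)"
    using assms unfolding C1_grad_def has_field_derivative_def
    by (intro has_derivative_compose[of f "\<lambda>h. g x \<bullet> h" x UNIV F]) auto
  then show "((\<lambda>x. F (f x)) has_derivative (\<lambda>h. (F' (f x) *\<^sub>R g x) \<bullet> h)) (at x)" by simp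
  show "continuous_on UNIV (\<lambda>x. F' (f x) *\<^sub>R g x)"
    using assms C1_grad_cont[OF assms(1)] unfolding C1_grad_def
    by (auto intro!: continuous_intros continuous_on_comp2[OF assms(3)])
qed

lemma C1_grad_prod:
  assumes "finite I" "\<And>i. i \<in> I \<Longrightarrow> \<exists>g. C1_grad (f i) g"
  shows "\<exists>g. C1_grad (\<lambda>x. \<Prod>i\<in>I. f i x) g"
  using assms
proof (induction I rule: finite_induct)
  case empty
  then show ?case using C1_grad_const by auto
next
  case (insert i I)
  obtain g where g: "C1_grad (f i) g" using insert.prems by blast
  obtain g' where g': "C1_grad (\<lambda>x. \<Prod>i\<in>I. f i x) g'" using insert by blast
  from C1_grad_mult[OF g g'] insert.hyps show ?case by auto
qed

lemma pd_C1_grad: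
  assumes "C1_grad f g"
  shows "pd j f x = g x $ j"
proof -
  have "(f has_derivative (\<lambda>h. g x \<bullet> h)) (at x)" using assms by (simp add: C1_grad_def)
  from fun_cong[OF frechet_derivative_at[OF this], of "axis j 1"] have "pd j f x = g x \<bullet> axis j 1"
    by (simp add: pd_def)
  then show ?thesis by (simp add: inner_axis)
qed

lemma testfunI:
  assumes "C1_grad f g" "compact S" "S \<subseteq> U" "\<And>x. x \<notin> S \<Longrightarrow> f x = 0"
  shows "testfun U f"
  unfolding testfun_def
proof (intro conjI allI)
  show "f differentiable at x" for x using assms(1) by (auto simp: C1_grad_def differentiable_def)
  show "continuous_on UNIV (pd j f)" for j
    using assms(1) unfolding pd_C1_grad[OF assms(1), abs_def] C1_grad_def by (auto intro!: continuous_intros)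
  have "closure {x. f x \<noteq> 0} \<subseteq> S"
    by (rule closure_minimal) (use assms in \<open>auto simp: compact_imp_closed\<close>)
  then show "compact (closure {x. f x \<noteq> 0})" "closure {x. f x \<noteq> 0} \<subseteq> U"
    using assms(2,3) by (auto intro: bounded_subset simp: compact_eq_bounded_closed)
qed

lemma testfun_C1_grad:
  assumes "testfun U f"
  shows "C1_grad f (\<lambda>x. \<chi> j. pd j f x)"
  unfolding C1_grad_def
proof (intro conjI allI)
  fix x
  have d: "(f has_derivative frechet_derivative f (at x)) (at x)"
    using assms by (simp add: testfun_def frechet_derivative_works)
  then have lin: "linear (frechet_derivative f (at x))" by (rule has_derivative_linear)
  have "frechet_derivative f (at x) h = (\<chi> j. pd j f x) \<bullet> h" for h
  proof -
    have "frechet_derivative f (at x) h = frechet_derivative f (at x) (\<Sum>j\<in>UNIV. (h $ j) *\<^sub>R axis j 1)"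
      using basis_expansion[of h] by (simp add: scalar_mult_eq_scaleR)
    also have "\<dots> = (\<Sum>j\<in>UNIV. (h $ j) * pd j f x)"
      by (simp add: linear_sum[OF lin] linear_scale[OF lin] pd_def)
    finally show ?thesis by (simp add: inner_vec_def mult.commute)
  qed
  then have "frechet_derivative f (at x) = (\<lambda>h. (\<chi> j. pd j f x) \<bullet> h)" by (rule ext)
  with d show "(f has_derivative (\<lambda>h. (\<chi> j. pd j f x) \<bullet> h)) (at x)" by simp
  show "continuous_on UNIV (\<lambda>x. \<chi> j. pd j f x)"
    using assms by (auto simp: testfun_def intro!: continuous_intros)
qed

lemma testfun_mono: "testfun U f \<Longrightarrow> U \<subseteq> V \<Longrightarrow> testfun V f"
  by (auto simp: testfun_def)

lemma testfun_zero:
  assumes "testfun U f" and x: "x \<notin> closure {x. f x \<noteq> 0}"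
  shows "f x = 0 \<and> pd j f x = 0"
proof -
  define S where "S = - closure {x. f x \<noteq> 0}"
  have S: "open S" "x \<in> S" using x by (auto simp: S_def)
  have 0: "f y = 0" if "y \<in> S" for y
    using that closure_subset[of "{x. f x \<noteq> 0}"] unfolding S_def by blast
  have "((\<lambda>x. 0) has_derivative (\<lambda>h. 0)) (at x)" by simp
  then have "(f has_derivative (\<lambda>h. 0)) (at x)"
    by (rule has_derivative_transform_within_open[OF _ S]) (simp add: 0)
  from fun_cong[OF frechet_derivative_at[OF this], of "axis j 1"] show ?thesis
    using 0[OF S(2)] by (simp add: pd_def)
qed

lemma testfun_outside:
  assumes "testfun U f" "x \<notin> U"
  shows "f x = 0" "pd j f x = 0"
proof -
  have "x \<notin> closure {x. f x \<noteq> 0}" using assms unfolding testfun_def by blast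
  from testfun_zero[OF assms(1) this] show "f x = 0" "pd j f x = 0" by simp_all
qed

lemma bounded_range_compact_support:
  fixes g :: "'a::topological_space \<Rightarrow> 'b::real_normed_vector"
  assumes "continuous_on UNIV g" "compact S" "\<And>x. x \<notin> S \<Longrightarrow> g x = 0"
  obtains B where "B > 0" "\<And>x. norm (g x) \<le> B"
proof -
  have "compact (g ` S)" by (rule compact_continuous_image[OF continuous_on_subset[OF assms(1)] assms(2)]) simp
  then have "bounded (g ` S)" by (rule compact_imp_bounded)
  then obtain B where B: "B > 0" "\<And>x. x \<in> S \<Longrightarrow> norm (g x) \<le> B"
    unfolding bounded_pos by blast
  have "norm (g x) \<le> B" for x using B assms(3)[of x] by (cases "x \<in> S") auto
  with B that show ?thesis by blast
qed

lemma testfun_bounded: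
  assumes "testfun U f"
  obtains B where "B > 0" "\<And>x. norm (f x) \<le> B" "\<And>x j. norm (pd j f x) \<le> B"
proof -
  let ?S = "closure {x. f x \<noteq> 0}" and ?g = "\<lambda>x. \<chi> j. pd j f x"
  have c: "compact ?S" using assms by (simp add: testfun_def)
  have z1: "f x = 0" if "x \<notin> ?S" for x using testfun_zero[OF assms that] by simp
  have z2: "?g x = 0" if "x \<notin> ?S" for x using testfun_zero[OF assms that] by (simp add: vec_eq_iff)
  have c1: "continuous_on UNIV f" by (rule C1_grad_cont[OF testfun_C1_grad[OF assms]])
  have c2: "continuous_on UNIV ?g" using testfun_C1_grad[OF assms] by (simp add: C1_grad_def)
  obtain B1 where B1: "B1 > 0" "\<And>x. norm (f x) \<le> B1"
    using bounded_range_compact_support[OF c1 c z1] by blast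
  obtain B2 where B2: "B2 > 0" "\<And>x. norm (?g x) \<le> B2"
    using bounded_range_compact_support[OF c2 c z2] by blast
  have "norm (pd j f x) \<le> B2" for j x
    using component_le_norm_cart[of "?g x" j] B2(2)[of x] by simp
  then have "norm (pd j f x) \<le> max B1 B2" for j x by (simp add: le_max_iff_disj)
  moreover have "norm (f x) \<le> max B1 B2" for x using B1(2)[of x] by (simp add: le_max_iff_disj)
  moreover have "max B1 B2 > 0" using B1(1) by simp
  ultimately show ?thesis using that[of "max B1 B2"] by blast
qed

lemma testfun_measurable:
  assumes "testfun U f"
  shows "f \<in> borel_measurable borel" "pd j f \<in> borel_measurable borel"
  using C1_grad_cont[OF testfun_C1_grad[OF assms]] assms
  by (auto intro!: borel_measurable_continuous_onI simp: testfun_def)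

section \<open>Cutoff functions\<close>

text \<open>Squaring the positive part removes its kink. All cutoffs below are built from this
  function.\<close>

lemma DERIV_max_square: "((\<lambda>t::real. (max 0 t)\<^sup>2) has_real_derivative 2 * max 0 t) (at t)"
proof -
  consider "t > 0" | "t < 0" | "t = 0" by linarith
  then show ?thesis
  proof cases
    case 1
    have "((\<lambda>t. t\<^sup>2) has_real_derivative 2 * max 0 t) (at t)" using 1 by (auto intro!: derivative_eq_intros)
    then show ?thesis
      by (rule has_field_derivative_transform_within_open[of _ _ _ "{0<..}"]) (use 1 in auto)
  next
    case 2
    have "((\<lambda>t. 0) has_real_derivative 2 * max 0 t) (at t)" using 2 by (auto intro!: derivative_eq_intros)
    then show ?thesis
      by (rule has_field_derivative_transform_within_open[of _ _ _ "{..<0}"]) (use 2 in auto)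
  next
    case 3
    have "((\<lambda>h::real. max 0 h * (max 0 h / h)) \<longlongrightarrow> 0) (at 0)"
    proof (rule Lim_null_comparison)
      show "\<forall>\<^sub>F h in at 0. norm (max 0 h * (max 0 h / h)) \<le> \<bar>h::real\<bar>"
        by (auto simp: eventually_at_filter max_def intro!: always_eventually)
      show "((\<lambda>h::real. \<bar>h\<bar>) \<longlongrightarrow> 0) (at 0)" by (rule tendsto_rabs_zero) (rule tendsto_ident_at)
    qed
    then show ?thesis using 3 by (simp add: DERIV_def power2_eq_square)
  qed
qed

text \<open>A C^1 step: zero on the negative axis and close to 1 far to the right, so that
  \<open>ramp (k * t)\<close> tends to the indicator of \<open>t > 0\<close>.\<close>

definition ramp :: "real \<Rightarrow> real" where "ramp t = (max 0 t)\<^sup>2 / (1 + t\<^sup>2)"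

lemma ramp_props: "0 \<le> ramp t" "ramp t \<le> 1" "t \<le> 0 \<Longrightarrow> ramp t = 0" "t > 0 \<Longrightarrow> ramp t = t\<^sup>2 / (1 + t\<^sup>2)"
  by (auto simp: ramp_def max_def divide_le_eq add_pos_nonneg)

lemma ramp_C1: "\<exists>F'. (\<forall>t. (ramp has_real_derivative F' t) (at t)) \<and> continuous_on UNIV F'"
proof (intro exI conjI allI)
  have pos: "1 + t\<^sup>2 \<noteq> 0" for t :: real by (smt (verit) zero_le_power2)
  show "(ramp has_real_derivative (2 * max 0 t * (1 + t\<^sup>2) - (max 0 t)\<^sup>2 * (2 * t)) / ((1 + t\<^sup>2) * (1 + t\<^sup>2))) (at t)" for t
    unfolding ramp_def
    by (rule DERIV_divide[OF DERIV_max_square]) (auto intro!: derivative_eq_intros simp: pos)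
  show "continuous_on UNIV (\<lambda>t::real. (2 * max 0 t * (1 + t\<^sup>2) - (max 0 t)\<^sup>2 * (2 * t)) / ((1 + t\<^sup>2) * (1 + t\<^sup>2)))"
    using pos by (intro continuous_intros) auto
qed

lemma ramp_tendsto: "(\<lambda>k. ramp (real k * t)) \<longlonglongrightarrow> (if t > 0 then 1 else 0)"
proof (cases "t > 0")
  case True
  have "ramp (real k * t) = 1 - 1 / (1 + (real k * t)\<^sup>2)" for k
  proof (cases "k = 0")
    case False
    then have "real k * t > 0" using True by simp
    moreover have "1 + (real k * t)\<^sup>2 \<noteq> 0" by (smt (verit) zero_le_power2)
    ultimately show ?thesis by (simp add: ramp_props(4) field_simps)
  qed (simp add: ramp_def)
  moreover have "(\<lambda>k. 1 - 1 / (1 + (real k * t)\<^sup>2)) \<longlonglongrightarrow> 1 - 0"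
  proof (intro tendsto_diff tendsto_const tendsto_divide_0[OF tendsto_const])
    have "filterlim (\<lambda>k. real k * t) at_top sequentially"
      using True by (simp add: filterlim_tendsto_pos_mult_at_top[OF tendsto_const] filterlim_real_sequentially mult.commute)
    then have "filterlim (\<lambda>k. (real k * t)\<^sup>2) at_top sequentially" by (rule filterlim_pow_at_top[rotated]) simp
    then have "filterlim (\<lambda>k. 1 + (real k * t)\<^sup>2) at_top sequentially"
      by (rule filterlim_tendsto_add_at_top[OF tendsto_const])
    then show "filterlim (\<lambda>k. 1 + (real k * t)\<^sup>2) at_infinity sequentially"
      by (rule filterlim_at_top_imp_at_infinity)
  qed
  ultimately show ?thesis using True by simp
next
  case False
  then have "ramp (real k * t) = 0" for k by (simp add: ramp_props mult_nonneg_nonpos)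
  then show ?thesis using False by simp
qed

text \<open>A product over the coordinates of one ramp for each face of the box. The support lies in
  the closed box, and the ramps steepen with \<open>k\<close>.\<close>

lemma box_bump:
  fixes l u :: "real^'n"
  assumes "cbox l u \<subseteq> U"
  obtains \<phi> where "\<And>k::nat. testfun U (\<phi> k)" "\<And>k x. 0 \<le> \<phi> k x \<and> \<phi> k x \<le> 1"
    "\<And>x. (\<lambda>k. \<phi> k x) \<longlonglongrightarrow> indicator (box l u) x"
proof
  define \<phi> where "\<phi> = (\<lambda>(k::nat) x. \<Prod>i\<in>UNIV. ramp (real k * (x $ i - l $ i)) * ramp (real k * (u $ i - x $ i)))"
  show b: "0 \<le> \<phi> k x \<and> \<phi> k x \<le> 1" for k x
    unfolding \<phi>_def by (auto intro!: prod_nonneg prod_le_1 mult_nonneg_nonneg mult_le_one ramp_props)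
  show "testfun U (\<phi> k)" for k
  proof -
    obtain F' where F': "\<And>t. (ramp has_real_derivative F' t) (at t)" "continuous_on UNIV F'" using ramp_C1 by blast
    have "\<exists>g. C1_grad (\<lambda>x. ramp (real k * (x $ i - l $ i)) * ramp (real k * (u $ i - x $ i))) g" for i
    proof -
      have 1: "C1_grad (\<lambda>x. real k * (x $ i - l $ i)) (\<lambda>x. real k *\<^sub>R (axis i 1 + 0))"
        using C1_grad_cmult[OF C1_grad_add[OF C1_grad_nth C1_grad_const[of "- l $ i"]]] by simp
      have 2: "C1_grad (\<lambda>x. real k * (u $ i - x $ i)) (\<lambda>x. real k *\<^sub>R (0 + (- 1) *\<^sub>R axis i 1))"
        using C1_grad_cmult[OF C1_grad_add[OF C1_grad_const[of "u $ i"] C1_grad_cmult[OF C1_grad_nth, of "-1"]]] by simp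
      from C1_grad_mult[OF C1_grad_compose[OF 1 F'] C1_grad_compose[OF 2 F']] show ?thesis by blast
    qed
    then obtain g where g: "C1_grad (\<phi> k) g"
      using C1_grad_prod[of UNIV "\<lambda>i x. ramp (real k * (x $ i - l $ i)) * ramp (real k * (u $ i - x $ i))"]
      unfolding \<phi>_def by auto
    show ?thesis
    proof (rule testfunI[OF g compact_cbox assms])
      fix x assume "x \<notin> cbox l u"
      then obtain i where "\<not> (l $ i \<le> x $ i \<and> x $ i \<le> u $ i)" by (auto simp: mem_box_cart)
      then have "x $ i - l $ i \<le> 0 \<or> u $ i - x $ i \<le> 0" by linarith
      then have "ramp (real k * (x $ i - l $ i)) * ramp (real k * (u $ i - x $ i)) = 0"
        by (auto simp: ramp_props mult_nonneg_nonpos)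
      then show "\<phi> k x = 0" unfolding \<phi>_def by (intro prod_zero) auto
    qed
  qed
  show "(\<lambda>k. \<phi> k x) \<longlonglongrightarrow> indicator (box l u) x" for x
  proof -
    have "(\<lambda>k. \<phi> k x) \<longlonglongrightarrow> (\<Prod>i\<in>UNIV. (if x $ i - l $ i > 0 then 1 else 0) * (if u $ i - x $ i > 0 then 1 else 0))"
      unfolding \<phi>_def by (intro tendsto_intros ramp_tendsto)
    also have "(\<Prod>i\<in>UNIV. (if x $ i - l $ i > 0 then 1 else 0) * (if u $ i - x $ i > 0 then 1 else (0::real))) = indicator (box l u) x"
    proof (cases "x \<in> box l u")
      case True
      then show ?thesis by (simp add: mem_box_cart)
    next
      case False
      then obtain i where "\<not> (x $ i - l $ i > 0 \<and> u $ i - x $ i > 0)" by (auto simp: mem_box_cart)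
      then have "(if x $ i - l $ i > 0 then 1 else 0) * (if u $ i - x $ i > 0 then 1 else (0::real)) = 0" by auto
      then have "(\<Prod>i\<in>UNIV. (if x $ i - l $ i > 0 then 1 else 0) * (if u $ i - x $ i > 0 then 1 else (0::real))) = 0"
        by (intro prod_zero bexI[of _ i]) auto
      then show ?thesis using False by simp
    qed
    finally show ?thesis .
  qed
qed

section \<open>Square-integrable functions\<close>

lemma L2_measurable: "L2 X f \<Longrightarrow> f \<in> borel_measurable (lebesgue_on X)"
  and L2_integrable: "L2 X f \<Longrightarrow> integrable (lebesgue_on X) (\<lambda>x. (norm (f x))\<^sup>2)"
  by (simp_all add: L2_def)

lemma L2_ip_integrable:
  assumes "L2 X f" "L2 X g"
  shows "integrable (lebesgue_on X) (\<lambda>x. f x \<bullet> g x)"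
proof (rule Bochner_Integration.integrable_bound)
  show "integrable (lebesgue_on X) (\<lambda>x. (norm (f x))\<^sup>2 + (norm (g x))\<^sup>2)"
    using assms by (intro Bochner_Integration.integrable_add L2_integrable)
  show "(\<lambda>x. f x \<bullet> g x) \<in> borel_measurable (lebesgue_on X)"
    using assms by (intro borel_measurable_inner L2_measurable)
  have "norm (f x \<bullet> g x) \<le> norm ((norm (f x))\<^sup>2 + (norm (g x))\<^sup>2)" for x
  proof -
    have "norm (f x \<bullet> g x) \<le> norm (f x) * norm (g x)" using Cauchy_Schwarz_ineq2 by simp
    also have "\<dots> \<le> (norm (f x))\<^sup>2 + (norm (g x))\<^sup>2"
      using sum_squares_bound[of "norm (f x)" "norm (g x)"] mult_nonneg_nonneg[OF norm_ge_zero norm_ge_zero, of "f x" "g x"] by linarith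
    finally show ?thesis by simp
  qed
  then show "AE x in lebesgue_on X. norm (f x \<bullet> g x) \<le> norm ((norm (f x))\<^sup>2 + (norm (g x))\<^sup>2)" by simp
qed

lemma L2_add:
  assumes "L2 X f" "L2 X g"
  shows "L2 X (\<lambda>x. f x + g x)"
  unfolding L2_def
proof
  show m: "(\<lambda>x. f x + g x) \<in> borel_measurable (lebesgue_on X)"
    using assms by (intro borel_measurable_add L2_measurable)
  have "(norm (f x + g x))\<^sup>2 = (norm (f x))\<^sup>2 + 2 * (f x \<bullet> g x) + (norm (g x))\<^sup>2" for x
    by (simp add: power2_norm_eq_inner inner_simps inner_commute)
  then show "integrable (lebesgue_on X) (\<lambda>x. (norm (f x + g x))\<^sup>2)"
    using assms L2_ip_integrable[OF assms] by (simp add: L2_integrable)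
qed

lemma L2_scaleR: "L2 X f \<Longrightarrow> L2 X (\<lambda>x. c *\<^sub>R f x)"
  by (auto simp: L2_def power_mult_distrib)

lemma L2_diff: "L2 X f \<Longrightarrow> L2 X g \<Longrightarrow> L2 X (\<lambda>x. f x - g x)"
  using L2_add[of X f "\<lambda>x. (-1) *\<^sub>R g x"] L2_scaleR[of X g "-1"] by simp

lemma L2_uminus: "L2 X f \<Longrightarrow> L2 X (\<lambda>x. - f x)"
  using L2_scaleR[of X f "-1"] by simp

lemma L2_zero: "L2 X (\<lambda>x. 0)" by (simp add: L2_def)

lemma L2_sum: "finite I \<Longrightarrow> (\<And>i. i \<in> I \<Longrightarrow> L2 X (f i)) \<Longrightarrow> L2 X (\<lambda>x. \<Sum>i\<in>I. f i x)"
  by (induction I rule: finite_induct) (auto intro: L2_zero L2_add)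

lemma L2_bound:
  assumes "L2 X f" "g \<in> borel_measurable (lebesgue_on X)" "AE x in lebesgue_on X. norm (g x) \<le> C * norm (f x)"
  shows "L2 X g"
  unfolding L2_def
proof
  show "integrable (lebesgue_on X) (\<lambda>x. (norm (g x))\<^sup>2)"
  proof (rule Bochner_Integration.integrable_bound)
    show "integrable (lebesgue_on X) (\<lambda>x. C\<^sup>2 * (norm (f x))\<^sup>2)"
      using assms(1) by (intro integrable_mult_right L2_integrable)
    show "(\<lambda>x. (norm (g x))\<^sup>2) \<in> borel_measurable (lebesgue_on X)" using assms(2) by measurable
    show "AE x in lebesgue_on X. norm ((norm (g x))\<^sup>2) \<le> norm (C\<^sup>2 * (norm (f x))\<^sup>2)"
      using assms(3)
    proof eventually_elim
      case (elim x)
      then have "(norm (g x))\<^sup>2 \<le> (C * norm (f x))\<^sup>2" by (intro power_mono) auto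
      then show ?case by (simp add: power_mult_distrib)
    qed
  qed
qed (use assms in auto)

lemma L2_linear:
  assumes "bounded_linear T" "L2 X f"
  shows "L2 X (\<lambda>x. T (f x))"
proof -
  obtain C where C: "\<And>y. norm (T y) \<le> norm y * C" using bounded_linear.bounded[OF assms(1)] by blast
  show ?thesis
  proof (rule L2_bound[OF assms(2)])
    show "(\<lambda>x. T (f x)) \<in> borel_measurable (lebesgue_on X)"
      using borel_measurable_continuous_onI[OF linear_continuous_on[OF assms(1)]] L2_measurable[OF assms(2)]
      by (rule measurable_compose[rotated])
    show "AE x in lebesgue_on X. norm (T (f x)) \<le> C * norm (f x)" using C by (simp add: mult.commute)
  qed
qed

lemma L2_nth: "L2 X u \<Longrightarrow> L2 X (\<lambda>x. u x $ i)"
  by (rule L2_linear) (rule bounded_linear_vec_nth)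

lemma L2_nth2: "L2 X G \<Longrightarrow> L2 X (\<lambda>x. G x $ i $ j)"
  by (intro L2_nth)

lemma L2_bounded:
  assumes "f \<in> borel_measurable (lebesgue_on X)" "AE x in lebesgue_on X. norm (f x) \<le> B" "X \<in> lmeasurable"
  shows "L2 X f"
proof (rule L2_bound[of X "\<lambda>x. 1::real"])
  have "finite_measure (lebesgue_on X)"
    using assms(3) by (intro finite_measureI) (auto simp: emeasure_restrict_space fmeasurable_def less_top[symmetric])
  then have "integrable (lebesgue_on X) (\<lambda>x. 1::real)" by (rule finite_measure.integrable_const)
  then show "L2 X (\<lambda>x. 1::real)" by (simp add: L2_def)
qed (use assms in auto)

lemma L2_mult_bounded:
  assumes "L2 X f" "c \<in> borel_measurable (lebesgue_on X)" "AE x in lebesgue_on X. \<bar>c x\<bar> \<le> B"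
  shows "L2 X (\<lambda>x. c x *\<^sub>R f x)"
proof (rule L2_bound[OF assms(1)])
  show "(\<lambda>x. c x *\<^sub>R f x) \<in> borel_measurable (lebesgue_on X)"
    using assms L2_measurable by (intro borel_measurable_scaleR)
  show "AE x in lebesgue_on X. norm (c x *\<^sub>R f x) \<le> B * norm (f x)"
    using assms(3) by eventually_elim (auto intro: mult_right_mono)
qed

lemma L2norm_nonneg: "0 \<le> L2norm X f"
  by (simp add: L2norm_def)

lemma L2norm_sq: "(L2norm X f)\<^sup>2 = ip X f f"
  by (simp add: L2norm_def ip_def power2_norm_eq_inner)

lemma ip_commute: "ip X f g = ip X g f" by (simp add: ip_def inner_commute)

lemma ip_add_right: "L2 X f \<Longrightarrow> L2 X g \<Longrightarrow> L2 X h \<Longrightarrow> ip X f (\<lambda>x. g x + h x) = ip X f g + ip X f h"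
  by (simp add: ip_def inner_add_right L2_ip_integrable)

lemma ip_diff_right: "L2 X f \<Longrightarrow> L2 X g \<Longrightarrow> L2 X h \<Longrightarrow> ip X f (\<lambda>x. g x - h x) = ip X f g - ip X f h"
  by (simp add: ip_def inner_diff_right L2_ip_integrable)

lemma ip_add_left: "L2 X f \<Longrightarrow> L2 X g \<Longrightarrow> L2 X h \<Longrightarrow> ip X (\<lambda>x. g x + h x) f = ip X g f + ip X h f"
  by (simp add: ip_def inner_add_left L2_ip_integrable)

lemma ip_diff_left: "L2 X f \<Longrightarrow> L2 X g \<Longrightarrow> L2 X h \<Longrightarrow> ip X (\<lambda>x. g x - h x) f = ip X g f - ip X h f"
  by (simp add: ip_def inner_diff_left L2_ip_integrable)

lemma ip_scaleR_right: "ip X f (\<lambda>x. c *\<^sub>R g x) = c * ip X f g"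
  by (simp add: ip_def)

lemma ip_scaleR_left: "ip X (\<lambda>x. c *\<^sub>R f x) g = c * ip X f g"
  by (simp add: ip_def)

lemma ip_sum_left:
  assumes "finite I" "\<And>i. i \<in> I \<Longrightarrow> L2 X (f i)" "L2 X g"
  shows "ip X (\<lambda>x. \<Sum>i\<in>I. f i x) g = (\<Sum>i\<in>I. ip X (f i) g)"
  unfolding ip_def inner_sum_left by (rule Bochner_Integration.integral_sum) (use assms L2_ip_integrable in auto)

lemma ip_cong_AE:
  assumes "L2 X f" "L2 X f'" "L2 X g" "L2 X g'" "AE x in lebesgue_on X. f x = f' x" "AE x in lebesgue_on X. g x = g' x"
  shows "ip X f g = ip X f' g'"
  unfolding ip_def
proof (rule integral_cong_AE)
  show "AE x in lebesgue_on X. f x \<bullet> g x = f' x \<bullet> g' x" using assms(5,6) by eventually_elim simp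
qed (use assms L2_measurable in \<open>auto intro!: borel_measurable_inner\<close>)

lemma L2norm_cong_AE:
  assumes "L2 X f" "L2 X f'" "AE x in lebesgue_on X. f x = f' x"
  shows "L2norm X f = L2norm X f'"
proof -
  have "(L2norm X f)\<^sup>2 = (L2norm X f')\<^sup>2" unfolding L2norm_sq by (rule ip_cong_AE) (use assms in auto)
  then show ?thesis using L2norm_nonneg by (metis power2_eq_imp_eq)
qed

lemma ip_cauchy:
  assumes f: "L2 X f" and g: "L2 X g"
  shows "\<bar>ip X f g\<bar> \<le> L2norm X f * L2norm X g"
proof -
  let ?a = "ip X f f" and ?b = "ip X g g" and ?c = "ip X f g"
  have q: "0 \<le> ?a - 2 * t * ?c + t\<^sup>2 * ?b" for t
  proof -
    have tg: "L2 X (\<lambda>x. t *\<^sub>R g x)" using g by (rule L2_scaleR)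
    have "0 \<le> (L2norm X (\<lambda>x. f x - t *\<^sub>R g x))\<^sup>2" by simp
    also have "\<dots> = ?a - t * ?c - (t * ip X g f - t * (t * ?b))"
      unfolding L2norm_sq using f g tg
      by (simp add: ip_diff_left ip_diff_right L2_diff ip_scaleR_left ip_scaleR_right right_diff_distrib)
    also have "\<dots> = ?a - 2 * t * ?c + t\<^sup>2 * ?b" by (simp add: ip_commute[of X g f] power2_eq_square)
    finally show ?thesis .
  qed
  have b0: "0 \<le> ?b" using L2norm_sq[of X g] by (metis zero_le_power2)
  have "?c\<^sup>2 \<le> ?a * ?b"
  proof (cases "?b = 0")
    case True
    have "?c = 0"
    proof (rule ccontr)
      assume c: "?c \<noteq> 0"
      \<comment> \<open>When \<open>g\<close> has norm 0 the quadratic \<open>q\<close> is affine in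
        \<open>t\<close>, and this choice of \<open>t\<close> makes it equal to -1.\<close>
      have "0 \<le> ?a - 2 * ((?a + 1) / (2 * ?c)) * ?c" using q[of "(?a + 1) / (2 * ?c)"] True by simp
      also have "\<dots> = - 1" using c by (simp add: field_simps)
      finally show False by simp
    qed
    then show ?thesis using True by simp
  next
    case False
    then have b: "?b > 0" using b0 by simp
    have "0 \<le> ?a - 2 * (?c / ?b) * ?c + (?c / ?b)\<^sup>2 * ?b" by (rule q)
    also have "\<dots> = ?a - ?c\<^sup>2 / ?b" using b by (simp add: field_simps power2_eq_square)
    finally have "?c\<^sup>2 / ?b \<le> ?a" by simp
    then show ?thesis using b by (simp add: pos_divide_le_eq)
  qed
  also have "\<dots> = (L2norm X f * L2norm X g)\<^sup>2" by (simp add: power_mult_distrib L2norm_sq)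
  finally have "\<bar>?c\<bar>\<^sup>2 \<le> (L2norm X f * L2norm X g)\<^sup>2" by simp
  then show ?thesis by (rule power2_le_imp_le) (simp add: L2norm_nonneg)
qed

lemma L2norm_triangle:
  assumes f: "L2 X f" and g: "L2 X g"
  shows "L2norm X (\<lambda>x. f x + g x) \<le> L2norm X f + L2norm X g"
proof (rule power2_le_imp_le)
  have "(L2norm X (\<lambda>x. f x + g x))\<^sup>2 = (L2norm X f)\<^sup>2 + 2 * ip X f g + (L2norm X g)\<^sup>2"
    unfolding L2norm_sq using f g by (simp add: ip_add_left ip_add_right L2_add ip_commute[of X g f])
  also have "\<dots> \<le> (L2norm X f + L2norm X g)\<^sup>2"
    using ip_cauchy[OF f g] by (simp add: power2_sum)
  finally show "(L2norm X (\<lambda>x. f x + g x))\<^sup>2 \<le> (L2norm X f + L2norm X g)\<^sup>2" .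
qed (simp add: L2norm_nonneg)

lemma L2norm_scaleR: "L2norm X (\<lambda>x. c *\<^sub>R f x) = \<bar>c\<bar> * L2norm X f"
  by (simp add: L2norm_def power_mult_distrib real_sqrt_mult)

lemma L2norm_diff_commute: "L2norm X (\<lambda>x. f x - g x) = L2norm X (\<lambda>x. g x - f x)"
  by (simp add: L2norm_def norm_minus_commute)

lemma L2norm_diff_ineq:
  assumes f: "L2 X f" and g: "L2 X g"
  shows "\<bar>L2norm X f - L2norm X g\<bar> \<le> L2norm X (\<lambda>x. f x - g x)"
  using L2norm_triangle[OF L2_diff[OF f g] g] L2norm_triangle[OF L2_diff[OF g f] f]
  by (simp add: L2norm_diff_commute[of X g f] abs_le_iff)

lemma ip_tendsto:
  assumes q: "L2 X q" and u: "L2 X u" "\<And>k. L2 X (\<phi> k)" and lim: "(\<lambda>k::nat. L2norm X (\<lambda>x. \<phi> k x - u x)) \<longlonglongrightarrow> 0"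
  shows "(\<lambda>k. ip X q (\<phi> k)) \<longlonglongrightarrow> ip X q u"
proof -
  have "(\<lambda>k. ip X q (\<phi> k) - ip X q u) \<longlonglongrightarrow> 0"
  proof (rule Lim_null_comparison)
    show "\<forall>\<^sub>F k in sequentially. norm (ip X q (\<phi> k) - ip X q u) \<le> L2norm X q * L2norm X (\<lambda>x. \<phi> k x - u x)"
      using ip_cauchy[OF q L2_diff[OF u(2,1)]] by (simp add: ip_diff_right q u)
    show "(\<lambda>k. L2norm X q * L2norm X (\<lambda>x. \<phi> k x - u x)) \<longlonglongrightarrow> 0"
      by (rule tendsto_mult_right_zero[OF lim])
  qed
  then show ?thesis by (simp add: LIM_zero_iff)
qed

lemma L2norm_tendsto:
  assumes u: "L2 X u" "\<And>k. L2 X (\<phi> k)" and lim: "(\<lambda>k::nat. L2norm X (\<lambda>x. \<phi> k x - u x)) \<longlonglongrightarrow> 0"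
  shows "(\<lambda>k. L2norm X (\<phi> k)) \<longlonglongrightarrow> L2norm X u"
proof -
  have "(\<lambda>k. L2norm X (\<phi> k) - L2norm X u) \<longlonglongrightarrow> 0"
    by (rule Lim_null_comparison[OF _ lim]) (simp add: L2norm_diff_ineq u)
  then show ?thesis by (simp add: LIM_zero_iff)
qed

lemma L2_subset:
  assumes "L2 X f" "Y \<subseteq> X" "X \<in> sets lebesgue" "Y \<in> sets lebesgue"
  shows "L2 Y f"
  unfolding L2_def
proof
  show "f \<in> borel_measurable (lebesgue_on Y)"
    using L2_measurable[OF assms(1)] assms(2) by (rule measurable_restrict_mono)
  have "integrable lebesgue (\<lambda>x. indicator X x *\<^sub>R (norm (f x))\<^sup>2)"
    using L2_integrable[OF assms(1)] assms(3) by (simp add: integrable_restrict_space)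
  from integrable_mult_indicator[OF assms(4) this]
  have "integrable lebesgue (\<lambda>x. indicator Y x *\<^sub>R (norm (f x))\<^sup>2)"
    by (rule Bochner_Integration.integrable_cong[THEN iffD1, rotated 2]) (use assms(2) in \<open>auto simp: indicator_def\<close>)
  then show "integrable (lebesgue_on Y) (\<lambda>x. (norm (f x))\<^sup>2)" using assms(4) by (simp add: integrable_restrict_space)
qed

lemma integral_extend:
  fixes f :: "real^'n \<Rightarrow> 'b::euclidean_space"
  assumes "Y \<subseteq> X" "X \<in> sets lebesgue" "Y \<in> sets lebesgue"
  shows "integral\<^sup>L (lebesgue_on X) (\<lambda>x. if x \<in> Y then f x else 0) = integral\<^sup>L (lebesgue_on Y) f"
  using Lebesgue_Measure.integral_restrict_Int[OF assms(3,2), of f] assms(1) by (simp add: Int_absorb2)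

lemma L2_extend:
  fixes f :: "real^'n \<Rightarrow> 'b::euclidean_space"
  assumes "L2 Y f" "Y \<subseteq> X" "X \<in> sets lebesgue" "Y \<in> sets lebesgue"
  shows "L2 X (\<lambda>x. if x \<in> Y then f x else 0)"
  unfolding L2_def
proof
  have "(\<lambda>x. if x \<in> Y then f x else 0) \<in> borel_measurable lebesgue"
    by (rule borel_measurable_if_I[OF L2_measurable[OF assms(1)] assms(4)])
  then show "(\<lambda>x. if x \<in> Y then f x else 0) \<in> borel_measurable (lebesgue_on X)"
    by (rule measurable_restrict_space1)
  have "integrable lebesgue (\<lambda>x. if x \<in> Y then (norm (f x))\<^sup>2 else 0)"
    using Lebesgue_Measure.integrable_restrict_UNIV[OF assms(4), of "\<lambda>x. (norm (f x))\<^sup>2"] L2_integrable[OF assms(1)] by blast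
  moreover have "(\<lambda>x. if x \<in> Y then (norm (f x))\<^sup>2 else 0) = (\<lambda>x. (norm (if x \<in> Y then f x else 0))\<^sup>2)" by auto
  ultimately have "integrable lebesgue (\<lambda>x. (norm (if x \<in> Y then f x else 0))\<^sup>2)" by simp
  from integrable_mult_indicator[OF assms(3) this]
  show "integrable (lebesgue_on X) (\<lambda>x. (norm (if x \<in> Y then f x else 0))\<^sup>2)"
    using assms(3) by (subst integrable_restrict_space) auto
qed

lemma ip_extend_left:
  fixes f :: "real^'n \<Rightarrow> 'b::euclidean_space"
  assumes "Y \<subseteq> X" "X \<in> sets lebesgue" "Y \<in> sets lebesgue"
  shows "ip X (\<lambda>x. if x \<in> Y then f x else 0) g = ip Y f g"
proof -
  have "(\<lambda>x. (if x \<in> Y then f x else 0) \<bullet> g x) = (\<lambda>x. if x \<in> Y then f x \<bullet> g x else 0)" by auto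
  then show ?thesis using integral_extend[OF assms, of "\<lambda>x. f x \<bullet> g x"] by (simp add: ip_def)
qed

lemma L2norm_mono_set:
  fixes f :: "real^'n \<Rightarrow> 'b::euclidean_space"
  assumes "L2 X f" "Y \<subseteq> X" "X \<in> sets lebesgue" "Y \<in> sets lebesgue"
  shows "L2norm Y f \<le> L2norm X f"
  unfolding L2norm_def integral_extend[OF assms(2-4), of "\<lambda>x. (norm (f x))\<^sup>2", symmetric]
proof (intro real_sqrt_le_mono integral_mono)
  have "L2 X (\<lambda>x. if x \<in> Y then f x else 0)" by (rule L2_extend[OF L2_subset[OF assms] assms(2-4)])
  from L2_integrable[OF this] show "integrable (lebesgue_on X) (\<lambda>x. if x \<in> Y then (norm (f x))\<^sup>2 else 0)"
    by (rule Bochner_Integration.integrable_cong[THEN iffD1, rotated 2]) auto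
qed (use L2_integrable[OF assms(1)] in auto)

section \<open>Fundamental lemma of the calculus of variations\<close>

text \<open>Boxes are an intersection-stable generator of the Borel sets, and the sets over which
  \<open>h\<close> integrates to 0 form a Dynkin system.\<close>

lemma AE_zero_if_box_integrals_zero:
  fixes h :: "real^'n \<Rightarrow> real"
  assumes h: "integrable lborel h" and z: "\<And>l u. (\<integral>x. indicator (box l u) x * h x \<partial>lborel) = 0"
  shows "AE x in lborel. h x = 0"
proof -
  have ih: "integrable lborel (\<lambda>x. indicator A x *\<^sub>R h x)" if "A \<in> sets borel" for A
    using integrable_mult_indicator[OF _ h, of A] that by simp
  have "(\<integral>x. indicator A x *\<^sub>R h x \<partial>lborel) = 0" if "A \<in> sets borel" for A
  proof -
    let ?E = "range (\<lambda>(a, b). box a b :: (real^'n) set)"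
    have "Int_stable ?E" by (auto simp: Int_stable_def box_Int_box)
    moreover have "?E \<subseteq> Pow UNIV" by simp
    moreover have "A \<in> sigma_sets UNIV ?E" using that by (simp add: borel_eq_box)
    ultimately show ?thesis
    proof (induction rule: sigma_sets_induct_disjoint)
      case (basic A)
      then show ?case using z by auto
    next
      case empty
      then show ?case by simp
    next
      case (compl A)
      then have A: "A \<in> sets borel" by (simp add: borel_eq_box)
      let ?B = "\<lambda>n::nat. box (- (real n *\<^sub>R One)) (real n *\<^sub>R One) :: (real^'n) set"
      \<comment> \<open>The complement involves the integral over the whole space, obtained by
        exhausting it with boxes.\<close>
      have "(\<lambda>n. \<integral>x. indicator (?B n) x *\<^sub>R h x \<partial>lborel) \<longlonglongrightarrow> (\<integral>x. h x \<partial>lborel)"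
      proof (rule integral_dominated_convergence[where w = "\<lambda>x. norm (h x)"])
        show "AE x in lborel. (\<lambda>n. indicator (?B n) x *\<^sub>R h x) \<longlonglongrightarrow> h x"
        proof (rule AE_I2)
          fix x :: "real^'n"
          have "x \<in> (\<Union>i. ?B i)" unfolding UN_box_eq_UNIV by simp
          then obtain N where N: "x \<in> ?B N" by (rule UN_E)
          have "x \<in> ?B n" if "n \<ge> N" for n
          proof -
            have "?B N \<subseteq> ?B n" using that by (intro subset_box_imp) (auto simp: inner_sum_left inner_Basis intro!: mult_right_mono sum_nonneg)
            then show ?thesis using N by blast
          qed
          then have "\<forall>\<^sub>F n in sequentially. indicator (?B n) x *\<^sub>R h x = h x"
            unfolding eventually_sequentially by (intro exI[of _ N]) simp
          then show "(\<lambda>n. indicator (?B n) x *\<^sub>R h x) \<longlonglongrightarrow> h x" by (rule tendsto_eventually)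
        qed
      qed (use h ih in \<open>auto simp: indicator_def\<close>)
      then have "(\<integral>x. h x \<partial>lborel) = 0" using z by (simp add: LIMSEQ_const_iff)
      moreover have "(\<integral>x. indicator (UNIV - A) x *\<^sub>R h x \<partial>lborel) = (\<integral>x. h x - indicator A x *\<^sub>R h x \<partial>lborel)"
        by (rule Bochner_Integration.integral_cong) (auto simp: indicator_def)
      ultimately show ?case using compl(2) h ih[OF A] by simp
    next
      case (union F)
      then have F: "F i \<in> sets borel" for i by (auto simp: borel_eq_box)
      have "set_integrable lborel (\<Union>i. F i) h" unfolding set_integrable_def using F by (intro ih) auto
      from lebesgue_integral_countable_add[OF _ _ this] union(1) F
      have "(LINT x:(\<Union>i. F i)|lborel. h x) = (\<Sum>i. LINT x:F i|lborel. h x)"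
        by (auto simp: disjoint_family_on_def)
      then show ?case using union(3) by (simp add: set_lebesgue_integral_def)
    qed
  qed
  then have "AE x in lborel. h x = (\<lambda>x. 0) x"
    by (intro density_unique_real[OF h]) (auto simp: set_lebesgue_integral_def)
  then show ?thesis by simp
qed

lemma testfun_integrable:
  assumes U: "open U" and h: "integrable (lebesgue_on U) h" and \<phi>: "testfun V \<phi>"
  shows "integrable (lebesgue_on U) (\<lambda>x. h x * \<phi> x)" "integrable (lebesgue_on U) (\<lambda>x. h x * pd j \<phi> x)"
proof -
  obtain B where B: "\<And>x. norm (\<phi> x) \<le> B" "\<And>x j. norm (pd j \<phi> x) \<le> B" using testfun_bounded[OF \<phi>] by metis
  have m: "\<phi> \<in> borel_measurable (lebesgue_on U)" "pd j \<phi> \<in> borel_measurable (lebesgue_on U)"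
    using testfun_measurable[OF \<phi>] by (simp_all add: measurable_restrict_space1 measurable_completion)
  have dom: "integrable (lebesgue_on U) (\<lambda>x. h x * f x)"
    if "f \<in> borel_measurable (lebesgue_on U)" "\<And>x. norm (f x) \<le> B" for f
  proof (rule Bochner_Integration.integrable_bound)
    show "integrable (lebesgue_on U) (\<lambda>x. B * norm (h x))" using h by (intro integrable_mult_right integrable_norm)
    show "(\<lambda>x. h x * f x) \<in> borel_measurable (lebesgue_on U)" using that h by (intro borel_measurable_times) auto
    show "AE x in lebesgue_on U. norm (h x * f x) \<le> norm (B * norm (h x))"
    proof (rule AE_I2)
      fix x
      have "norm (h x * f x) \<le> norm (h x) * B" using that(2)[of x] by (simp add: abs_mult mult_left_mono)
      also have "\<dots> \<le> norm (B * norm (h x))" by (simp add: abs_mult mult.commute[of _ B] mult_right_mono)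
      finally show "norm (h x * f x) \<le> norm (B * norm (h x))" .
    qed
  qed
  show "integrable (lebesgue_on U) (\<lambda>x. h x * \<phi> x)" "integrable (lebesgue_on U) (\<lambda>x. h x * pd j \<phi> x)"
    by (intro dom m B)+
qed

text \<open>Test functions approximate the indicators of boxes inside \<open>U\<close>, so
  \<open>h\<close> integrates to 0 over each of them. A countable cover of \<open>U\<close> by
  closed boxes turns the resulting local statements into the global one.\<close>

lemma fundamental_lemma:
  fixes h :: "real^'n \<Rightarrow> real"
  assumes U: "open U" and h: "integrable (lebesgue_on U) h"
    and z: "\<And>\<phi>. testfun U \<phi> \<Longrightarrow> (\<integral>x. h x * \<phi> x \<partial>(lebesgue_on U)) = 0"
  shows "AE x in lebesgue_on U. h x = 0"
proof -
  have sU: "U \<in> sets lebesgue" using U by simp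
  define H where "H = (\<lambda>x. if x \<in> U then h x else 0)"
  have iH: "integrable lebesgue H"
    unfolding H_def using h Lebesgue_Measure.integrable_restrict_UNIV[OF sU] by blast
  \<comment> \<open>A Borel representative, since the box argument runs in
    \<open>lborel\<close>.\<close>
  obtain H' where H': "H' \<in> borel_measurable lborel" "AE x in lborel. H x = H' x"
    using completion_ex_borel_measurable_real[of H lborel] iH by auto
  have AE': "AE x in lebesgue. H x = H' x" using H'(2) by (rule AE_completion)
  have iH': "integrable lborel H'"
  proof -
    have "H' \<in> borel_measurable lebesgue" using H'(1) by (rule measurable_completion)
    then have "integrable lebesgue H'" using integrable_cong_AE[of H lebesgue H'] iH AE' by auto
    then show ?thesis using H'(1) by (simp add: integrable_completion)
  qed
  have box0: "(\<integral>x. indicator (box l u) x * H' x \<partial>lborel) = 0" if lu: "cbox l u \<subseteq> U" for l u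
  proof -
    obtain \<phi> where \<phi>: "\<And>k::nat. testfun U (\<phi> k)" "\<And>k x. 0 \<le> \<phi> k x \<and> \<phi> k x \<le> 1"
      "\<And>x. (\<lambda>k. \<phi> k x) \<longlonglongrightarrow> indicator (box l u) x"
      using box_bump[OF lu] by metis
    have [measurable]: "\<phi> k \<in> borel_measurable borel" for k using testfun_measurable[OF \<phi>(1)] by simp
    have [measurable]: "H' \<in> borel_measurable borel" using H'(1) by simp
    have "(\<lambda>k. \<integral>x. \<phi> k x * H' x \<partial>lborel) \<longlonglongrightarrow> (\<integral>x. indicator (box l u) x * H' x \<partial>lborel)"
    proof (rule integral_dominated_convergence[where w = "\<lambda>x. norm (H' x)"])
      show "AE x in lborel. (\<lambda>k. \<phi> k x * H' x) \<longlonglongrightarrow> indicator (box l u) x * H' x"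
        using \<phi>(3) by (intro AE_I2 tendsto_intros)
      show "AE x in lborel. norm (\<phi> k x * H' x) \<le> norm (H' x)" for k
        using \<phi>(2)[of k] by (intro AE_I2) (simp add: abs_mult mult_left_le_one_le)
    qed (use iH' in \<open>auto intro!: integrable_norm\<close>)
    moreover have "(\<integral>x. \<phi> k x * H' x \<partial>lborel) = 0" for k
    proof -
      have mk: "\<phi> k \<in> borel_measurable lebesgue" by (simp add: measurable_completion)
      have "(\<integral>x. \<phi> k x * H' x \<partial>lborel) = (\<integral>x. \<phi> k x * H' x \<partial>lebesgue)"
        by (rule integral_completion[symmetric]) measurable
      also have "\<dots> = (\<integral>x. \<phi> k x * H x \<partial>lebesgue)"
      proof (rule integral_cong_AE)
        show "AE x in lebesgue. \<phi> k x * H' x = \<phi> k x * H x" using AE' by eventually_elim simp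
      qed (use mk iH H'(1) in \<open>auto intro!: borel_measurable_times measurable_completion\<close>)
      also have "\<dots> = (\<integral>x. (if x \<in> U then h x * \<phi> k x else 0) \<partial>lebesgue)"
        by (rule Bochner_Integration.integral_cong) (auto simp: H_def)
      also have "\<dots> = (\<integral>x. h x * \<phi> k x \<partial>lebesgue_on U)"
        by (rule Lebesgue_Measure.integral_restrict_UNIV[OF sU])
      also have "\<dots> = 0" by (rule z[OF \<phi>(1)])
      finally show ?thesis .
    qed
    ultimately show ?thesis by (simp add: LIMSEQ_const_iff)
  qed
  have cb0: "AE x in lborel. x \<in> cbox a b \<longrightarrow> H' x = 0" if ab: "cbox a b \<subseteq> U" for a b
  proof -
    have i: "integrable lborel (\<lambda>x. indicator (box a b) x * H' x)"
      using integrable_mult_indicator[OF _ iH', of "box a b"] by simp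
    have "AE x in lborel. indicator (box a b) x * H' x = 0"
    proof (rule AE_zero_if_box_integrals_zero[OF i])
      fix l u :: "real^'n"
      \<comment> \<open>The intersection of two boxes is a box again. When it is empty, the corners
        0 and 0 are taken and the inclusion holds vacuously.\<close>
      obtain l' u' where lu: "box l u \<inter> box a b = box l' u'" "box l' u' \<noteq> {} \<Longrightarrow> cbox l' u' \<subseteq> cbox a b"
      proof (cases "box l u \<inter> box a b = {}")
        case True
        then show ?thesis using that[of 0 0] by simp
      next
        case False
        define l' u' where "l' = (\<Sum>i\<in>Basis. max (l \<bullet> i) (a \<bullet> i) *\<^sub>R i)" and "u' = (\<Sum>i\<in>Basis. min (u \<bullet> i) (b \<bullet> i) *\<^sub>R i)"
        have e: "box l u \<inter> box a b = box l' u'" by (simp add: box_Int_box l'_def u'_def)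
        have "cbox l' u' \<subseteq> cbox a b" by (intro subset_box_imp) (auto simp: l'_def u'_def)
        then show ?thesis using that[OF e] by blast
      qed
      have "(\<integral>x. indicator (box l' u') x * H' x \<partial>lborel) = 0"
        using box0[of l' u'] lu(2) ab by (cases "box l' u' = {}") auto
      moreover have "indicator (box l u) x * (indicator (box a b) x * H' x) = indicator (box l' u') x * H' x" for x
        unfolding lu(1)[symmetric] by (simp add: indicator_inter_arith)
      ultimately show "(\<integral>x. indicator (box l u) x * (indicator (box a b) x * H' x) \<partial>lborel) = 0" by (simp only:)
    qed
    moreover have "AE x in lborel. x \<notin> cbox a b - box a b"
    proof (rule AE_not_in)
      have "cbox a b - box a b = frontier (cbox a b)" by (simp add: frontier_cbox)
      moreover have "negligible (frontier (cbox a b))" by (rule negligible_convex_frontier) simp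
      ultimately show "cbox a b - box a b \<in> null_sets lborel"
        unfolding negligible_iff_null_sets by (simp add: null_sets_completion_iff)
    qed
    ultimately show ?thesis by eventually_elim (auto simp: indicator_def)
  qed
  obtain D where D: "countable D" "\<And>X. X \<in> D \<Longrightarrow> \<exists>a b. X = cbox a b" "\<Union>D = U"
    using open_countable_Union_open_cbox[OF U] by metis
  have "AE x in lborel. \<forall>X\<in>D. x \<in> X \<longrightarrow> H' x = 0"
  proof (subst AE_ball_countable[OF D(1)], rule ballI)
    fix X assume "X \<in> D"
    then obtain a b where X: "X = cbox a b" using D(2) by blast
    have "cbox a b \<subseteq> U" using \<open>X \<in> D\<close> D(3) X by blast
    then show "AE x in lborel. x \<in> X \<longrightarrow> H' x = 0" unfolding X by (rule cb0)
  qed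
  then have "AE x in lborel. x \<in> U \<longrightarrow> h x = 0"
    using H'(2)
  proof eventually_elim
    case (elim x)
    show ?case
    proof
      assume x: "x \<in> U"
      then have "H' x = 0" using elim(1) D(3) by blast
      with elim(2) x show "h x = 0" by (simp add: H_def)
    qed
  qed
  then have "AE x in lebesgue. x \<in> U \<longrightarrow> h x = 0" by (rule AE_completion)
  then show ?thesis using sU by (simp add: AE_restrict_space_iff)
qed

section \<open>Integration by parts from translation invariance\<close>

lemma integral_lborel_translate:
  fixes f :: "'a::euclidean_space \<Rightarrow> 'b::euclidean_space"
  assumes "f \<in> borel_measurable borel"
  shows "(\<integral>x. f (c + x) \<partial>lborel) = (\<integral>x. f x \<partial>lborel)"
proof -
  have "(\<integral>x. f x \<partial>lborel) = (\<integral>x. f x \<partial>(distr lborel borel ((+) c)))"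
    by (simp add: lborel_distr_plus)
  also have "\<dots> = (\<integral>x. f (c + x) \<partial>lborel)" by (rule integral_distr) (use assms in auto)
  finally show ?thesis ..
qed

lemma integrable_lborel_translate:
  fixes f :: "'a::euclidean_space \<Rightarrow> 'b::euclidean_space"
  assumes "integrable lborel f"
  shows "integrable lborel (\<lambda>x. f (c + x))"
proof -
  have "integrable (distr lborel borel ((+) c)) f" using assms by (simp add: lborel_distr_plus)
  then show ?thesis by (subst (asm) integrable_distr_eq) (use borel_measurable_integrable[OF assms] in auto)
qed

text \<open>The sequential form of a directional derivative, suited to dominated
  convergence.\<close>

lemma has_derivative_sequence:
  fixes w :: "'a::euclidean_space \<Rightarrow> real"
  assumes "(w has_derivative (\<lambda>h. g \<bullet> h)) (at x)"
  shows "(\<lambda>k. (w (x + (1 / real (Suc k)) *\<^sub>R e) - w x) * real (Suc k)) \<longlonglongrightarrow> g \<bullet> e"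
proof -
  have "((\<lambda>t. x + t *\<^sub>R e) has_derivative (\<lambda>t. t *\<^sub>R e)) (at 0)" by (auto intro!: derivative_eq_intros)
  then have "((\<lambda>t. w (x + t *\<^sub>R e)) has_derivative (\<lambda>t. g \<bullet> (t *\<^sub>R e))) (at 0)"
    by (rule has_derivative_compose) (simp add: assms)
  then have "((\<lambda>t. w (x + t *\<^sub>R e)) has_real_derivative g \<bullet> e) (at 0)"
    by (simp add: has_field_derivative_def mult.commute[of _ "g \<bullet> e"])
  then have lim: "((\<lambda>t. (w (x + t *\<^sub>R e) - w x) / t) \<longlongrightarrow> g \<bullet> e) (at 0)"
    by (simp add: has_field_derivative_iff)
  have "filterlim (\<lambda>k. 1 / real (Suc k)) (at 0) sequentially"
    using LIMSEQ_inverse_real_of_nat by (intro filterlim_atI) (auto simp: inverse_eq_divide)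
  from filterlim_compose[OF lim this] show ?thesis by simp
qed

text \<open>Translation invariance plus dominated convergence.\<close>
lemma integral_derivative_zero:
  fixes w :: "'a::euclidean_space \<Rightarrow> real"
  assumes lip: "\<And>x y. \<bar>w x - w y\<bar> \<le> L * norm (x - y)"
    and supp: "\<And>x. norm x > R \<Longrightarrow> w x = 0"
    and der: "AE x in lborel. (w has_derivative (\<lambda>h. g x \<bullet> h)) (at x)"
    and meas: "(\<lambda>x. g x \<bullet> e) \<in> borel_measurable borel"
  shows "(\<integral>x. g x \<bullet> e \<partial>lborel) = 0"
proof -
  have L0: "L * norm e \<ge> 0" using lip[of e 0] by (metis abs_ge_zero diff_zero order_trans)
  have "\<bar>L\<bar>-lipschitz_on UNIV w"
  proof (rule lipschitz_onI)
    fix x y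
    have "dist (w x) (w y) \<le> L * norm (x - y)" using lip by (simp add: dist_real_def)
    also have "\<dots> \<le> \<bar>L\<bar> * dist x y" by (simp add: dist_norm mult_right_mono)
    finally show "dist (w x) (w y) \<le> \<bar>L\<bar> * dist x y" .
  qed simp
  then have cw: "continuous_on UNIV w" by (rule lipschitz_on_continuous_on)
  then have [measurable]: "w \<in> borel_measurable borel" by (rule borel_measurable_continuous_onI)
  define s where "s = (\<lambda>k x. (w (x + (1 / real (Suc k)) *\<^sub>R e) - w x) * real (Suc k))"
  let ?B = "cball 0 (R + norm e) :: 'a set"
  have iw: "integrable lborel w"
  proof -
    have "integrable lborel (\<lambda>x. indicator (cball 0 R) x * w x)" by (rule integrable_indicator_continuous[OF cw]) auto
    moreover have "(\<lambda>x. indicator (cball 0 R) x * w x) = w" using supp by (auto simp: indicator_def fun_eq_iff)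
    ultimately show ?thesis by simp
  qed
  have s0: "(\<integral>x. s k x \<partial>lborel) = 0" for k
  proof -
    let ?c = "(1 / real (Suc k)) *\<^sub>R e"
    have "integrable lborel (\<lambda>x. w (?c + x))" by (rule integrable_lborel_translate[OF iw])
    then have "(\<integral>x. w (?c + x) - w x \<partial>lborel) = 0"
      using iw by (simp add: integral_lborel_translate)
    then show ?thesis unfolding s_def by (simp add: add.commute)
  qed
  have "(\<lambda>k. \<integral>x. s k x \<partial>lborel) \<longlonglongrightarrow> (\<integral>x. g x \<bullet> e \<partial>lborel)"
  proof (rule integral_dominated_convergence[where w = "\<lambda>x. indicator ?B x * (L * norm e)"])
    show "AE x in lborel. (\<lambda>k. s k x) \<longlonglongrightarrow> g x \<bullet> e"
      using der unfolding s_def by eventually_elim (rule has_derivative_sequence)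
    show "integrable lborel (\<lambda>x. indicator ?B x * (L * norm e))"
      by (rule integrable_indicator_continuous) (auto intro: continuous_intros)
    show "AE x in lborel. norm (s k x) \<le> indicator ?B x * (L * norm e)" for k
    proof (rule AE_I2)
      fix x
      let ?c = "(1 / real (Suc k)) *\<^sub>R e"
      have nc: "norm ?c \<le> norm e"
        using mult_left_le_one_le[of "norm e" "1 / real (Suc k)"] by (simp add: divide_le_eq)
      show "norm (s k x) \<le> indicator ?B x * (L * norm e)"
      proof (cases "x \<in> ?B")
        case True
        have "norm (s k x) = \<bar>w (x + ?c) - w x\<bar> * real (Suc k)" by (simp add: s_def abs_mult)
        also have "\<dots> \<le> (L * norm (x + ?c - x)) * real (Suc k)" by (intro mult_right_mono lip) simp
        also have "\<dots> = L * norm e" by simp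
        finally show ?thesis using True by simp
      next
        case False
        then have n: "norm x > R + norm e" by simp
        have "norm x \<le> norm (x + ?c) + norm ?c" using norm_triangle_ineq4[of "x + ?c" ?c] by simp
        then have "norm (x + ?c) > R" using n nc by linarith
        moreover have "norm x > R" using n norm_ge_zero[of e] by linarith
        ultimately have "s k x = 0" unfolding s_def using supp by simp
        then show ?thesis using False by simp
      qed
    qed
  qed (use meas in \<open>auto simp: s_def\<close>)
  then show ?thesis by (simp add: s0 LIMSEQ_const_iff)
qed

lemma C1_lipschitz:
  fixes w :: "'a::euclidean_space \<Rightarrow> real"
  assumes w: "C1_grad w g" and B: "\<And>x. x \<in> S \<Longrightarrow> norm (g x) \<le> B" and S: "convex S" "x \<in> S" "y \<in> S"
  shows "\<bar>w x - w y\<bar> \<le> B * norm (x - y)"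
proof -
  have "norm (w x - w y) \<le> B * norm (x - y)"
  proof (rule differentiable_bound[OF S(1) _ _ S(2,3)])
    show "(w has_derivative (\<lambda>h. g x \<bullet> h)) (at x within S)" for x
      using w by (simp add: C1_grad_def has_derivative_at_withinI)
    show "onorm (\<lambda>h. g x \<bullet> h) \<le> B" if "x \<in> S" for x
    proof (rule onorm_le)
      fix h
      have "norm (g x \<bullet> h) \<le> norm (g x) * norm h" using Cauchy_Schwarz_ineq2 by simp
      also have "\<dots> \<le> B * norm h" using B[OF that] by (rule mult_right_mono) simp
      finally show "norm (g x \<bullet> h) \<le> B * norm h" .
    qed
  qed
  then show ?thesis by simp
qed

lemma testfun_supp_bounded:
  assumes "testfun U f"
  obtains R where "R > 0" "\<And>x. norm x > R \<Longrightarrow> f x = 0" "\<And>x j. norm x > R \<Longrightarrow> pd j f x = 0"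
proof -
  have "bounded (closure {x. f x \<noteq> 0})" using assms by (simp add: testfun_def compact_imp_bounded)
  then obtain R where R: "R > 0" "\<forall>x\<in>closure {x. f x \<noteq> 0}. norm x \<le> R" unfolding bounded_pos by blast
  have "x \<notin> closure {x. f x \<noteq> 0}" if "norm x > R" for x using R(2) that by force
  with testfun_zero[OF assms] R(1) that show ?thesis by blast
qed

lemma C1_integral_pd_zero:
  fixes w :: "real^'n \<Rightarrow> real"
  assumes w: "C1_grad w g" and supp: "\<And>x. norm x > R \<Longrightarrow> w x = 0" "\<And>x. norm x > R \<Longrightarrow> g x = 0"
  shows "(\<integral>x. g x $ j \<partial>lborel) = 0"
proof -
  have cg: "continuous_on UNIV g" using w by (simp add: C1_grad_def)
  obtain B where B: "\<And>x. norm (g x) \<le> B"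
    using bounded_range_compact_support[OF cg compact_cball[of 0 R]] supp(2) by (metis mem_cball_0 not_le)
  have "(\<integral>x. g x \<bullet> axis j 1 \<partial>lborel) = 0"
  proof (rule integral_derivative_zero[of w B R])
    show "\<bar>w x - w y\<bar> \<le> B * norm (x - y)" for x y by (rule C1_lipschitz[OF w, of UNIV]) (use B in auto)
    show "AE x in lborel. (w has_derivative (\<lambda>h. g x \<bullet> h)) (at x)" using w by (simp add: C1_grad_def)
    show "(\<lambda>x. g x \<bullet> axis j 1) \<in> borel_measurable borel"
      by (intro borel_measurable_continuous_onI continuous_intros cg)
  qed (rule supp(1))
  then show ?thesis by (simp add: inner_axis)
qed

text \<open>One factor has compact support, hence so does the product, and the integral of its
  partial derivative is 0.\<close>

lemma testfun_ibp:
  fixes \<phi> \<eta> :: "real^'n \<Rightarrow> real"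
  assumes \<phi>: "C1_grad \<phi> g" and \<eta>: "testfun U \<eta>"
  shows "(\<integral>x. \<phi> x * pd j \<eta> x \<partial>lborel) = - (\<integral>x. g x $ j * \<eta> x \<partial>lborel)"
proof -
  obtain R where R: "\<And>x. norm x > R \<Longrightarrow> \<eta> x = 0" "\<And>x j. norm x > R \<Longrightarrow> pd j \<eta> x = 0"
    using testfun_supp_bounded[OF \<eta>] by metis
  have z: "(\<chi> j. pd j \<eta> x) = 0" if "norm x > R" for x using R(2)[OF that] by (simp add: vec_eq_iff)
  have c: "continuous_on UNIV \<phi>" "continuous_on UNIV g" "continuous_on UNIV \<eta>" "continuous_on UNIV (pd j \<eta>)"
    using C1_grad_cont[OF \<phi>] \<phi> C1_grad_cont[OF testfun_C1_grad[OF \<eta>]] \<eta> by (auto simp: C1_grad_def testfun_def)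
  have i: "integrable lborel f" if "continuous_on UNIV f" "\<And>x. norm x > R \<Longrightarrow> f x = 0" for f :: "real^'n \<Rightarrow> real"
  proof -
    have "integrable lborel (\<lambda>x. indicator (cball 0 R) x * f x)" by (rule integrable_indicator_continuous[OF that(1)]) auto
    moreover have "(\<lambda>x. indicator (cball 0 R) x * f x) = f" using that(2) by (auto simp: indicator_def fun_eq_iff)
    ultimately show ?thesis by simp
  qed
  have "(\<integral>x. (\<phi> x *\<^sub>R (\<chi> j. pd j \<eta> x) + \<eta> x *\<^sub>R g x) $ j \<partial>lborel) = 0"
    by (rule C1_integral_pd_zero[OF C1_grad_mult[OF \<phi> testfun_C1_grad[OF \<eta>]], of R]) (simp_all add: R vec_eq_iff)
  moreover have "integrable lborel (\<lambda>x. \<phi> x * pd j \<eta> x)" "integrable lborel (\<lambda>x. g x $ j * \<eta> x)"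
    by (rule i, intro continuous_intros c, simp add: R)+
  ultimately show ?thesis by (simp add: mult.commute[of "\<eta> _"])
qed

lemma C1_grad_translate: "C1_grad f g \<Longrightarrow> C1_grad (\<lambda>x. f (c + x)) (\<lambda>x. g (c + x))"
  unfolding C1_grad_def
proof (intro conjI allI)
  fix x assume f: "(\<forall>x. (f has_derivative (\<bullet>) (g x)) (at x)) \<and> continuous_on UNIV g"
  have "((\<lambda>x. c + x) has_derivative (\<lambda>h. h)) (at x)" by (auto intro!: derivative_eq_intros)
  then show "((\<lambda>x. f (c + x)) has_derivative (\<bullet>) (g (c + x))) (at x)"
    by (rule has_derivative_compose) (use f in simp)
  show "continuous_on UNIV (\<lambda>x. g (c + x))" by (rule continuous_on_comp2) (use f in \<open>auto intro!: continuous_intros\<close>)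
qed

text \<open>The test functions are only of class \<open>C\<^sup>1\<close>, so one derivative is moved as a difference quotient.\<close>
lemma testfun_swap:
  fixes \<phi> \<psi> :: "real^'n \<Rightarrow> real"
  assumes \<phi>: "testfun U \<phi>" and \<psi>: "testfun U \<psi>"
  shows "(\<integral>x. pd i \<phi> x * pd j \<psi> x \<partial>lborel) = (\<integral>x. pd j \<phi> x * pd i \<psi> x \<partial>lborel)"
proof -
  let ?e = "axis i 1 :: real^'n"
  define t where "t = (\<lambda>k. 1 / real (Suc k))"
  \<comment> \<open>\<open>A\<close> and \<open>B\<close> are difference quotients in opposite
    directions: shifting the integration variable moves the quotient from one factor to the other,
    while \<open>testfun_ibp\<close> moves the derivative in direction \<open>j\<close>.\<close>
  define A where "A = (\<lambda>k x. (\<phi> (x + t k *\<^sub>R ?e) - \<phi> x) * real (Suc k))"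
  define B where "B = (\<lambda>k x. (\<psi> (x + t k *\<^sub>R (- ?e)) - \<psi> x) * real (Suc k))"
  have C: "C1_grad \<phi> (\<lambda>x. \<chi> j. pd j \<phi> x)" "C1_grad \<psi> (\<lambda>x. \<chi> j. pd j \<psi> x)"
    using testfun_C1_grad \<phi> \<psi> by auto
  note mm = testfun_measurable[OF \<phi>] testfun_measurable[OF \<psi>]
  obtain R1 where R1: "R1 > 0" "\<And>x. norm x > R1 \<Longrightarrow> \<phi> x = 0" "\<And>x j. norm x > R1 \<Longrightarrow> pd j \<phi> x = 0"
    using testfun_supp_bounded[OF \<phi>] by metis
  obtain R2 where R2: "R2 > 0" "\<And>x. norm x > R2 \<Longrightarrow> \<psi> x = 0" "\<And>x j. norm x > R2 \<Longrightarrow> pd j \<psi> x = 0"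
    using testfun_supp_bounded[OF \<psi>] by metis
  obtain M1 where M1: "M1 > 0" "\<And>x. norm (\<phi> x) \<le> M1" "\<And>x j. norm (pd j \<phi> x) \<le> M1" using testfun_bounded[OF \<phi>] by metis
  obtain M2 where M2: "M2 > 0" "\<And>x. norm (\<psi> x) \<le> M2" "\<And>x j. norm (pd j \<psi> x) \<le> M2" using testfun_bounded[OF \<psi>] by metis
  have gb: "\<exists>N. \<forall>x. norm (\<chi> j. pd j f x) \<le> N" if "\<And>x j. norm (pd j f x) \<le> M" for f :: "real^'n \<Rightarrow> real" and M
  proof (intro exI allI)
    fix x
    have "norm (\<chi> j. pd j f x) \<le> (\<Sum>j\<in>UNIV. \<bar>(\<chi> j. pd j f x) $ j\<bar>)" by (rule norm_le_l1_cart)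
    also have "\<dots> \<le> (\<Sum>j\<in>(UNIV::'n set). M)" using that by (intro sum_mono) simp
    finally show "norm (\<chi> j. pd j f x) \<le> (\<Sum>j\<in>(UNIV::'n set). M)" .
  qed
  obtain N1 where N1: "\<And>x. norm (\<chi> j. pd j \<phi> x) \<le> N1" using gb[OF M1(3)] by blast
  obtain N2 where N2: "\<And>x. norm (\<chi> j. pd j \<psi> x) \<le> N2" using gb[OF M2(3)] by blast
  have l1: "\<bar>\<phi> x - \<phi> y\<bar> \<le> N1 * norm (x - y)" for x y by (rule C1_lipschitz[OF C(1), of UNIV]) (use N1 in auto)
  have l2: "\<bar>\<psi> x - \<psi> y\<bar> \<le> N2 * norm (x - y)" for x y by (rule C1_lipschitz[OF C(2), of UNIV]) (use N2 in auto)
  have ne: "norm ?e = 1" by (simp add: norm_axis_1)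
  have bA: "norm (A k x) \<le> N1" for k x
    using mult_right_mono[OF l1[of "x + t k *\<^sub>R ?e" x], of "real (Suc k)"] by (simp add: A_def t_def abs_mult ne)
  have bB: "norm (B k x) \<le> N2" for k x
    using mult_right_mono[OF l2[of "x + t k *\<^sub>R (- ?e)" x], of "real (Suc k)"] by (simp add: B_def t_def abs_mult ne)
  have lA: "(\<lambda>k. A k x) \<longlonglongrightarrow> pd i \<phi> x" for x
    using has_derivative_sequence[of \<phi> "\<chi> j. pd j \<phi> x" x ?e] C(1) by (simp add: A_def t_def C1_grad_def inner_axis)
  have lB: "(\<lambda>k. B k x) \<longlonglongrightarrow> - pd i \<psi> x" for x
    using has_derivative_sequence[of \<psi> "\<chi> j. pd j \<psi> x" x "- ?e"] C(2) by (simp add: B_def t_def C1_grad_def inner_axis)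
  have mA: "A k \<in> borel_measurable borel" for k
    unfolding A_def
    by (intro borel_measurable_continuous_onI continuous_intros continuous_on_comp2[OF C1_grad_cont[OF C(1)]] C1_grad_cont[OF C(1)])
  have mB: "B k \<in> borel_measurable borel" for k
    unfolding B_def
    by (intro borel_measurable_continuous_onI continuous_intros continuous_on_comp2[OF C1_grad_cont[OF C(2)]] C1_grad_cont[OF C(2)])
  have LA: "(\<lambda>k. \<integral>x. A k x * pd j \<psi> x \<partial>lborel) \<longlonglongrightarrow> (\<integral>x. pd i \<phi> x * pd j \<psi> x \<partial>lborel)"
  proof (rule integral_dominated_convergence[where w = "\<lambda>x. indicator (cball 0 R2) x * (N1 * M2)"])
    show "integrable lborel (\<lambda>x::real^'n. indicator (cball 0 R2) x * (N1 * M2))"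
      by (rule integrable_indicator_continuous) (auto intro: continuous_intros)
    show "AE x in lborel. (\<lambda>k. A k x * pd j \<psi> x) \<longlonglongrightarrow> pd i \<phi> x * pd j \<psi> x" by (intro AE_I2 tendsto_intros lA)
    show "AE x in lborel. norm (A k x * pd j \<psi> x) \<le> indicator (cball 0 R2) x * (N1 * M2)" for k
    proof (rule AE_I2)
      fix x
      have "norm (A k x * pd j \<psi> x) \<le> N1 * M2"
        using mult_mono[OF bA[of k x] M2(3)[of j x]] order_trans[OF norm_ge_zero bA] by (simp add: abs_mult)
      then show "norm (A k x * pd j \<psi> x) \<le> indicator (cball 0 R2) x * (N1 * M2)"
        using R2(3)[of x j] by (cases "norm x > R2") auto
    qed
  qed (use mm mA in auto)
  have LB: "(\<lambda>k. \<integral>x. pd j \<phi> x * B k x \<partial>lborel) \<longlonglongrightarrow> (\<integral>x. pd j \<phi> x * (- pd i \<psi> x) \<partial>lborel)"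
  proof (rule integral_dominated_convergence[where w = "\<lambda>x. indicator (cball 0 R1) x * (M1 * N2)"])
    show "integrable lborel (\<lambda>x::real^'n. indicator (cball 0 R1) x * (M1 * N2))"
      by (rule integrable_indicator_continuous) (auto intro: continuous_intros)
    show "AE x in lborel. (\<lambda>k. pd j \<phi> x * B k x) \<longlonglongrightarrow> pd j \<phi> x * (- pd i \<psi> x)" by (intro AE_I2 tendsto_intros lB)
    show "AE x in lborel. norm (pd j \<phi> x * B k x) \<le> indicator (cball 0 R1) x * (M1 * N2)" for k
    proof (rule AE_I2)
      fix x
      have "norm (pd j \<phi> x * B k x) \<le> M1 * N2"
        using mult_mono[OF M1(3)[of j x] bB[of k x]] M1(1) by (simp add: abs_mult)
      then show "norm (pd j \<phi> x * B k x) \<le> indicator (cball 0 R1) x * (M1 * N2)"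
        using R1(3)[of x j] by (cases "norm x > R1") auto
    qed
  qed (use mm mB in auto)
  have "(\<integral>x. A k x * pd j \<psi> x \<partial>lborel) = - (\<integral>x. pd j \<phi> x * B k x \<partial>lborel)" for k
  proof -
    let ?c = "t k *\<^sub>R ?e"
    have s1: "(\<integral>x. \<phi> (?c + x) * pd j \<psi> x \<partial>lborel) = - (\<integral>x. pd j \<phi> (?c + x) * \<psi> x \<partial>lborel)"
      using testfun_ibp[OF C1_grad_translate[OF C(1)] \<psi>] by simp
    also have "(\<integral>x. pd j \<phi> (?c + x) * \<psi> x \<partial>lborel) = (\<integral>x. pd j \<phi> (?c + x) * \<psi> ((?c + x) - ?c) \<partial>lborel)" by simp
    also have "\<dots> = (\<integral>x. pd j \<phi> x * \<psi> (x - ?c) \<partial>lborel)"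
    proof (rule integral_lborel_translate[where f = "\<lambda>x. pd j \<phi> x * \<psi> (x - ?c)"])
      show "(\<lambda>x. pd j \<phi> x * \<psi> (x - ?c)) \<in> borel_measurable borel"
        using \<phi> by (intro borel_measurable_continuous_onI continuous_intros continuous_on_comp2[OF C1_grad_cont[OF C(2)]])
          (simp add: testfun_def)
    qed
    finally have 1: "(\<integral>x. \<phi> (?c + x) * pd j \<psi> x \<partial>lborel) = - (\<integral>x. pd j \<phi> x * \<psi> (x - ?c) \<partial>lborel)" .
    have 2: "(\<integral>x. \<phi> x * pd j \<psi> x \<partial>lborel) = - (\<integral>x. pd j \<phi> x * \<psi> x \<partial>lborel)"
      using testfun_ibp[OF C(1) \<psi>] by simp
    have int: "integrable lborel f" if "continuous_on UNIV f" "\<And>x. norm x > R \<Longrightarrow> f x = 0" for f :: "real^'n \<Rightarrow> real" and R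
    proof -
      have "integrable lborel (\<lambda>x. indicator (cball 0 R) x * f x)" by (rule integrable_indicator_continuous[OF that(1)]) auto
      moreover have "(\<lambda>x. indicator (cball 0 R) x * f x) = f" using that(2) by (auto simp: indicator_def fun_eq_iff)
      ultimately show ?thesis by simp
    qed
    note cc = C1_grad_cont[OF C(1), of UNIV] C1_grad_cont[OF C(2), of UNIV]
    have cp: "continuous_on UNIV (pd j \<phi>)" "continuous_on UNIV (pd j \<psi>)" using \<phi> \<psi> by (auto simp: testfun_def)
    have i1: "integrable lborel (\<lambda>x. \<phi> (?c + x) * pd j \<psi> x)" "integrable lborel (\<lambda>x. \<phi> x * pd j \<psi> x)"
      by (rule int[of _ R2], intro continuous_intros continuous_on_comp2[OF cc(1)] cp cc, simp add: R2)+
    have i2: "integrable lborel (\<lambda>x. pd j \<phi> x * \<psi> (x - ?c))" "integrable lborel (\<lambda>x. pd j \<phi> x * \<psi> x)"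
      by (rule int[of _ R1], intro continuous_intros continuous_on_comp2[OF cc(2)] cp cc, simp add: R1)+
    have "(\<integral>x. A k x * pd j \<psi> x \<partial>lborel) = (\<integral>x. real (Suc k) * (\<phi> (?c + x) * pd j \<psi> x - \<phi> x * pd j \<psi> x) \<partial>lborel)"
      by (rule Bochner_Integration.integral_cong) (auto simp: A_def algebra_simps)
    also have "\<dots> = real (Suc k) * ((\<integral>x. \<phi> (?c + x) * pd j \<psi> x \<partial>lborel) - (\<integral>x. \<phi> x * pd j \<psi> x \<partial>lborel))"
      using i1 by simp
    also have "\<dots> = - (real (Suc k) * ((\<integral>x. pd j \<phi> x * \<psi> (x - ?c) \<partial>lborel) - (\<integral>x. pd j \<phi> x * \<psi> x \<partial>lborel)))"
      unfolding 1 2 by (simp add: algebra_simps)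
    also have "(real (Suc k) * ((\<integral>x. pd j \<phi> x * \<psi> (x - ?c) \<partial>lborel) - (\<integral>x. pd j \<phi> x * \<psi> x \<partial>lborel)))
        = (\<integral>x. real (Suc k) * (pd j \<phi> x * \<psi> (x - ?c) - pd j \<phi> x * \<psi> x) \<partial>lborel)"
      using i2 by simp
    also have "\<dots> = (\<integral>x. pd j \<phi> x * B k x \<partial>lborel)"
      by (rule Bochner_Integration.integral_cong) (auto simp: B_def algebra_simps)
    finally show ?thesis .
  qed
  with LA have "(\<lambda>k. - (\<integral>x. pd j \<phi> x * B k x \<partial>lborel)) \<longlonglongrightarrow> (\<integral>x. pd i \<phi> x * pd j \<psi> x \<partial>lborel)" by simp
  from LIMSEQ_unique[OF this tendsto_minus[OF LB]] show ?thesis by simp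
qed

lemma integral_lebesgue_on_lborel:
  fixes F :: "real^'n \<Rightarrow> real"
  assumes "F \<in> borel_measurable borel" "\<And>x. x \<notin> U \<Longrightarrow> F x = 0" "U \<in> sets lebesgue"
  shows "integral\<^sup>L (lebesgue_on U) F = (\<integral>x. F x \<partial>lborel)"
proof -
  have "integral\<^sup>L (lebesgue_on U) F = integral\<^sup>L lebesgue (\<lambda>x. if x \<in> U then F x else 0)"
    by (rule Lebesgue_Measure.integral_restrict_UNIV[OF assms(3), symmetric])
  also have "(\<lambda>x. if x \<in> U then F x else 0) = F" using assms(2) by auto
  also have "integral\<^sup>L lebesgue F = (\<integral>x. F x \<partial>lborel)" using assms(1) by (intro integral_completion) simp
  finally show ?thesis .
qed

lemma borel_lebesgue_on: "f \<in> borel_measurable borel \<Longrightarrow> f \<in> borel_measurable (lebesgue_on U)"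
  by (simp add: measurable_restrict_space1 measurable_completion)

section \<open>Weak derivatives and their uniqueness\<close>

locale bounded_open =
  fixes U :: "(real^'n) set"
  assumes open_U: "open U" and bounded_U: "bounded U"
begin

lemma sets_U: "U \<in> sets lebesgue" using open_U by simp

lemma lmeasurable_U: "U \<in> lmeasurable" by (rule lmeasurable_open[OF bounded_U open_U])

lemma L2_const: "L2 U (\<lambda>x. c)"
  by (rule L2_bounded[OF _ _ lmeasurable_U, of _ "norm c"]) auto

lemma L2_integrable1: "L2 U (f :: real^'n \<Rightarrow> real) \<Longrightarrow> integrable (lebesgue_on U) f"
  using L2_ip_integrable[OF L2_const[of "1::real"], of f] by simp

lemma L2_testfun: "testfun V \<phi> \<Longrightarrow> L2 U \<phi>" "testfun V \<phi> \<Longrightarrow> L2 U (pd j \<phi>)"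
proof -
  assume \<phi>: "testfun V \<phi>"
  obtain B where B: "\<And>x. norm (\<phi> x) \<le> B" "\<And>x j. norm (pd j \<phi> x) \<le> B" using testfun_bounded[OF \<phi>] by metis
  show "L2 U \<phi>"
    by (rule L2_bounded[OF borel_lebesgue_on[OF testfun_measurable(1)[OF \<phi>]] _ lmeasurable_U, where B = B]) (intro AE_I2 B)
  show "L2 U (pd j \<phi>)"
    by (rule L2_bounded[OF borel_lebesgue_on[OF testfun_measurable(2)[OF \<phi>]] _ lmeasurable_U, where B = B]) (intro AE_I2 B)
qed

lemma AE_eq_if_weakly_eq:
  fixes a b :: "real^'n \<Rightarrow> real"
  assumes a: "L2 U a" and b: "L2 U b"
    and eq: "\<And>\<phi>. testfun U \<phi> \<Longrightarrow> (\<integral>x. a x * \<phi> x \<partial>lebesgue_on U) = (\<integral>x. b x * \<phi> x \<partial>lebesgue_on U)"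
  shows "AE x in lebesgue_on U. a x = b x"
proof -
  have "AE x in lebesgue_on U. a x - b x = 0"
  proof (rule fundamental_lemma[OF open_U])
    show "integrable (lebesgue_on U) (\<lambda>x. a x - b x)" using a b by (intro L2_integrable1 L2_diff)
    fix \<phi> assume \<phi>: "testfun U \<phi>"
    have "integrable (lebesgue_on U) (\<lambda>x. a x * \<phi> x)" "integrable (lebesgue_on U) (\<lambda>x. b x * \<phi> x)"
      using testfun_integrable[OF open_U _ \<phi>] L2_integrable1 a b by auto
    then show "(\<integral>x. (a x - b x) * \<phi> x \<partial>lebesgue_on U) = 0" by (simp add: left_diff_distrib eq[OF \<phi>])
  qed
  then show ?thesis by eventually_elim simp
qed

lemma has_weak_grad_unique:
  assumes "has_weak_grad U u G" "has_weak_grad U u G'"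
  shows "AE x in lebesgue_on U. G x = G' x"
proof -
  have "AE x in lebesgue_on U. G x $ i $ j = G' x $ i $ j" for i j
    by (rule AE_eq_if_weakly_eq) (use assms in \<open>auto simp: has_weak_grad_def intro!: L2_nth\<close>)
  then have "AE x in lebesgue_on U. \<forall>i j. G x $ i $ j = G' x $ i $ j" by (simp add: AE_all_countable)
  then show ?thesis by eventually_elim (simp add: vec_eq_iff)
qed

lemma has_weak_grad_s_unique:
  assumes "has_weak_grad_s U u G" "has_weak_grad_s U u G'"
  shows "AE x in lebesgue_on U. G x = G' x"
proof -
  have "AE x in lebesgue_on U. G x $ j = G' x $ j" for j
    by (rule AE_eq_if_weakly_eq) (use assms in \<open>auto simp: has_weak_grad_s_def intro!: L2_nth\<close>)
  then have "AE x in lebesgue_on U. \<forall>j. G x $ j = G' x $ j" by (simp add: AE_all_countable)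
  then show ?thesis by eventually_elim (simp add: vec_eq_iff)
qed

lemma has_weak_div_unique:
  assumes "has_weak_div U u G" "has_weak_div U u G'"
  shows "AE x in lebesgue_on U. G x = G' x"
proof -
  have "AE x in lebesgue_on U. G x $ j = G' x $ j" for j
    by (rule AE_eq_if_weakly_eq) (use assms in \<open>auto simp: has_weak_div_def intro!: L2_nth\<close>)
  then have "AE x in lebesgue_on U. \<forall>j. G x $ j = G' x $ j" by (simp add: AE_all_countable)
  then show ?thesis by eventually_elim (simp add: vec_eq_iff)
qed

text \<open>\<open>weak_grad\<close> is a choice; uniqueness almost everywhere makes it
  interchangeable with any weak gradient that is known explicitly.\<close>

lemma weak_grad_props:
  assumes "has_weak_grad U u G"
  shows "has_weak_grad U u (weak_grad U u)" "AE x in lebesgue_on U. weak_grad U u x = G x"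
proof -
  show *: "has_weak_grad U u (weak_grad U u)" unfolding weak_grad_def using assms by (rule someI[where P = "has_weak_grad U u"])
  show "AE x in lebesgue_on U. weak_grad U u x = G x" by (rule has_weak_grad_unique[OF * assms])
qed

lemma weak_grad_s_props:
  assumes "has_weak_grad_s U u G"
  shows "has_weak_grad_s U u (weak_grad_s U u)" "AE x in lebesgue_on U. weak_grad_s U u x = G x"
proof -
  show *: "has_weak_grad_s U u (weak_grad_s U u)" unfolding weak_grad_s_def using assms by (rule someI[where P = "has_weak_grad_s U u"])
  show "AE x in lebesgue_on U. weak_grad_s U u x = G x" by (rule has_weak_grad_s_unique[OF * assms])
qed

lemma weak_div_props:
  assumes "has_weak_div U u G"
  shows "has_weak_div U u (weak_div U u)" "AE x in lebesgue_on U. weak_div U u x = G x"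
proof -
  show *: "has_weak_div U u (weak_div U u)" unfolding weak_div_def using assms by (rule someI[where P = "has_weak_div U u"])
  show "AE x in lebesgue_on U. weak_div U u x = G x" by (rule has_weak_div_unique[OF * assms])
qed

end

section \<open>Functions in \<open>H10\<close> and Korn's inequality\<close>

definition jac :: "(real^'n \<Rightarrow> real^'n) \<Rightarrow> real^'n \<Rightarrow> real^'n^'n" where
  "jac \<phi> x = (\<chi> i j. pd j (\<lambda>y. \<phi> y $ i) x)"

definition vtest :: "(real^'n) set \<Rightarrow> (real^'n \<Rightarrow> real^'n) \<Rightarrow> bool" where
  "vtest U \<phi> \<longleftrightarrow> (\<forall>i. testfun U (\<lambda>x. \<phi> x $ i))"

lemma jac_nth: "jac \<phi> x $ i $ j = pd j (\<lambda>y. \<phi> y $ i) x"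
  by (simp add: jac_def)

lemma H10_alt: "H10 U u \<longleftrightarrow> (\<exists>G. has_weak_grad U u G \<and>
     (\<exists>\<phi> :: nat \<Rightarrow> real^'n \<Rightarrow> real^'n. (\<forall>k. vtest U (\<phi> k)) \<and>
        (\<lambda>k. L2norm U (\<lambda>x. \<phi> k x - u x)) \<longlonglongrightarrow> 0 \<and> (\<lambda>k. L2norm U (\<lambda>x. jac (\<phi> k) x - G x)) \<longlonglongrightarrow> 0))"
  by (simp add: H10_def vtest_def jac_def)

lemma continuous_vtest: "vtest U \<phi> \<Longrightarrow> continuous_on UNIV \<phi>" "vtest U \<phi> \<Longrightarrow> continuous_on UNIV (jac \<phi>)"
proof -
  assume v: "vtest U \<phi>"
  have "continuous_on UNIV (\<lambda>x. \<phi> x $ i)" for i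
    using v C1_grad_cont[OF testfun_C1_grad] unfolding vtest_def by blast
  then have "continuous_on UNIV (\<lambda>x. \<chi> i. \<phi> x $ i)" by (rule continuous_on_vec_lambda)
  then show "continuous_on UNIV \<phi>" by simp
  have "continuous_on UNIV (pd j (\<lambda>y. \<phi> y $ i))" for i j using v by (simp add: vtest_def testfun_def)
  then show "continuous_on UNIV (jac \<phi>)" unfolding jac_def by (intro continuous_on_vec_lambda)
qed

lemma testfun_diff:
  assumes "testfun U f" "testfun U g"
  shows "testfun U (\<lambda>x. f x - g x)" "pd j (\<lambda>x. f x - g x) x = pd j f x - pd j g x"
proof -
  have *: "C1_grad (\<lambda>x. f x + (-1) * g x) (\<lambda>x. (\<chi> j. pd j f x) + (-1) *\<^sub>R (\<chi> j. pd j g x))"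
    by (rule C1_grad_add[OF testfun_C1_grad[OF assms(1)] C1_grad_cmult[OF testfun_C1_grad[OF assms(2)]]])
  then have c: "C1_grad (\<lambda>x. f x - g x) (\<lambda>x. (\<chi> j. pd j f x) + (-1) *\<^sub>R (\<chi> j. pd j g x))" by simp
  show "testfun U (\<lambda>x. f x - g x)"
  proof (rule testfunI[OF c, of "closure {x. f x \<noteq> 0} \<union> closure {x. g x \<noteq> 0}"])
    show "compact (closure {x. f x \<noteq> 0} \<union> closure {x. g x \<noteq> 0})" "closure {x. f x \<noteq> 0} \<union> closure {x. g x \<noteq> 0} \<subseteq> U"
      using assms by (auto simp: testfun_def intro!: compact_Un)
    show "f x - g x = 0" if "x \<notin> closure {x. f x \<noteq> 0} \<union> closure {x. g x \<noteq> 0}" for x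
      using that testfun_zero[OF assms(1), of x] testfun_zero[OF assms(2), of x] by simp
  qed
  show "pd j (\<lambda>x. f x - g x) x = pd j f x - pd j g x" by (simp add: pd_C1_grad[OF c])
qed

lemma vtest_diff:
  assumes "vtest U f" "vtest U g"
  shows "vtest U (\<lambda>x. f x - g x)" "jac (\<lambda>x. f x - g x) x = jac f x - jac g x"
proof -
  have t: "testfun U (\<lambda>x. f x $ i)" "testfun U (\<lambda>x. g x $ i)" for i using assms by (auto simp: vtest_def)
  show "vtest U (\<lambda>x. f x - g x)" unfolding vtest_def vector_minus_component using testfun_diff(1)[OF t] by blast
  show "jac (\<lambda>x. f x - g x) x = jac f x - jac g x"
    by (simp add: vec_eq_iff jac_nth testfun_diff(2)[OF t])
qed

lemma inner_transpose: "transpose A \<bullet> transpose B = A \<bullet> (B :: real^'n^'n)"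
  unfolding inner_vec_def transpose_def by (simp add: inner_vec_def) (rule sum.swap)

lemma norm_transpose: "norm (transpose A) = norm (A :: real^'n^'n)"
  by (simp add: norm_eq_sqrt_inner inner_transpose)

definition symm :: "real^'n^'n \<Rightarrow> real^'n^'n" where
  "symm A = (1/2) *\<^sub>R (A + transpose A)"

lemma transpose_add: "transpose (A + B) = transpose A + transpose (B :: real^'n^'n)"
  by (simp add: transpose_def vec_eq_iff)

lemma transpose_scaleR: "transpose (c *\<^sub>R A) = c *\<^sub>R transpose (A :: real^'n^'n)"
  by (simp add: transpose_def vec_eq_iff)

lemma transpose_symm: "transpose (symm A) = symm A"
  by (simp add: symm_def transpose_add transpose_scaleR add.commute)

lemma symm_eq: "transpose A = A \<Longrightarrow> symm A = A"
  by (simp add: symm_def flip: scaleR_2)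

text \<open>Transposition is an isometry, so a symmetric tensor does not see the skew part. This
  exchanges \<open>eps\<close> and the full gradient in pairings with a stress.\<close>

lemma inner_symm: "transpose A = A \<Longrightarrow> A \<bullet> symm B = A \<bullet> B"
  using inner_transpose[of A B] by (simp add: symm_def inner_add_right)

lemma norm_symm_le: "norm (symm A) \<le> norm A"
  using norm_triangle_ineq[of A "transpose A"] by (simp add: symm_def norm_transpose)

lemma bounded_linear_symm: "bounded_linear symm"
proof (rule bounded_linear_intro[of _ 1])
  show "symm (A + B) = symm A + symm B" for A B :: "real^'n^'n"
    by (simp add: symm_def transpose_add scaleR_add_right algebra_simps)
  show "symm (r *\<^sub>R A) = r *\<^sub>R symm A" for r and A :: "real^'n^'n"
    by (simp add: symm_def transpose_scaleR scaleR_add_right mult.commute)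
  show "norm (symm A) \<le> norm A * 1" for A :: "real^'n^'n" using norm_symm_le by simp
qed

lemma eps_symm: "eps U v x = symm (weak_grad U v x)"
  by (simp add: eps_def symm_def)

lemma L2norm_linear_contraction:
  assumes "bounded_linear T" "\<And>y. norm (T y) \<le> norm y" "L2 X f"
  shows "L2norm X (\<lambda>x. T (f x)) \<le> L2norm X f"
  unfolding L2norm_def
proof (rule real_sqrt_le_mono[OF integral_mono])
  show "integrable (lebesgue_on X) (\<lambda>x. (norm (T (f x)))\<^sup>2)" by (rule L2_integrable[OF L2_linear[OF assms(1,3)]])
  show "integrable (lebesgue_on X) (\<lambda>x. (norm (f x))\<^sup>2)" by (rule L2_integrable[OF assms(3)])
  show "(norm (T (f x)))\<^sup>2 \<le> (norm (f x))\<^sup>2" for x by (rule power_mono[OF assms(2)]) simp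
qed

context bounded_open
begin

lemma L2_vtest:
  assumes "vtest V \<phi>"
  shows "L2 U \<phi>" "L2 U (jac \<phi>)"
proof -
  have t: "testfun V (\<lambda>x. \<phi> x $ i)" for i using assms by (simp add: vtest_def)
  have "\<exists>B. (\<forall>x. norm (\<phi> x $ i) \<le> B) \<and> (\<forall>x j. norm (pd j (\<lambda>y. \<phi> y $ i) x) \<le> B)" for i
  proof -
    obtain B where "B > 0" "\<And>x. norm (\<phi> x $ i) \<le> B" "\<And>x j. norm (pd j (\<lambda>y. \<phi> y $ i) x) \<le> B"
      by (rule testfun_bounded[OF t[of i]]) (rule that)
    then show ?thesis by (intro exI[of _ B]) simp
  qed
  then have "\<forall>i. \<exists>B. (\<forall>x. norm (\<phi> x $ i) \<le> B) \<and> (\<forall>x j. norm (pd j (\<lambda>y. \<phi> y $ i) x) \<le> B)" by (rule allI)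
  from choice[OF this] obtain B where B': "\<forall>i. (\<forall>x. norm (\<phi> x $ i) \<le> B i) \<and> (\<forall>x j. norm (pd j (\<lambda>y. \<phi> y $ i) x) \<le> B i)"
    by (rule exE)
  have B: "norm (\<phi> x $ i) \<le> B i" "norm (pd j (\<lambda>y. \<phi> y $ i) x) \<le> B i" for i j x
    using B' by simp_all
  have "norm (\<phi> x) \<le> (\<Sum>i\<in>UNIV. B i)" for x
  proof -
    have "norm (\<phi> x) \<le> (\<Sum>i\<in>UNIV. \<bar>\<phi> x $ i\<bar>)" by (rule norm_le_l1_cart)
    also have "\<dots> \<le> (\<Sum>i\<in>UNIV. B i)" using B by (intro sum_mono) simp
    finally show ?thesis .
  qed
  then show "L2 U \<phi>"
    by (intro L2_bounded[OF borel_lebesgue_on[OF borel_measurable_continuous_onI[OF continuous_vtest(1)[OF assms]]] _ lmeasurable_U] AE_I2)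
  have "jac \<phi> \<in> borel_measurable borel" using continuous_vtest(2)[OF assms] by (rule borel_measurable_continuous_onI)
  moreover have "\<exists>B. \<forall>x. norm (jac \<phi> x) \<le> B"
  proof -
    have "norm (jac \<phi> x) \<le> (\<Sum>i\<in>UNIV. \<Sum>j\<in>(UNIV :: 'n set). B i)" for x
    proof -
      have "norm (jac \<phi> x) \<le> (\<Sum>i\<in>UNIV. norm (jac \<phi> x $ i))"
        unfolding norm_vec_def[of "jac \<phi> x"] by (rule L2_set_le_sum) simp
      also have "\<dots> \<le> (\<Sum>i\<in>UNIV. \<Sum>j\<in>UNIV. \<bar>jac \<phi> x $ i $ j\<bar>)" by (intro sum_mono norm_le_l1_cart)
      also have "\<dots> \<le> (\<Sum>i\<in>UNIV. \<Sum>j\<in>(UNIV :: 'n set). B i)" using B by (intro sum_mono) (simp add: jac_nth)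
      finally show ?thesis .
    qed
    then show ?thesis by blast
  qed
  ultimately show "L2 U (jac \<phi>)" using L2_bounded[OF borel_lebesgue_on _ lmeasurable_U] by blast
qed

text \<open>The Jacobians converge to the chosen \<open>weak_grad U u\<close>, not just to the
  witness \<open>G\<close> of the definition.\<close>

lemma H10_sequence:
  assumes "H10 U u"
  obtains \<phi> where "\<And>k::nat. vtest U (\<phi> k)" "(\<lambda>k. L2norm U (\<lambda>x. \<phi> k x - u x)) \<longlonglongrightarrow> 0"
    "(\<lambda>k. L2norm U (\<lambda>x. jac (\<phi> k) x - weak_grad U u x)) \<longlonglongrightarrow> 0"
    "has_weak_grad U u (weak_grad U u)" "L2 U u" "L2 U (weak_grad U u)"
proof -
  obtain G and \<phi> :: "nat \<Rightarrow> real^'n \<Rightarrow> real^'n" where G: "has_weak_grad U u G" and \<phi>: "\<And>k. vtest U (\<phi> k)"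
    "(\<lambda>k. L2norm U (\<lambda>x. \<phi> k x - u x)) \<longlonglongrightarrow> 0" "(\<lambda>k. L2norm U (\<lambda>x. jac (\<phi> k) x - G x)) \<longlonglongrightarrow> 0"
    using assms unfolding H10_alt by blast
  note w = weak_grad_props[OF G]
  have L: "L2 U u" "L2 U (weak_grad U u)" "L2 U G" using w(1) G by (auto simp: has_weak_grad_def)
  have "L2norm U (\<lambda>x. jac (\<phi> k) x - G x) = L2norm U (\<lambda>x. jac (\<phi> k) x - weak_grad U u x)" for k
    using w(2) by (intro L2norm_cong_AE L2_diff L2_vtest[OF \<phi>(1)] L) auto
  with \<phi>(3) have "(\<lambda>k. L2norm U (\<lambda>x. jac (\<phi> k) x - weak_grad U u x)) \<longlonglongrightarrow> 0" by simp
  from that[OF \<phi>(1,2) this w(1) L(1,2)] show ?thesis .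
qed

lemma has_weak_grad_diff:
  assumes "has_weak_grad U u G" "has_weak_grad U v H"
  shows "has_weak_grad U (\<lambda>x. u x - v x) (\<lambda>x. G x - H x)"
proof -
  have L: "L2 U u" "L2 U v" "L2 U G" "L2 U H" using assms by (auto simp: has_weak_grad_def)
  show ?thesis
    unfolding has_weak_grad_def
  proof (intro conjI allI impI)
    fix i j \<phi> assume \<phi>: "testfun U \<phi>"
    have i: "integrable (lebesgue_on U) (\<lambda>x. u x $ i * pd j \<phi> x)" "integrable (lebesgue_on U) (\<lambda>x. v x $ i * pd j \<phi> x)"
      "integrable (lebesgue_on U) (\<lambda>x. G x $ i $ j * \<phi> x)" "integrable (lebesgue_on U) (\<lambda>x. H x $ i $ j * \<phi> x)"
      by (intro testfun_integrable[OF open_U _ \<phi>] L2_integrable1 L2_nth L)+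
    show "(\<integral>x. (u x - v x) $ i * pd j \<phi> x \<partial>lebesgue_on U) = - (\<integral>x. (G x - H x) $ i $ j * \<phi> x \<partial>lebesgue_on U)"
      using assms \<phi> i by (simp add: has_weak_grad_def left_diff_distrib)
  qed (intro L2_diff L)+
qed

lemma H10_diff:
  assumes "H10 U u" "H10 U v"
  shows "H10 U (\<lambda>x. u x - v x)"
    and "AE x in lebesgue_on U. weak_grad U (\<lambda>x. u x - v x) x = weak_grad U u x - weak_grad U v x"
proof -
  obtain \<phi> where \<phi>: "\<And>k::nat. vtest U (\<phi> k)" "(\<lambda>k. L2norm U (\<lambda>x. \<phi> k x - u x)) \<longlonglongrightarrow> 0"
    "(\<lambda>k. L2norm U (\<lambda>x. jac (\<phi> k) x - weak_grad U u x)) \<longlonglongrightarrow> 0"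
    "has_weak_grad U u (weak_grad U u)" "L2 U u" "L2 U (weak_grad U u)" by (rule H10_sequence[OF assms(1)]) (rule that)
  obtain \<psi> where \<psi>: "\<And>k::nat. vtest U (\<psi> k)" "(\<lambda>k. L2norm U (\<lambda>x. \<psi> k x - v x)) \<longlonglongrightarrow> 0"
    "(\<lambda>k. L2norm U (\<lambda>x. jac (\<psi> k) x - weak_grad U v x)) \<longlonglongrightarrow> 0"
    "has_weak_grad U v (weak_grad U v)" "L2 U v" "L2 U (weak_grad U v)" by (rule H10_sequence[OF assms(2)]) (rule that)
  note D = has_weak_grad_diff[OF \<phi>(4) \<psi>(4)]
  show "AE x in lebesgue_on U. weak_grad U (\<lambda>x. u x - v x) x = weak_grad U u x - weak_grad U v x"
    by (rule weak_grad_props(2)[OF D])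
  have lim: "(\<lambda>k. L2norm U (\<lambda>x. (a k x - b k x) - (c x - d x))) \<longlonglongrightarrow> 0"
    if "(\<lambda>k. L2norm U (\<lambda>x. a k x - c x)) \<longlonglongrightarrow> 0" "(\<lambda>k. L2norm U (\<lambda>x. b k x - d x)) \<longlonglongrightarrow> 0"
      "\<And>k. L2 U (a k)" "\<And>k. L2 U (b k)" "L2 U c" "L2 U d" for a b :: "nat \<Rightarrow> real^'n \<Rightarrow> 'b::euclidean_space" and c d
  proof (rule Lim_null_comparison)
    show "(\<lambda>k. L2norm U (\<lambda>x. a k x - c x) + L2norm U (\<lambda>x. b k x - d x)) \<longlonglongrightarrow> 0"
      using tendsto_add[OF that(1,2)] by simp
    have "L2norm U (\<lambda>x. (a k x - b k x) - (c x - d x)) \<le> L2norm U (\<lambda>x. a k x - c x) + L2norm U (\<lambda>x. b k x - d x)" for k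
    proof -
      have "(\<lambda>x. (a k x - b k x) - (c x - d x)) = (\<lambda>x. (a k x - c x) + (d x - b k x))" by (simp add: algebra_simps)
      then show ?thesis
        using L2norm_triangle[OF L2_diff[OF that(3,5)] L2_diff[OF that(6,4)]] by (simp add: L2norm_diff_commute[of U d])
    qed
    then show "\<forall>\<^sub>F k in sequentially. norm (L2norm U (\<lambda>x. (a k x - b k x) - (c x - d x)))
        \<le> L2norm U (\<lambda>x. a k x - c x) + L2norm U (\<lambda>x. b k x - d x)"
      by (simp add: L2norm_nonneg)
  qed
  show "H10 U (\<lambda>x. u x - v x)"
    unfolding H10_alt
  proof (intro exI conjI allI)
    show "has_weak_grad U (\<lambda>x. u x - v x) (\<lambda>x. weak_grad U u x - weak_grad U v x)" by (rule D)
    show "vtest U (\<lambda>x. \<phi> k x - \<psi> k x)" for k using \<phi>(1) \<psi>(1) by (rule vtest_diff)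
    show "(\<lambda>k. L2norm U (\<lambda>x. (\<phi> k x - \<psi> k x) - (u x - v x))) \<longlonglongrightarrow> 0"
      by (rule lim[OF \<phi>(2) \<psi>(2)]) (intro L2_vtest[OF \<phi>(1)] L2_vtest[OF \<psi>(1)] \<phi> \<psi>)+
    show "(\<lambda>k. L2norm U (\<lambda>x. jac (\<lambda>x. \<phi> k x - \<psi> k x) x - (weak_grad U u x - weak_grad U v x))) \<longlonglongrightarrow> 0"
      unfolding vtest_diff(2)[OF \<phi>(1) \<psi>(1)]
      by (rule lim[OF \<phi>(3) \<psi>(3)]) (intro L2_vtest[OF \<phi>(1)] L2_vtest[OF \<psi>(1)] \<phi> \<psi>)+
  qed
qed

text \<open>By \<open>testfun_swap\<close> the pairing of the gradient with its transpose is the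
  integral of the squared divergence, hence nonnegative. Expanding the square of the symmetric part
  then gives the factor 2.\<close>

lemma korn_vtest:
  assumes v: "vtest U \<phi>"
  shows "(L2norm U (jac \<phi>))\<^sup>2 \<le> 2 * (L2norm U (\<lambda>x. symm (jac \<phi> x)))\<^sup>2"
proof -
  let ?p = "\<lambda>i j. pd j (\<lambda>y. \<phi> y $ i)"
  have t: "testfun U (\<lambda>x. \<phi> x $ i)" for i using v by (simp add: vtest_def)
  have m: "?p i j \<in> borel_measurable borel" for i j by (rule testfun_measurable[OF t])
  have z: "?p i j x = 0" if "x \<notin> U" for i j x by (rule testfun_outside[OF t that])
  have L: "L2 U (jac \<phi>)" by (rule L2_vtest[OF v])
  have bt: "bounded_linear (transpose :: real^'n^'n \<Rightarrow> _)"
    by (rule bounded_linear_intro[of _ 1]) (simp_all add: transpose_add transpose_scaleR norm_transpose)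
  have Lt: "L2 U (\<lambda>x. transpose (jac \<phi> x))" by (rule L2_linear[OF bt L])
  have ij: "integrable (lebesgue_on U) (\<lambda>x. ?p i j x * ?p k l x)" for i j k l
    using L2_ip_integrable[OF L2_testfun(2)[OF t] L2_testfun(2)[OF t]] by simp
  have e: "(\<integral>x. ?p i j x * ?p k l x \<partial>lebesgue_on U) = (\<integral>x. ?p i j x * ?p k l x \<partial>lborel)" for i j k l
    by (rule integral_lebesgue_on_lborel[OF _ _ sets_U]) (auto intro: borel_measurable_times m simp: z)
  have "ip U (jac \<phi>) (\<lambda>x. transpose (jac \<phi> x)) = (\<integral>x. (\<Sum>i\<in>UNIV. \<Sum>j\<in>UNIV. ?p i j x * ?p j i x) \<partial>lebesgue_on U)"
    by (simp add: ip_def inner_vec_def transpose_def jac_nth)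
  also have "\<dots> = (\<Sum>i\<in>UNIV. \<Sum>j\<in>UNIV. \<integral>x. ?p i j x * ?p j i x \<partial>lebesgue_on U)"
    by (simp add: ij Bochner_Integration.integral_sum)
  also have "\<dots> = (\<Sum>i\<in>UNIV. \<Sum>j\<in>UNIV. \<integral>x. ?p i i x * ?p j j x \<partial>lebesgue_on U)"
    unfolding e by (intro sum.cong refl testfun_swap[OF t t])
  also have "\<dots> = (\<integral>x. (\<Sum>i\<in>UNIV. \<Sum>j\<in>UNIV. ?p i i x * ?p j j x) \<partial>lebesgue_on U)"
    by (simp add: ij Bochner_Integration.integral_sum)
  also have "\<dots> = (\<integral>x. (\<Sum>i\<in>UNIV. ?p i i x)\<^sup>2 \<partial>lebesgue_on U)"
    by (simp add: power2_eq_square sum_product)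
  also have "\<dots> \<ge> 0" by (rule Bochner_Integration.integral_nonneg) simp
  finally have pos: "0 \<le> ip U (jac \<phi>) (\<lambda>x. transpose (jac \<phi> x))" .
  have tt: "ip U (\<lambda>x. transpose (jac \<phi> x)) (\<lambda>x. transpose (jac \<phi> x)) = ip U (jac \<phi>) (jac \<phi>)"
    by (simp add: ip_def inner_transpose)
  have "(L2norm U (\<lambda>x. symm (jac \<phi> x)))\<^sup>2 = (1/4) * (L2norm U (\<lambda>x. jac \<phi> x + transpose (jac \<phi> x)))\<^sup>2"
    unfolding symm_def L2norm_scaleR by (simp add: power_mult_distrib power_divide)
  also have "(L2norm U (\<lambda>x. jac \<phi> x + transpose (jac \<phi> x)))\<^sup>2
      = 2 * (L2norm U (jac \<phi>))\<^sup>2 + 2 * ip U (jac \<phi>) (\<lambda>x. transpose (jac \<phi> x))"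
    unfolding L2norm_sq using L Lt by (simp add: ip_add_left ip_add_right L2_add tt ip_commute[of U "\<lambda>x. transpose (jac \<phi> x)" "jac \<phi>"])
  finally show ?thesis using pos by simp
qed

lemma korn:
  assumes "H10 U u"
  shows "L2norm U (weak_grad U u) \<le> sqrt 2 * L2norm U (eps U u)" "L2 U (eps U u)"
proof -
  obtain \<phi> where \<phi>: "\<And>k::nat. vtest U (\<phi> k)" "(\<lambda>k. L2norm U (\<lambda>x. \<phi> k x - u x)) \<longlonglongrightarrow> 0"
    "(\<lambda>k. L2norm U (\<lambda>x. jac (\<phi> k) x - weak_grad U u x)) \<longlonglongrightarrow> 0"
    "has_weak_grad U u (weak_grad U u)" "L2 U u" "L2 U (weak_grad U u)" by (rule H10_sequence[OF assms]) (rule that)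
  have Lj: "L2 U (jac (\<phi> k))" for k by (rule L2_vtest[OF \<phi>(1)])
  note Ls = L2_linear[OF bounded_linear_symm]
  have e: "eps U u = (\<lambda>x. symm (weak_grad U u x))" by (simp add: eps_symm fun_eq_iff)
  show "L2 U (eps U u)" unfolding e by (rule Ls[OF \<phi>(6)])
  have "(\<lambda>k. L2norm U (\<lambda>x. symm (jac (\<phi> k) x) - symm (weak_grad U u x))) \<longlonglongrightarrow> 0"
  proof (rule Lim_null_comparison[OF _ \<phi>(3)])
    have "L2norm U (\<lambda>x. symm (jac (\<phi> k) x - weak_grad U u x)) \<le> L2norm U (\<lambda>x. jac (\<phi> k) x - weak_grad U u x)" for k
      by (rule L2norm_linear_contraction[OF bounded_linear_symm norm_symm_le]) (intro L2_diff Lj \<phi>)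
    then show "\<forall>\<^sub>F k in sequentially. norm (L2norm U (\<lambda>x. symm (jac (\<phi> k) x) - symm (weak_grad U u x)))
       \<le> L2norm U (\<lambda>x. jac (\<phi> k) x - weak_grad U u x)"
      by (simp add: L2norm_nonneg linear_diff[OF bounded_linear.linear[OF bounded_linear_symm]])
  qed
  then have l1: "(\<lambda>k. L2norm U (\<lambda>x. symm (jac (\<phi> k) x))) \<longlonglongrightarrow> L2norm U (eps U u)"
    unfolding e by (rule L2norm_tendsto[OF Ls[OF \<phi>(6)] Ls[OF Lj]])
  have l2: "(\<lambda>k. L2norm U (jac (\<phi> k))) \<longlonglongrightarrow> L2norm U (weak_grad U u)"
    by (rule L2norm_tendsto[OF \<phi>(6) Lj \<phi>(3)])
  have "L2norm U (jac (\<phi> k)) \<le> sqrt 2 * L2norm U (\<lambda>x. symm (jac (\<phi> k) x))" for k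
    by (rule power2_le_imp_le) (simp_all add: power_mult_distrib korn_vtest[OF \<phi>(1)] L2norm_nonneg)
  then show "L2norm U (weak_grad U u) \<le> sqrt 2 * L2norm U (eps U u)"
    by (intro LIMSEQ_le[OF l2 tendsto_mult_left[OF l1]]) auto
qed

end

section \<open>Dual form of the Poincare inequality\<close>

context full_simplex
begin

lemma lmeasurable_hull: "convex hull K \<in> lmeasurable" using compact_hull by (rule lmeasurable_compact)

end

text \<open>As \<open>q\<close> has mean zero, a constant vector may be subtracted from
  \<open>\<phi>\<close> in the pairing; \<open>simplex_poincare\<close> supplies it component by
  component.\<close>

lemma simplex_dual_poincare:
  fixes K :: "(real^'n) set"
  assumes d: "CARD('n) = 2 \<or> CARD('n) = 3" and K: "full_simplex K"
    and q: "L2 (convex hull K) q" "\<And>i. (\<integral>x. q x $ i \<partial>lebesgue_on (convex hull K)) = 0"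
    and \<phi>: "vtest U \<phi>"
  shows "\<bar>ip (convex hull K) q \<phi>\<bar> \<le> diameter (convex hull K) / pi * L2norm (convex hull K) q * L2norm (convex hull K) (jac \<phi>)"
proof -
  interpret full_simplex K by (rule K)
  let ?S = "convex hull K"
  let ?C = "diameter ?S / pi"
  have C0: "?C \<ge> 0" using compact_hull by (simp add: diameter_ge_0 compact_imp_bounded)
  have t: "C1_grad (\<lambda>x. \<phi> x $ i) (\<lambda>x. \<chi> j. pd j (\<lambda>y. \<phi> y $ i) x)" for i
    using testfun_C1_grad \<phi> unfolding vtest_def by blast
  have "\<exists>m. (\<integral>x. (\<phi> x $ i - m)\<^sup>2 \<partial>lebesgue_on ?S) \<le> ?C\<^sup>2 * (\<integral>x. (norm (\<chi> j. pd j (\<lambda>y. \<phi> y $ i) x))\<^sup>2 \<partial>lebesgue_on ?S)" for i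
    by (rule simplex_poincare) (use d t[of i] in \<open>auto simp: C1_grad_def\<close>)
  then obtain m where m: "\<And>i. (\<integral>x. (\<phi> x $ i - m i)\<^sup>2 \<partial>lebesgue_on ?S) \<le> ?C\<^sup>2 * (\<integral>x. (norm (jac \<phi> x $ i))\<^sup>2 \<partial>lebesgue_on ?S)"
    unfolding jac_def vec_lambda_beta by metis
  define M :: "real^'n" where "M = (\<chi> i. m i)"
  have L2c: "L2 ?S f" if "continuous_on UNIV f" for f :: "real^'n \<Rightarrow> 'b::euclidean_space"
  proof -
    have "compact (f ` ?S)" by (rule compact_continuous_image[OF continuous_on_subset[OF that] compact_hull]) simp
    then obtain B where B: "\<forall>y\<in>f ` ?S. norm y \<le> B" using compact_imp_bounded bounded_iff by blast
    show ?thesis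
    proof (rule L2_bounded[OF borel_lebesgue_on[OF borel_measurable_continuous_onI[OF that]] _ lmeasurable_hull])
      show "AE x in lebesgue_on ?S. norm (f x) \<le> B" by (rule AE_I2) (use B in auto)
    qed
  qed
  have c: "continuous_on UNIV \<phi>" "continuous_on UNIV (jac \<phi>)" by (rule continuous_vtest[OF \<phi>])+
  have L: "L2 ?S \<phi>" "L2 ?S (jac \<phi>)" "L2 ?S (\<lambda>x. M)" by (intro L2c c continuous_on_const)+
  have "ip ?S q (\<lambda>x. M) = (\<Sum>i\<in>UNIV. M $ i * (\<integral>x. q x $ i \<partial>lebesgue_on ?S))"
  proof -
    have "integrable (lebesgue_on ?S) (\<lambda>x. q x $ i)" for i
      using L2_ip_integrable[OF L2_nth[OF q(1), of i] L2c[OF continuous_on_const[of UNIV "1::real"]]] by simp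
    then have "(\<integral>x. (\<Sum>i\<in>UNIV. q x $ i * M $ i) \<partial>lebesgue_on ?S) = (\<Sum>i\<in>UNIV. (\<integral>x. q x $ i \<partial>lebesgue_on ?S) * M $ i)"
      by (subst Bochner_Integration.integral_sum) auto
    then show ?thesis by (simp add: ip_def inner_vec_def mult.commute)
  qed
  then have qM: "ip ?S q (\<lambda>x. M) = 0" by (simp add: q(2))
  have sq: "(L2norm ?S (\<lambda>x. \<phi> x - M))\<^sup>2 \<le> (?C * L2norm ?S (jac \<phi>))\<^sup>2"
  proof -
    have i1: "integrable (lebesgue_on ?S) (\<lambda>x. (\<phi> x $ i - m i)\<^sup>2)" for i
      using L2_integrable[OF L2_nth[OF L2_diff[OF L(1,3)], of i]] by (simp add: M_def)
    have i2: "integrable (lebesgue_on ?S) (\<lambda>x. (norm (jac \<phi> x $ i))\<^sup>2)" for i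
      using L2_integrable[OF L2_nth[OF L(2), of i]] .
    have "(L2norm ?S (\<lambda>x. \<phi> x - M))\<^sup>2 = (\<integral>x. (\<Sum>i\<in>UNIV. (\<phi> x $ i - m i)\<^sup>2) \<partial>lebesgue_on ?S)"
      unfolding L2norm_sq ip_def inner_vec_def M_def by (simp add: power2_eq_square)
    also have "\<dots> = (\<Sum>i\<in>UNIV. \<integral>x. (\<phi> x $ i - m i)\<^sup>2 \<partial>lebesgue_on ?S)" using i1 by simp
    also have "\<dots> \<le> (\<Sum>i\<in>UNIV. ?C\<^sup>2 * (\<integral>x. (norm (jac \<phi> x $ i))\<^sup>2 \<partial>lebesgue_on ?S))" by (intro sum_mono m)
    also have "\<dots> = ?C\<^sup>2 * (\<integral>x. (\<Sum>i\<in>UNIV. (norm (jac \<phi> x $ i))\<^sup>2) \<partial>lebesgue_on ?S)"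
      using i2 by (simp add: sum_distrib_left)
    also have "\<dots> = ?C\<^sup>2 * (L2norm ?S (jac \<phi>))\<^sup>2"
    proof -
      have "(\<Sum>i\<in>UNIV. (norm (jac \<phi> x $ i))\<^sup>2) = jac \<phi> x \<bullet> jac \<phi> x" for x
        by (subst inner_vec_def) (simp add: power2_norm_eq_inner)
      then show ?thesis by (simp add: L2norm_sq ip_def)
    qed
    finally show ?thesis by (simp only: power_mult_distrib)
  qed
  have "\<bar>ip ?S q \<phi>\<bar> = \<bar>ip ?S q (\<lambda>x. \<phi> x - M)\<bar>" using qM by (simp add: ip_diff_right q L)
  also have "\<dots> \<le> L2norm ?S q * L2norm ?S (\<lambda>x. \<phi> x - M)" by (rule ip_cauchy[OF q(1) L2_diff[OF L(1,3)]])
  also have "\<dots> \<le> L2norm ?S q * (?C * L2norm ?S (jac \<phi>))"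
    by (intro mult_left_mono power2_le_imp_le[OF sq] mult_nonneg_nonneg C0 L2norm_nonneg)
  finally show ?thesis by (simp add: mult_ac)
qed

section \<open>Hat functions\<close>

text \<open>An abstraction of a hat function times a C^1 factor: \<open>N\<close> plays the role of
  the element faces and \<open>C\<close> contains the support. Setting \<open>g\<close> to 0 on
  \<open>N\<close> makes it a total measurable function.\<close>

locale piecewise_C1 =
  fixes w :: "real^'n \<Rightarrow> real" and g :: "real^'n \<Rightarrow> real^'n" and N C :: "(real^'n) set" and L :: real
  assumes lip: "\<And>x y. \<bar>w x - w y\<bar> \<le> L * norm (x - y)"
    and closed_N: "closed N" and negligible_N: "negligible N"
    and der: "\<And>x. x \<notin> N \<Longrightarrow> (w has_derivative (\<lambda>h. g x \<bullet> h)) (at x)"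
    and cont_g: "\<And>x. x \<notin> N \<Longrightarrow> isCont g x"
    and g_N: "\<And>x. x \<in> N \<Longrightarrow> g x = 0"
    and compact_C: "compact C" and w_C: "\<And>x. x \<notin> C \<Longrightarrow> w x = 0"
begin

lemma L_nonneg: "0 \<le> L"
proof -
  have "0 \<le> L * norm (axis undefined 1 - (0::real^'n))" by (rule order_trans[OF abs_ge_zero lip])
  then show ?thesis by (simp add: norm_axis_1)
qed

lemma continuous_w: "continuous_on S w"
proof -
  have "L-lipschitz_on UNIV w"
    by (rule lipschitz_onI) (use lip L_nonneg in \<open>auto simp: dist_real_def dist_norm\<close>)
  then show ?thesis using lipschitz_on_continuous_on continuous_on_subset by blast
qed

lemma measurable_w: "w \<in> borel_measurable borel"
  by (rule borel_measurable_continuous_onI[OF continuous_w])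

lemma measurable_g: "g \<in> borel_measurable borel"
proof -
  have "continuous_on (- N) g" using cont_g by (auto intro!: continuous_at_imp_continuous_on)
  then have "(\<lambda>x. indicator (- N) x *\<^sub>R g x) \<in> borel_measurable borel"
    using closed_N by (intro borel_measurable_continuous_on_indicator) auto
  moreover have "(\<lambda>x. indicator (- N) x *\<^sub>R g x) = g" using g_N by (auto simp: indicator_def fun_eq_iff)
  ultimately show ?thesis by simp
qed

text \<open>Differentiating in the direction of the gradient itself gives
  \<open>(norm (g x))\<^sup>2 \<le> L * norm (g x)\<close>.\<close>

lemma norm_g_le: "norm (g x) \<le> L"
proof (cases "x \<in> N")
  case True
  then show ?thesis using g_N L_nonneg by simp
next
  case False
  have "(\<lambda>k. norm ((w (x + (1 / real (Suc k)) *\<^sub>R g x) - w x) * real (Suc k))) \<longlonglongrightarrow> norm (g x \<bullet> g x)"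
    by (intro tendsto_norm has_derivative_sequence der False)
  moreover have "norm ((w (x + (1 / real (Suc k)) *\<^sub>R g x) - w x) * real (Suc k)) \<le> L * norm (g x)" for k
    using mult_right_mono[OF lip[of "x + (1 / real (Suc k)) *\<^sub>R g x" x], of "real (Suc k)"] by (simp add: abs_mult)
  ultimately have "norm (g x \<bullet> g x) \<le> L * norm (g x)" by (intro LIMSEQ_le_const2) auto
  then have "norm (g x) * norm (g x) \<le> L * norm (g x)" by (simp add: power2_norm_eq_inner flip: power2_eq_square)
  then show ?thesis using L_nonneg by (cases "norm (g x) = 0") auto
qed

lemma AE_N: "AE x in lborel. x \<notin> N"
proof (rule AE_not_in)
  show "N \<in> null_sets lborel" using negligible_N closed_N
    unfolding negligible_iff_null_sets by (simp add: null_sets_completion_iff)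
qed

text \<open>Affine maps with nonzero scaling preserve null sets. So for fixed \<open>x\<close> the
  integrand of the mollification is differentiable in \<open>x\<close> for almost every
  \<open>y\<close>.\<close>

lemma AE_N_affine:
  assumes "h \<noteq> 0"
  shows "AE y in lborel. x + h *\<^sub>R y \<notin> N"
proof -
  have [measurable]: "{x. x \<notin> N} \<in> sets borel" using closed_N by (simp add: open_Compl Collect_neg_eq borel_open)
  have "AE z in density (distr lborel borel (\<lambda>y. x + h *\<^sub>R y)) (\<lambda>_. ennreal (\<bar>h\<bar> ^ DIM(real^'n))). z \<notin> N"
    using AE_N unfolding lborel_affine[OF assms, of x, symmetric] .
  then have "AE z in distr lborel borel (\<lambda>y. x + h *\<^sub>R y). z \<notin> N"
    using assms by (subst (asm) AE_density) auto
  then show ?thesis by (subst (asm) AE_distr_iff) auto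
qed

text \<open>Integration by parts across element faces: Lipschitz continuity takes the place of
  matching the traces.\<close>

lemma integral_g_zero: "(\<integral>x. g x $ j \<partial>lborel) = 0"
proof -
  obtain R where R: "\<forall>x\<in>C. norm x \<le> R" using compact_C compact_imp_bounded bounded_iff by blast
  have "(\<integral>x. g x \<bullet> axis j 1 \<partial>lborel) = 0"
  proof (rule integral_derivative_zero[where L = L and R = R and w = w])
    show "w x = 0" if "norm x > R" for x using R that w_C[of x] by force
    show "AE x in lborel. (w has_derivative (\<lambda>h. g x \<bullet> h)) (at x)" using AE_N by eventually_elim (rule der)
    show "(\<lambda>x. g x \<bullet> axis j 1) \<in> borel_measurable borel" using measurable_g by measurable
  qed (rule lip)
  then show ?thesis by (simp add: inner_axis)
qed

end

section \<open>Mollification over a small cube\<close>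

abbreviation unit_cube :: "(real^'n) set" where "unit_cube \<equiv> cbox 0 One"

text \<open>Averaging over a small cube suffices as a mollifier: the average of a Lipschitz function that
  is \<open>C\<^sup>1\<close> off a closed null set is \<open>C\<^sup>1\<close>.\<close>
definition moll :: "real \<Rightarrow> (real^'n \<Rightarrow> 'b::euclidean_space) \<Rightarrow> real^'n \<Rightarrow> 'b" where
  "moll h F x = (\<integral>y. indicator unit_cube y *\<^sub>R F (x + h *\<^sub>R y) \<partial>lborel)"

lemma integrable_unit_cube_bounded:
  fixes F :: "real^'n \<Rightarrow> 'b::euclidean_space"
  assumes "F \<in> borel_measurable borel" "\<And>y. norm (F y) \<le> B"
  shows "integrable lborel (\<lambda>y. indicator unit_cube y *\<^sub>R F y)"
  by (rule integrableI_bounded_set_indicator[where B = B]) (use assms in \<open>auto intro: emeasure_bounded_finite\<close>)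

lemma integral_unit_cube_dominated:
  fixes F :: "nat \<Rightarrow> real^'n \<Rightarrow> 'b::euclidean_space"
  assumes "\<And>k. F k \<in> borel_measurable borel" "G \<in> borel_measurable borel" "\<And>k y. norm (F k y) \<le> B"
    and "AE y in lborel. (\<lambda>k. F k y) \<longlonglongrightarrow> G y"
  shows "(\<lambda>k. \<integral>y. indicator unit_cube y *\<^sub>R F k y \<partial>lborel) \<longlonglongrightarrow> (\<integral>y. indicator unit_cube y *\<^sub>R G y \<partial>lborel)"
proof (rule integral_dominated_convergence[where w = "\<lambda>y. indicator unit_cube y *\<^sub>R B"])
  show "integrable lborel (\<lambda>y::real^'n. indicator unit_cube y *\<^sub>R B)"
    by (rule integrable_unit_cube_bounded[where B = "norm B"]) auto
  show "AE y in lborel. (\<lambda>k. indicator unit_cube y *\<^sub>R F k y) \<longlonglongrightarrow> indicator unit_cube y *\<^sub>R G y"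
    using assms(4) by eventually_elim (intro tendsto_intros)
  show "AE y in lborel. norm (indicator unit_cube y *\<^sub>R F k y) \<le> indicator unit_cube y *\<^sub>R B" for k
    using assms(3) by (intro AE_I2) (auto simp: indicator_def)
qed (use assms(1,2) in measurable)

lemma integral_unit_cube_const: "(\<integral>y. indicator (unit_cube :: (real^'n) set) y *\<^sub>R c \<partial>lborel) = (c :: 'b::euclidean_space)"
proof -
  have "measure lborel (unit_cube :: (real^'n) set) = 1" using content_unit by simp
  then show ?thesis by simp
qed

context piecewise_C1
begin

lemma measurable_affine [measurable]: "(\<lambda>y. x + h *\<^sub>R y) \<in> borel_measurable (borel :: (real^'n) measure)"
  by measurable

lemma measurable_w' [measurable]: "(\<lambda>y. w (x + h *\<^sub>R y)) \<in> borel_measurable borel"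
  by (rule measurable_compose[OF measurable_affine measurable_w])

lemma measurable_g' [measurable]: "(\<lambda>y. g (x + h *\<^sub>R y)) \<in> borel_measurable borel"
  by (rule measurable_compose[OF measurable_affine measurable_g])

lemma w_bounded: obtains W where "W \<ge> 0" "\<And>x. norm (w x) \<le> W"
proof -
  obtain B where "B > 0" "\<And>x. norm (w x) \<le> B"
    by (rule bounded_range_compact_support[OF continuous_w compact_C], erule w_C, rule that)
  then show ?thesis using that[of B] by simp
qed

text \<open>Dominated convergence for the remainder quotients, which are bounded by
  \<open>L + L\<close> and tend to 0 wherever \<open>x + h *\<^sub>R y\<close> avoids
  \<open>N\<close>.\<close>

lemma moll_has_derivative:
  assumes h: "h \<noteq> 0"
  shows "(moll h w has_derivative (\<lambda>v. moll h g x \<bullet> v)) (at x)"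
  unfolding has_derivative_iff_norm
proof
  show "bounded_linear (\<lambda>v. moll h g x \<bullet> v)" by (rule bounded_linear_inner_right)
  obtain W where W: "W \<ge> 0" "\<And>x. norm (w x) \<le> W" by (rule w_bounded) (rule that)
  have iw: "integrable lborel (\<lambda>y. indicator unit_cube y *\<^sub>R w (x + h *\<^sub>R y))" for x
    by (rule integrable_unit_cube_bounded[OF measurable_w' W(2)])
  have ig: "integrable lborel (\<lambda>y. indicator unit_cube y *\<^sub>R g (x + h *\<^sub>R y))" for x
    by (rule integrable_unit_cube_bounded[OF measurable_g' norm_g_le])
  show "((\<lambda>y. norm ((moll h w y - moll h w x) - moll h g x \<bullet> (y - x)) / norm (y - x)) \<longlongrightarrow> 0) (at x)"
    unfolding tendsto_at_iff_sequentially
  proof (intro allI impI)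
    fix X :: "nat \<Rightarrow> real^'n" assume X: "\<forall>i. X i \<in> UNIV - {x}" "X \<longlonglongrightarrow> x"
    define F where "F = (\<lambda>i y. ((w (X i + h *\<^sub>R y) - w (x + h *\<^sub>R y)) - g (x + h *\<^sub>R y) \<bullet> (X i - x)) / norm (X i - x))"
    have nz: "norm (X i - x) > 0" for i using X(1) by auto
    have mF: "F i \<in> borel_measurable borel" for i unfolding F_def by measurable
    have bF: "norm (F i y) \<le> L + L" for i y
    proof -
      have "\<bar>w (X i + h *\<^sub>R y) - w (x + h *\<^sub>R y)\<bar> \<le> L * norm (X i - x)" using lip[of "X i + h *\<^sub>R y" "x + h *\<^sub>R y"] by simp
      moreover have "\<bar>g (x + h *\<^sub>R y) \<bullet> (X i - x)\<bar> \<le> L * norm (X i - x)"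
        by (rule order_trans[OF Cauchy_Schwarz_ineq2]) (intro mult_right_mono norm_g_le norm_ge_zero)
      ultimately have "\<bar>(w (X i + h *\<^sub>R y) - w (x + h *\<^sub>R y)) - g (x + h *\<^sub>R y) \<bullet> (X i - x)\<bar> \<le> (L + L) * norm (X i - x)"
        by (simp add: distrib_right)
      then show ?thesis using nz[of i] by (simp add: F_def abs_divide pos_divide_le_eq)
    qed
    have lF: "AE y in lborel. (\<lambda>i. F i y) \<longlonglongrightarrow> 0"
      using AE_N_affine[OF h, of x]
    proof eventually_elim
      case (elim y)
      have "((\<lambda>z. norm ((w z - w (x + h *\<^sub>R y)) - g (x + h *\<^sub>R y) \<bullet> (z - (x + h *\<^sub>R y))) / norm (z - (x + h *\<^sub>R y))) \<longlongrightarrow> 0) (at (x + h *\<^sub>R y))"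
        using der[OF elim] unfolding has_derivative_iff_norm by blast
      moreover have "filterlim (\<lambda>i. X i + h *\<^sub>R y) (at (x + h *\<^sub>R y)) sequentially"
        using X by (intro filterlim_atI tendsto_intros) auto
      ultimately have "(\<lambda>i. norm ((w (X i + h *\<^sub>R y) - w (x + h *\<^sub>R y)) - g (x + h *\<^sub>R y) \<bullet> ((X i + h *\<^sub>R y) - (x + h *\<^sub>R y))) / norm ((X i + h *\<^sub>R y) - (x + h *\<^sub>R y))) \<longlonglongrightarrow> 0"
        by (rule filterlim_compose)
      then have "(\<lambda>i. norm (F i y)) \<longlonglongrightarrow> 0" by (simp add: F_def)
      then show ?case by (rule tendsto_norm_zero_cancel)
    qed
    have "(\<lambda>i. \<integral>y. indicator unit_cube y *\<^sub>R F i y \<partial>lborel) \<longlonglongrightarrow> (\<integral>y. indicator (unit_cube :: (real^'n) set) y *\<^sub>R 0 \<partial>lborel)"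
      by (rule integral_unit_cube_dominated[OF mF _ bF lF]) simp
    then have lim: "(\<lambda>i. \<integral>y. indicator unit_cube y *\<^sub>R F i y \<partial>lborel) \<longlonglongrightarrow> 0" by simp
    have "(\<integral>y. indicator unit_cube y *\<^sub>R F i y \<partial>lborel)
        = ((moll h w (X i) - moll h w x) - moll h g x \<bullet> (X i - x)) / norm (X i - x)" for i
    proof -
      have "(\<integral>y. indicator unit_cube y *\<^sub>R F i y \<partial>lborel)
          = (\<integral>y. ((indicator unit_cube y *\<^sub>R w (X i + h *\<^sub>R y) - indicator unit_cube y *\<^sub>R w (x + h *\<^sub>R y))
              - (indicator unit_cube y *\<^sub>R g (x + h *\<^sub>R y)) \<bullet> (X i - x)) / norm (X i - x) \<partial>lborel)"
        by (rule Bochner_Integration.integral_cong) (auto simp: F_def right_diff_distrib)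
      also have "\<dots> = ((\<integral>y. indicator unit_cube y *\<^sub>R w (X i + h *\<^sub>R y) \<partial>lborel) - (\<integral>y. indicator unit_cube y *\<^sub>R w (x + h *\<^sub>R y) \<partial>lborel)
              - (\<integral>y. (indicator unit_cube y *\<^sub>R g (x + h *\<^sub>R y)) \<bullet> (X i - x) \<partial>lborel)) / norm (X i - x)"
        using iw ig[of x]
        by (subst integral_divide_zero, subst Bochner_Integration.integral_diff, intro Bochner_Integration.integrable_diff iw,
            intro integrable_inner_left ig, subst Bochner_Integration.integral_diff) (auto simp del: scaleR_conv_of_real real_scaleR_def)
      also have "(\<integral>y. (indicator unit_cube y *\<^sub>R g (x + h *\<^sub>R y)) \<bullet> (X i - x) \<partial>lborel) = moll h g x \<bullet> (X i - x)"
        unfolding moll_def by (rule integral_inner_left[OF ig])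
      finally show ?thesis unfolding moll_def .
    qed
    with lim have "(\<lambda>i. ((moll h w (X i) - moll h w x) - moll h g x \<bullet> (X i - x)) / norm (X i - x)) \<longlonglongrightarrow> 0" by simp
    then have "(\<lambda>i. norm (((moll h w (X i) - moll h w x) - moll h g x \<bullet> (X i - x)) / norm (X i - x))) \<longlonglongrightarrow> 0"
      by (rule tendsto_norm_zero)
    then show "((\<lambda>y. norm ((moll h w y - moll h w x) - moll h g x \<bullet> (y - x)) / norm (y - x)) \<circ> X) \<longlonglongrightarrow> 0"
      by (simp add: o_def)
  qed
qed

lemma moll_C1:
  assumes h: "h \<noteq> 0"
  shows "C1_grad (moll h w) (moll h g)"
  unfolding C1_grad_def
proof (intro conjI allI moll_has_derivative h)
  have "isCont (moll h g) x" for x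
    unfolding continuous_at_sequentially
  proof (intro allI impI)
    fix X :: "nat \<Rightarrow> real^'n" assume X: "X \<longlonglongrightarrow> x"
    have "AE y in lborel. (\<lambda>k. g (X k + h *\<^sub>R y)) \<longlonglongrightarrow> g (x + h *\<^sub>R y)"
      using AE_N_affine[OF h, of x]
    proof eventually_elim
      case (elim y)
      show ?case by (rule isCont_tendsto_compose[OF cont_g[OF elim]]) (intro tendsto_intros X)
    qed
    from integral_unit_cube_dominated[OF measurable_g' measurable_g' norm_g_le this]
    show "(moll h g \<circ> X) \<longlonglongrightarrow> moll h g x" by (simp add: moll_def o_def)
  qed
  then show "continuous_on UNIV (moll h g)" by (simp add: continuous_at_imp_continuous_on)
qed

lemma moll_norm_le:
  fixes F :: "real^'n \<Rightarrow> 'b::euclidean_space"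
  assumes "F \<in> borel_measurable borel" "\<And>x. norm (F x) \<le> B"
  shows "norm (moll h F x) \<le> B"
proof -
  have m: "(\<lambda>y. F (x + h *\<^sub>R y)) \<in> borel_measurable borel" by (rule measurable_compose[OF measurable_affine assms(1)])
  have "norm (moll h F x) \<le> (\<integral>y. indicator (unit_cube :: (real^'n) set) y *\<^sub>R B \<partial>lborel)"
    unfolding moll_def
  proof (rule Bochner_Integration.integral_norm_bound_integral)
    show "integrable lborel (\<lambda>y. indicator unit_cube y *\<^sub>R F (x + h *\<^sub>R y))"
      by (rule integrable_unit_cube_bounded[OF m assms(2)])
    show "integrable lborel (\<lambda>y::real^'n. indicator unit_cube y *\<^sub>R B)"
      by (rule integrable_unit_cube_bounded[where B = "norm B"]) auto
    show "norm (indicator unit_cube y *\<^sub>R F (x + h *\<^sub>R y)) \<le> indicator unit_cube y *\<^sub>R B" for y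
      using assms(2) by (auto simp: indicator_def)
  qed
  then show ?thesis by (simp add: integral_unit_cube_const)
qed

lemma moll_tendsto:
  fixes F :: "real^'n \<Rightarrow> 'b::euclidean_space"
  assumes F: "F \<in> borel_measurable borel" "\<And>x. norm (F x) \<le> B" and x: "isCont F x" and h: "h \<longlonglongrightarrow> 0"
  shows "(\<lambda>k::nat. moll (h k) F x) \<longlonglongrightarrow> F x"
proof -
  have m: "(\<lambda>y. F (x + t *\<^sub>R y)) \<in> borel_measurable borel" for t by (rule measurable_compose[OF measurable_affine F(1)])
  have "(\<lambda>k. moll (h k) F x) \<longlonglongrightarrow> (\<integral>y. indicator (unit_cube :: (real^'n) set) y *\<^sub>R F x \<partial>lborel)"
    unfolding moll_def
  proof (rule integral_unit_cube_dominated[where F = "\<lambda>k y. F (x + h k *\<^sub>R y)" and G = "\<lambda>y. F x" and B = B])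
    show "AE y in lborel. (\<lambda>k. F (x + h k *\<^sub>R y)) \<longlonglongrightarrow> F x"
    proof (rule AE_I2)
      fix y
      have "(\<lambda>k. x + h k *\<^sub>R y) \<longlonglongrightarrow> x + 0 *\<^sub>R y" by (intro tendsto_intros h)
      then show "(\<lambda>k. F (x + h k *\<^sub>R y)) \<longlonglongrightarrow> F x" by (intro isCont_tendsto_compose[OF x]) simp
    qed
  qed (simp_all add: m F(2))
  then show ?thesis by (simp only: integral_unit_cube_const)
qed

text \<open>Mollification enlarges the support by at most \<open>h\<close> times the radius of the
  unit cube, so it stays in \<open>U\<close> for small \<open>h\<close>; both errors vanish by
  bounded convergence.\<close>

lemma approx_by_testfun:
  assumes U: "open U" "bounded U" and CU: "C \<subseteq> U" and \<epsilon>: "\<epsilon> > 0"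
  shows "\<exists>\<phi>. testfun U \<phi> \<and> L2norm U (\<lambda>x. \<phi> x - w x) < \<epsilon> \<and> L2norm U (\<lambda>x. (\<chi> j. pd j \<phi> x) - g x) < \<epsilon>"
proof -
  define h where "h = (\<lambda>k. 1 / real (Suc k))"
  have h0: "h k \<noteq> 0" "h k > 0" for k by (auto simp: h_def)
  have hlim: "h \<longlonglongrightarrow> 0" unfolding h_def using LIMSEQ_inverse_real_of_nat by (simp add: inverse_eq_divide)
  obtain e where e: "e > 0" "(\<Union>x\<in>C. cball x e) \<subseteq> U"
    using compact_subset_open_imp_cball_epsilon_subset[OF compact_C U(1) CU] by blast
  obtain M where M: "\<And>y. y \<in> (unit_cube :: (real^'n) set) \<Longrightarrow> norm y \<le> M"
    using bounded_cbox[of 0 "One :: real^'n"] unfolding bounded_iff by blast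
  obtain W where W: "W \<ge> 0" "\<And>x. norm (w x) \<le> W" by (rule w_bounded) (rule that)
  interpret fm: finite_measure "lebesgue_on U"
    using lmeasurable_open[OF U(2,1)] by (intro finite_measureI) (auto simp: emeasure_restrict_space fmeasurable_def less_top[symmetric])
  have conv: "(\<lambda>k. L2norm U (\<lambda>x. moll (h k) F x - F x)) \<longlonglongrightarrow> 0"
    if F: "F \<in> borel_measurable borel" "\<And>x. norm (F x) \<le> B" "\<And>x. x \<notin> N \<Longrightarrow> isCont F x"
      "\<And>k. continuous_on UNIV (moll (h k) F)" for F :: "real^'n \<Rightarrow> 'b::euclidean_space" and B
  proof -
    have mm: "moll (h k) F \<in> borel_measurable (lebesgue_on U)" "F \<in> borel_measurable (lebesgue_on U)" for k
      using borel_measurable_continuous_onI[OF F(4)] F(1) by (simp_all add: measurable_restrict_space1 measurable_completion)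
    have "(\<lambda>k. \<integral>x. (norm (moll (h k) F x - F x))\<^sup>2 \<partial>lebesgue_on U) \<longlonglongrightarrow> (\<integral>x. 0 \<partial>lebesgue_on U)"
    proof (rule integral_dominated_convergence[where w = "\<lambda>x. (B + B)\<^sup>2"])
      have "AE x in lebesgue. x \<notin> N" by (rule AE_completion[OF AE_N])
      then have "AE x in lebesgue. x \<in> U \<longrightarrow> x \<notin> N" by eventually_elim simp
      then have "AE x in lebesgue_on U. x \<notin> N" using U(1) by (simp add: AE_restrict_space_iff)
      then show "AE x in lebesgue_on U. (\<lambda>k. (norm (moll (h k) F x - F x))\<^sup>2) \<longlonglongrightarrow> 0"
      proof eventually_elim
        case (elim x)
        have "(\<lambda>k. moll (h k) F x) \<longlonglongrightarrow> F x" by (rule moll_tendsto[OF F(1,2) F(3)[OF elim] hlim])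
        then have "(\<lambda>k. (norm (moll (h k) F x - F x))\<^sup>2) \<longlonglongrightarrow> (norm (F x - F x))\<^sup>2" by (intro tendsto_intros)
        then show ?case by simp
      qed
      show "AE x in lebesgue_on U. norm ((norm (moll (h k) F x - F x))\<^sup>2) \<le> (B + B)\<^sup>2" for k
      proof (rule AE_I2)
        fix x
        have "norm (moll (h k) F x - F x) \<le> B + B"
          using norm_triangle_ineq4[of "moll (h k) F x" "F x"] moll_norm_le[OF F(1,2), of "h k" x] F(2)[of x] by linarith
        then have "(norm (moll (h k) F x - F x))\<^sup>2 \<le> (B + B)\<^sup>2" by (rule power_mono) simp
        then show "norm ((norm (moll (h k) F x - F x))\<^sup>2) \<le> (B + B)\<^sup>2" by simp
      qed
    qed (use mm in \<open>auto intro!: borel_measurable_power borel_measurable_norm borel_measurable_diff\<close>)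
    then have "(\<lambda>k. sqrt (\<integral>x. (norm (moll (h k) F x - F x))\<^sup>2 \<partial>lebesgue_on U)) \<longlonglongrightarrow> sqrt 0"
      by (intro tendsto_real_sqrt) simp
    then show ?thesis by (simp add: L2norm_def)
  qed
  note C1 = moll_C1[OF h0(1)]
  have "\<forall>\<^sub>F k in sequentially. L2norm U (\<lambda>x. moll (h k) w x - w x) < \<epsilon>"
    by (rule order_tendstoD(2)[OF conv[OF measurable_w W(2)] \<epsilon>])
       (use C1_grad_cont[OF C1] continuous_w[of UNIV] in \<open>auto simp: continuous_on_eq_continuous_at\<close>)
  moreover have "\<forall>\<^sub>F k in sequentially. L2norm U (\<lambda>x. moll (h k) g x - g x) < \<epsilon>"
    by (rule order_tendstoD(2)[OF conv[OF measurable_g norm_g_le cont_g] \<epsilon>])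
       (use C1 in \<open>auto simp: C1_grad_def\<close>)
  moreover have "\<forall>\<^sub>F k in sequentially. h k * M < e"
  proof -
    have "(\<lambda>k. h k * M) \<longlonglongrightarrow> 0 * M" by (intro tendsto_intros hlim)
    then show ?thesis using e(1) by (intro order_tendstoD(2)) auto
  qed
  ultimately have "\<forall>\<^sub>F k in sequentially. L2norm U (\<lambda>x. moll (h k) w x - w x) < \<epsilon> \<and>
      L2norm U (\<lambda>x. moll (h k) g x - g x) < \<epsilon> \<and> h k * M < e"
    by eventually_elim simp
  then obtain k where k: "L2norm U (\<lambda>x. moll (h k) w x - w x) < \<epsilon>" "L2norm U (\<lambda>x. moll (h k) g x - g x) < \<epsilon>" "h k * M < e"
    unfolding eventually_sequentially by blast
  have "testfun U (moll (h k) w)"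
  proof (rule testfunI[OF C1])
    let ?S = "{x + y | x y. x \<in> C \<and> y \<in> cball 0 e}"
    show "compact ?S" by (rule compact_sums[OF compact_C compact_cball])
    show "?S \<subseteq> U"
    proof
      fix z assume "z \<in> ?S"
      then obtain x y where "x \<in> C" "norm y \<le> e" "z = x + y" by auto
      then have "z \<in> cball x e" by (simp add: dist_norm)
      then show "z \<in> U" using e(2) \<open>x \<in> C\<close> by blast
    qed
    fix x assume x: "x \<notin> ?S"
    have "indicator unit_cube y *\<^sub>R w (x + h k *\<^sub>R y) = 0" for y
    proof (cases "y \<in> unit_cube")
      case True
      have "x + h k *\<^sub>R y \<notin> C"
      proof
        assume a: "x + h k *\<^sub>R y \<in> C"
        have "norm (- (h k *\<^sub>R y)) \<le> h k * M" using M[OF True] h0(2)[of k] by simp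
        then have "- (h k *\<^sub>R y) \<in> cball 0 e" using k(3) by simp
        moreover have "x = (x + h k *\<^sub>R y) + (- (h k *\<^sub>R y))" by simp
        ultimately show False using x a by blast
      qed
      then show ?thesis using w_C by simp
    qed simp
    then show "moll (h k) w x = 0" unfolding moll_def by (simp only: Bochner_Integration.integral_zero)
  qed
  moreover have "(\<chi> j. pd j (moll (h k) w) x) = moll (h k) g x" for x
    by (simp add: vec_eq_iff pd_C1_grad[OF C1])
  ultimately show ?thesis using k by (intro exI[of _ "moll (h k) w"]) simp
qed

end

section \<open>Geometry of the mesh and hat functions\<close>

locale mesh = bounded_open \<Omega> for \<Omega> :: "(real^'n) set" +
  fixes Th :: "(real^'n) set set"
  assumes mesh: "simplicial_mesh \<Omega> Th"
begin

abbreviation T :: "(real^'n) set" where "T \<equiv> (\<Union>K\<in>Th. convex hull K)"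

definition Nf :: "(real^'n) set" where "Nf = (\<Union>K\<in>Th. frontier (convex hull K))"

text \<open>The elementwise gradient of the hat function. At most one summand is nonzero since the
  interiors of the elements are disjoint, and on all faces the value is 0.\<close>

definition hatg :: "real^'n \<Rightarrow> real^'n \<Rightarrow> real^'n" where
  "hatg a x = (\<Sum>K\<in>star Th a. indicator (interior (convex hull K)) x *\<^sub>R bcg K a)"

lemma finite_Th: "finite Th" using mesh by (simp add: simplicial_mesh_def)

lemma conforming: "K \<in> Th \<Longrightarrow> L \<in> Th \<Longrightarrow> convex hull K \<inter> convex hull L = convex hull (K \<inter> L)"
  using mesh by (simp add: simplicial_mesh_def)

lemma T_closure: "T = closure \<Omega>" and Omega_interior: "\<Omega> = interior T"
  using mesh unfolding simplicial_mesh_def by blast+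

lemma full_simplex:
  assumes "K \<in> Th"
  shows "full_simplex K"
proof -
  have "card K = CARD('n) + 1" "\<not> affine_dependent K" using mesh assms unfolding simplicial_mesh_def by blast+
  then show ?thesis by unfold_locales simp_all
qed

lemma finite_vertices: "finite (vertices Th)"
  unfolding vertices_def by (rule finite_Union[OF finite_Th]) (rule full_simplex.finite_K[OF full_simplex])

lemma finite_star: "finite (star Th a)" using finite_Th by (simp add: star_def)

lemma closed_hull: "K \<in> Th \<Longrightarrow> closed (convex hull K)"
  by (rule compact_imp_closed[OF full_simplex.compact_hull[OF full_simplex]])

lemma closed_T: "closed T" unfolding T_closure by simp

lemma closed_Nf: "closed Nf" unfolding Nf_def using finite_Th by (intro closed_UN) auto

lemma negligible_Nf: "negligible Nf"
  unfolding Nf_def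
  by (rule negligible_Union) (use finite_Th in \<open>auto intro: negligible_convex_frontier convex_convex_hull\<close>)

lemma AE_Nf: "AE x in lebesgue_on X. x \<notin> Nf" if "X \<in> sets lebesgue"
proof -
  have "AE x in lebesgue. x \<notin> Nf" using negligible_Nf unfolding negligible_iff_null_sets by (rule AE_not_in)
  then have "AE x in lebesgue. x \<in> X \<longrightarrow> x \<notin> Nf" by eventually_elim simp
  then show ?thesis using that by (simp add: AE_restrict_space_iff)
qed

lemma Omega_subset_T: "\<Omega> \<subseteq> T" unfolding T_closure by (rule closure_subset)

lemma not_Nf_interior:
  assumes "K \<in> Th" "x \<in> convex hull K" "x \<notin> Nf"
  shows "x \<in> interior (convex hull K)"
proof -
  have "x \<notin> frontier (convex hull K)" using assms unfolding Nf_def by blast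
  then show ?thesis using assms closed_hull[OF assms(1)] by (simp add: frontier_def)
qed

lemma T_cases:
  assumes "x \<in> T" "x \<notin> Nf"
  obtains K where "K \<in> Th" "x \<in> interior (convex hull K)"
  using assms not_Nf_interior by blast

lemma interior_subset_Omega: "K \<in> Th \<Longrightarrow> interior (convex hull K) \<subseteq> \<Omega>"
  unfolding Omega_interior by (rule interior_mono) blast

text \<open>In the interior of \<open>K\<close> all barycentric coordinates are positive, whereas
  conformity places a point shared with \<open>L\<close> in the hull of the common vertices. So
  every vertex of \<open>K\<close> belongs to \<open>L\<close>, and the cardinalities agree.\<close>

lemma interior_not_Nf:
  assumes "K \<in> Th" "x \<in> interior (convex hull K)"
  shows "\<And>L. L \<in> Th \<Longrightarrow> x \<in> convex hull L \<Longrightarrow> L = K" and "x \<notin> Nf"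
proof -
  interpret K: full_simplex K by (rule full_simplex[OF assms(1)])
  show eq: "L = K" if L: "L \<in> Th" "x \<in> convex hull L" for L
  proof -
    interpret L: full_simplex L by (rule full_simplex[OF L(1)])
    have "x \<in> convex hull K" using assms(2) interior_subset by blast
    then have "x \<in> convex hull (K \<inter> L)" using conforming[OF assms(1) L(1)] L(2) by blast
    moreover have fin: "finite (K \<inter> L)" using K.finite_K by simp
    ultimately obtain u where u: "\<forall>v\<in>K \<inter> L. 0 \<le> u v" "sum u (K \<inter> L) = 1" "(\<Sum>v\<in>K \<inter> L. u v *\<^sub>R v) = x"
      unfolding convex_hull_finite[OF fin] by blast
    have "K \<subseteq> L"
    proof
      fix v assume v: "v \<in> K"
      show "v \<in> L"
      proof (rule ccontr)
        assume "v \<notin> L"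
        let ?u = "\<lambda>w. if w \<in> L then u w else 0"
        have "(\<Sum>w\<in>K. ?u w) = 1" using u(2) K.finite_K by (simp add: sum.inter_restrict)
        moreover have "(\<Sum>w\<in>K. ?u w *\<^sub>R w) = x"
        proof -
          have "(\<Sum>w\<in>K. ?u w *\<^sub>R w) = (\<Sum>w\<in>K. if w \<in> L then u w *\<^sub>R w else 0)" by (rule sum.cong) auto
          then show ?thesis using u(3) K.finite_K by (simp add: sum.inter_restrict)
        qed
        ultimately have "bc K v x = ?u v" using v by (rule K.bc_eqI)
        then have "bc K v x = 0" using \<open>v \<notin> L\<close> by simp
        then show False using assms(2) v unfolding K.interior_hull_bc by force
      qed
    qed
    then show "L = K" using K.card_K L.card_K L.finite_K card_subset_eq by metis
  qed
  show "x \<notin> Nf"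
  proof
    assume "x \<in> Nf"
    then obtain L where L: "L \<in> Th" "x \<in> frontier (convex hull L)" unfolding Nf_def by blast
    then have "x \<in> convex hull L" using closed_hull[OF L(1)] frontier_subset_closed by blast
    then have "L = K" using eq L(1) by blast
    then show False using L(2) assms(2) by (simp add: frontier_def)
  qed
qed

lemma interiors_disjoint:
  "K \<in> Th \<Longrightarrow> L \<in> Th \<Longrightarrow> K \<noteq> L \<Longrightarrow> interior (convex hull K) \<inter> interior (convex hull L) = {}"
  using interior_not_Nf(1)[of K] interior_subset by blast

text \<open>A shared point is a convex combination of the shared vertices, and barycentric
  coordinates are unique in either element. Hence hat functions are continuous and independent of
  the element chosen in their definition.\<close>

lemma bc_consistent:
  assumes "K \<in> Th" "L \<in> Th" "x \<in> convex hull K" "x \<in> convex hull L" "a \<in> K"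
  shows "bc K a x = (if a \<in> L then bc L a x else 0)"
proof -
  interpret K: full_simplex K by (rule full_simplex[OF assms(1)])
  interpret L: full_simplex L by (rule full_simplex[OF assms(2)])
  have fin: "finite (K \<inter> L)" using K.finite_K by simp
  have "x \<in> convex hull (K \<inter> L)" using conforming[OF assms(1,2)] assms(3,4) by blast
  then obtain u where u: "sum u (K \<inter> L) = 1" "(\<Sum>v\<in>K \<inter> L. u v *\<^sub>R v) = x"
    unfolding convex_hull_finite[OF fin] by blast
  have ext: "bc M a x = (if a \<in> M' then u a else 0)"
    if M: "full_simplex M" "M \<inter> M' = K \<inter> L" "a \<in> M" for M M'
  proof (rule full_simplex.bc_eqI[OF M(1) _ _ M(3)])
    note f = full_simplex.finite_K[OF M(1)]
    show "(\<Sum>w\<in>M. if w \<in> M' then u w else 0) = 1" using u(1) f M(2) by (simp add: sum.inter_restrict[symmetric])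
    have "(\<Sum>w\<in>M. (if w \<in> M' then u w else 0) *\<^sub>R w) = (\<Sum>w\<in>M. if w \<in> M' then u w *\<^sub>R w else 0)" by (rule sum.cong) auto
    then show "(\<Sum>w\<in>M. (if w \<in> M' then u w else 0) *\<^sub>R w) = x" using u(2) f M(2) by (simp add: sum.inter_restrict[symmetric])
  qed
  have "bc K a x = (if a \<in> L then u a else 0)" by (rule ext) (use assms K.full_simplex_axioms in auto)
  moreover have "a \<in> L \<Longrightarrow> bc L a x = (if a \<in> K then u a else 0)" by (rule ext) (use assms L.full_simplex_axioms in auto)
  ultimately show ?thesis using assms(5) by simp
qed

lemma bary_eq_bc:
  assumes "K \<in> Th" "x \<in> convex hull K" "a \<in> K"
  shows "bary K a x = bc K a x"
  unfolding bary_def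
proof (rule the_equality)
  interpret K: full_simplex K by (rule full_simplex[OF assms(1)])
  show "\<exists>c. (\<forall>v\<in>K. 0 \<le> c v) \<and> sum c K = 1 \<and> (\<Sum>v\<in>K. c v *\<^sub>R v) = x \<and> c a = bc K a x"
    using assms(2) unfolding K.hull_bc
    by (intro exI[of _ "\<lambda>v. bc K v x"] conjI) (simp_all only: K.bc_sum K.bc_rep mem_Collect_eq)
  show "t = bc K a x" if "\<exists>c. (\<forall>v\<in>K. 0 \<le> c v) \<and> sum c K = 1 \<and> (\<Sum>v\<in>K. c v *\<^sub>R v) = x \<and> c a = t" for t
  proof -
    from that obtain c where c: "sum c K = 1" "(\<Sum>v\<in>K. c v *\<^sub>R v) = x" "c a = t" by blast
    from K.bc_eqI[OF c(1,2) assms(3)] c(3) show ?thesis by simp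
  qed
qed

lemma hat_on:
  assumes K: "K \<in> Th" "x \<in> convex hull K"
  shows "hat Th a x = (if a \<in> K then bc K a x else 0)"
proof (cases "\<exists>L\<in>Th. a \<in> L \<and> x \<in> convex hull L")
  case True
  define L where "L = (SOME L. L \<in> Th \<and> a \<in> L \<and> x \<in> convex hull L)"
  have "\<exists>L. L \<in> Th \<and> a \<in> L \<and> x \<in> convex hull L" using True by blast
  then have L: "L \<in> Th \<and> a \<in> L \<and> x \<in> convex hull L" unfolding L_def by (rule someI_ex)
  have "hat Th a x = bary L a x" unfolding hat_def L_def using True by simp
  also have "\<dots> = bc L a x" using L bary_eq_bc by blast
  also have "\<dots> = (if a \<in> K then bc K a x else 0)" using bc_consistent[of L K x a] L K by simp
  finally show ?thesis .
next
  case False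
  then have "hat Th a x = 0" "a \<notin> K" using K by (auto simp: hat_def)
  then show ?thesis by simp
qed

lemma hat_outside: "x \<notin> T \<Longrightarrow> hat Th a x = 0"
  by (auto simp: hat_def)

lemma hat_bounds: "0 \<le> hat Th a x" "hat Th a x \<le> 1"
proof -
  have "0 \<le> hat Th a x \<and> hat Th a x \<le> 1"
  proof (cases "x \<in> T")
    case True
    then obtain K where K: "K \<in> Th" "x \<in> convex hull K" by blast
    interpret K: full_simplex K by (rule full_simplex[OF K(1)])
    have nn: "\<And>w. w \<in> K \<Longrightarrow> 0 \<le> bc K w x" using K(2) unfolding K.hull_bc by blast
    have "bc K a x \<le> 1" if "a \<in> K"
      using member_le_sum[OF that nn K.finite_K] K.bc_sum by force
    then show ?thesis unfolding hat_on[OF K] using nn by simp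
  next
    case False
    then show ?thesis by (simp add: hat_outside)
  qed
  then show "0 \<le> hat Th a x" "hat Th a x \<le> 1" by auto
qed

lemma hatg_on:
  assumes "K \<in> Th" "x \<in> interior (convex hull K)"
  shows "hatg a x = (if a \<in> K then bcg K a else 0)"
proof -
  have "hatg a x = (\<Sum>L\<in>star Th a. if L = K then bcg K a else 0)"
    unfolding hatg_def
  proof (rule sum.cong[OF refl])
    fix L assume "L \<in> star Th a"
    then have "L \<in> Th" by (simp add: star_def)
    then show "indicator (interior (convex hull L)) x *\<^sub>R bcg L a = (if L = K then bcg K a else 0)"
      using interiors_disjoint[OF assms(1)] assms(2) by (auto simp: indicator_def)
  qed
  also have "\<dots> = (if K \<in> star Th a then bcg K a else 0)" using finite_star by simp
  finally show ?thesis using assms(1) by (simp add: star_def)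
qed

lemma continuous_hat: "continuous_on T (hat Th a)"
proof (rule continuous_on_closed_Union[OF finite_Th closed_hull])
  fix K assume K: "K \<in> Th"
  interpret K: full_simplex K by (rule full_simplex[OF K])
  have "continuous_on (convex hull K) (\<lambda>x. if a \<in> K then bc K a x else 0)"
    by (cases "a \<in> K") (auto intro!: K.continuous_on_bc continuous_intros)
  then show "continuous_on (convex hull K) (hat Th a)"
    by (rule continuous_on_eq) (simp add: hat_on[OF K])
qed

lemma sum_hat:
  assumes K: "K \<in> Th" "x \<in> convex hull K"
  shows "(\<Sum>a\<in>K. hat Th a x) = 1"
proof -
  interpret K: full_simplex K by (rule full_simplex[OF K(1)])
  have "(\<Sum>a\<in>K. hat Th a x) = (\<Sum>a\<in>K. bc K a x)" by (rule sum.cong) (auto simp: hat_on[OF K])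
  then show ?thesis by (simp add: K.bc_sum)
qed

text \<open>Barycentric coordinates add up to 1 at every point, so their increments add up to
  0.\<close>

lemma sum_hatg:
  assumes K: "K \<in> Th" "x \<in> interior (convex hull K)"
  shows "(\<Sum>a\<in>K. hatg a x) = 0"
proof -
  interpret K: full_simplex K by (rule full_simplex[OF K(1)])
  have "(\<Sum>a\<in>K. hatg a x) = (\<Sum>a\<in>K. bcg K a)" by (rule sum.cong) (auto simp: hatg_on[OF K])
  also have "\<dots> = (\<Sum>a\<in>K. \<Sum>b\<in>Basis. (bc K a b - bc K a 0) *\<^sub>R b)" by (simp add: bcg_def)
  also have "\<dots> = (\<Sum>b\<in>Basis. (\<Sum>a\<in>K. (bc K a b - bc K a 0)) *\<^sub>R b)"
    by (subst sum.swap) (simp add: scaleR_sum_left)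
  also have "\<dots> = 0" by (simp add: sum_subtractf K.bc_sum)
  finally show ?thesis .
qed

lemma patch_subset: "patch Th a \<subseteq> \<Omega>"
  unfolding patch_def Omega_interior star_def by (rule interior_mono) blast

lemma open_patch: "open (patch Th a)" by (simp add: patch_def)

lemma interior_subset_patch: "K \<in> Th \<Longrightarrow> a \<in> K \<Longrightarrow> interior (convex hull K) \<subseteq> patch Th a"
  unfolding patch_def star_def by (rule interior_mono) blast

lemma patch_interior:
  assumes "K \<in> Th" "x \<in> interior (convex hull K)" "x \<in> patch Th a"
  shows "a \<in> K"
proof -
  have "x \<in> (\<Union>K\<in>star Th a. convex hull K)" using assms(3) interior_subset unfolding patch_def by blast
  then obtain L where "L \<in> Th" "a \<in> L" "x \<in> convex hull L" by (auto simp: star_def)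
  with interior_not_Nf(1)[OF assms(1,2)] show ?thesis by blast
qed

lemma bounded_open_patch: "bounded_open (patch Th a)"
  unfolding bounded_open_def using open_patch bounded_subset[OF bounded_U patch_subset] by simp

text \<open>If \<open>x\<close> were outside the domain, points \<open>y\<close> outside the mesh
  would accumulate at it. Shrinking towards the interior vertex \<open>a\<close> brings them into
  the mesh, and frequently into one and the same element \<open>L\<close>, which then has
  \<open>a\<close> as a vertex. Undoing the shrinking only rescales the coordinates at the other
  vertices of \<open>L\<close>, and the coordinate at \<open>a\<close> stays positive by continuity;
  so some such \<open>y\<close> would lie in \<open>L\<close>.\<close>

lemma hat_pos_Omega:
  assumes a: "a \<in> \<Omega>" and pos: "hat Th a x > 0"
  shows "x \<in> \<Omega>"
proof (rule ccontr)
  assume x: "x \<notin> \<Omega>"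
  have "x \<in> T" using pos hat_outside[of x a] by force
  then obtain K where K: "K \<in> Th" "x \<in> convex hull K" by blast
  have aK: "a \<in> K" "bc K a x > 0" using pos unfolding hat_on[OF K] by (auto split: if_splits)
  interpret K: full_simplex K by (rule full_simplex[OF K(1)])
  have fr: "\<exists>\<^sub>F y in nhds x. y \<notin> T"
  proof (rule ccontr)
    assume "\<not> (\<exists>\<^sub>F y in nhds x. y \<notin> T)"
    then have "\<forall>\<^sub>F y in nhds x. y \<in> T" by (simp add: frequently_def)
    then have "x \<in> interior T" unfolding eventually_nhds interior_def by blast
    then show False using x Omega_interior by simp
  qed
  obtain r where r: "r > 0" "ball a r \<subseteq> \<Omega>" using a open_U open_contains_ball by blast
  \<comment> \<open>Chosen so that shrinking the unit neighbourhood of \<open>x\<close> towards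
    \<open>a\<close> lands in the ball of radius \<open>r\<close>; the summand 1 accounts for the
    size of that neighbourhood.\<close>
  define \<epsilon> where "\<epsilon> = min (1/2) (r / (norm (x - a) + 1) / 2)"
  have np: "norm (x - a) + 1 > 0" by (simp add: add_nonneg_pos)
  have \<epsilon>: "0 < \<epsilon>" "\<epsilon> < 1" using r np by (auto simp: \<epsilon>_def)
  have \<epsilon>r: "\<epsilon> * (norm (x - a) + 1) < r"
  proof -
    have "\<epsilon> * (norm (x - a) + 1) \<le> (r / (norm (x - a) + 1) / 2) * (norm (x - a) + 1)"
      using np by (intro mult_right_mono) (auto simp: \<epsilon>_def)
    also have "\<dots> = r / 2"
    proof -
      have "r / d / 2 * d = r / 2" if "d > 0" for d :: real using that by simp
      from this[OF np] show ?thesis .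
    qed
    finally show ?thesis using r by simp
  qed
  have near: "\<forall>\<^sub>F y in nhds x. a + \<epsilon> *\<^sub>R (y - a) \<in> T"
    unfolding eventually_nhds_metric
  proof (intro exI[of _ 1] conjI allI impI)
    fix y assume y: "dist y x < 1"
    have "norm (y - a) \<le> norm (y - x) + norm (x - a)" using norm_triangle_ineq[of "y - x" "x - a"] by simp
    then have "norm (y - a) \<le> norm (x - a) + 1" using y by (simp add: dist_norm)
    then have "\<epsilon> * norm (y - a) \<le> \<epsilon> * (norm (x - a) + 1)" using \<epsilon> by (intro mult_left_mono) auto
    with \<epsilon>r have "\<epsilon> * norm (y - a) < r" by (rule order_le_less_trans[rotated])
    then have "a + \<epsilon> *\<^sub>R (y - a) \<in> ball a r" using \<epsilon> by (simp add: dist_norm)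
    then show "a + \<epsilon> *\<^sub>R (y - a) \<in> T" using r(2) Omega_subset_T by blast
  qed simp
  have "\<exists>\<^sub>F y in nhds x. \<exists>L\<in>Th. y \<notin> T \<and> a + \<epsilon> *\<^sub>R (y - a) \<in> convex hull L"
    by (rule frequently_rev_mp[OF fr]) (use near in \<open>rule eventually_mono, blast\<close>)
  \<comment> \<open>Pigeonhole over the finitely many elements.\<close>
  then have "\<exists>L\<in>Th. \<exists>\<^sub>F y in nhds x. y \<notin> T \<and> a + \<epsilon> *\<^sub>R (y - a) \<in> convex hull L"
    by (rule frequently_bex_finite[OF finite_Th])
  then obtain L where L: "L \<in> Th" and frL: "\<exists>\<^sub>F y in nhds x. y \<notin> T \<and> a + \<epsilon> *\<^sub>R (y - a) \<in> convex hull L" by blast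
  interpret L: full_simplex L by (rule full_simplex[OF L])
  define x' where "x' = a + \<epsilon> *\<^sub>R (x - a)"
  have x'L: "x' \<in> convex hull L"
  proof (rule ccontr)
    assume "x' \<notin> convex hull L"
    moreover have "((\<lambda>y. a + \<epsilon> *\<^sub>R (y - a)) \<longlongrightarrow> x') (nhds x)"
      unfolding x'_def by (intro tendsto_intros filterlim_ident)
    ultimately have "\<forall>\<^sub>F y in nhds x. a + \<epsilon> *\<^sub>R (y - a) \<in> - (convex hull L)"
      using closed_hull[OF L] by (intro topological_tendstoD) (auto simp: open_Compl)
    with frL have "\<exists>\<^sub>F y in nhds x. False" by (rule frequently_eventually_frequently[THEN frequently_elim1]) auto
    then show False by simp
  qed
  have x'K: "x' \<in> convex hull K"
  proof -
    have "x' = (1 - \<epsilon>) *\<^sub>R a + \<epsilon> *\<^sub>R x" by (simp add: x'_def algebra_simps)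
    also have "\<dots> \<in> convex hull K" using K(2) aK(1) \<epsilon> by (intro convexD) (auto intro: hull_inc)
    finally show ?thesis .
  qed
  have bK: "bc K a x' = (1 - \<epsilon>) + \<epsilon> * bc K a x"
    unfolding x'_def using K.bc_affine[OF aK(1)] K.bc_vertex aK(1) by simp
  have "0 < \<epsilon> * bc K a x" using \<epsilon>(1) aK(2) by (rule mult_pos_pos)
  then have "bc K a x' > 0" unfolding bK using \<epsilon>(2) by linarith
  then have aL: "a \<in> L" and eq: "bc L a x' = bc K a x'"
    using bc_consistent[OF K(1) L x'K x'L aK(1)] by (auto split: if_splits)
  \<comment> \<open>Expanding from \<open>a\<close> by \<open>1 / \<epsilon>\<close> undoes the
    shrinking. For \<open>w\<close> different from \<open>a\<close> the first term vanishes, so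
    signs are kept.\<close>
  have up: "bc L w y = (1 - 1 / \<epsilon>) * bc L w a + (1 / \<epsilon>) * bc L w (a + \<epsilon> *\<^sub>R (y - a))" if "w \<in> L" for w y
  proof -
    have "y = a + (1 / \<epsilon>) *\<^sub>R ((a + \<epsilon> *\<^sub>R (y - a)) - a)" using \<epsilon> by simp
    then show ?thesis using L.bc_affine[OF that, of a "1 / \<epsilon>" "a + \<epsilon> *\<^sub>R (y - a)"] by simp
  qed
  have "bc L a x = (1 - 1 / \<epsilon>) + (1 / \<epsilon>) * bc L a x'"
    using up[OF aL, of x] L.bc_vertex[OF aL aL] unfolding x'_def by simp
  also have "\<dots> = bc K a x" unfolding eq bK using \<epsilon> by (simp add: field_simps)
  finally have La: "bc L a x > 0" using aK(2) by simp
  have "((\<lambda>y. bc L a y) \<longlongrightarrow> bc L a x) (nhds x)"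
  proof -
    have "isCont (bc L a) x"
      using L.continuous_on_bc[OF aL continuous_on_id, of UNIV] by (simp add: continuous_on_eq_continuous_at)
    then show ?thesis by (simp add: isCont_def tendsto_at_iff_tendsto_nhds)
  qed
  then have "\<forall>\<^sub>F y in nhds x. bc L a y > 0" using La by (rule order_tendstoD(1))
  with frL have "\<exists>\<^sub>F y in nhds x. (y \<notin> T \<and> a + \<epsilon> *\<^sub>R (y - a) \<in> convex hull L) \<and> bc L a y > 0"
    by (rule frequently_eventually_frequently)
  then obtain y where y: "y \<notin> T" "a + \<epsilon> *\<^sub>R (y - a) \<in> convex hull L" "bc L a y > 0"
    by (blast dest: frequently_ex)
  have "y \<in> convex hull L"
    unfolding L.hull_bc
  proof (intro CollectI ballI)
    fix w assume w: "w \<in> L"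
    show "0 \<le> bc L w y"
    proof (cases "w = a")
      case False
      have "bc L w y = (1 / \<epsilon>) * bc L w (a + \<epsilon> *\<^sub>R (y - a))" using up[OF w, of y] L.bc_vertex[OF w aL] False by simp
      moreover have "0 \<le> bc L w (a + \<epsilon> *\<^sub>R (y - a))" using y(2) w unfolding L.hull_bc by blast
      ultimately show ?thesis using \<epsilon> by simp
    qed (use y(3) in simp)
  qed
  then show False using y(1) L by blast
qed

end

section \<open>Products with hat functions\<close>

text \<open>Go from \<open>a\<close> to the last point lying in the same set \<open>S i\<close>;
  that set is not met again afterwards, so one index is removed and the induction continues. Along a
  segment through the mesh this chains elementwise Lipschitz bounds together.\<close>

lemma lipschitz_finite_closed_cover:
  fixes h :: "real \<Rightarrow> real"
  assumes "finite I" "\<And>i. i \<in> I \<Longrightarrow> closed (S i)" "{a..b} \<subseteq> (\<Union>i\<in>I. S i)" "a \<le> b"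
    and "\<And>i s t. i \<in> I \<Longrightarrow> s \<in> S i \<Longrightarrow> t \<in> S i \<Longrightarrow> s \<in> {a..b} \<Longrightarrow> t \<in> {a..b} \<Longrightarrow> \<bar>h s - h t\<bar> \<le> M * \<bar>s - t\<bar>"
  shows "\<bar>h a - h b\<bar> \<le> M * (b - a)"
  using assms
proof (induction "card I" arbitrary: I a)
  case 0
  then have "I = {}" by simp
  then show ?case using "0.prems"(3,4) by auto
next
  case (Suc n)
  have "a \<in> {a..b}" using Suc.prems(4) by simp
  then obtain i where i: "i \<in> I" "a \<in> S i" using Suc.prems(3) by blast
  have cS: "compact (S i \<inter> {a..b})" using Suc.prems(2)[OF i(1)] by (simp add: closed_Int_compact)
  have nS: "S i \<inter> {a..b} \<noteq> {}" using i(2) Suc.prems(4) by auto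
  from compact_attains_sup[OF cS nS] obtain m where m': "m \<in> S i \<inter> {a..b}" "\<forall>t\<in>S i \<inter> {a..b}. t \<le> m" ..
  then have m: "m \<in> S i \<inter> {a..b}" "\<And>t. t \<in> S i \<inter> {a..b} \<Longrightarrow> t \<le> m" by simp_all
  have am: "\<bar>h a - h m\<bar> \<le> M * (m - a)"
    using Suc.prems(5)[OF i(1) i(2), of m] m(1) Suc.prems(4) by auto
  show ?case
  proof (cases "m = b")
    case True
    then show ?thesis using am by simp
  next
    case False
    then have mb: "m < b" using m(1) by simp
    let ?J = "I - {i}"
    have "{m<..b} \<subseteq> (\<Union>j\<in>?J. S j)"
    proof
      fix t assume t: "t \<in> {m<..b}"
      then have "t \<in> {a..b}" using m(1) by auto
      then obtain j where "j \<in> I" "t \<in> S j" using Suc.prems(3) by blast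
      moreover have "t \<notin> S i" using m(2)[of t] t \<open>t \<in> {a..b}\<close> by auto
      ultimately show "t \<in> (\<Union>j\<in>?J. S j)" by blast
    qed
    moreover have "closed (\<Union>j\<in>?J. S j)" using Suc.prems(1,2) by (intro closed_UN) auto
    \<comment> \<open>The other sets are known to cover the points strictly after \<open>m\<close>;
      being closed, they also cover \<open>m\<close>.\<close>
    ultimately have "closure {m<..b} \<subseteq> (\<Union>j\<in>?J. S j)" by (rule closure_minimal)
    then have cov: "{m..b} \<subseteq> (\<Union>j\<in>?J. S j)" using mb by simp
    have "\<bar>h m - h b\<bar> \<le> M * (b - m)"
    proof (rule Suc.hyps(1)[OF _ _ _ cov])
      show "n = card ?J" using Suc.hyps(2) Suc.prems(1) i(1) by simp
      show "\<bar>h s - h t\<bar> \<le> M * \<bar>s - t\<bar>" if "j \<in> ?J" "s \<in> S j" "t \<in> S j" "s \<in> {m..b}" "t \<in> {m..b}" for j s t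
        using that m(1) by (intro Suc.prems(5)[of j]) auto
    qed (use Suc.prems(1,2) mb in auto)
    then show ?thesis using am by (simp add: right_diff_distrib)
  qed
qed

lemma (in full_simplex) bc_C1:
  assumes "w \<in> K"
  shows "C1_grad (bc K w) (\<lambda>x. bcg K w)"
proof -
  have "C1_grad (\<lambda>x. bc K w 0 + bcg K w \<bullet> x) (\<lambda>x. 0 + bcg K w)"
    by (rule C1_grad_add[OF C1_grad_const C1_grad_inner])
  moreover have "(\<lambda>x. bc K w 0 + bcg K w \<bullet> x) = bc K w"
    by (rule ext) (rule bc_grad[OF assms, symmetric])
  ultimately show ?thesis by simp
qed

lemma continuous_bounded_on_compact:
  fixes f :: "'a::topological_space \<Rightarrow> 'b::real_normed_vector"
  assumes "continuous_on UNIV f" "compact S"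
  obtains B where "B \<ge> 0" "\<And>x. x \<in> S \<Longrightarrow> norm (f x) \<le> B"
proof -
  have "compact (f ` S)" by (rule compact_continuous_image[OF continuous_on_subset[OF assms(1)] assms(2)]) simp
  then have "bounded (f ` S)" by (rule compact_imp_bounded)
  then obtain B where "B > 0" "\<forall>y\<in>f ` S. norm y \<le> B" unfolding bounded_pos by blast
  then show ?thesis using that[of B] by simp
qed

context mesh
begin

text \<open>Setting the product to 0 outside \<open>U\<close> creates no jump because it already
  vanishes on \<open>U\<close> outside the compact set \<open>C\<close>. \<open>F\<close> will be
  the identity for the weak gradient and \<open>trunc k\<close> for the approximation in
  \<open>H10\<close>.\<close>

lemma piecewise_hat:
  assumes \<phi>: "C1_grad \<phi> g\<phi>" and F: "\<And>t. (F has_real_derivative F' t) (at t)" "continuous_on UNIV F'"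
    and U: "open U" "U \<subseteq> T" and C: "compact C" "C \<subseteq> U"
    and zero: "\<And>x. x \<in> U \<Longrightarrow> x \<notin> C \<Longrightarrow> F (hat Th a x) * \<phi> x = 0"
  defines "w \<equiv> \<lambda>x. if x \<in> U then F (hat Th a x) * \<phi> x else 0"
    and "g \<equiv> \<lambda>x. if x \<in> U - Nf then (F' (hat Th a x) * \<phi> x) *\<^sub>R hatg a x + F (hat Th a x) *\<^sub>R g\<phi> x else 0"
  shows "\<exists>L. piecewise_C1 w g Nf C L"
proof -
  define b where "b = (\<lambda>K x. if a \<in> K then bc K a x else 0)"
  define bg where "bg = (\<lambda>K. if a \<in> K then bcg K a else 0)"
  define W where "W = (\<lambda>K x. F (b K x) * \<phi> x)"
  define G where "G = (\<lambda>K x. F (b K x) *\<^sub>R g\<phi> x + \<phi> x *\<^sub>R (F' (b K x) *\<^sub>R bg K))"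
  have bC1: "C1_grad (b K) (\<lambda>x. bg K)" if "K \<in> Th" for K
  proof (cases "a \<in> K")
    case True
    then have "b K = bc K a" "bg K = bcg K a" by (auto simp: b_def bg_def)
    then show ?thesis using full_simplex.bc_C1[OF full_simplex[OF that] True] by simp
  next
    case False
    then show ?thesis by (simp add: b_def bg_def C1_grad_const)
  qed
  have WC1: "C1_grad (W K) (G K)" if "K \<in> Th" for K
    unfolding W_def G_def by (rule C1_grad_mult[OF C1_grad_compose[OF bC1[OF that] F] \<phi>])
  have wW: "w x = W K x" if "x \<in> U" "K \<in> Th" "x \<in> convex hull K" for x K
    using that by (simp add: w_def W_def b_def hat_on)
  have gG: "g x = G K x" if "x \<in> U" "K \<in> Th" "x \<in> interior (convex hull K)" for x K
  proof -
    have "x \<in> convex hull K" using that(3) interior_subset by blast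
    then have "hat Th a x = b K x" using hat_on[OF that(2)] by (simp add: b_def)
    moreover have "hatg a x = bg K" using hatg_on[OF that(2,3)] by (simp add: bg_def)
    ultimately show ?thesis using that(1) interior_not_Nf(2)[OF that(2,3)] by (simp add: g_def G_def mult.commute add.commute)
  qed
  have cG: "continuous_on UNIV (G K)" "continuous_on UNIV (W K)" if "K \<in> Th" for K
    using WC1[OF that] C1_grad_cont[OF WC1[OF that]] by (auto simp: C1_grad_def)
  have "\<exists>B. \<forall>x\<in>convex hull K. norm (G K x) \<le> B \<and> norm (W K x) \<le> B" if K: "K \<in> Th" for K
  proof -
    note ch = full_simplex.compact_hull[OF full_simplex[OF K]]
    obtain B1 where B1: "B1 \<ge> 0" "\<And>x. x \<in> convex hull K \<Longrightarrow> norm (G K x) \<le> B1"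
      by (rule continuous_bounded_on_compact[OF cG(1)[OF K] ch]) (rule that)
    obtain B2 where B2: "B2 \<ge> 0" "\<And>x. x \<in> convex hull K \<Longrightarrow> norm (W K x) \<le> B2"
      by (rule continuous_bounded_on_compact[OF cG(2)[OF K] ch]) (rule that)
    show ?thesis
    proof (intro exI[of _ "B1 + B2"] ballI conjI)
      fix x assume "x \<in> convex hull K"
      then have "norm (G K x) \<le> B1" "norm (W K x) \<le> B2" using B1(2) B2(2) by simp_all
      then show "norm (G K x) \<le> B1 + B2" "norm (W K x) \<le> B1 + B2" using B1(1) B2(1) by linarith+
    qed
  qed
  then have "\<forall>K\<in>Th. \<exists>B. \<forall>x\<in>convex hull K. norm (G K x) \<le> B \<and> norm (W K x) \<le> B" by blast
  from bchoice[OF this] obtain B where B: "\<forall>K\<in>Th. \<forall>x\<in>convex hull K. norm (G K x) \<le> B K \<and> norm (W K x) \<le> B K" by (rule exE)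
  define L0 where "L0 = (\<Sum>K\<in>Th. \<bar>B K\<bar>)"
  have L00: "L0 \<ge> 0" unfolding L0_def by (intro sum_nonneg) simp
  have L0: "norm (G K x) \<le> L0" "norm (W K x) \<le> L0" if "K \<in> Th" "x \<in> convex hull K" for K x
  proof -
    have "\<bar>B K\<bar> \<le> L0" unfolding L0_def by (rule member_le_sum[OF that(1)]) (use finite_Th in auto)
    moreover have "norm (G K x) \<le> B K" "norm (W K x) \<le> B K" using B that by auto
    ultimately show "norm (G K x) \<le> L0" "norm (W K x) \<le> L0" by linarith+
  qed
  have wb: "\<bar>w x\<bar> \<le> L0" for x
  proof (cases "x \<in> U")
    case True
    then obtain K where K: "K \<in> Th" "x \<in> convex hull K" using U(2) by blast
    show ?thesis using L0(2)[OF K] unfolding wW[OF True K] by simp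
  qed (simp add: w_def L00)
  \<comment> \<open>Inside \<open>U\<close> the whole segment is covered by elements, so the
    elementwise bounds can be chained.\<close>
  have seg: "\<bar>w x - w y\<bar> \<le> L0 * norm (x - y)" if xy: "closed_segment x y \<subseteq> U" for x y
  proof -
    let ?p = "\<lambda>t. x + t *\<^sub>R (y - x)"
    have pU: "?p t \<in> U" if "t \<in> {0..1}" for t
    proof -
      have "?p t = (1 - t) *\<^sub>R x + t *\<^sub>R y" by (simp add: algebra_simps)
      then have "?p t \<in> closed_segment x y" unfolding closed_segment_def using that by auto
      then show ?thesis using xy by blast
    qed
    have "\<bar>w (?p 0) - w (?p 1)\<bar> \<le> (L0 * norm (y - x)) * (1 - 0)"
    proof (rule lipschitz_finite_closed_cover[where h = "\<lambda>t. w (?p t)" and S = "\<lambda>K. ?p -` (convex hull K)", OF finite_Th])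
      show "closed (?p -` (convex hull K))" if "K \<in> Th" for K
        by (rule closed_vimage[OF closed_hull[OF that]]) (intro continuous_intros)
      show "{0..1} \<subseteq> (\<Union>K\<in>Th. ?p -` (convex hull K))" using pU U(2) by blast
      fix K s t assume K: "K \<in> Th" and st: "s \<in> ?p -` (convex hull K)" "t \<in> ?p -` (convex hull K)" "s \<in> {0..1}" "t \<in> {0..1}"
      have "\<bar>W K (?p s) - W K (?p t)\<bar> \<le> L0 * norm (?p s - ?p t)"
        by (rule C1_lipschitz[OF WC1[OF K] L0(1)[OF K] convex_convex_hull]) (use st in auto)
      also have "?p s - ?p t = (s - t) *\<^sub>R (y - x)" by (simp add: algebra_simps)
      finally show "\<bar>w (?p s) - w (?p t)\<bar> \<le> L0 * norm (y - x) * \<bar>s - t\<bar>"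
        using wW[OF pU[OF st(3)] K] wW[OF pU[OF st(4)] K] st(1,2) by (simp add: mult_ac)
    qed simp
    then show ?thesis by (simp add: norm_minus_commute)
  qed
  obtain e where e: "e > 0" "(\<Union>x\<in>C. cball x e) \<subseteq> U"
    using compact_subset_open_imp_cball_epsilon_subset[OF C(1) U(1) C(2)] by blast
  have w0: "w x = 0" if "x \<notin> C" for x using zero that by (simp add: w_def)
  \<comment> \<open>Points at distance at most \<open>e\<close> are joined inside \<open>U\<close>
    unless both values are 0. For points farther apart the bound \<open>2 * L0\<close> on the
    difference is a slope of at most \<open>2 * L0 / e\<close>.\<close>
  define L where "L = L0 + 2 * L0 / e"
  have "2 * L0 / e \<ge> 0" using L00 e by simp
  have lip: "\<bar>w x - w y\<bar> \<le> L * norm (x - y)" for x y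
  proof (cases "norm (x - y) \<le> e")
    case True
    have "\<bar>w x - w y\<bar> \<le> L0 * norm (x - y)"
    proof (cases "x \<in> C \<or> y \<in> C")
      case True
      then obtain c where c: "c \<in> C" "c = x \<or> c = y" by blast
      then have "x \<in> cball c e" "y \<in> cball c e" using \<open>norm (x - y) \<le> e\<close> e(1) by (auto simp: dist_norm norm_minus_commute)
      then have "closed_segment x y \<subseteq> cball c e" by (simp add: closed_segment_subset)
      also have "\<dots> \<subseteq> U" using e(2) c(1) by blast
      finally show ?thesis by (rule seg)
    next
      case False
      then show ?thesis using w0 L00 by simp
    qed
    also have "\<dots> \<le> L * norm (x - y)" unfolding L_def using \<open>2 * L0 / e \<ge> 0\<close> by (intro mult_right_mono) auto
    finally show ?thesis .
  next
    case False
    have "\<bar>w x - w y\<bar> \<le> 2 * L0" using wb[of x] wb[of y] by linarith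
    also have "\<dots> = 2 * L0 / e * e" using e by simp
    also have "\<dots> \<le> 2 * L0 / e * norm (x - y)" using False \<open>2 * L0 / e \<ge> 0\<close> by (intro mult_left_mono) auto
    also have "\<dots> \<le> L * norm (x - y)" unfolding L_def using L00 by (intro mult_right_mono) auto
    finally show ?thesis .
  qed
  have dU: "(w has_derivative (\<lambda>h. g x \<bullet> h)) (at x)" "isCont g x" if x: "x \<in> U" "x \<notin> Nf" for x
  proof -
    obtain K where K: "K \<in> Th" "x \<in> interior (convex hull K)" using T_cases[of x] x U(2) by blast
    let ?O = "U \<inter> interior (convex hull K)"
    have O: "open ?O" "x \<in> ?O" using U(1) x K by auto
    have "(W K has_derivative (\<lambda>h. G K x \<bullet> h)) (at x)" using WC1[OF K(1)] by (simp add: C1_grad_def)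
    then have "(w has_derivative (\<lambda>h. G K x \<bullet> h)) (at x)"
    proof (rule has_derivative_transform_within_open[OF _ O])
      fix y assume "y \<in> ?O"
      then have "y \<in> U" "y \<in> convex hull K" using interior_subset by blast+
      then show "W K y = w y" using wW[of y K] K(1) by simp
    qed
    then show "(w has_derivative (\<lambda>h. g x \<bullet> h)) (at x)" using gG[OF x(1) K] by simp
    have "isCont (G K) x" using cG(1)[OF K(1)] by (simp add: continuous_on_eq_continuous_at)
    moreover have "\<forall>\<^sub>F y in nhds x. G K y = g y"
      unfolding eventually_nhds using O gG[OF _ K(1)] by (intro exI[of _ ?O]) auto
    ultimately show "isCont g x" using isCont_cong[of "G K" g x] by simp
  qed
  \<comment> \<open>Off \<open>C\<close> the function is locally 0, so uniqueness of the derivative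
    forces the explicit formula for \<open>g\<close> to vanish there too.\<close>
  have g0: "g x = 0" if x: "x \<notin> C" for x
  proof (cases "x \<in> U \<and> x \<notin> Nf")
    case True
    have op: "open (- C)" using C(1) by (simp add: compact_imp_closed open_Compl)
    have "((\<lambda>x. 0) has_derivative (\<lambda>h. 0)) (at x)" by simp
    then have "(w has_derivative (\<lambda>h. 0)) (at x)"
      by (rule has_derivative_transform_within_open[OF _ op]) (use x w0 in auto)
    from fun_cong[OF has_derivative_unique[OF this dU(1)], of "g x"] True show ?thesis by simp
  qed (auto simp: g_def)
  have dnU: "(w has_derivative (\<lambda>h. g x \<bullet> h)) (at x)" "isCont g x" if x: "x \<notin> C" for x
  proof -
    have op: "open (- C)" using C(1) by (simp add: compact_imp_closed open_Compl)
    have "((\<lambda>x. 0) has_derivative (\<lambda>h. 0)) (at x)" by simp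
    then have "(w has_derivative (\<lambda>h. 0)) (at x)"
      by (rule has_derivative_transform_within_open[OF _ op]) (use x w0 in auto)
    then show "(w has_derivative (\<lambda>h. g x \<bullet> h)) (at x)" by (simp add: g0[OF x])
    have "\<forall>\<^sub>F y in nhds x. (\<lambda>y. 0) y = g y"
      unfolding eventually_nhds using op x g0 by (intro exI[of _ "- C"]) auto
    from isCont_cong[OF this] show "isCont g x" by simp
  qed
  show ?thesis
  proof (intro exI[of _ L], unfold_locales)
    show "(w has_derivative (\<lambda>h. g x \<bullet> h)) (at x)" "isCont g x" if "x \<notin> Nf" for x
      using dU[OF _ that] dnU[of x] C(2) by (cases "x \<in> C"; blast)+
    show "g x = 0" if "x \<in> Nf" for x using that by (simp add: g_def)
  qed (use lip w0 C(1) closed_Nf negligible_Nf in auto)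
qed

lemma measurable_hat: "X \<subseteq> \<Omega> \<Longrightarrow> hat Th a \<in> borel_measurable (lebesgue_on X)"
proof -
  assume "X \<subseteq> \<Omega>"
  have "T \<in> sets lebesgue" using closed_T by simp
  from continuous_imp_measurable_on_sets_lebesgue[OF continuous_hat this]
  show ?thesis by (rule measurable_restrict_mono) (use \<open>X \<subseteq> \<Omega>\<close> Omega_subset_T in blast)
qed

lemma measurable_hatg: "hatg a \<in> borel_measurable borel"
proof -
  have "hatg a = (\<lambda>x. \<Sum>K\<in>star Th a. indicator (interior (convex hull K)) x *\<^sub>R bcg K a)"
    by (rule ext) (rule hatg_def)
  also have "\<dots> \<in> borel_measurable borel"
    by (intro borel_measurable_sum borel_measurable_scaleR borel_measurable_indicator borel_measurable_const) simp
  finally show ?thesis .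
qed

lemma hatg_bounded: obtains B where "B \<ge> 0" "\<And>x. norm (hatg a x) \<le> B"
proof
  show "norm (hatg a x) \<le> (\<Sum>K\<in>star Th a. norm (bcg K a))" for x
    unfolding hatg_def
  proof (rule order_trans[OF norm_sum sum_mono])
    show "norm (indicator (interior (convex hull K)) x *\<^sub>R bcg K a) \<le> norm (bcg K a)" for K
      by (simp add: indicator_def)
  qed
qed (intro sum_nonneg norm_ge_zero)

text \<open>The product with a test function is Lipschitz with compact support, so the integral of
  its gradient is 0. The product rule splits this into the weak formula.\<close>

lemma hat_weak_grad: "has_weak_grad_s (patch Th a) (hat Th a) (hatg a)"
proof -
  let ?P = "patch Th a"
  interpret P: bounded_open ?P by (rule bounded_open_patch)
  obtain B where B: "B \<ge> 0" "\<And>x. norm (hatg a x) \<le> B" by (rule hatg_bounded) (rule that)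
  have L: "L2 ?P (hat Th a)" "L2 ?P (hatg a)"
  proof -
    show "L2 ?P (hat Th a)"
      by (rule L2_bounded[OF measurable_hat[OF patch_subset] _ P.lmeasurable_U, where B = 1]) (simp add: hat_bounds)
    show "L2 ?P (hatg a)"
      by (rule L2_bounded[OF borel_lebesgue_on[OF measurable_hatg] _ P.lmeasurable_U, where B = B]) (simp add: B)
  qed
  show ?thesis
    unfolding has_weak_grad_s_def
  proof (intro conjI allI impI L)
    fix j \<phi> assume \<phi>: "testfun ?P \<phi>"
    let ?w = "\<lambda>x. if x \<in> ?P then hat Th a x * \<phi> x else 0"
    let ?g = "\<lambda>x. if x \<in> ?P - Nf then (1 * \<phi> x) *\<^sub>R hatg a x + hat Th a x *\<^sub>R (\<chi> j. pd j \<phi> x) else 0"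
    have "\<exists>L. piecewise_C1 ?w ?g Nf (closure {x. \<phi> x \<noteq> 0}) L"
    proof (rule piecewise_hat[OF testfun_C1_grad[OF \<phi>], where F = "\<lambda>t. t" and F' = "\<lambda>t. 1"])
      show "?P \<subseteq> T" using patch_subset Omega_subset_T by blast
      show "compact (closure {x. \<phi> x \<noteq> 0})" "closure {x. \<phi> x \<noteq> 0} \<subseteq> ?P" using \<phi> by (auto simp: testfun_def)
      show "hat Th a x * \<phi> x = 0" if "x \<notin> closure {x. \<phi> x \<noteq> 0}" for x
        using testfun_zero[OF \<phi> that] by simp
    qed (auto simp: open_patch)
    then obtain L where "piecewise_C1 ?w ?g Nf (closure {x. \<phi> x \<noteq> 0}) L" by blast
    then interpret pw: piecewise_C1 ?w ?g Nf "closure {x. \<phi> x \<noteq> 0}" L .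
    have i: "integrable (lebesgue_on ?P) (\<lambda>x. hatg a x $ j * \<phi> x)" "integrable (lebesgue_on ?P) (\<lambda>x. hat Th a x * pd j \<phi> x)"
      by (intro testfun_integrable[OF open_patch _ \<phi>] P.L2_integrable1 L2_nth L)+
    have mg: "(\<lambda>x. ?g x $ j) \<in> borel_measurable borel"
      by (rule measurable_compose[OF pw.measurable_g]) (intro borel_measurable_continuous_onI continuous_intros)
    have "0 = (\<integral>x. ?g x $ j \<partial>lborel)" by (rule pw.integral_g_zero[symmetric])
    also have "\<dots> = integral\<^sup>L (lebesgue_on ?P) (\<lambda>x. ?g x $ j)"
      by (rule integral_lebesgue_on_lborel[OF mg _ P.sets_U, symmetric]) simp
    also have "\<dots> = integral\<^sup>L (lebesgue_on ?P) (\<lambda>x. hatg a x $ j * \<phi> x + hat Th a x * pd j \<phi> x)"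
    proof (rule integral_cong_AE)
      have "AE x in lebesgue_on ?P. x \<in> ?P" by (rule AE_I2) simp
      with AE_Nf[OF P.sets_U] show "AE x in lebesgue_on ?P. ?g x $ j = hatg a x $ j * \<phi> x + hat Th a x * pd j \<phi> x"
        by eventually_elim simp
      show "(\<lambda>x. ?g x $ j) \<in> borel_measurable (lebesgue_on ?P)" by (rule borel_lebesgue_on[OF mg])
      show "(\<lambda>x. hatg a x $ j * \<phi> x + hat Th a x * pd j \<phi> x) \<in> borel_measurable (lebesgue_on ?P)"
        using i by (intro borel_measurable_add borel_measurable_integrable)
    qed
    also have "\<dots> = (\<integral>x. hatg a x $ j * \<phi> x \<partial>lebesgue_on ?P) + (\<integral>x. hat Th a x * pd j \<phi> x \<partial>lebesgue_on ?P)"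
      by (rule Bochner_Integration.integral_add[OF i])
    finally show "(\<integral>x. hat Th a x * pd j \<phi> x \<partial>lebesgue_on ?P) = - (\<integral>x. hatg a x $ j * \<phi> x \<partial>lebesgue_on ?P)" by simp
  qed
qed

end

text \<open>A hat function composed with the \<open>C\<^sup>1\<close> function \<open>trunc k\<close> has compact support in the open patch
  of an interior vertex, and \<open>trunc k\<close> tends to the identity.\<close>
definition trunc :: "nat \<Rightarrow> real \<Rightarrow> real" where
  "trunc k s = real (Suc k) / 2 * ((max 0 (s - 1 / real (Suc k)))\<^sup>2 - (max 0 (s - 2 / real (Suc k)))\<^sup>2)"

text \<open>The derivative of \<open>trunc k\<close>: continuous, rising linearly from 0 to 1
  between \<open>1 / (k + 1)\<close> and \<open>2 / (k + 1)\<close>.\<close>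

definition trunc' :: "nat \<Rightarrow> real \<Rightarrow> real" where
  "trunc' k s = real (Suc k) * (max 0 (s - 1 / real (Suc k)) - max 0 (s - 2 / real (Suc k)))"

lemma trunc_DERIV: "(trunc k has_real_derivative trunc' k s) (at s)"
proof -
  have d: "((\<lambda>s. (max 0 (s - c))\<^sup>2) has_real_derivative 2 * max 0 (s - c)) (at s)" for c
  proof -
    have "((\<lambda>s. s - c) has_real_derivative 1) (at s)" by (auto intro!: derivative_eq_intros)
    from DERIV_chain2[OF DERIV_max_square this] show ?thesis by simp
  qed
  have "(trunc k has_real_derivative real (Suc k) / 2 * (2 * max 0 (s - 1 / real (Suc k)) - 2 * max 0 (s - 2 / real (Suc k)))) (at s)"
    unfolding trunc_def by (rule DERIV_cmult[OF DERIV_diff[OF d d]])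
  then show ?thesis by (simp add: trunc'_def right_diff_distrib)
qed

lemma continuous_trunc': "continuous_on UNIV (trunc' k)"
  unfolding trunc'_def by (intro continuous_intros)

lemma trunc_zero: "s \<le> 1 / real (Suc k) \<Longrightarrow> trunc k s = 0" "s \<le> 1 / real (Suc k) \<Longrightarrow> trunc' k s = 0"
proof -
  assume s: "s \<le> 1 / real (Suc k)"
  have "1 / real (Suc k) \<le> 2 / real (Suc k)" by (simp add: divide_right_mono)
  then have "max 0 (s - 1 / real (Suc k)) = 0" "max 0 (s - 2 / real (Suc k)) = 0" using s by auto
  then show "trunc k s = 0" "trunc' k s = 0" by (simp_all add: trunc_def trunc'_def)
qed

lemma trunc_large:
  assumes "s \<ge> 2 / real (Suc k)"
  shows "trunc k s = s - 3 / 2 * (1 / real (Suc k))" "trunc' k s = 1"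
proof -
  define e where "e = 1 / real (Suc k)"
  have e: "e > 0" "real (Suc k) * e = 1" "2 / real (Suc k) = 2 * e" by (simp_all add: e_def)
  have m: "max 0 (s - e) = s - e" "max 0 (s - 2 * e) = s - 2 * e" using assms e by auto
  have "trunc k s = real (Suc k) / 2 * ((s - e)\<^sup>2 - (s - 2 * e)\<^sup>2)"
    unfolding trunc_def e(3) e_def[symmetric] m ..
  also have "\<dots> = (real (Suc k) * e) * (s - 3 / 2 * e)" by (simp add: power2_eq_square algebra_simps)
  finally show "trunc k s = s - 3 / 2 * (1 / real (Suc k))" unfolding e(2) e_def by simp
  have "trunc' k s = real (Suc k) * ((s - e) - (s - 2 * e))"
    unfolding trunc'_def e(3) e_def[symmetric] m ..
  then show "trunc' k s = 1" using e(2) by (simp add: right_diff_distrib)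
qed

lemma trunc'_bounds: "0 \<le> trunc' k s \<and> trunc' k s \<le> 1"
proof -
  define e where "e = 1 / real (Suc k)"
  have e: "e > 0" "real (Suc k) * e = 1" "2 / real (Suc k) = 2 * e" by (simp_all add: e_def)
  have t: "trunc' k s = real (Suc k) * (max 0 (s - e) - max 0 (s - 2 * e))" unfolding trunc'_def e(3) e_def[symmetric] ..
  have "0 \<le> max 0 (s - e) - max 0 (s - 2 * e)" "max 0 (s - e) - max 0 (s - 2 * e) \<le> e" using e(1) by (auto simp: max_def)
  then have "0 \<le> trunc' k s" "trunc' k s \<le> real (Suc k) * e" unfolding t by (auto intro: mult_left_mono)
  then show ?thesis using e(2) by simp
qed

lemma trunc_bounds:
  assumes "0 \<le> s" "s \<le> 1"
  shows "\<bar>trunc k s\<bar> \<le> 1"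
proof -
  have "\<bar>trunc k s - trunc k 0\<bar> \<le> 1 * \<bar>s - 0\<bar>"
  proof -
    have "norm (trunc k s - trunc k 0) \<le> 1 * norm (s - 0)"
      by (rule field_differentiable_bound[of UNIV "trunc k" "trunc' k"])
         (use trunc_DERIV trunc'_bounds in \<open>auto simp: has_field_derivative_at_within\<close>)
    then show ?thesis by simp
  qed
  moreover have "trunc k 0 = 0" by (rule trunc_zero) simp
  ultimately show ?thesis using assms by simp
qed

lemma trunc_tendsto:
  assumes "0 \<le> s"
  shows "(\<lambda>k. trunc k s) \<longlonglongrightarrow> s" and "s > 0 \<Longrightarrow> (\<lambda>k. trunc' k s) \<longlonglongrightarrow> 1"
proof -
  have lim: "(\<lambda>k. 1 / real (Suc k)) \<longlonglongrightarrow> 0" using LIMSEQ_inverse_real_of_nat by (simp add: inverse_eq_divide)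
  have ev: "\<forall>\<^sub>F k in sequentially. 2 / real (Suc k) \<le> s" if "s > 0"
  proof -
    have "(\<lambda>k. 2 * (1 / real (Suc k))) \<longlonglongrightarrow> 2 * 0" by (intro tendsto_intros lim)
    then have "\<forall>\<^sub>F k in sequentially. 2 * (1 / real (Suc k)) < s" using that by (intro order_tendstoD(2)) auto
    then show ?thesis by eventually_elim simp
  qed
  show "(\<lambda>k. trunc k s) \<longlonglongrightarrow> s"
  proof (cases "s = 0")
    case True
    have "trunc k s = 0" for k unfolding True by (rule trunc_zero) simp
    then show ?thesis using True by simp
  next
    case False
    then have "\<forall>\<^sub>F k in sequentially. s - 3 / 2 * (1 / real (Suc k)) = trunc k s"
      using ev assms by (auto elim!: eventually_mono simp: trunc_large(1))
    moreover have "(\<lambda>k. s - 3 / 2 * (1 / real (Suc k))) \<longlonglongrightarrow> s - 3 / 2 * 0" by (intro tendsto_intros lim)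
    ultimately show ?thesis using tendsto_cong[of "\<lambda>k. s - 3 / 2 * (1 / real (Suc k))" "\<lambda>k. trunc k s" sequentially s] by simp
  qed
  show "(\<lambda>k. trunc' k s) \<longlonglongrightarrow> 1" if "s > 0"
    by (rule tendsto_eventually) (use ev[OF that] in \<open>auto elim!: eventually_mono simp: trunc_large(2)\<close>)
qed

section \<open>Hat functions times affine fields as members of \<open>H10\<close>\<close>

context bounded_open
begin

lemma L2norm_dominated_convergence:
  fixes F :: "nat \<Rightarrow> real^'n \<Rightarrow> 'b::euclidean_space"
  assumes m: "\<And>k. F k \<in> borel_measurable (lebesgue_on U)" "F0 \<in> borel_measurable (lebesgue_on U)"
    and b: "\<And>k x. x \<in> U \<Longrightarrow> norm (F k x) \<le> B" "\<And>x. x \<in> U \<Longrightarrow> norm (F0 x) \<le> B"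
    and lim: "AE x in lebesgue_on U. (\<lambda>k. F k x) \<longlonglongrightarrow> F0 x"
  shows "(\<lambda>k. L2norm U (\<lambda>x. F k x - F0 x)) \<longlonglongrightarrow> 0"
proof -
  interpret fm: finite_measure "lebesgue_on U"
    using lmeasurable_U by (intro finite_measureI) (auto simp: emeasure_restrict_space fmeasurable_def less_top[symmetric])
  have "(\<lambda>k. \<integral>x. (norm (F k x - F0 x))\<^sup>2 \<partial>lebesgue_on U) \<longlonglongrightarrow> (\<integral>x. 0 \<partial>lebesgue_on U)"
  proof (rule integral_dominated_convergence[where w = "\<lambda>x. (B + B)\<^sup>2"])
    show "AE x in lebesgue_on U. (\<lambda>k. (norm (F k x - F0 x))\<^sup>2) \<longlonglongrightarrow> 0"
      using lim
    proof eventually_elim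
      case (elim x)
      then have "(\<lambda>k. (norm (F k x - F0 x))\<^sup>2) \<longlonglongrightarrow> (norm (F0 x - F0 x))\<^sup>2" by (intro tendsto_intros)
      then show ?case by simp
    qed
    show "AE x in lebesgue_on U. norm ((norm (F k x - F0 x))\<^sup>2) \<le> (B + B)\<^sup>2" for k
    proof (rule AE_I2)
      fix x assume "x \<in> space (lebesgue_on U)"
      then have x: "x \<in> U" by simp
      have "norm (F k x - F0 x) \<le> B + B"
        using norm_triangle_ineq4[of "F k x" "F0 x"] b(1)[OF x, of k] b(2)[OF x] by linarith
      then have "(norm (F k x - F0 x))\<^sup>2 \<le> (B + B)\<^sup>2" by (rule power_mono) simp
      then show "norm ((norm (F k x - F0 x))\<^sup>2) \<le> (B + B)\<^sup>2" by simp
    qed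
    show "(\<lambda>x. (norm (F k x - F0 x))\<^sup>2) \<in> borel_measurable (lebesgue_on U)" for k
      using m by measurable
  qed simp_all
  then have "(\<lambda>k. sqrt (\<integral>x. (norm (F k x - F0 x))\<^sup>2 \<partial>lebesgue_on U)) \<longlonglongrightarrow> sqrt 0"
    by (intro tendsto_real_sqrt) simp
  then show ?thesis by (simp add: L2norm_def)
qed

lemma L2norm_components:
  fixes f :: "real^'n \<Rightarrow> 'b::euclidean_space^'m"
  assumes "L2 U f"
  shows "(L2norm U f)\<^sup>2 = (\<Sum>i\<in>UNIV. (L2norm U (\<lambda>x. f x $ i))\<^sup>2)"
proof -
  have i: "L2 U (\<lambda>x. f x $ i)" for i by (rule L2_linear[OF bounded_linear_vec_nth assms])
  have "(L2norm U f)\<^sup>2 = (\<integral>x. (\<Sum>i\<in>UNIV. f x $ i \<bullet> f x $ i) \<partial>lebesgue_on U)"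
    unfolding L2norm_sq ip_def inner_vec_def ..
  also have "\<dots> = (\<Sum>i\<in>UNIV. \<integral>x. f x $ i \<bullet> f x $ i \<partial>lebesgue_on U)"
    by (rule Bochner_Integration.integral_sum) (rule L2_ip_integrable[OF i i])
  finally show ?thesis unfolding L2norm_sq ip_def .
qed

text \<open>Each component is approximated to within \<open>1 / (k + 1)\<close>, and the vector of
  approximants is the sequence demanded by \<open>H10\<close>. The weak gradient relation is
  inherited in the limit from \<open>testfun_ibp\<close>.\<close>

lemma H10_from_components:
  assumes v: "L2 U v" and G: "L2 U G"
    and approx: "\<And>i \<epsilon>. \<epsilon> > 0 \<Longrightarrow> \<exists>\<eta>. testfun U \<eta> \<and> L2norm U (\<lambda>x. \<eta> x - v x $ i) < \<epsilon> \<and>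
       L2norm U (\<lambda>x. (\<chi> j. pd j \<eta> x) - G x $ i) < \<epsilon>"
  shows "has_weak_grad U v G" "H10 U v"
proof -
  have "\<forall>k i. \<exists>\<eta>. testfun U \<eta> \<and> L2norm U (\<lambda>x. \<eta> x - v x $ i) < 1 / real (Suc k) \<and>
       L2norm U (\<lambda>x. (\<chi> j. pd j \<eta> x) - G x $ i) < 1 / real (Suc k)"
    by (intro allI approx) simp
  then obtain \<eta> where \<eta>: "\<forall>k i. testfun U (\<eta> k i) \<and> L2norm U (\<lambda>x. \<eta> k i x - v x $ i) < 1 / real (Suc k) \<and>
       L2norm U (\<lambda>x. (\<chi> j. pd j (\<eta> k i) x) - G x $ i) < 1 / real (Suc k)"
    unfolding choice_iff by (elim exE)
  have lim: "(\<lambda>k. 1 / real (Suc k)) \<longlonglongrightarrow> 0" using LIMSEQ_inverse_real_of_nat by (simp add: inverse_eq_divide)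
  have l1: "(\<lambda>k. L2norm U (\<lambda>x. \<eta> k i x - v x $ i)) \<longlonglongrightarrow> 0" for i
    by (rule Lim_null_comparison[OF always_eventually lim]) (use \<eta> in \<open>simp add: L2norm_nonneg less_imp_le\<close>)
  have l2: "(\<lambda>k. L2norm U (\<lambda>x. (\<chi> j. pd j (\<eta> k i) x) - G x $ i)) \<longlonglongrightarrow> 0" for i
    by (rule Lim_null_comparison[OF always_eventually lim]) (use \<eta> in \<open>simp add: L2norm_nonneg less_imp_le\<close>)
  define \<phi> where "\<phi> = (\<lambda>k x. \<chi> i. \<eta> k i x)"
  have t: "testfun U (\<eta> k i)" for k i using \<eta> by blast
  have vt: "vtest U (\<phi> k)" for k unfolding vtest_def \<phi>_def by (simp add: t)
  have jr: "jac (\<phi> k) x $ i = (\<chi> j. pd j (\<eta> k i) x)" for k x i by (simp add: jac_def \<phi>_def)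
  have comp: "(\<lambda>k. L2norm U (f k)) \<longlonglongrightarrow> 0"
    if "\<And>k. L2 U (f k)" "\<And>i. (\<lambda>k. L2norm U (\<lambda>x. f k x $ i)) \<longlonglongrightarrow> 0" for f :: "nat \<Rightarrow> real^'n \<Rightarrow> 'b::euclidean_space^'n"
  proof -
    have "(\<lambda>k. sqrt (\<Sum>i\<in>UNIV. (L2norm U (\<lambda>x. f k x $ i))\<^sup>2)) \<longlonglongrightarrow> sqrt (\<Sum>i\<in>(UNIV::'n set). 0\<^sup>2)"
      by (intro tendsto_real_sqrt tendsto_sum tendsto_power that(2))
    moreover have "sqrt (\<Sum>i\<in>UNIV. (L2norm U (\<lambda>x. f k x $ i))\<^sup>2) = L2norm U (f k)" for k
      unfolding L2norm_components[OF that(1), symmetric] by (simp add: L2norm_nonneg)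
    ultimately show ?thesis by simp
  qed
  have L\<phi>: "(\<lambda>k. L2norm U (\<lambda>x. \<phi> k x - v x)) \<longlonglongrightarrow> 0"
  proof (rule comp)
    show "L2 U (\<lambda>x. \<phi> k x - v x)" for k by (intro L2_diff L2_vtest[OF vt] v)
    show "(\<lambda>k. L2norm U (\<lambda>x. (\<phi> k x - v x) $ i)) \<longlonglongrightarrow> 0" for i using l1[of i] by (simp add: \<phi>_def)
  qed
  have LJ: "(\<lambda>k. L2norm U (\<lambda>x. jac (\<phi> k) x - G x)) \<longlonglongrightarrow> 0"
  proof (rule comp)
    show "L2 U (\<lambda>x. jac (\<phi> k) x - G x)" for k by (intro L2_diff L2_vtest[OF vt] G)
    show "(\<lambda>k. L2norm U (\<lambda>x. (jac (\<phi> k) x - G x) $ i)) \<longlonglongrightarrow> 0" for i using l2[of i] by (simp add: jr)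
  qed
  show wg: "has_weak_grad U v G"
    unfolding has_weak_grad_def
  proof (intro conjI allI impI v G)
    fix i j \<psi> assume \<psi>: "testfun U \<psi>"
    have Lv: "L2 U (\<lambda>x. v x $ i)" by (rule L2_nth[OF v])
    have LG: "L2 U (\<lambda>x. G x $ i $ j)" by (rule L2_nth2[OF G])
    have l3: "(\<lambda>k. L2norm U (\<lambda>x. pd j (\<eta> k i) x - G x $ i $ j)) \<longlonglongrightarrow> 0"
    proof (rule Lim_null_comparison[OF always_eventually l2[of i]], rule allI)
      fix k
      have "L2norm U (\<lambda>x. ((\<chi> j. pd j (\<eta> k i) x) - G x $ i) $ j) \<le> L2norm U (\<lambda>x. (\<chi> j. pd j (\<eta> k i) x) - G x $ i)"
      proof (rule L2norm_linear_contraction[OF bounded_linear_vec_nth])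
        show "norm (y $ j) \<le> norm y" for y :: "real^'n" using component_le_norm_cart by simp
        have "L2 U (\<lambda>x. (jac (\<phi> k) x - G x) $ i)" by (intro L2_nth L2_diff L2_vtest[OF vt] G)
        then show "L2 U (\<lambda>x. (\<chi> j. pd j (\<eta> k i) x) - G x $ i)" by (simp add: jr)
      qed
      then show "norm (L2norm U (\<lambda>x. pd j (\<eta> k i) x - G x $ i $ j)) \<le> L2norm U (\<lambda>x. (\<chi> j. pd j (\<eta> k i) x) - G x $ i)"
        by (simp add: L2norm_nonneg)
    qed
    have a1: "(\<lambda>k. ip U (pd j \<psi>) (\<eta> k i)) \<longlonglongrightarrow> ip U (pd j \<psi>) (\<lambda>x. v x $ i)"
      by (rule ip_tendsto[OF L2_testfun(2)[OF \<psi>] Lv L2_testfun(1)[OF t] l1])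
    have a2: "(\<lambda>k. ip U \<psi> (pd j (\<eta> k i))) \<longlonglongrightarrow> ip U \<psi> (\<lambda>x. G x $ i $ j)"
      by (rule ip_tendsto[OF L2_testfun(1)[OF \<psi>] LG L2_testfun(2)[OF t] l3])
    have eq: "ip U (pd j \<psi>) (\<eta> k i) = - ip U \<psi> (pd j (\<eta> k i))" for k
    proof -
      note mm = testfun_measurable[OF \<psi>] testfun_measurable[OF t[of k i]]
      have "ip U (pd j \<psi>) (\<eta> k i) = (\<integral>x. \<eta> k i x * pd j \<psi> x \<partial>lborel)"
        unfolding ip_def inner_real_def mult.commute[of "pd j \<psi> _"]
        by (rule integral_lebesgue_on_lborel[OF _ _ sets_U]) (use mm testfun_outside[OF \<psi>] in auto)
      also have "\<dots> = - (\<integral>x. (\<chi> j. pd j (\<eta> k i) x) $ j * \<psi> x \<partial>lborel)" by (rule testfun_ibp[OF testfun_C1_grad[OF t] \<psi>])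
      also have "(\<integral>x. (\<chi> j. pd j (\<eta> k i) x) $ j * \<psi> x \<partial>lborel) = ip U \<psi> (pd j (\<eta> k i))"
        unfolding ip_def inner_real_def mult.commute[of "\<psi> _"] vec_lambda_beta
        by (rule integral_lebesgue_on_lborel[OF _ _ sets_U, symmetric]) (use mm testfun_outside[OF \<psi>] in auto)
      finally show ?thesis .
    qed
    have "ip U (pd j \<psi>) (\<lambda>x. v x $ i) = - ip U \<psi> (\<lambda>x. G x $ i $ j)"
      using LIMSEQ_unique[OF a1] tendsto_minus[OF a2] by (simp add: eq)
    then show "(\<integral>x. v x $ i * pd j \<psi> x \<partial>lebesgue_on U) = - (\<integral>x. G x $ i $ j * \<psi> x \<partial>lebesgue_on U)"
      by (simp add: ip_def mult.commute)
  qed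
  show "H10 U v" unfolding H10_alt using wg vt L\<phi> LJ by blast
qed

end

context mesh
begin

text \<open>Two approximations, each costing half of \<open>\<epsilon>\<close>: truncating the hat
  function gives compact support in the domain, and mollifying the truncated product gives a test
  function.\<close>

lemma hat_C1_approx:
  assumes a: "a \<in> \<Omega>" and \<phi>: "C1_grad \<phi> g\<phi>" and \<epsilon>: "\<epsilon> > 0"
  shows "\<exists>\<eta>. testfun \<Omega> \<eta> \<and> L2norm \<Omega> (\<lambda>x. \<eta> x - hat Th a x * \<phi> x) < \<epsilon> \<and>
    L2norm \<Omega> (\<lambda>x. (\<chi> j. pd j \<eta> x) - (\<phi> x *\<^sub>R hatg a x + hat Th a x *\<^sub>R g\<phi> x)) < \<epsilon>"
proof -
  let ?G = "\<lambda>x. \<phi> x *\<^sub>R hatg a x + hat Th a x *\<^sub>R g\<phi> x"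
  define w where "w = (\<lambda>k x. if x \<in> \<Omega> then trunc k (hat Th a x) * \<phi> x else 0)"
  define g where "g = (\<lambda>k x. if x \<in> \<Omega> - Nf then (trunc' k (hat Th a x) * \<phi> x) *\<^sub>R hatg a x + trunc k (hat Th a x) *\<^sub>R g\<phi> x else 0)"
  \<comment> \<open>The points where the hat function is at least \<open>1 / (k + 1)\<close>,
    outside of which its truncation vanishes. This set is compact, and \<open>hat_pos_Omega\<close>
    puts it inside the domain.\<close>
  define C where "C = (\<lambda>k. \<Union>K\<in>star Th a. {x \<in> convex hull K. 1 / real (Suc k) \<le> bc K a x})"
  have C\<Omega>: "C k \<subseteq> \<Omega>" for k
  proof
    fix x assume "x \<in> C k"
    then obtain K where K: "K \<in> Th" "a \<in> K" "x \<in> convex hull K" "1 / real (Suc k) \<le> bc K a x"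
      unfolding C_def star_def by blast
    have "0 < 1 / real (Suc k)" by simp
    then have "0 < bc K a x" using K(4) by (rule order_less_le_trans)
    then have "hat Th a x > 0" using hat_on[OF K(1,3), of a] K(2) by simp
    then show "x \<in> \<Omega>" by (rule hat_pos_Omega[OF a])
  qed
  have cC: "compact (C k)" for k
    unfolding C_def
  proof (rule compact_UN[OF finite_star])
    fix K assume "K \<in> star Th a"
    then have K: "K \<in> Th" "a \<in> K" by (auto simp: star_def)
    interpret K: full_simplex K by (rule full_simplex[OF K(1)])
    have "closed {x. 1 / real (Suc k) \<le> bc K a x}"
      by (intro closed_Collect_le continuous_on_const K.continuous_on_bc[OF K(2)] continuous_on_id)
    then have "compact (convex hull K \<inter> {x. 1 / real (Suc k) \<le> bc K a x})" by (rule compact_Int_closed[OF K.compact_hull])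
    moreover have "convex hull K \<inter> {x. 1 / real (Suc k) \<le> bc K a x} = {x \<in> convex hull K. 1 / real (Suc k) \<le> bc K a x}" by blast
    ultimately show "compact {x \<in> convex hull K. 1 / real (Suc k) \<le> bc K a x}" by simp
  qed
  have pw: "\<exists>L. piecewise_C1 (w k) (g k) Nf (C k) L" for k
    unfolding w_def g_def
  proof (rule piecewise_hat[OF \<phi> trunc_DERIV continuous_trunc' open_U Omega_subset_T cC C\<Omega>])
    fix x assume x: "x \<in> \<Omega>" "x \<notin> C k"
    then obtain K where K: "K \<in> Th" "x \<in> convex hull K" using Omega_subset_T by blast
    have "hat Th a x \<le> 1 / real (Suc k)"
    proof (cases "a \<in> K")
      case True
      then have "\<not> 1 / real (Suc k) \<le> bc K a x" using x(2) K unfolding C_def star_def by blast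
      then show ?thesis using hat_on[OF K, of a] True by simp
    next
      case False
      then show ?thesis using hat_on[OF K, of a] by simp
    qed
    then show "trunc k (hat Th a x) * \<phi> x = 0" by (simp add: trunc_zero)
  qed
  have cl: "compact (closure \<Omega>)" using bounded_U by (simp add: compact_closure)
  have c\<phi>: "continuous_on UNIV \<phi>" "continuous_on UNIV g\<phi>" using \<phi> C1_grad_cont[OF \<phi>] by (auto simp: C1_grad_def)
  obtain B1 where B1: "B1 \<ge> 0" "\<And>x. x \<in> closure \<Omega> \<Longrightarrow> norm (\<phi> x) \<le> B1"
    by (rule continuous_bounded_on_compact[OF c\<phi>(1) cl]) (rule that)
  obtain B2 where B2: "B2 \<ge> 0" "\<And>x. x \<in> closure \<Omega> \<Longrightarrow> norm (g\<phi> x) \<le> B2"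
    by (rule continuous_bounded_on_compact[OF c\<phi>(2) cl]) (rule that)
  obtain H where H: "H \<ge> 0" "\<And>x. norm (hatg a x) \<le> H" by (rule hatg_bounded) (rule that)
  have b1: "\<bar>t * \<phi> x\<bar> \<le> B1" if "x \<in> \<Omega>" "\<bar>t\<bar> \<le> 1" for t x
  proof -
    have "\<bar>t\<bar> * \<bar>\<phi> x\<bar> \<le> 1 * B1" by (rule mult_mono) (use that B1 closure_subset[of \<Omega>] in auto)
    then show ?thesis by (simp add: abs_mult)
  qed
  have b2: "norm ((s * \<phi> x) *\<^sub>R hatg a x + t *\<^sub>R g\<phi> x) \<le> B1 * H + B2" if "x \<in> \<Omega>" "\<bar>t\<bar> \<le> 1" "\<bar>s\<bar> \<le> 1" for s t x
  proof (rule norm_triangle_le[OF add_mono])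
    have "\<bar>s * \<phi> x\<bar> * norm (hatg a x) \<le> B1 * H" using b1[OF that(1,3)] H B1(1) by (intro mult_mono) auto
    then show "norm ((s * \<phi> x) *\<^sub>R hatg a x) \<le> B1 * H" by simp
    have "\<bar>t\<bar> * norm (g\<phi> x) \<le> 1 * B2" by (rule mult_mono) (use that B2 closure_subset[of \<Omega>] in auto)
    then show "norm (t *\<^sub>R g\<phi> x) \<le> B2" by simp
  qed
  have mw: "w k \<in> borel_measurable (lebesgue_on \<Omega>)" "g k \<in> borel_measurable (lebesgue_on \<Omega>)" for k
  proof -
    obtain L where L: "piecewise_C1 (w k) (g k) Nf (C k) L" using pw by blast
    show "w k \<in> borel_measurable (lebesgue_on \<Omega>)" "g k \<in> borel_measurable (lebesgue_on \<Omega>)"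
      by (rule borel_lebesgue_on[OF piecewise_C1.measurable_w[OF L]], rule borel_lebesgue_on[OF piecewise_C1.measurable_g[OF L]])
  qed
  have mh: "hat Th a \<in> borel_measurable (lebesgue_on \<Omega>)" by (rule measurable_hat) simp
  have m\<phi>: "\<phi> \<in> borel_measurable (lebesgue_on \<Omega>)" "g\<phi> \<in> borel_measurable (lebesgue_on \<Omega>)"
    by (intro borel_lebesgue_on borel_measurable_continuous_onI c\<phi>)+
  have m0: "(\<lambda>x. hat Th a x * \<phi> x) \<in> borel_measurable (lebesgue_on \<Omega>)" "?G \<in> borel_measurable (lebesgue_on \<Omega>)"
    by (intro borel_measurable_times borel_measurable_add borel_measurable_scaleR mh m\<phi> borel_lebesgue_on[OF measurable_hatg])+
  have hb: "\<bar>hat Th a x\<bar> \<le> 1" "\<bar>trunc k (hat Th a x)\<bar> \<le> 1" "\<bar>trunc' k (hat Th a x)\<bar> \<le> 1" for k x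
    using hat_bounds[of a x] trunc_bounds[of "hat Th a x" k] trunc'_bounds[of k "hat Th a x"] by auto
  have lw: "(\<lambda>k. L2norm \<Omega> (\<lambda>x. w k x - hat Th a x * \<phi> x)) \<longlonglongrightarrow> 0"
  proof (rule L2norm_dominated_convergence[OF mw(1) m0(1), where B = B1])
    show "norm (w k x) \<le> B1" if "x \<in> \<Omega>" for k x using b1[OF that hb(2)] that by (simp add: w_def)
    show "norm (hat Th a x * \<phi> x) \<le> B1" if "x \<in> \<Omega>" for x using b1[OF that hb(1)] by simp
    show "AE x in lebesgue_on \<Omega>. (\<lambda>k. w k x) \<longlonglongrightarrow> hat Th a x * \<phi> x"
    proof (rule AE_I2)
      fix x assume "x \<in> space (lebesgue_on \<Omega>)"
      then show "(\<lambda>k. w k x) \<longlonglongrightarrow> hat Th a x * \<phi> x"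
        unfolding w_def by (auto intro!: tendsto_intros trunc_tendsto hat_bounds)
    qed
  qed
  have lg: "(\<lambda>k. L2norm \<Omega> (\<lambda>x. g k x - ?G x)) \<longlonglongrightarrow> 0"
  proof (rule L2norm_dominated_convergence[OF mw(2) m0(2), where B = "B1 * H + B2"])
    show "norm (g k x) \<le> B1 * H + B2" if "x \<in> \<Omega>" for k x
      using b2[OF that hb(2) hb(3)] B1(1) B2(1) H(1) by (simp add: g_def)
    show "norm (?G x) \<le> B1 * H + B2" if "x \<in> \<Omega>" for x using b2[OF that hb(1), of 1] by simp
    have "AE x in lebesgue_on \<Omega>. x \<in> \<Omega>" by (rule AE_I2) simp
    with AE_Nf[OF sets_U] show "AE x in lebesgue_on \<Omega>. (\<lambda>k. g k x) \<longlonglongrightarrow> ?G x"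
    proof eventually_elim
      case (elim x)
      then obtain K where K: "K \<in> Th" "x \<in> interior (convex hull K)" using T_cases[of x] Omega_subset_T by blast
      have xK: "x \<in> convex hull K" using K(2) interior_subset by blast
      have l1: "(\<lambda>k. trunc k (hat Th a x)) \<longlonglongrightarrow> hat Th a x" by (rule trunc_tendsto(1)[OF hat_bounds(1)])
      \<comment> \<open>\<open>trunc'\<close> tends to 1 only where the hat function is positive.
        Off the faces, wherever it is not positive, its gradient is 0.\<close>
      have l2: "(\<lambda>k. (trunc' k (hat Th a x) * \<phi> x) *\<^sub>R hatg a x) \<longlonglongrightarrow> \<phi> x *\<^sub>R hatg a x"
      proof (cases "a \<in> K")
        case True
        have "0 < bc K a x" using K(2) True unfolding full_simplex.interior_hull_bc[OF full_simplex[OF K(1)]] by blast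
        then have "hat Th a x > 0" using hat_on[OF K(1) xK, of a] True by simp
        from trunc_tendsto(2)[OF hat_bounds(1) this]
        have "(\<lambda>k. (trunc' k (hat Th a x) * \<phi> x) *\<^sub>R hatg a x) \<longlonglongrightarrow> (1 * \<phi> x) *\<^sub>R hatg a x" by (intro tendsto_intros)
        then show ?thesis by simp
      next
        case False
        then show ?thesis using hatg_on[OF K, of a] by simp
      qed
      have "(\<lambda>k. (trunc' k (hat Th a x) * \<phi> x) *\<^sub>R hatg a x + trunc k (hat Th a x) *\<^sub>R g\<phi> x) \<longlonglongrightarrow> ?G x"
        by (intro tendsto_add l2 tendsto_scaleR l1 tendsto_const)
      then show ?case using elim by (simp add: g_def)
    qed
  qed
  have "\<forall>\<^sub>F k in sequentially. L2norm \<Omega> (\<lambda>x. w k x - hat Th a x * \<phi> x) < \<epsilon> / 2"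
    by (rule order_tendstoD(2)[OF lw]) (use \<epsilon> in simp)
  moreover have "\<forall>\<^sub>F k in sequentially. L2norm \<Omega> (\<lambda>x. g k x - ?G x) < \<epsilon> / 2"
    by (rule order_tendstoD(2)[OF lg]) (use \<epsilon> in simp)
  ultimately have "\<forall>\<^sub>F k in sequentially. L2norm \<Omega> (\<lambda>x. w k x - hat Th a x * \<phi> x) < \<epsilon> / 2 \<and> L2norm \<Omega> (\<lambda>x. g k x - ?G x) < \<epsilon> / 2"
    by eventually_elim simp
  then obtain k where k: "L2norm \<Omega> (\<lambda>x. w k x - hat Th a x * \<phi> x) < \<epsilon> / 2" "L2norm \<Omega> (\<lambda>x. g k x - ?G x) < \<epsilon> / 2"
    unfolding eventually_sequentially by blast
  obtain L where "piecewise_C1 (w k) (g k) Nf (C k) L" using pw by blast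
  then interpret pw: piecewise_C1 "w k" "g k" Nf "C k" L .
  obtain \<eta> where \<eta>: "testfun \<Omega> \<eta>" "L2norm \<Omega> (\<lambda>x. \<eta> x - w k x) < \<epsilon> / 2" "L2norm \<Omega> (\<lambda>x. (\<chi> j. pd j \<eta> x) - g k x) < \<epsilon> / 2"
    using pw.approx_by_testfun[OF open_U bounded_U C\<Omega>, of "\<epsilon> / 2"] \<epsilon> by auto
  have tri: "L2norm \<Omega> (\<lambda>x. f x - h x) < \<epsilon>" if "L2norm \<Omega> (\<lambda>x. f x - f' x) < \<epsilon> / 2" "L2norm \<Omega> (\<lambda>x. f' x - h x) < \<epsilon> / 2"
    "L2 \<Omega> f" "L2 \<Omega> f'" "L2 \<Omega> h" for f f' h :: "real^'n \<Rightarrow> 'b::euclidean_space"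
    using L2norm_triangle[OF L2_diff[OF that(3,4)] L2_diff[OF that(4,5)]] that(1,2) by simp
  have L2w: "L2 \<Omega> (w k)" "L2 \<Omega> (\<lambda>x. hat Th a x * \<phi> x)"
    by (rule L2_bounded[OF mw(1) _ lmeasurable_U, where B = B1], rule AE_I2, use b1[OF _ hb(2)] in \<open>simp add: w_def\<close>)
       (rule L2_bounded[OF m0(1) _ lmeasurable_U, where B = B1], rule AE_I2, use b1[OF _ hb(1)] in simp)
  have L2g: "L2 \<Omega> (g k)" "L2 \<Omega> ?G"
  proof -
    show "L2 \<Omega> (g k)"
      by (rule L2_bounded[OF mw(2) _ lmeasurable_U, where B = "B1 * H + B2"], rule AE_I2)
         (use b2[OF _ hb(2) hb(3)] B1(1) B2(1) H(1) in \<open>simp add: g_def\<close>)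
    show "L2 \<Omega> ?G"
      by (rule L2_bounded[OF m0(2) _ lmeasurable_U, where B = "B1 * H + B2"], rule AE_I2)
         (use b2[OF _ hb(1), of _ 1] in simp)
  qed
  have L\<eta>: "L2 \<Omega> \<eta>" "L2 \<Omega> (\<lambda>x. \<chi> j. pd j \<eta> x)"
  proof -
    show "L2 \<Omega> \<eta>" by (rule L2_testfun[OF \<eta>(1)])
    have "vtest \<Omega> (\<lambda>x. \<chi> i. \<eta> x)" using \<eta>(1) by (simp add: vtest_def)
    from L2_nth[OF L2_vtest(2)[OF this]] show "L2 \<Omega> (\<lambda>x. \<chi> j. pd j \<eta> x)" by (simp add: jac_def)
  qed
  show ?thesis
    using \<eta>(1) tri[OF \<eta>(2) k(1) L\<eta>(1) L2w] tri[OF \<eta>(3) k(2) L\<eta>(2) L2g] by blast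
qed

text \<open>With a skew \<open>A\<close> this is the test function that makes the patch data
  compatible with rigid motions; \<open>G\<close> comes from the product rule.\<close>

lemma hat_affine_H10:
  fixes A :: "real^'n^'n" and b :: "real^'n"
  assumes a: "a \<in> \<Omega>"
  defines "v \<equiv> \<lambda>x. hat Th a x *\<^sub>R (b + A *v x)"
    and "G \<equiv> \<lambda>x. \<chi> i j. (b + A *v x) $ i * hatg a x $ j + hat Th a x * A $ i $ j"
  shows "H10 \<Omega> v" "has_weak_grad \<Omega> v G"
proof -
  have C1: "C1_grad (\<lambda>x. (b + A *v x) $ i) (\<lambda>x. A $ i)" for i
  proof -
    have "C1_grad (\<lambda>x. b $ i + A $ i \<bullet> x) (\<lambda>x. 0 + A $ i)" by (rule C1_grad_add[OF C1_grad_const C1_grad_inner])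
    then show ?thesis by (simp add: matrix_vector_mult_def inner_vec_def)
  qed
  have cont: "continuous_on UNIV (\<lambda>x. b + A *v x)"
    by (intro continuous_intros linear_continuous_on matrix_vector_mul_bounded_linear)
  have cl: "compact (closure \<Omega>)" using bounded_U by (simp add: compact_closure)
  obtain B1 where B1: "B1 \<ge> 0" "\<And>x. x \<in> closure \<Omega> \<Longrightarrow> norm (b + A *v x) \<le> B1"
    by (rule continuous_bounded_on_compact[OF cont cl]) (rule that)
  obtain H where H: "H \<ge> 0" "\<And>x. norm (hatg a x) \<le> H" by (rule hatg_bounded) (rule that)
  have mz: "(\<lambda>x. b + A *v x) \<in> borel_measurable (lebesgue_on \<Omega>)"
    by (intro borel_lebesgue_on borel_measurable_continuous_onI cont)
  have mh: "hat Th a \<in> borel_measurable (lebesgue_on \<Omega>)" by (rule measurable_hat) simp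
  have bz: "norm (b + A *v x) \<le> B1" if "x \<in> \<Omega>" for x using B1(2) closure_subset that by blast
  have hb: "\<bar>hat Th a x\<bar> \<le> 1" for x using hat_bounds[of a x] by simp
  have Lz: "L2 \<Omega> (\<lambda>x. b + A *v x)"
    by (rule L2_bounded[OF mz _ lmeasurable_U, where B = B1], rule AE_I2) (simp add: bz)
  have Lv: "L2 \<Omega> v"
    unfolding v_def by (rule L2_mult_bounded[OF Lz mh, where B = 1]) (simp add: hb)
  have nth: "bounded_linear (\<lambda>y::real^'n. y $ j)" for j by (rule bounded_linear_vec_nth)
  have Lg: "L2 \<Omega> (hatg a)"
    by (rule L2_bounded[OF borel_lebesgue_on[OF measurable_hatg] _ lmeasurable_U, where B = H]) (simp add: H)
  have LGij: "L2 \<Omega> (\<lambda>x. G x $ i $ j)" for i j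
  proof -
    have "L2 \<Omega> (\<lambda>x. ((b + A *v x) $ i) *\<^sub>R (hatg a x $ j))"
    proof (rule L2_mult_bounded[OF L2_nth[OF Lg] L2_measurable[OF L2_nth[OF Lz]], where B = B1])
      show "AE x in lebesgue_on \<Omega>. \<bar>(b + A *v x) $ i\<bar> \<le> B1"
      proof (rule AE_I2)
        fix x assume "x \<in> space (lebesgue_on \<Omega>)"
        then show "\<bar>(b + A *v x) $ i\<bar> \<le> B1" using component_le_norm_cart[of "b + A *v x" i] bz[of x] by simp
      qed
    qed
    moreover have "L2 \<Omega> (\<lambda>x. hat Th a x *\<^sub>R (A $ i $ j))"
      by (rule L2_mult_bounded[OF L2_const mh, where B = 1]) (simp add: hb)
    ultimately have "L2 \<Omega> (\<lambda>x. ((b + A *v x) $ i) *\<^sub>R (hatg a x $ j) + hat Th a x *\<^sub>R (A $ i $ j))" by (rule L2_add)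
    then show ?thesis by (simp add: G_def)
  qed
  have LG: "L2 \<Omega> G"
  proof -
    \<comment> \<open>Expansion in matrix units, which reduces square integrability of
      \<open>G\<close> to that of its entries.\<close>
    have "G = (\<lambda>x. \<Sum>i\<in>UNIV. \<Sum>j\<in>UNIV. (G x $ i $ j) *\<^sub>R axis i (axis j 1))"
    proof
      fix x
      have "(\<Sum>i\<in>UNIV. \<Sum>j\<in>UNIV. (G x $ i $ j) *\<^sub>R axis i (axis j 1)) $ i' $ j' = G x $ i' $ j'" for i' j'
      proof -
        have inner: "(\<Sum>j\<in>UNIV. (G x $ i $ j) *\<^sub>R axis i (axis j 1)) $ i' $ j' = (if i = i' then G x $ i $ j' else 0)" for i
        proof (cases "i = i'")
          case True
          have "(\<Sum>j\<in>UNIV. G x $ i' $ j * (if j' = j then 1 else 0)) = (\<Sum>j\<in>UNIV. if j = j' then G x $ i' $ j' else 0)"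
            by (rule sum.cong) auto
          then show ?thesis using True by (simp add: axis_def)
        next
          case False
          then show ?thesis by (simp add: axis_def)
        qed
        have "(\<Sum>i\<in>UNIV. \<Sum>j\<in>UNIV. (G x $ i $ j) *\<^sub>R axis i (axis j 1)) $ i' $ j'
            = (\<Sum>i\<in>UNIV. (\<Sum>j\<in>UNIV. (G x $ i $ j) *\<^sub>R axis i (axis j 1)) $ i' $ j')"
          by (simp only: sum_component)
        also have "\<dots> = (\<Sum>i\<in>UNIV. if i = i' then G x $ i $ j' else 0)" by (rule sum.cong[OF refl inner])
        finally show ?thesis by simp
      qed
      then show "G x = (\<Sum>i\<in>UNIV. \<Sum>j\<in>UNIV. (G x $ i $ j) *\<^sub>R axis i (axis j 1))" by (simp add: vec_eq_iff)
    qed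
    moreover have "L2 \<Omega> (\<lambda>x. \<Sum>i\<in>UNIV. \<Sum>j\<in>UNIV. (G x $ i $ j) *\<^sub>R (axis i (axis j 1) :: real^'n^'n))"
    proof (intro L2_sum finite)
      fix i j
      have "bounded_linear (\<lambda>t. t *\<^sub>R (axis i (axis j 1) :: real^'n^'n))" by (rule bounded_linear_scaleR_left)
      from L2_linear[OF this LGij] show "L2 \<Omega> (\<lambda>x. (G x $ i $ j) *\<^sub>R (axis i (axis j 1) :: real^'n^'n))" .
    qed
    ultimately show ?thesis by simp
  qed
  have ap: "\<exists>\<eta>. testfun \<Omega> \<eta> \<and> L2norm \<Omega> (\<lambda>x. \<eta> x - v x $ i) < \<epsilon> \<and> L2norm \<Omega> (\<lambda>x. (\<chi> j. pd j \<eta> x) - G x $ i) < \<epsilon>"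
    if "\<epsilon> > 0" for i \<epsilon>
  proof -
    have e1: "v x $ i = hat Th a x * (b + A *v x) $ i" for x by (simp add: v_def)
    have e2: "G x $ i = (b + A *v x) $ i *\<^sub>R hatg a x + hat Th a x *\<^sub>R A $ i" for x by (simp add: G_def vec_eq_iff)
    show ?thesis unfolding e1 e2 by (rule hat_C1_approx[OF a C1 that])
  qed
  show "has_weak_grad \<Omega> v G" by (rule H10_from_components(1)[OF Lv LG ap])
  show "H10 \<Omega> v" by (rule H10_from_components(2)[OF Lv LG ap])
qed

end

section \<open>Polynomials and rigid motions\<close>

lemma finite_multi_indices: "finite {\<alpha> :: 'n::finite \<Rightarrow> nat. sum \<alpha> UNIV \<le> p}"
proof (rule finite_subset)
  show "{\<alpha> :: 'n \<Rightarrow> nat. sum \<alpha> UNIV \<le> p} \<subseteq> PiE UNIV (\<lambda>_. {..p})"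
  proof
    fix \<alpha> :: "'n \<Rightarrow> nat" assume "\<alpha> \<in> {\<alpha>. sum \<alpha> UNIV \<le> p}"
    then have "\<alpha> i \<le> p" for i using member_le_sum[of i UNIV \<alpha>] by simp
    then show "\<alpha> \<in> PiE UNIV (\<lambda>_. {..p})" by (simp add: PiE_UNIV_domain)
  qed
  show "finite (PiE (UNIV :: 'n set) (\<lambda>_. {..p}))" by (rule finite_PiE) auto
qed

lemma poly_deg_monomial:
  fixes \<alpha> :: "'n::finite \<Rightarrow> nat"
  assumes "sum \<alpha> UNIV \<le> p"
  shows "poly_deg p (\<lambda>x. c * (\<Prod>i\<in>UNIV. (x $ i) ^ \<alpha> i))"
  unfolding poly_deg_def
proof (intro exI allI)
  fix x :: "real^'n"
  have "(\<Sum>\<beta>\<in>{\<alpha>. sum \<alpha> UNIV \<le> p}. (if \<beta> = \<alpha> then c else 0) * (\<Prod>i\<in>UNIV. (x $ i) ^ \<beta> i))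
     = (\<Sum>\<beta>\<in>{\<alpha>. sum \<alpha> UNIV \<le> p}. if \<beta> = \<alpha> then c * (\<Prod>i\<in>UNIV. (x $ i) ^ \<alpha> i) else 0)"
    by (rule sum.cong) auto
  then show "c * (\<Prod>i\<in>UNIV. (x $ i) ^ \<alpha> i) = (\<Sum>\<beta>\<in>{\<alpha>. sum \<alpha> UNIV \<le> p}. (if \<beta> = \<alpha> then c else 0) * (\<Prod>i\<in>UNIV. (x $ i) ^ \<beta> i))"
    using assms by (simp add: sum.delta[OF finite_multi_indices])
qed

lemma poly_deg_add:
  assumes "poly_deg p f" "poly_deg p g"
  shows "poly_deg p (\<lambda>x. f x + g x)"
proof -
  obtain c d where "\<forall>x. f x = (\<Sum>\<alpha>\<in>{\<alpha>. sum \<alpha> UNIV \<le> p}. c \<alpha> * (\<Prod>i\<in>UNIV. (x $ i) ^ (\<alpha> i)))"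
    "\<forall>x. g x = (\<Sum>\<alpha>\<in>{\<alpha>. sum \<alpha> UNIV \<le> p}. d \<alpha> * (\<Prod>i\<in>UNIV. (x $ i) ^ (\<alpha> i)))"
    using assms unfolding poly_deg_def by blast
  then show ?thesis unfolding poly_deg_def
    by (intro exI[of _ "\<lambda>\<alpha>. c \<alpha> + d \<alpha>"]) (simp add: distrib_right sum.distrib)
qed

lemma poly_deg_const: "poly_deg p (\<lambda>x. c)"
  using poly_deg_monomial[of "\<lambda>_. 0" p c] by simp

lemma poly_deg_sum: "finite I \<Longrightarrow> (\<And>i. i \<in> I \<Longrightarrow> poly_deg p (f i)) \<Longrightarrow> poly_deg p (\<lambda>x. \<Sum>i\<in>I. f i x)"
  by (induction I rule: finite_induct) (auto intro: poly_deg_const poly_deg_add)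

lemma poly_deg_mult:
  assumes "poly_deg p f" "poly_deg q g" "p + q \<le> r"
  shows "poly_deg r (\<lambda>x. f x * g x)"
proof -
  obtain c d where f: "\<And>x. f x = (\<Sum>\<alpha>\<in>{\<alpha>. sum \<alpha> UNIV \<le> p}. c \<alpha> * (\<Prod>i\<in>UNIV. (x $ i) ^ (\<alpha> i)))"
    and g: "\<And>x. g x = (\<Sum>\<alpha>\<in>{\<alpha>. sum \<alpha> UNIV \<le> q}. d \<alpha> * (\<Prod>i\<in>UNIV. (x $ i) ^ (\<alpha> i)))"
    using assms(1,2) unfolding poly_deg_def by blast
  have "poly_deg r (\<lambda>x. \<Sum>\<alpha>\<in>{\<alpha>. sum \<alpha> UNIV \<le> p}. \<Sum>\<beta>\<in>{\<alpha>. sum \<alpha> UNIV \<le> q}. (c \<alpha> * d \<beta>) * (\<Prod>i\<in>UNIV. (x $ i) ^ (\<alpha> i + \<beta> i)))"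
  proof (intro poly_deg_sum finite_multi_indices poly_deg_monomial)
    fix \<alpha> \<beta> :: "'a \<Rightarrow> nat" assume "\<alpha> \<in> {\<alpha>. sum \<alpha> UNIV \<le> p}" "\<beta> \<in> {\<alpha>. sum \<alpha> UNIV \<le> q}"
    then show "(\<Sum>i\<in>UNIV. \<alpha> i + \<beta> i) \<le> r" using assms(3) by (simp add: sum.distrib)
  qed
  then show ?thesis unfolding f g by (simp add: sum_product power_add prod.distrib mult_ac)
qed

lemma poly_deg_nth: "poly_deg 1 (\<lambda>x. x $ i)"
proof -
  have "(\<Prod>j\<in>UNIV. (x $ j) ^ (if j = i then 1 else 0)) = x $ i" for x :: "real^'a"
    using prod.remove[of UNIV i "\<lambda>j. (x $ j) ^ (if j = i then 1 else 0)"] by simp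
  then show ?thesis using poly_deg_monomial[of "\<lambda>j. if j = i then 1 else 0" 1 1] by simp
qed

lemma poly_deg_affine: "poly_deg 1 (\<lambda>x. c + g \<bullet> (x :: real^'n))"
proof -
  have "poly_deg 1 (\<lambda>x. c + (\<Sum>i\<in>UNIV. g $ i * (x :: real^'n) $ i))"
    by (intro poly_deg_add poly_deg_const poly_deg_sum finite poly_deg_mult[OF poly_deg_const[of 0] poly_deg_nth]) simp
  then show ?thesis by (simp add: inner_vec_def)
qed

lemma rigid_motion_poly:
  assumes "z \<in> rigid_motions"
  shows "poly_deg 1 (\<lambda>x. z x $ i)"
proof -
  obtain A b where "z = (\<lambda>x. b + A *v x)" using assms unfolding rigid_motions_def by blast
  then have "(\<lambda>x. z x $ i) = (\<lambda>x. b $ i + A $ i \<bullet> x)" by (simp add: matrix_vector_mult_def inner_vec_def)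
  then show ?thesis using poly_deg_affine[of "b $ i" "A $ i"] by simp
qed

lemma polyfun_vecI:
  fixes P :: "real^'n \<Rightarrow> real^'m"
  assumes "\<And>i. poly_deg p (\<lambda>x. P x $ i)"
  shows "polyfun p P"
  unfolding polyfun_def
proof
  fix b :: "real^'m" assume "b \<in> Basis"
  then obtain i where "b = axis i 1" by (auto simp: Basis_vec_def)
  then show "poly_deg p (\<lambda>x. P x \<bullet> b)" using assms[of i] by (simp add: inner_axis)
qed

lemma polyfun_const: "polyfun p (\<lambda>x. c)"
  unfolding polyfun_def by (simp add: poly_deg_const)

text \<open>Gram--Schmidt for a semi-inner product. The second conjunct stands for membership of \<open>m\<close> in the
  span of \<open>Z\<close> and carries the induction.\<close>
lemma L2_projection:
  fixes M :: "(real^'n \<Rightarrow> real^'n) set"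
  assumes "finite Z" "Z \<subseteq> M" and L: "\<And>m. m \<in> M \<Longrightarrow> L2 X m"
    and M: "(\<lambda>x. 0) \<in> M" "\<And>m m' c. m \<in> M \<Longrightarrow> m' \<in> M \<Longrightarrow> (\<lambda>x. m x + c *\<^sub>R m' x) \<in> M"
    and v: "L2 X v"
  shows "\<exists>m\<in>M. (\<forall>z\<in>Z. ip X (\<lambda>x. v x - m x) z = 0)
    \<and> (\<forall>r. L2 X r \<longrightarrow> (\<forall>z\<in>Z. ip X r z = 0) \<longrightarrow> ip X r m = 0)"
  using assms(1,2) v
proof (induction Z arbitrary: v rule: finite_induct)
  case empty
  have "ip X r (\<lambda>x. 0) = 0" for r :: "real^'n \<Rightarrow> real^'n" by (simp add: ip_def)
  then show ?case using M(1) by blast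
next
  case (insert z Z)
  have zM: "z \<in> M" and ZM: "Z \<subseteq> M" using insert.prems by auto
  have LZ: "L2 X y" if "y \<in> Z" for y using that ZM L by blast
  obtain m where m: "m \<in> M" "\<And>y. y \<in> Z \<Longrightarrow> ip X (\<lambda>x. v x - m x) y = 0"
      "\<And>r. L2 X r \<Longrightarrow> (\<And>y. y \<in> Z \<Longrightarrow> ip X r y = 0) \<Longrightarrow> ip X r m = 0"
    using insert.IH[OF ZM insert.prems(2)] by blast
  obtain n where n: "n \<in> M" "\<And>y. y \<in> Z \<Longrightarrow> ip X (\<lambda>x. z x - n x) y = 0"
      "\<And>r. L2 X r \<Longrightarrow> (\<And>y. y \<in> Z \<Longrightarrow> ip X r y = 0) \<Longrightarrow> ip X r n = 0"
    using insert.IH[OF ZM L[OF zM]] by blast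
  define v' where "v' = (\<lambda>x. v x - m x)"
  define z' where "z' = (\<lambda>x. z x - n x)"
  have Lv: "L2 X v'" unfolding v'_def by (intro L2_diff insert.prems(2) L m)
  have Lz: "L2 X z'" unfolding z'_def by (intro L2_diff L zM n)
  \<comment> \<open>The family may be linearly dependent: if \<open>z'\<close> has norm 0, division
    by zero makes \<open>t\<close> zero, and Cauchy--Schwarz gives the identity below.\<close>
  define t where "t = ip X v' z' / ip X z' z'"
  have vz: "ip X v' z' = t * ip X z' z'"
  proof (cases "ip X z' z' = 0")
    case True
    then have "L2norm X z' = 0" using L2norm_sq[of X z'] by simp
    then show ?thesis using ip_cauchy[OF Lv Lz] True by simp
  next
    case False
    then show ?thesis by (simp add: t_def)
  qed
  have Ltz: "L2 X (\<lambda>x. t *\<^sub>R z' x)" by (rule L2_scaleR[OF Lz])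
  define r where "r = (\<lambda>x. v' x - t *\<^sub>R z' x)"
  have rip: "ip X r y = ip X v' y - t * ip X z' y" if "L2 X y" for y
    unfolding r_def by (simp add: ip_diff_left[OF that Lv Ltz] ip_scaleR_left)
  have r0: "ip X r y = 0" if "y \<in> Z" for y
    using rip[OF LZ[OF that]] m(2)[OF that] n(2)[OF that] unfolding v'_def z'_def by simp
  have rz': "ip X r z' = 0" using rip[OF Lz] vz by simp
  have Lr: "L2 X r" unfolding r_def by (rule L2_diff[OF Lv Ltz])
  \<comment> \<open>This is \<open>m + t (z - n)\<close>, written so that the closure property of
    \<open>M\<close> applies twice.\<close>
  define m' where "m' = (\<lambda>x. (m x + t *\<^sub>R z x) + (- t) *\<^sub>R n x)"
  have m'M: "m' \<in> M" unfolding m'_def by (intro M(2) m zM n)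
  have re: "(\<lambda>x. v x - m' x) = r" by (simp add: fun_eq_iff m'_def r_def v'_def z'_def scaleR_diff_right)
  have Ln: "L2 X n" by (rule L[OF n(1)])
  have Lm: "L2 X m" by (rule L[OF m(1)])
  have rn: "ip X r n = 0" by (rule n(3)[OF Lr r0])
  have zsplit: "ip X w z = ip X w z' + ip X w n" if "L2 X w" for w
    unfolding z'_def using ip_diff_right[OF that L[OF zM] Ln] by simp
  have "ip X r z = 0" using zsplit[OF Lr] rz' rn by simp
  then have A: "\<forall>y\<in>insert z Z. ip X (\<lambda>x. v x - m' x) y = 0" using r0 unfolding re by blast
  have B: "ip X w m' = 0" if w: "L2 X w" and "\<forall>y\<in>insert z Z. ip X w y = 0" for w
  proof -
    have wZ: "ip X w y = 0" if "y \<in> Z" for y using that \<open>\<forall>y\<in>insert z Z. ip X w y = 0\<close> by blast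
    have wz: "ip X w z = 0" using \<open>\<forall>y\<in>insert z Z. ip X w y = 0\<close> by blast
    have "ip X w m' = ip X w m + t * ip X w z + (- t) * ip X w n"
      unfolding m'_def
      by (simp only: ip_add_right[OF w L2_add[OF Lm L2_scaleR[OF L[OF zM]]] L2_scaleR[OF Ln]]
          ip_add_right[OF w Lm L2_scaleR[OF L[OF zM]]] ip_scaleR_right)
    then show ?thesis using m(3)[OF w wZ] n(3)[OF w wZ] wz by simp
  qed
  show ?case using m'M A B by blast
qed

section \<open>Rigid motions\<close>

lemma rigidI: "(\<And>i j. A $ i $ j = - A $ j $ i) \<Longrightarrow> (\<lambda>x. b + A *v x) \<in> rigid_motions"
  unfolding rigid_motions_def by (rule CollectI, rule exI[of _ A], rule exI[of _ b]) (intro conjI allI refl)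

lemma rigidE:
  assumes "z \<in> rigid_motions"
  obtains A b where "\<And>i j. A $ i $ j = - A $ j $ i" "z = (\<lambda>x. b + A *v x)"
proof -
  obtain A b where *: "(\<forall>i j. A $ i $ j = - A $ j $ i) \<and> z = (\<lambda>x. b + A *v x)"
    using assms unfolding rigid_motions_def by (elim CollectE exE) (rule that)
  show thesis by (rule that[OF conjunct1[OF *, THEN spec, THEN spec] conjunct2[OF *]])
qed

lemma transpose_skew:
  fixes A :: "real^'n^'n"
  assumes "\<And>i j. A $ i $ j = - A $ j $ i"
  shows "transpose A = - A"
  unfolding vec_eq_iff
proof (intro allI)
  show "transpose A $ i $ j = (- A) $ i $ j" for i j using assms[of j i] by (simp add: transpose_def)
qed

lemma skew_basis_rigid:
  "(\<lambda>x :: real^'n. x $ j *\<^sub>R axis i 1 - x $ i *\<^sub>R axis j 1) \<in> rigid_motions"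
proof -
  define B :: "'n \<Rightarrow> 'n \<Rightarrow> real" where "B k l = (if k = i then if l = j then 1 else 0 else 0)" for k l
  define A :: "real^'n^'n" where "A = (\<chi> k l. B k l - B l k)"
  have "A *v x = x $ j *\<^sub>R axis i 1 - x $ i *\<^sub>R axis j 1" for x
  proof (subst vec_eq_iff, rule allI)
    fix k
    have "(A *v x) $ k = (\<Sum>l\<in>UNIV. (if l = j then (if k = i then x $ j else 0) else 0) - (if l = i then (if k = j then x $ i else 0) else 0))"
      unfolding matrix_vector_mult_def A_def vec_lambda_beta left_diff_distrib B_def by (intro sum.cong arg_cong2[of _ _ _ _ "(-)"]) simp_all
    then show "(A *v x) $ k = (x $ j *\<^sub>R axis i 1 - x $ i *\<^sub>R axis j 1) $ k"
      by (simp add: sum_subtractf axis_def)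
  qed
  note eq = this
  have "(\<lambda>x. 0 + A *v x) \<in> rigid_motions"
  proof (rule rigidI)
    show "A $ k $ l = - A $ l $ k" for k l unfolding A_def vec_lambda_beta minus_diff_eq ..
  qed
  then show ?thesis unfolding add_0_left eq .
qed

lemma const_rigid: "(\<lambda>x. b :: real^'n) \<in> rigid_motions"
proof -
  have "(\<lambda>x :: real^'n. b + 0 *v x) \<in> rigid_motions" by (rule rigidI) simp
  then show ?thesis by simp
qed

lemma rigid_add_scaleR:
  assumes "m \<in> rigid_motions" "m' \<in> rigid_motions"
  shows "(\<lambda>x. m x + c *\<^sub>R m' x) \<in> rigid_motions"
proof -
  obtain A b where m: "\<And>i j. A $ i $ j = - A $ j $ i" "m = (\<lambda>x. b + A *v x)"
    by (rule rigidE[OF assms(1)]) (rule that)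
  obtain A' b' where m': "\<And>i j. A' $ i $ j = - A' $ j $ i" "m' = (\<lambda>x. b' + A' *v x)"
    by (rule rigidE[OF assms(2)]) (rule that)
  have "(\<lambda>x. m x + c *\<^sub>R m' x) = (\<lambda>x. (b + c *\<^sub>R b') + (A + c *\<^sub>R A') *v x)"
    by (simp add: fun_eq_iff m(2) m'(2) matrix_vector_mult_add_rdistrib scaleR_matrix_vector_assoc scaleR_add_right)
  moreover have "(\<lambda>x. (b + c *\<^sub>R b') + (A + c *\<^sub>R A') *v x) \<in> rigid_motions"
  proof (rule rigidI)
    fix i j
    show "(A + c *\<^sub>R A') $ i $ j = - (A + c *\<^sub>R A') $ j $ i" using m(1)[of i j] m'(1)[of i j] by simp
  qed
  ultimately show ?thesis by simp
qed

text \<open>A finite spanning family of the rigid motions. By skew symmetry each entry of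
  \<open>A\<close> is seen from both \<open>(i, j)\<close> and \<open>(j, i)\<close>, which accounts
  for the division by 2.\<close>

lemma rigid_decomposition:
  fixes A :: "real^'n^'n"
  assumes "\<And>i j. A $ i $ j = - A $ j $ i"
  shows "b + A *v x = (\<Sum>i\<in>UNIV. b $ i *\<^sub>R axis i 1)
    + (\<Sum>(i, j)\<in>UNIV. (A $ i $ j / 2) *\<^sub>R (x $ j *\<^sub>R axis i 1 - x $ i *\<^sub>R axis j 1))"
proof (subst vec_eq_iff, rule allI)
  fix k
  have 1: "(\<Sum>i\<in>UNIV. b $ i *\<^sub>R axis i 1) = b"
    by (simp add: vec_eq_iff axis_def if_distrib[of "\<lambda>t. _ * t"] cong: if_cong)
  have "(\<Sum>(i, j)\<in>UNIV. (A $ i $ j / 2) *\<^sub>R (x $ j *\<^sub>R axis i 1 - x $ i *\<^sub>R axis j 1)) $ k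
      = (\<Sum>i\<in>UNIV. \<Sum>j\<in>UNIV. (A $ i $ j / 2) * (x $ j * axis i 1 $ k - x $ i * axis j 1 $ k))"
    by (simp add: UNIV_Times_UNIV[symmetric] sum.cartesian_product[symmetric] del: UNIV_Times_UNIV)
  also have "\<dots> = (\<Sum>i\<in>UNIV. (\<Sum>j\<in>UNIV. A $ i $ j / 2 * x $ j) * axis i 1 $ k)
      - (\<Sum>i\<in>UNIV. \<Sum>j\<in>UNIV. (A $ i $ j / 2 * x $ i) * axis j 1 $ k)"
    by (simp add: right_diff_distrib sum_subtractf sum_distrib_right mult.assoc)
  also have "(\<Sum>i\<in>UNIV. (\<Sum>j\<in>UNIV. A $ i $ j / 2 * x $ j) * axis i 1 $ k) = (\<Sum>j\<in>UNIV. A $ k $ j / 2 * x $ j)"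
    by (simp add: axis_def if_distrib[of "\<lambda>t. _ * t"] cong: if_cong)
  also have "(\<Sum>i\<in>UNIV. \<Sum>j\<in>UNIV. (A $ i $ j / 2 * x $ i) * axis j 1 $ k) = (\<Sum>i\<in>UNIV. A $ i $ k / 2 * x $ i)"
    by (simp add: axis_def if_distrib[of "\<lambda>t. _ * t"] cong: if_cong)
  also have "\<dots> = - (\<Sum>i\<in>UNIV. A $ k $ i / 2 * x $ i)"
    unfolding sum_negf[symmetric]
  proof (rule sum.cong[OF refl])
    show "A $ i $ k / 2 * x $ i = - (A $ k $ i / 2 * x $ i)" for i using assms[of i k] by simp
  qed
  also have "(\<Sum>j\<in>UNIV. A $ k $ j / 2 * x $ j) - - (\<Sum>i\<in>UNIV. A $ k $ i / 2 * x $ i) = (\<Sum>j\<in>UNIV. A $ k $ j * x $ j)"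
    by (simp add: sum.distrib[symmetric] mult.commute)
  finally show "(b + A *v x) $ k = ((\<Sum>i\<in>UNIV. b $ i *\<^sub>R axis i 1)
    + (\<Sum>(i, j)\<in>UNIV. (A $ i $ j / 2) *\<^sub>R (x $ j *\<^sub>R axis i 1 - x $ i *\<^sub>R axis j 1))) $ k"
    unfolding 1 by (simp add: matrix_vector_mult_def)
qed

section \<open>Projection onto rigid motions and extension by cutoff\<close>

context bounded_open
begin

lemma L2_affine: "L2 U (\<lambda>x. b + A *v (x :: real^'n) :: real^'n)"
proof -
  have cont: "continuous_on UNIV (\<lambda>x. b + A *v x)"
    by (intro continuous_intros linear_continuous_on matrix_vector_mul_bounded_linear)
  have cl: "compact (closure U)" using bounded_U by (simp add: compact_closure)
  obtain B1 where B1: "B1 \<ge> 0" "\<And>x. x \<in> closure U \<Longrightarrow> norm (b + A *v x) \<le> B1"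
    by (rule continuous_bounded_on_compact[OF cont cl]) (rule that)
  have B2: "norm (b + A *v x) \<le> B1" if "x \<in> U" for x using B1(2) closure_subset that by blast
  show ?thesis
    by (rule L2_bounded[OF borel_lebesgue_on[OF borel_measurable_continuous_onI[OF cont]] _ lmeasurable_U, where B = B1], rule AE_I2)
      (simp add: B2)
qed

lemma L2_rigid: "z \<in> rigid_motions \<Longrightarrow> L2 U z"
  unfolding rigid_motions_def using L2_affine by auto

text \<open>\<open>L2_projection\<close> gives orthogonality to a finite family, and
  \<open>rigid_decomposition\<close> extends it to all rigid motions.\<close>

lemma rigid_projection:
  assumes v: "L2 U v"
  shows "\<exists>m\<in>rigid_motions. \<forall>z\<in>rigid_motions. ip U (\<lambda>x. v x - m x) z = 0"
proof -
  define w :: "'n \<times> 'n \<Rightarrow> real^'n \<Rightarrow> real^'n" where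
    "w ij = (\<lambda>x. x $ (snd ij) *\<^sub>R axis (fst ij) 1 - x $ (fst ij) *\<^sub>R axis (snd ij) 1)" for ij
  define Z where "Z = range (\<lambda>i (x :: real^'n). axis i 1 :: real^'n) \<union> range w"
  have wR: "w ij \<in> rigid_motions" for ij unfolding w_def by (rule skew_basis_rigid)
  have "finite Z" by (simp add: Z_def)
  moreover have "Z \<subseteq> rigid_motions" unfolding Z_def using wR const_rigid by blast
  ultimately obtain m where m: "m \<in> rigid_motions" "\<And>y. y \<in> Z \<Longrightarrow> ip U (\<lambda>x. v x - m x) y = 0"
    using L2_projection[OF _ _ L2_rigid const_rigid rigid_add_scaleR v, of Z] by blast
  define r where "r = (\<lambda>x. v x - m x)"
  have r: "L2 U r" unfolding r_def by (rule L2_diff[OF v L2_rigid[OF m(1)]])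
  have "ip U r z = 0" if z: "z \<in> rigid_motions" for z
  proof -
    obtain A b where Ab: "\<And>i j. A $ i $ j = - A $ j $ i" "z = (\<lambda>x. b + A *v x)"
      by (rule rigidE[OF z]) (rule that)
    let ?e = "\<lambda>i (x :: real^'n). b $ i *\<^sub>R (axis i 1 :: real^'n)"
    let ?w = "\<lambda>ij x. (A $ fst ij $ snd ij / 2) *\<^sub>R w ij x"
    have ze: "z = (\<lambda>x. (\<Sum>i\<in>UNIV. ?e i x) + (\<Sum>ij\<in>UNIV. ?w ij x))"
      unfolding Ab(2) w_def by (rule ext, subst rigid_decomposition[OF Ab(1)]) (simp add: case_prod_unfold)
    have Le: "L2 U (?e i)" for i by (rule L2_const)
    have Lw: "L2 U (?w ij)" for ij by (rule L2_scaleR[OF L2_rigid[OF wR]])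
    have "ip U z r = ip U (\<lambda>x. \<Sum>i\<in>UNIV. ?e i x) r + ip U (\<lambda>x. \<Sum>ij\<in>UNIV. ?w ij x) r"
      unfolding ze by (rule ip_add_left[OF r L2_sum L2_sum]) (use Le Lw in auto)
    also have "ip U (\<lambda>x. \<Sum>i\<in>UNIV. ?e i x) r = (\<Sum>i\<in>UNIV. ip U (?e i) r)" by (rule ip_sum_left[OF finite Le r])
    also have "\<dots> = 0"
    proof (rule sum.neutral, rule ballI)
      fix i
      have "ip U r (\<lambda>x. axis i 1) = 0" using m(2)[of "\<lambda>x. axis i 1"] unfolding r_def Z_def by blast
      then show "ip U (?e i) r = 0" unfolding ip_scaleR_left by (simp add: ip_commute)
    qed
    also have "ip U (\<lambda>x. \<Sum>ij\<in>UNIV. ?w ij x) r = (\<Sum>ij\<in>UNIV. ip U (?w ij) r)" by (rule ip_sum_left[OF finite Lw r])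
    also have "\<dots> = 0"
    proof (rule sum.neutral, rule ballI)
      fix ij
      have "ip U r (w ij) = 0" using m(2)[of "w ij"] unfolding r_def Z_def by blast
      then show "ip U (?w ij) r = 0" unfolding ip_scaleR_left by (simp add: ip_commute)
    qed
    finally show ?thesis by (simp add: ip_commute)
  qed
  then show ?thesis using m(1) unfolding r_def by blast
qed

text \<open>The cutoff \<open>c\<close> is 1 where \<open>norm x \<le> R\<close> and 0 beyond
  \<open>2 * R\<close>. The purpose is to insert affine functions into the trace condition of
  \<open>Sigma_a\<close>, whose test functions have compact support.\<close>

lemma testfun_extension:
  assumes f: "C1_grad f g"
  obtains \<phi> where "testfun UNIV \<phi>" "\<And>x. x \<in> U \<Longrightarrow> \<phi> x = f x" "\<And>x j. x \<in> U \<Longrightarrow> pd j \<phi> x = g x $ j"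
proof -
  obtain R where R: "R > 0" "\<And>x. x \<in> U \<Longrightarrow> norm x \<le> R" using bounded_U unfolding bounded_pos by blast
  define q :: "real \<Rightarrow> real" where "q t = (max 0 t)\<^sup>2" for t
  have q: "(q has_real_derivative 2 * max 0 t) (at t)" for t unfolding q_def by (rule DERIV_max_square)
  have qc: "continuous_on UNIV (\<lambda>t::real. 2 * max 0 t)" by (intro continuous_intros)
  have "C1_grad (\<lambda>x :: real^'n. x \<bullet> x) (\<lambda>x. 2 *\<^sub>R x)"
    unfolding C1_grad_def by (auto intro!: derivative_eq_intros continuous_intros simp: inner_commute)
  from C1_grad_add[OF C1_grad_const C1_grad_cmult[OF this], of "-1" "1 / R\<^sup>2"]
  have n: "C1_grad (\<lambda>x :: real^'n. -1 + 1 / R\<^sup>2 * (x \<bullet> x)) (\<lambda>x. 0 + (1 / R\<^sup>2) *\<^sub>R 2 *\<^sub>R x)" .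
  define c where "c x = q (1 + (-1) * q (-1 + 1 / R\<^sup>2 * (x \<bullet> x)))" for x :: "real^'n"
  have "\<exists>h. C1_grad c h"
    unfolding c_def by (rule exI, rule C1_grad_compose[OF C1_grad_add[OF C1_grad_const C1_grad_cmult[OF C1_grad_compose[OF n q qc]]] q qc])
  then obtain h where h: "C1_grad c h" by blast
  define \<phi> where "\<phi> x = f x * c x" for x
  have G: "C1_grad \<phi> (\<lambda>x. f x *\<^sub>R h x + c x *\<^sub>R g x)" unfolding \<phi>_def by (rule C1_grad_mult[OF f h])
  have nR: "x \<bullet> x = (norm x)\<^sup>2" for x :: "real^'n" by (simp add: power2_norm_eq_inner)
  have c1: "c x = 1" if "norm x \<le> R" for x
  proof -
    have "(norm x)\<^sup>2 \<le> R\<^sup>2" using that by (simp add: power_mono)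
    then have "1 / R\<^sup>2 * (x \<bullet> x) \<le> 1" using R(1) unfolding nR by simp
    then have "q (-1 + 1 / R\<^sup>2 * (x \<bullet> x)) = 0" by (simp add: q_def)
    then show ?thesis by (simp add: c_def q_def)
  qed
  have c0: "c x = 0" if "x \<notin> cball 0 (2 * R)" for x
  proof -
    have "2 * R < norm x" using that by simp
    then have "(2 * R)\<^sup>2 \<le> (norm x)\<^sup>2" using R(1) by (intro power_mono) auto
    then have "4 * R\<^sup>2 \<le> (norm x)\<^sup>2" by (simp add: power_mult_distrib)
    moreover have "0 \<le> R\<^sup>2" by simp
    ultimately have "2 * R\<^sup>2 \<le> (norm x)\<^sup>2" by linarith
    then have "2 \<le> 1 / R\<^sup>2 * (x \<bullet> x)" using R(1) unfolding nR by (simp add: pos_le_divide_eq)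
    then have "1 \<le> q (-1 + 1 / R\<^sup>2 * (x \<bullet> x))" by (simp add: q_def)
    then show ?thesis by (simp add: c_def q_def)
  qed
  show ?thesis
  proof
    show "testfun UNIV \<phi>" by (rule testfunI[OF G compact_cball[of 0 "2 * R"]]) (auto simp: \<phi>_def c0)
    show e: "\<phi> x = f x" if "x \<in> U" for x using c1[OF R(2)[OF that]] by (simp add: \<phi>_def)
    show "pd j \<phi> x = g x $ j" if x: "x \<in> U" for x j
    proof -
      have "(f has_derivative (\<bullet>) (g x)) (at x)" using f unfolding C1_grad_def by blast
      then have "(\<phi> has_derivative (\<bullet>) (g x)) (at x)"
        by (rule has_derivative_transform_within_open[OF _ open_U x]) (simp add: e)
      then have "frechet_derivative \<phi> (at x) = (\<bullet>) (g x)" by (rule frechet_derivative_at[symmetric])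
      then show ?thesis by (simp add: pd_def inner_axis)
    qed
  qed
qed

end

lemma L2_matrix_vector:
  fixes S :: "real^'n \<Rightarrow> real^'n^'n"
  assumes S: "L2 X S" and h: "h \<in> borel_measurable (lebesgue_on X)" and B: "AE x in lebesgue_on X. norm (h x) \<le> B"
  shows "L2 X (\<lambda>x. S x *v h x)"
proof -
  have "S x *v h x = (\<Sum>j\<in>UNIV. h x $ j *\<^sub>R column j (S x))" for x
    by (simp add: matrix_mult_sum scalar_mult_eq_scaleR)
  moreover have "L2 X (\<lambda>x. \<Sum>j\<in>UNIV. h x $ j *\<^sub>R column j (S x))"
  proof (intro L2_sum finite L2_mult_bounded)
    fix j
    have lin: "bounded_linear (\<lambda>M :: real^'n^'n. column j M)"
    proof (subst linear_conv_bounded_linear[symmetric], rule linearI)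
      show "column j (M + N) = column j M + column j N" for M N :: "real^'n^'n" by (simp add: column_def vec_eq_iff)
      show "column j (c *\<^sub>R M) = c *\<^sub>R column j M" for c and M :: "real^'n^'n" by (simp add: column_def vec_eq_iff)
    qed
    show "L2 X (\<lambda>x. column j (S x))" by (rule L2_linear[OF lin S])
    show "(\<lambda>x. h x $ j) \<in> borel_measurable (lebesgue_on X)"
      by (rule measurable_compose[OF h]) (intro borel_measurable_continuous_onI continuous_intros)
    show "AE x in lebesgue_on X. \<bar>h x $ j\<bar> \<le> B"
      using B by eventually_elim (rule order_trans[OF component_le_norm_cart])
  qed
  ultimately show ?thesis by simp
qed

section \<open>Equilibration\<close>

lemma pw_polyI:
  assumes "\<And>K. K \<in> Ks \<Longrightarrow> \<exists>P. polyfun p P \<and> (\<forall>x\<in>interior (convex hull K). f x = P x)"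
  shows "pw_poly p Ks f"
  using assms unfolding pw_poly_def by blast

context mesh
begin

lemma sets_interior: "interior (convex hull K) \<in> sets lebesgue" by simp

lemma bounded_open_interior:
  assumes "K \<in> Th"
  shows "bounded_open (interior (convex hull K))"
  by unfold_locales (use bounded_subset[OF bounded_U interior_subset_Omega[OF assms]] in auto)

end

lemma inner_matrix_vector: "(M *v h) \<bullet> w = (\<Sum>i\<in>UNIV. \<Sum>j\<in>UNIV. M $ i $ j * (w $ i * h $ j))"
  by (simp add: inner_vec_def matrix_vector_mult_def sum_distrib_left mult_ac)

section \<open>Compatibility of the patch problems\<close>

text \<open>\<open>S\<close> stands for the discrete stress
  \<open>\<sigma> (eps \<Omega> uh x)\<close>. The assumptions on \<open>sa\<close> are the trace
  condition, the divergence equation and the weak symmetry of the patch solutions.\<close>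

locale equilibration = mesh \<Omega> Th for \<Omega> :: "(real^'n) set" and Th +
  fixes p :: nat and f :: "real^'n \<Rightarrow> real^'n" and S :: "real^'n \<Rightarrow> real^'n^'n"
    and sa :: "real^'n \<Rightarrow> real^'n \<Rightarrow> real^'n^'n"
  assumes p2: "p \<ge> 2" and f: "L2 \<Omega> f" and S: "L2 \<Omega> S" and S_sym: "\<And>x. transpose (S x) = S x"
    and discrete: "\<And>v. H10 \<Omega> v \<Longrightarrow> pw_poly p Th v \<Longrightarrow> ip \<Omega> S (eps \<Omega> v) = ip \<Omega> f v"
    and stress: "\<And>a. a \<in> vertices Th \<Longrightarrow> Sigma_a \<Omega> Th p a (sa a)"
    and local_div: "\<And>a v. a \<in> vertices Th \<Longrightarrow> V_a \<Omega> Th p a v \<Longrightarrow>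
       ip (patch Th a) (weak_div (patch Th a) (sa a)) v
       = ip (patch Th a) (\<lambda>x. - (hat Th a x *\<^sub>R f x) + S x *v weak_grad_s (patch Th a) (hat Th a) x) v"
    and local_symm: "\<And>a \<mu>. a \<in> vertices Th \<Longrightarrow> Lambda_a Th p a \<mu> \<Longrightarrow> ip (patch Th a) (sa a) \<mu> = 0"
begin

abbreviation D :: "real^'n \<Rightarrow> real^'n \<Rightarrow> real^'n" where "D a \<equiv> weak_div (patch Th a) (sa a)"

text \<open>The data of the local divergence equation, with the explicit gradient
  \<open>hatg\<close> in place of the chosen weak gradient.\<close>

definition g :: "real^'n \<Rightarrow> real^'n \<Rightarrow> real^'n" where
  "g a x = - (hat Th a x *\<^sub>R f x) + S x *v hatg a x"

lemma sets_patch: "patch Th a \<in> sets lebesgue"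
  using bounded_open.sets_U[OF bounded_open_patch] .

lemma sets_Omega: "\<Omega> \<in> sets lebesgue" by (rule sets_U)

lemma sa_div:
  assumes "a \<in> vertices Th"
  shows "has_weak_div (patch Th a) (sa a) (D a)" "L2 (patch Th a) (sa a)" "L2 (patch Th a) (D a)"
proof -
  obtain E where E: "has_weak_div (patch Th a) (sa a) E"
    using stress[OF assms] unfolding Sigma_a_def Hdiv_def by blast
  show "has_weak_div (patch Th a) (sa a) (D a)" by (rule bounded_open.weak_div_props(1)[OF bounded_open_patch E])
  then show "L2 (patch Th a) (sa a)" "L2 (patch Th a) (D a)" unfolding has_weak_div_def by blast+
qed

lemma L2_hat_scaleR:
  assumes "X \<subseteq> \<Omega>" "L2 X w"
  shows "L2 X (\<lambda>x. hat Th a x *\<^sub>R w x)"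
  by (rule L2_mult_bounded[OF assms(2) measurable_hat[OF assms(1)], where B = 1], rule AE_I2) (simp add: hat_bounds)

lemma L2_g:
  assumes X: "X \<subseteq> \<Omega>" "X \<in> sets lebesgue"
  shows "L2 X (g a)"
proof -
  obtain H where H: "H \<ge> 0" "\<And>x. norm (hatg a x) \<le> H" by (rule hatg_bounded) (rule that)
  have "L2 X (\<lambda>x. S x *v hatg a x)"
    by (rule L2_matrix_vector[OF L2_subset[OF S X(1) sets_Omega X(2)] borel_lebesgue_on[OF measurable_hatg], where B = H])
      (simp add: H)
  moreover have "L2 X (\<lambda>x. - (hat Th a x *\<^sub>R f x))"
    by (intro L2_uminus L2_hat_scaleR X L2_subset[OF f X(1) sets_Omega X(2)])
  ultimately show ?thesis unfolding g_def by (intro L2_add)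
qed

lemma local_div_g:
  assumes a: "a \<in> vertices Th" and v: "V_a \<Omega> Th p a v" "L2 (patch Th a) v"
  shows "ip (patch Th a) (D a) v = ip (patch Th a) (g a) v"
proof -
  let ?P = "patch Th a" and ?w = "weak_grad_s (patch Th a) (hat Th a)"
  obtain H where H: "H \<ge> 0" "\<And>x. norm (hatg a x) \<le> H" by (rule hatg_bounded) (rule that)
  have ae: "AE x in lebesgue_on ?P. ?w x = hatg a x"
    by (rule bounded_open.weak_grad_s_props(2)[OF bounded_open_patch hat_weak_grad])
  have "has_weak_grad_s ?P (hat Th a) ?w"
    by (rule bounded_open.weak_grad_s_props(1)[OF bounded_open_patch hat_weak_grad])
  then have w: "L2 ?P ?w" unfolding has_weak_grad_s_def by blast
  have B: "AE x in lebesgue_on ?P. norm (?w x) \<le> H" using ae by eventually_elim (simp add: H)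
  have SP: "L2 ?P S" by (rule L2_subset[OF S patch_subset sets_Omega sets_patch])
  have fP: "L2 ?P f" by (rule L2_subset[OF f patch_subset sets_Omega sets_patch])
  have 1: "L2 ?P (\<lambda>x. - (hat Th a x *\<^sub>R f x) + S x *v ?w x)"
    by (intro L2_add L2_uminus L2_hat_scaleR patch_subset fP L2_matrix_vector[OF SP L2_measurable[OF w] B])
  have 2: "L2 ?P (g a)" by (rule L2_g[OF patch_subset sets_patch])
  have 3: "AE x in lebesgue_on ?P. - (hat Th a x *\<^sub>R f x) + S x *v ?w x = g a x"
    using ae by eventually_elim (simp add: g_def)
  show ?thesis unfolding local_div[OF a v(1)] by (rule ip_cong_AE[OF 1 2 v(2) v(2) 3]) simp
qed

text \<open>At an interior vertex the normal trace vanishes on the whole patch boundary. So the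
  divergence pairs with a rigid motion like minus the stress with the constant skew gradient
  \<open>A\<close>, which is 0 by weak symmetry.\<close>

lemma div_rigid:
  assumes a: "a \<in> vertices Th" "a \<in> \<Omega>" and A: "\<And>i j. A $ i $ j = - A $ j $ i"
  shows "ip (patch Th a) (D a) (\<lambda>x. b + A *v x) = 0"
proof -
  interpret P: bounded_open "patch Th a" by (rule bounded_open_patch)
  let ?P = "patch Th a" and ?z = "\<lambda>x. b + A *v x" and ?s = "sa a"
  have skew: "Lambda_a Th p a (\<lambda>x. A)"
    unfolding Lambda_a_def
  proof (intro conjI ballI)
    show "pw_poly (p - 1) (star Th a) (\<lambda>x. A)" by (rule pw_polyI) (intro exI[of _ "\<lambda>x. A"] conjI polyfun_const, simp)
    show "transpose A = - A" by (rule transpose_skew[OF A])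
  qed
  have C1: "C1_grad (\<lambda>x. ?z x $ i) (\<lambda>x. A $ i)" for i
  proof -
    have "C1_grad (\<lambda>x. b $ i + A $ i \<bullet> x) (\<lambda>x. 0 + A $ i)" by (rule C1_grad_add[OF C1_grad_const C1_grad_inner])
    then show ?thesis by (simp add: matrix_vector_mult_def inner_vec_def)
  qed
  have Ls: "L2 ?P (\<lambda>x. ?s x $ i)" for i by (rule L2_linear[OF bounded_linear_vec_nth sa_div(2)[OF a(1)]])
  have LD: "L2 ?P (\<lambda>x. D a x $ i)" for i by (rule L2_nth[OF sa_div(3)[OF a(1)]])
  have Lz: "L2 ?P (\<lambda>x. ?z x $ i)" for i by (rule L2_nth[OF P.L2_affine])
  have row: "ip ?P (\<lambda>x. ?s x $ i) (\<lambda>x. A $ i) + ip ?P (\<lambda>x. D a x $ i) (\<lambda>x. ?z x $ i) = 0" for i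
  proof -
    obtain \<phi> where \<phi>: "testfun UNIV \<phi>" "\<And>x. x \<in> ?P \<Longrightarrow> \<phi> x = ?z x $ i" "\<And>x j. x \<in> ?P \<Longrightarrow> pd j \<phi> x = A $ i $ j"
      by (rule P.testfun_extension[OF C1]) (rule that)
    have "(\<integral>x. (\<Sum>j\<in>UNIV. ?s x $ i $ j * pd j \<phi> x) \<partial>lebesgue_on ?P) + (\<integral>x. D a x $ i * \<phi> x \<partial>lebesgue_on ?P) = 0"
      using stress[OF a(1)] \<phi>(1) a(2) unfolding Sigma_a_def by simp
    moreover have "(\<integral>x. (\<Sum>j\<in>UNIV. ?s x $ i $ j * pd j \<phi> x) \<partial>lebesgue_on ?P) = ip ?P (\<lambda>x. ?s x $ i) (\<lambda>x. A $ i)"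
      unfolding ip_def by (rule Bochner_Integration.integral_cong) (simp_all add: \<phi>(3) inner_vec_def)
    moreover have "(\<integral>x. D a x $ i * \<phi> x \<partial>lebesgue_on ?P) = ip ?P (\<lambda>x. D a x $ i) (\<lambda>x. ?z x $ i)"
      unfolding ip_def by (rule Bochner_Integration.integral_cong) (simp_all add: \<phi>(2))
    ultimately show ?thesis by simp
  qed
  have "ip ?P ?s (\<lambda>x. A) = (\<Sum>i\<in>UNIV. ip ?P (\<lambda>x. ?s x $ i) (\<lambda>x. A $ i))"
    unfolding ip_def inner_vec_def[of "?s _"]
    by (rule Bochner_Integration.integral_sum) (rule L2_ip_integrable[OF Ls P.L2_const])
  moreover have "ip ?P (D a) ?z = (\<Sum>i\<in>UNIV. ip ?P (\<lambda>x. D a x $ i) (\<lambda>x. ?z x $ i))"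
    unfolding ip_def inner_vec_def[of "D a _"]
    by (rule Bochner_Integration.integral_sum) (rule L2_ip_integrable[OF LD Lz])
  ultimately have "ip ?P ?s (\<lambda>x. A) + ip ?P (D a) ?z = 0" using row by (simp add: sum.distrib[symmetric])
  then show ?thesis using local_symm[OF a(1) skew] by simp
qed

lemma g_outside_patch:
  assumes "x \<in> \<Omega>" "x \<notin> Nf" "x \<notin> patch Th a"
  shows "hat Th a x = 0" "hatg a x = 0"
proof -
  have "x \<in> T" using assms(1) Omega_subset_T by blast
  then obtain K where K: "K \<in> Th" "x \<in> interior (convex hull K)" using T_cases assms(2) by blast
  have "a \<notin> K" using interior_subset_patch[OF K(1), of a] K(2) assms(3) by blast
  then show "hat Th a x = 0" "hatg a x = 0"
    using hat_on[OF K(1) subsetD[OF interior_subset K(2)], of a] hatg_on[OF K, of a] by simp_all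
qed

text \<open>The pairing is the discrete residual tested with the hat function times the rigid
  motion. Of the gradient of this product, the part containing \<open>A\<close> drops out since
  \<open>S\<close> is symmetric.\<close>

lemma data_rigid:
  assumes a: "a \<in> \<Omega>" and A: "\<And>i j. A $ i $ j = - A $ j $ i"
  shows "ip (patch Th a) (g a) (\<lambda>x. b + A *v x) = 0"
proof -
  let ?z = "\<lambda>x. b + A *v x"
  define v where "v = (\<lambda>x. hat Th a x *\<^sub>R ?z x)"
  define G where "G = (\<lambda>x. \<chi> i j. ?z x $ i * hatg a x $ j + hat Th a x * A $ i $ j)"
  have H: "H10 \<Omega> v" "has_weak_grad \<Omega> v G" unfolding v_def G_def by (rule hat_affine_H10[OF a])+
  have pw: "pw_poly p Th v"
  proof (rule pw_polyI)
    fix K assume K: "K \<in> Th"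
    interpret K: full_simplex K by (rule full_simplex[OF K])
    have int: "x \<in> convex hull K" if "x \<in> interior (convex hull K)" for x using that interior_subset by blast
    show "\<exists>P. polyfun p P \<and> (\<forall>x\<in>interior (convex hull K). v x = P x)"
    proof (cases "a \<in> K")
      case False
      then have "\<forall>x\<in>interior (convex hull K). v x = 0" using hat_on[OF K int] by (simp add: v_def)
      then show ?thesis using polyfun_const by blast
    next
      case True
      have bc: "poly_deg 1 (bc K a)"
      proof -
        have "bc K a = (\<lambda>x. bc K a 0 + bcg K a \<bullet> x)" by (rule ext) (rule K.bc_grad[OF True])
        then show ?thesis using poly_deg_affine[of "bc K a 0" "bcg K a"] by simp
      qed
      have zi: "poly_deg 1 (\<lambda>x. ?z x $ i)" for i
        using poly_deg_affine[of "b $ i" "A $ i"] by (simp add: matrix_vector_mult_def inner_vec_def)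
      have "polyfun p (\<lambda>x. bc K a x *\<^sub>R ?z x)"
        by (rule polyfun_vecI) (use poly_deg_mult[OF bc zi, of p] p2 in simp)
      moreover have "\<forall>x\<in>interior (convex hull K). v x = bc K a x *\<^sub>R ?z x" using hat_on[OF K int] True by (simp add: v_def)
      ultimately show ?thesis by blast
    qed
  qed
  have Lv: "L2 \<Omega> v" and LG: "L2 \<Omega> G" using H(2) unfolding has_weak_grad_def by blast+
  have Lz: "L2 \<Omega> ?z" by (rule L2_affine)
  have Lg: "L2 \<Omega> (g a)" by (rule L2_g[OF order_refl sets_Omega])
  have Se: "ip \<Omega> S (eps \<Omega> v) = ip \<Omega> S G"
  proof -
    have "ip \<Omega> S (eps \<Omega> v) = ip \<Omega> S (weak_grad \<Omega> v)"
      unfolding ip_def eps_symm inner_symm[OF S_sym] ..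
    also have "\<dots> = ip \<Omega> S G"
    proof (rule ip_cong_AE[OF S S _ LG])
      show "L2 \<Omega> (weak_grad \<Omega> v)" using weak_grad_props(1)[OF H(2)] unfolding has_weak_grad_def by blast
      show "AE x in lebesgue_on \<Omega>. weak_grad \<Omega> v x = G x" by (rule weak_grad_props(2)[OF H(2)])
    qed simp
    finally show ?thesis .
  qed
  have SA: "S x \<bullet> A = 0" for x
  proof -
    have "transpose A = - A" by (rule transpose_skew[OF A])
    then have "symm A = 0" by (simp add: symm_def)
    then show ?thesis using inner_symm[OF S_sym, of x A] by simp
  qed
  have pt: "S x \<bullet> G x - f x \<bullet> v x = g a x \<bullet> ?z x" for x
  proof -
    have "S x \<bullet> G x = (\<Sum>i\<in>UNIV. \<Sum>j\<in>UNIV. S x $ i $ j * (?z x $ i * hatg a x $ j)) + hat Th a x * (S x \<bullet> A)"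
      by (simp add: inner_vec_def G_def algebra_simps sum.distrib sum_distrib_left)
    also have "(\<Sum>i\<in>UNIV. \<Sum>j\<in>UNIV. S x $ i $ j * (?z x $ i * hatg a x $ j)) = (S x *v hatg a x) \<bullet> ?z x"
      by (simp add: inner_matrix_vector mult_ac)
    finally show ?thesis by (simp add: SA g_def v_def inner_diff_left)
  qed
  have "ip \<Omega> (g a) ?z = ip \<Omega> S G - ip \<Omega> f v"
    unfolding ip_def pt[symmetric] by (rule Bochner_Integration.integral_diff) (intro L2_ip_integrable S LG f Lv)+
  also have "\<dots> = 0" using Se discrete[OF H(1) pw] by simp
  finally have z: "ip \<Omega> (g a) ?z = 0" .
  \<comment> \<open>Off the patch the hat function and its gradient vanish almost everywhere, so the
    patch integral equals the one over the domain.\<close>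
  have "ip (patch Th a) (g a) ?z = ip \<Omega> (\<lambda>x. if x \<in> patch Th a then g a x else 0) ?z"
    by (rule ip_extend_left[symmetric, OF patch_subset sets_Omega sets_patch])
  also have "\<dots> = ip \<Omega> (g a) ?z"
  proof (rule ip_cong_AE[OF _ Lg Lz Lz])
    show "L2 \<Omega> (\<lambda>x. if x \<in> patch Th a then g a x else 0)"
      by (rule L2_extend[OF L2_g[OF patch_subset sets_patch] patch_subset sets_Omega sets_patch])
    show "AE x in lebesgue_on \<Omega>. (if x \<in> patch Th a then g a x else 0) = g a x"
      using AE_Nf[OF sets_Omega] AE_space
    proof eventually_elim
      case (elim x)
      then show ?case using g_outside_patch[of x a] by (simp add: g_def)
    qed
  qed simp
  finally show ?thesis using z by simp
qed

lemma rigid_compatible: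
  assumes a: "a \<in> vertices Th" "a \<in> \<Omega>" and z: "z \<in> rigid_motions"
  shows "ip (patch Th a) (D a) z = ip (patch Th a) (g a) z"
proof -
  obtain A b where A: "\<And>i j. A $ i $ j = - A $ j $ i" and zb: "z = (\<lambda>x. b + A *v x)"
    by (rule rigidE[OF z]) (rule that)
  show ?thesis unfolding zb using div_rigid[OF a A, of b] data_rigid[OF a(2) A, of b] by simp
qed

text \<open>A rigid motion has degree 1, which is at most \<open>p - 1\<close> since
  \<open>p \<ge> 2\<close>.\<close>

lemma V_a_minus_rigid:
  assumes K: "K \<in> Th" and m: "m \<in> rigid_motions"
  shows "pw_poly (p - 1) (star Th a) (\<lambda>x. (if x \<in> interior (convex hull K) then c else 0) - m x)"
proof (rule pw_polyI)
  fix L assume "L \<in> star Th a"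
  then have L: "L \<in> Th" by (simp add: star_def)
  define d where "d = (if L = K then c else 0)"
  have "poly_deg (p - 1) (\<lambda>x. d $ i + (-1) * m x $ i)" for i
    using p2 by (intro poly_deg_add poly_deg_const poly_deg_mult[OF poly_deg_const[of 0] rigid_motion_poly[OF m]]) simp
  then have "polyfun (p - 1) (\<lambda>x. d - m x)" by (intro polyfun_vecI) simp
  moreover have "\<forall>x\<in>interior (convex hull L). (if x \<in> interior (convex hull K) then c else 0) - m x = d - m x"
    using interiors_disjoint[OF L K] by (auto simp: d_def)
  ultimately show "\<exists>P. polyfun (p - 1) P \<and> (\<forall>x\<in>interior (convex hull L).
      (if x \<in> interior (convex hull K) then c else 0) - m x = P x)" by blast
qed

text \<open>The intended test function is constant on one element and 0 elsewhere. At an interior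
  vertex its projection onto the rigid motions is subtracted to make it admissible; on the
  projection both sides agree by \<open>rigid_compatible\<close>.\<close>

lemma local_equilibrium:
  assumes K: "K \<in> Th" and a: "a \<in> K"
  shows "ip (interior (convex hull K)) (D a) (\<lambda>x. c) = ip (interior (convex hull K)) (g a) (\<lambda>x. c)"
proof -
  let ?P = "patch Th a" and ?I = "interior (convex hull K)"
  interpret P: bounded_open ?P by (rule bounded_open_patch)
  have aV: "a \<in> vertices Th" using K a by (auto simp: vertices_def)
  have IP: "?I \<subseteq> ?P" by (rule interior_subset_patch[OF K a])
  define v where "v = (\<lambda>x. if x \<in> ?I then c else 0)"
  have Lv: "L2 ?P v" unfolding v_def
    by (rule L2_extend[OF bounded_open.L2_const[OF bounded_open_interior[OF K]] IP sets_patch sets_interior])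
  have res: "ip ?P w v = ip ?I w (\<lambda>x. c)" for w
    unfolding v_def ip_commute[of _ w] by (rule ip_extend_left[OF IP sets_patch sets_interior])
  have Lg: "L2 ?P (g a)" by (rule L2_g[OF patch_subset sets_patch])
  have zR: "(\<lambda>x. 0) \<in> rigid_motions" by (rule const_rigid)
  have "ip ?P (D a) v = ip ?P (g a) v"
  proof (cases "a \<in> \<Omega>")
    case False
    then have "V_a \<Omega> Th p a v" using V_a_minus_rigid[OF K zR, of a c] by (simp add: V_a_def v_def)
    then show ?thesis by (rule local_div_g[OF aV _ Lv])
  next
    case True
    obtain m where m: "m \<in> rigid_motions" "\<forall>z\<in>rigid_motions. ip ?P (\<lambda>x. v x - m x) z = 0"
      using P.rigid_projection[OF Lv] by (elim bexE) (rule that)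
    have Lm: "L2 ?P m" by (rule P.L2_rigid[OF m(1)])
    have "V_a \<Omega> Th p a (\<lambda>x. v x - m x)"
      unfolding V_a_def by (intro conjI impI m(2)) (unfold v_def, rule V_a_minus_rigid[OF K m(1)])
    from local_div_g[OF aV this L2_diff[OF Lv Lm]]
    have "ip ?P (D a) v - ip ?P (D a) m = ip ?P (g a) v - ip ?P (g a) m"
      unfolding ip_diff_right[OF sa_div(3)[OF aV] Lv Lm] ip_diff_right[OF Lg Lv Lm] .
    then show ?thesis using rigid_compatible[OF aV True m(1)] by simp
  qed
  then show ?thesis unfolding res .
qed

section \<open>The global stress\<close>

definition glue :: "(real^'n \<Rightarrow> real^'n \<Rightarrow> 'b::euclidean_space) \<Rightarrow> real^'n \<Rightarrow> 'b" where
  "glue w x = (\<Sum>a\<in>vertices Th. if x \<in> patch Th a then w a x else 0)"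

lemma glue_on:
  assumes K: "K \<in> Th" and x: "x \<in> interior (convex hull K)"
  shows "glue w x = (\<Sum>a\<in>K. w a x)"
  unfolding glue_def
proof (rule sum.mono_neutral_cong_right[OF finite_vertices])
  show "K \<subseteq> vertices Th" using K by (auto simp: vertices_def)
  show "\<forall>a\<in>vertices Th - K. (if x \<in> patch Th a then w a x else 0) = 0" using patch_interior[OF K x] by auto
  show "(if x \<in> patch Th a then w a x else 0) = w a x" if "a \<in> K" for a
    using interior_subset_patch[OF K that] x by auto
qed

lemma L2_glue:
  assumes "\<And>a. a \<in> vertices Th \<Longrightarrow> L2 (patch Th a) (w a)"
  shows "L2 \<Omega> (glue w)"
  unfolding glue_def
  by (rule L2_sum[OF finite_vertices]) (rule L2_extend[OF assms patch_subset sets_Omega sets_patch])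

text \<open>A test function supported in the open domain is admissible in the trace condition of
  interior and boundary vertices alike. Hence the zero extension of each local stress keeps its
  divergence.\<close>

lemma glue_div: "has_weak_div \<Omega> (glue sa) (glue D)"
  unfolding has_weak_div_def
proof (intro conjI allI impI)
  show "L2 \<Omega> (glue sa)" by (rule L2_glue[OF sa_div(2)])
  show "L2 \<Omega> (glue D)" by (rule L2_glue[OF sa_div(3)])
  fix i \<phi> assume \<phi>: "testfun \<Omega> \<phi>"
  let ?E = "\<lambda>a x. if x \<in> patch Th a then sa a x else 0" and ?F = "\<lambda>a x. if x \<in> patch Th a then D a x else 0"
  have LE: "L2 \<Omega> (?E a)" if "a \<in> vertices Th" for a
    by (rule L2_extend[OF sa_div(2)[OF that] patch_subset sets_Omega sets_patch])
  have LF: "L2 \<Omega> (?F a)" if "a \<in> vertices Th" for a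
    by (rule L2_extend[OF sa_div(3)[OF that] patch_subset sets_Omega sets_patch])
  have intE: "integrable (lebesgue_on \<Omega>) (\<lambda>x. \<Sum>j\<in>UNIV. ?E a x $ i $ j * pd j \<phi> x)" if "a \<in> vertices Th" for a
  proof (rule Bochner_Integration.integrable_sum)
    fix j
    show "integrable (lebesgue_on \<Omega>) (\<lambda>x. ?E a x $ i $ j * pd j \<phi> x)"
      using L2_ip_integrable[OF L2_nth2[OF LE[OF that]] L2_testfun(2)[OF \<phi>]] by simp
  qed
  have intF: "integrable (lebesgue_on \<Omega>) (\<lambda>x. ?F a x $ i * \<phi> x)" if "a \<in> vertices Th" for a
    using L2_ip_integrable[OF L2_nth[OF LF[OF that]] L2_testfun(1)[OF \<phi>]] by simp
  have zero: "(\<integral>x. (\<Sum>j\<in>UNIV. ?E a x $ i $ j * pd j \<phi> x) \<partial>lebesgue_on \<Omega>) + (\<integral>x. ?F a x $ i * \<phi> x \<partial>lebesgue_on \<Omega>) = 0"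
    if a: "a \<in> vertices Th" for a
  proof -
    have "\<Omega> \<subseteq> - frontier \<Omega>" using open_U by (auto simp: frontier_def interior_open)
    then have "testfun (if a \<in> \<Omega> then UNIV else - frontier \<Omega>) \<phi>" using testfun_mono[OF \<phi>] by simp
    then have "(\<integral>x. (\<Sum>j\<in>UNIV. sa a x $ i $ j * pd j \<phi> x) \<partial>lebesgue_on (patch Th a)) + (\<integral>x. D a x $ i * \<phi> x \<partial>lebesgue_on (patch Th a)) = 0"
      using stress[OF a] unfolding Sigma_a_def by blast
    moreover have "(\<integral>x. (\<Sum>j\<in>UNIV. ?E a x $ i $ j * pd j \<phi> x) \<partial>lebesgue_on \<Omega>)
        = (\<integral>x. (\<Sum>j\<in>UNIV. sa a x $ i $ j * pd j \<phi> x) \<partial>lebesgue_on (patch Th a))"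
    proof -
      have "(\<lambda>x. \<Sum>j\<in>UNIV. ?E a x $ i $ j * pd j \<phi> x)
          = (\<lambda>x. if x \<in> patch Th a then \<Sum>j\<in>UNIV. sa a x $ i $ j * pd j \<phi> x else 0)" by (rule ext) simp
      then show ?thesis using integral_extend[OF patch_subset sets_Omega sets_patch] by simp
    qed
    moreover have "(\<integral>x. ?F a x $ i * \<phi> x \<partial>lebesgue_on \<Omega>) = (\<integral>x. D a x $ i * \<phi> x \<partial>lebesgue_on (patch Th a))"
    proof -
      have "(\<lambda>x. ?F a x $ i * \<phi> x) = (\<lambda>x. if x \<in> patch Th a then D a x $ i * \<phi> x else 0)" by (rule ext) simp
      then show ?thesis using integral_extend[OF patch_subset sets_Omega sets_patch] by simp
    qed
    ultimately show ?thesis by simp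
  qed
  have "(\<integral>x. (\<Sum>j\<in>UNIV. glue sa x $ i $ j * pd j \<phi> x) \<partial>lebesgue_on \<Omega>)
      = (\<integral>x. (\<Sum>a\<in>vertices Th. \<Sum>j\<in>UNIV. ?E a x $ i $ j * pd j \<phi> x) \<partial>lebesgue_on \<Omega>)"
    unfolding glue_def sum_component sum_distrib_right by (subst sum.swap) (rule refl)
  also have "\<dots> = (\<Sum>a\<in>vertices Th. \<integral>x. (\<Sum>j\<in>UNIV. ?E a x $ i $ j * pd j \<phi> x) \<partial>lebesgue_on \<Omega>)"
    by (rule Bochner_Integration.integral_sum) (rule intE)
  finally have 1: "(\<integral>x. (\<Sum>j\<in>UNIV. glue sa x $ i $ j * pd j \<phi> x) \<partial>lebesgue_on \<Omega>)
      = (\<Sum>a\<in>vertices Th. \<integral>x. (\<Sum>j\<in>UNIV. ?E a x $ i $ j * pd j \<phi> x) \<partial>lebesgue_on \<Omega>)" .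
  have "(\<integral>x. glue D x $ i * \<phi> x \<partial>lebesgue_on \<Omega>) = (\<integral>x. (\<Sum>a\<in>vertices Th. ?F a x $ i * \<phi> x) \<partial>lebesgue_on \<Omega>)"
    unfolding glue_def sum_component sum_distrib_right ..
  also have "\<dots> = (\<Sum>a\<in>vertices Th. \<integral>x. ?F a x $ i * \<phi> x \<partial>lebesgue_on \<Omega>)"
    by (rule Bochner_Integration.integral_sum) (rule intF)
  finally have 2: "(\<integral>x. glue D x $ i * \<phi> x \<partial>lebesgue_on \<Omega>) = (\<Sum>a\<in>vertices Th. \<integral>x. ?F a x $ i * \<phi> x \<partial>lebesgue_on \<Omega>)" .
  have "(\<integral>x. (\<Sum>j\<in>UNIV. glue sa x $ i $ j * pd j \<phi> x) \<partial>lebesgue_on \<Omega>) + (\<integral>x. glue D x $ i * \<phi> x \<partial>lebesgue_on \<Omega>)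
     = (\<Sum>a\<in>vertices Th. (\<integral>x. (\<Sum>j\<in>UNIV. ?E a x $ i $ j * pd j \<phi> x) \<partial>lebesgue_on \<Omega>) + (\<integral>x. ?F a x $ i * \<phi> x \<partial>lebesgue_on \<Omega>))"
    unfolding 1 2 by (rule sum.distrib[symmetric])
  also have "\<dots> = 0" by (rule sum.neutral) (use zero in blast)
  finally show "(\<integral>x. (\<Sum>j\<in>UNIV. glue sa x $ i $ j * pd j \<phi> x) \<partial>lebesgue_on \<Omega>) = - (\<integral>x. glue D x $ i * \<phi> x \<partial>lebesgue_on \<Omega>)"
    by simp
qed

lemma L2_glue_sa: "L2 \<Omega> (glue sa)" and L2_glue_D: "L2 \<Omega> (glue D)"
  using glue_div unfolding has_weak_div_def by blast+

text \<open>Test functions on the element are test functions on the domain, so the elementwise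
  divergence is the restriction of the global one.\<close>

lemma weak_div_element:
  assumes K: "K \<in> Th"
  shows "L2 (interior (convex hull K)) (weak_div (interior (convex hull K)) (glue sa))"
    and "AE x in lebesgue_on (interior (convex hull K)). weak_div (interior (convex hull K)) (glue sa) x = glue D x"
proof -
  let ?I = "interior (convex hull K)"
  have IO: "?I \<subseteq> \<Omega>" by (rule interior_subset_Omega[OF K])
  have res: "(\<integral>x. F x \<partial>lebesgue_on ?I) = (\<integral>x. F x \<partial>lebesgue_on \<Omega>)" if "\<And>x. x \<notin> ?I \<Longrightarrow> F x = (0::real)" for F
  proof -
    have "F = (\<lambda>x. if x \<in> ?I then F x else 0)" using that by auto
    then show ?thesis using integral_extend[OF IO sets_Omega sets_interior, of F] by simp
  qed
  have "has_weak_div ?I (glue sa) (glue D)"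
    unfolding has_weak_div_def
  proof (intro conjI allI impI)
    show "L2 ?I (glue sa)" "L2 ?I (glue D)"
      by (rule L2_subset[OF L2_glue_sa IO sets_Omega sets_interior], rule L2_subset[OF L2_glue_D IO sets_Omega sets_interior])
    fix i \<phi> assume \<phi>: "testfun ?I \<phi>"
    have 1: "(\<integral>x. (\<Sum>j\<in>UNIV. glue sa x $ i $ j * pd j \<phi> x) \<partial>lebesgue_on ?I) = (\<integral>x. (\<Sum>j\<in>UNIV. glue sa x $ i $ j * pd j \<phi> x) \<partial>lebesgue_on \<Omega>)"
      by (rule res) (simp add: testfun_outside[OF \<phi>])
    have 2: "(\<integral>x. glue D x $ i * \<phi> x \<partial>lebesgue_on ?I) = (\<integral>x. glue D x $ i * \<phi> x \<partial>lebesgue_on \<Omega>)"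
      by (rule res) (simp add: testfun_outside[OF \<phi>])
    have "testfun \<Omega> \<phi>" by (rule testfun_mono[OF \<phi> IO])
    then show "(\<integral>x. (\<Sum>j\<in>UNIV. glue sa x $ i $ j * pd j \<phi> x) \<partial>lebesgue_on ?I) = - (\<integral>x. glue D x $ i * \<phi> x \<partial>lebesgue_on ?I)"
      unfolding 1 2 using glue_div unfolding has_weak_div_def by blast
  qed
  note w = bounded_open.weak_div_props[OF bounded_open_interior[OF K] this]
  show "L2 ?I (weak_div ?I (glue sa))" using w(1) unfolding has_weak_div_def by blast
  show "AE x in lebesgue_on ?I. weak_div ?I (glue sa) x = glue D x" by (rule w(2))
qed

text \<open>Sum \<open>local_equilibrium\<close> over the vertices of \<open>K\<close>: the hat
  functions add up to 1 and their gradients to 0, so the data add up to \<open>- f\<close>.\<close>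

lemma residual_mean_zero:
  assumes K: "K \<in> Th"
  shows "ip (interior (convex hull K)) (\<lambda>x. f x + glue D x) (\<lambda>x. c) = 0"
proof -
  let ?I = "interior (convex hull K)"
  interpret I: bounded_open ?I by (rule bounded_open_interior[OF K])
  have IO: "?I \<subseteq> \<Omega>" by (rule interior_subset_Omega[OF K])
  have finK: "finite K" by (rule full_simplex.finite_K[OF full_simplex[OF K]])
  have aV: "a \<in> vertices Th" if "a \<in> K" for a using K that by (auto simp: vertices_def)
  have Lf: "L2 ?I f" by (rule L2_subset[OF f IO sets_Omega sets_interior])
  have Ld: "L2 ?I (glue D)" by (rule L2_subset[OF L2_glue_D IO sets_Omega sets_interior])
  have Lc: "L2 ?I (\<lambda>x. c)" by (rule I.L2_const)
  have LD: "L2 ?I (D a)" if "a \<in> K" for a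
    by (rule L2_subset[OF sa_div(3)[OF aV[OF that]] interior_subset_patch[OF K that] sets_patch sets_interior])
  have Lg: "L2 ?I (g a)" for a by (rule L2_g[OF IO sets_interior])
  have gsum: "(\<Sum>a\<in>K. g a x) = - f x" if x: "x \<in> ?I" for x
  proof -
    have "(\<Sum>a\<in>K. g a x) = - ((\<Sum>a\<in>K. hat Th a x) *\<^sub>R f x) + S x *v (\<Sum>a\<in>K. hatg a x)"
      unfolding g_def sum.distrib sum_negf scaleR_left.sum
      by (simp add: linear_sum[OF matrix_vector_mul_linear])
    then show ?thesis using sum_hat[OF K subsetD[OF interior_subset x]] sum_hatg[OF K x] by simp
  qed
  have "ip ?I (glue D) (\<lambda>x. c) = ip ?I (\<lambda>x. \<Sum>a\<in>K. D a x) (\<lambda>x. c)"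
    unfolding ip_def by (rule Bochner_Integration.integral_cong) (simp_all add: glue_on[OF K])
  also have "\<dots> = (\<Sum>a\<in>K. ip ?I (D a) (\<lambda>x. c))" by (rule ip_sum_left[OF finK LD Lc])
  also have "\<dots> = (\<Sum>a\<in>K. ip ?I (g a) (\<lambda>x. c))" by (rule sum.cong[OF refl local_equilibrium[OF K]])
  also have "\<dots> = ip ?I (\<lambda>x. \<Sum>a\<in>K. g a x) (\<lambda>x. c)" by (rule ip_sum_left[OF finK Lg Lc, symmetric])
  also have "\<dots> = ip ?I (\<lambda>x. (-1) *\<^sub>R f x) (\<lambda>x. c)"
    unfolding ip_def by (rule Bochner_Integration.integral_cong) (simp_all add: gsum)
  also have "\<dots> = - ip ?I f (\<lambda>x. c)" by (simp only: ip_scaleR_left)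
  finally show ?thesis unfolding ip_add_left[OF Lc Lf Ld] by simp
qed

end

section \<open>Green's formula and estimates on elements\<close>

context bounded_open
begin

text \<open>The defining identity of the weak divergence, passed to the limit along the
  approximating test functions.\<close>

lemma green_H10:
  assumes \<tau>: "has_weak_div U \<tau> E" and e: "H10 U e"
  shows "ip U \<tau> (weak_grad U e) + ip U E e = 0"
proof -
  have L\<tau>: "L2 U \<tau>" and LE: "L2 U E" using \<tau> unfolding has_weak_div_def by blast+
  obtain \<phi> where \<phi>: "\<And>k::nat. vtest U (\<phi> k)" "(\<lambda>k. L2norm U (\<lambda>x. \<phi> k x - e x)) \<longlonglongrightarrow> 0"
    "(\<lambda>k. L2norm U (\<lambda>x. jac (\<phi> k) x - weak_grad U e x)) \<longlonglongrightarrow> 0" "L2 U e" "L2 U (weak_grad U e)"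
    by (rule H10_sequence[OF e]) (rule that)
  have "ip U \<tau> (jac (\<phi> k)) + ip U E (\<phi> k) = 0" for k
  proof -
    have t: "testfun U (\<lambda>x. \<phi> k x $ i)" for i using \<phi>(1) by (simp add: vtest_def)
    have "ip U \<tau> (jac (\<phi> k)) = (\<Sum>i\<in>UNIV. \<integral>x. (\<Sum>j\<in>UNIV. \<tau> x $ i $ j * pd j (\<lambda>x. \<phi> k x $ i) x) \<partial>lebesgue_on U)"
      unfolding ip_def inner_vec_def jac_nth inner_real_def
    proof (rule Bochner_Integration.integral_sum, rule Bochner_Integration.integrable_sum)
      fix i j
      show "integrable (lebesgue_on U) (\<lambda>x. \<tau> x $ i $ j * pd j (\<lambda>x. \<phi> k x $ i) x)"
        using L2_ip_integrable[OF L2_nth2[OF L\<tau>] L2_testfun(2)[OF t]] by simp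
    qed
    moreover have "ip U E (\<phi> k) = (\<Sum>i\<in>UNIV. \<integral>x. E x $ i * \<phi> k x $ i \<partial>lebesgue_on U)"
      unfolding ip_def inner_vec_def inner_real_def
    proof (rule Bochner_Integration.integral_sum)
      fix i
      show "integrable (lebesgue_on U) (\<lambda>x. E x $ i * \<phi> k x $ i)"
        using L2_ip_integrable[OF L2_nth[OF LE] L2_testfun(1)[OF t]] by simp
    qed
    moreover have "(\<integral>x. (\<Sum>j\<in>UNIV. \<tau> x $ i $ j * pd j (\<lambda>x. \<phi> k x $ i) x) \<partial>lebesgue_on U) + (\<integral>x. E x $ i * \<phi> k x $ i \<partial>lebesgue_on U) = 0" for i
      using \<tau> t[of i] unfolding has_weak_div_def by simp
    ultimately show ?thesis by (simp add: sum.distrib[symmetric])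
  qed
  moreover have "(\<lambda>k. ip U \<tau> (jac (\<phi> k)) + ip U E (\<phi> k)) \<longlonglongrightarrow> ip U \<tau> (weak_grad U e) + ip U E e"
    by (intro tendsto_add ip_tendsto[OF L\<tau> \<phi>(5) L2_vtest(2)[OF \<phi>(1)] \<phi>(3)] ip_tendsto[OF LE \<phi>(4) L2_vtest(1)[OF \<phi>(1)] \<phi>(2)])
  ultimately show ?thesis using LIMSEQ_unique[OF _ tendsto_const[of 0]] by simp
qed

end

context mesh
begin

lemma sets_hull:
  assumes "K \<in> Th"
  shows "convex hull K \<in> sets lebesgue"
  using closed_hull[OF assms] by simp

text \<open>The estimator uses norms over closed elements and over their interiors; the difference
  is a null set.\<close>

lemma integral_hull:
  fixes F :: "real^'n \<Rightarrow> real"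
  assumes K: "K \<in> Th" and F: "F \<in> borel_measurable (lebesgue_on (interior (convex hull K)))"
  shows "integral\<^sup>L (lebesgue_on (convex hull K)) F = integral\<^sup>L (lebesgue_on (interior (convex hull K))) F"
proof -
  let ?I = "interior (convex hull K)"
  have 0: "(\<lambda>x. if x \<in> ?I then F x else 0) \<in> borel_measurable lebesgue" by (rule borel_measurable_if_I[OF F sets_interior])
  have "AE x in lebesgue_on UNIV. x \<notin> Nf" by (rule AE_Nf) simp
  then have ae: "AE x in lebesgue. (if x \<in> ?I then F x else 0) = (if x \<in> convex hull K then F x else 0)"
    unfolding lebesgue_on_UNIV_eq
  proof eventually_elim
    case (elim x)
    then show ?case using not_Nf_interior[OF K _ elim] subsetD[OF interior_subset, of x "convex hull K"] by auto
  qed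
  \<comment> \<open>Lebesgue measure is complete, so measurability survives the change on a null
    set.\<close>
  have 1: "(\<lambda>x. if x \<in> convex hull K then F x else 0) \<in> borel_measurable lebesgue" by (rule borel_measurable_AE[OF 0 ae])
  have "integral\<^sup>L (lebesgue_on (convex hull K)) F = integral\<^sup>L lebesgue (\<lambda>x. if x \<in> convex hull K then F x else 0)"
    using integral_extend[OF subset_UNIV _ sets_hull[OF K], where f = F] by (simp add: lebesgue_on_UNIV_eq)
  also have "\<dots> = integral\<^sup>L lebesgue (\<lambda>x. if x \<in> ?I then F x else 0)"
    by (rule integral_cong_AE[OF 1 0]) (use ae in eventually_elim, simp)
  also have "\<dots> = integral\<^sup>L (lebesgue_on ?I) F"
    using integral_extend[OF subset_UNIV _ sets_interior[of K], where f = F] by (simp add: lebesgue_on_UNIV_eq)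
  finally show ?thesis .
qed

lemma L2norm_hull:
  assumes K: "K \<in> Th" and q: "L2 (interior (convex hull K)) q"
  shows "L2norm (convex hull K) q = L2norm (interior (convex hull K)) q"
  unfolding L2norm_def by (subst integral_hull[OF K borel_measurable_integrable[OF L2_integrable[OF q]]]) (rule refl)

text \<open>\<open>q\<close> is given on the open element and is extended by 0 to the closed one,
  where \<open>simplex_dual_poincare\<close> applies.\<close>

lemma element_poincare_vtest:
  assumes d: "CARD('n) = 2 \<or> CARD('n) = 3" and K: "K \<in> Th"
    and q: "L2 (interior (convex hull K)) q" "\<And>c. ip (interior (convex hull K)) q (\<lambda>x. c) = 0"
    and \<phi>: "vtest V \<phi>"
  shows "\<bar>ip (interior (convex hull K)) q \<phi>\<bar>
    \<le> diameter (convex hull K) / pi * L2norm (interior (convex hull K)) q * L2norm (interior (convex hull K)) (jac \<phi>)"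
proof -
  let ?I = "interior (convex hull K)"
  interpret I: bounded_open ?I by (rule bounded_open_interior[OF K])
  define w where "w = (\<lambda>x. if x \<in> ?I then q x else 0)"
  have Lw: "L2 (convex hull K) w" unfolding w_def by (rule L2_extend[OF q(1) interior_subset sets_hull[OF K] sets_interior])
  have "(\<integral>x. w x $ i \<partial>lebesgue_on (convex hull K)) = 0" for i
  proof -
    have "(\<lambda>x. w x $ i) = (\<lambda>x. if x \<in> ?I then q x $ i else 0)" by (rule ext) (simp add: w_def)
    then have "(\<integral>x. w x $ i \<partial>lebesgue_on (convex hull K)) = (\<integral>x. q x $ i \<partial>lebesgue_on ?I)"
      using integral_extend[OF interior_subset sets_hull[OF K] sets_interior] by simp
    also have "\<dots> = ip ?I q (\<lambda>x. axis i 1)" by (simp add: ip_def cart_eq_inner_axis)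
    finally show ?thesis using q(2) by simp
  qed
  from simplex_dual_poincare[OF d full_simplex[OF K] Lw this \<phi>]
  have "\<bar>ip (convex hull K) w \<phi>\<bar> \<le> diameter (convex hull K) / pi * L2norm (convex hull K) w * L2norm (convex hull K) (jac \<phi>)" .
  moreover have "ip (convex hull K) w \<phi> = ip ?I q \<phi>"
    unfolding w_def by (rule ip_extend_left[OF interior_subset sets_hull[OF K] sets_interior])
  moreover have "L2norm (convex hull K) w = L2norm ?I q"
  proof -
    have "L2norm (convex hull K) w = L2norm ?I w"
      by (rule L2norm_hull[OF K L2_subset[OF Lw interior_subset sets_hull[OF K] sets_interior]])
    also have "\<dots> = L2norm ?I q"
      unfolding L2norm_def by (intro arg_cong[of _ _ sqrt] Bochner_Integration.integral_cong) (simp_all add: w_def)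
    finally show ?thesis .
  qed
  moreover have "L2norm (convex hull K) (jac \<phi>) = L2norm ?I (jac \<phi>)" by (rule L2norm_hull[OF K I.L2_vtest(2)[OF \<phi>]])
  ultimately show ?thesis by simp
qed

lemma element_poincare:
  assumes d: "CARD('n) = 2 \<or> CARD('n) = 3" and K: "K \<in> Th"
    and q: "L2 (interior (convex hull K)) q" "\<And>c. ip (interior (convex hull K)) q (\<lambda>x. c) = 0"
    and e: "H10 \<Omega> e"
  shows "\<bar>ip (interior (convex hull K)) q e\<bar>
    \<le> diameter (convex hull K) / pi * L2norm (interior (convex hull K)) q * L2norm (interior (convex hull K)) (weak_grad \<Omega> e)"
proof -
  let ?I = "interior (convex hull K)"
  interpret I: bounded_open ?I by (rule bounded_open_interior[OF K])
  have IO: "?I \<subseteq> \<Omega>" by (rule interior_subset_Omega[OF K])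
  obtain \<phi> where \<phi>: "\<And>k::nat. vtest \<Omega> (\<phi> k)" "(\<lambda>k. L2norm \<Omega> (\<lambda>x. \<phi> k x - e x)) \<longlonglongrightarrow> 0"
    "(\<lambda>k. L2norm \<Omega> (\<lambda>x. jac (\<phi> k) x - weak_grad \<Omega> e x)) \<longlonglongrightarrow> 0" "L2 \<Omega> e" "L2 \<Omega> (weak_grad \<Omega> e)"
    by (rule H10_sequence[OF e]) (rule that)
  note sub = L2_subset[OF _ IO sets_U sets_interior]
  have l1: "(\<lambda>k. L2norm ?I (\<lambda>x. \<phi> k x - e x)) \<longlonglongrightarrow> 0"
    by (rule tendsto_sandwich[OF _ _ tendsto_const \<phi>(2)])
      (intro always_eventually allI L2norm_nonneg,
        intro always_eventually allI L2norm_mono_set[OF L2_diff[OF L2_vtest(1)[OF \<phi>(1)] \<phi>(4)] IO sets_U sets_interior])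
  have l2: "(\<lambda>k. L2norm ?I (\<lambda>x. jac (\<phi> k) x - weak_grad \<Omega> e x)) \<longlonglongrightarrow> 0"
    by (rule tendsto_sandwich[OF _ _ tendsto_const \<phi>(3)])
      (intro always_eventually allI L2norm_nonneg,
        intro always_eventually allI L2norm_mono_set[OF L2_diff[OF L2_vtest(2)[OF \<phi>(1)] \<phi>(5)] IO sets_U sets_interior])
  have t1: "(\<lambda>k. \<bar>ip ?I q (\<phi> k)\<bar>) \<longlonglongrightarrow> \<bar>ip ?I q e\<bar>"
    by (intro tendsto_rabs ip_tendsto[OF q(1) sub[OF \<phi>(4)] I.L2_vtest(1)[OF \<phi>(1)] l1])
  have t2: "(\<lambda>k. diameter (convex hull K) / pi * L2norm ?I q * L2norm ?I (jac (\<phi> k)))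
      \<longlonglongrightarrow> diameter (convex hull K) / pi * L2norm ?I q * L2norm ?I (weak_grad \<Omega> e)"
    by (intro tendsto_mult tendsto_const L2norm_tendsto[OF sub[OF \<phi>(5)] I.L2_vtest(2)[OF \<phi>(1)] l2])
  show ?thesis
    by (rule LIMSEQ_le[OF t1 t2]) (intro exI[of _ 0] allI impI element_poincare_vtest[OF d K q \<phi>(1)])
qed

text \<open>The interiors of the elements are disjoint and exhaust the domain up to the null set
  \<open>Nf\<close>.\<close>

lemma ip_split:
  fixes a :: "real^'n \<Rightarrow> 'b::euclidean_space"
  assumes a: "L2 \<Omega> a" and b: "L2 \<Omega> b"
  shows "ip \<Omega> a b = (\<Sum>K\<in>Th. ip (interior (convex hull K)) a b)"
proof -
  let ?A = "\<lambda>K x. if x \<in> interior (convex hull K) then a x else 0"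
  have LA: "L2 \<Omega> (?A K)" if "K \<in> Th" for K
    by (rule L2_extend[OF L2_subset[OF a interior_subset_Omega[OF that] sets_U sets_interior]
          interior_subset_Omega[OF that] sets_U sets_interior])
  have "ip \<Omega> a b = ip \<Omega> (\<lambda>x. \<Sum>K\<in>Th. ?A K x) b"
  proof (rule ip_cong_AE[OF a L2_sum[OF finite_Th LA] b b])
    show "AE x in lebesgue_on \<Omega>. a x = (\<Sum>K\<in>Th. ?A K x)"
      using AE_Nf[OF sets_U] AE_space
    proof eventually_elim
      case (elim x)
      then have "x \<in> T" using Omega_subset_T by (simp add: subset_iff)
      then obtain K where K: "K \<in> Th" "x \<in> interior (convex hull K)" by (rule T_cases[OF _ elim(1)]) (rule that)
      have "(\<Sum>L\<in>Th. ?A L x) = (\<Sum>L\<in>Th. if L = K then a x else 0)"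
      proof (rule sum.cong[OF refl])
        show "?A L x = (if L = K then a x else 0)" if "L \<in> Th" for L
          using interiors_disjoint[OF that K(1)] K(2) by auto
      qed
      then show ?case using K(1) finite_Th by simp
    qed
  qed simp_all
  also have "\<dots> = (\<Sum>K\<in>Th. ip \<Omega> (?A K) b)" by (rule ip_sum_left[OF finite_Th LA b])
  also have "\<dots> = (\<Sum>K\<in>Th. ip (interior (convex hull K)) a b)"
    by (rule sum.cong[OF refl]) (rule ip_extend_left[OF interior_subset_Omega sets_U sets_interior])
  finally show ?thesis .
qed

end

section \<open>Residual bound and error estimate\<close>

lemma (in equilibration) residual_bound:
  assumes d: "CARD('n) = 2 \<or> CARD('n) = 3" and e: "H10 \<Omega> e"
  shows "ip \<Omega> f e - ip \<Omega> S (weak_grad \<Omega> e)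
    \<le> sqrt (\<Sum>K\<in>Th. (diameter (convex hull K) / pi
           * L2norm (interior (convex hull K)) (\<lambda>x. f x + weak_div (interior (convex hull K)) (glue sa) x)
         + L2norm (convex hull K) (\<lambda>x. glue sa x - S x))\<^sup>2) * L2norm \<Omega> (weak_grad \<Omega> e)"
proof -
  let ?I = "\<lambda>K. interior (convex hull K)" and ?G = "weak_grad \<Omega> e"
  define \<eta> where "\<eta> K = diameter (convex hull K) / pi * L2norm (?I K) (\<lambda>x. f x + weak_div (?I K) (glue sa) x)
         + L2norm (convex hull K) (\<lambda>x. glue sa x - S x)" for K
  define q where "q = (\<lambda>x. f x + glue D x)"
  define t where "t = (\<lambda>x. glue sa x - S x)"
  have Le: "L2 \<Omega> e" and LG: "L2 \<Omega> ?G"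
    by (rule H10_sequence[OF e], assumption)+
  have Lq: "L2 \<Omega> q" unfolding q_def by (rule L2_add[OF f L2_glue_D])
  have Lt: "L2 \<Omega> t" unfolding t_def by (rule L2_diff[OF L2_glue_sa S])
  note sub = L2_subset[OF _ interior_subset_Omega sets_U sets_interior]
  \<comment> \<open>Green's formula for the glued stress is added; it contributes 0.\<close>
  have "ip \<Omega> f e - ip \<Omega> S ?G = ip \<Omega> q e + ip \<Omega> t ?G"
    unfolding q_def t_def ip_add_left[OF Le f L2_glue_D] ip_diff_left[OF LG L2_glue_sa S]
    using green_H10[OF glue_div e] by simp
  also have "\<dots> = (\<Sum>K\<in>Th. ip (?I K) q e + ip (?I K) t ?G)"
    unfolding ip_split[OF Lq Le] ip_split[OF Lt LG] by (rule sum.distrib[symmetric])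
  \<comment> \<open>The absolute values put the sum into the form of the finite Cauchy--Schwarz
    inequality \<open>L2_set_mult_ineq\<close>.\<close>
  also have "\<dots> \<le> (\<Sum>K\<in>Th. \<bar>\<eta> K\<bar> * \<bar>L2norm (?I K) ?G\<bar>)"
  proof (rule sum_mono)
    fix K assume K: "K \<in> Th"
    have IO: "?I K \<subseteq> \<Omega>" by (rule interior_subset_Omega[OF K])
    note sK = L2_subset[OF _ IO sets_U sets_interior]
    have 1: "\<bar>ip (?I K) q e\<bar> \<le> diameter (convex hull K) / pi * L2norm (?I K) q * L2norm (?I K) ?G"
      by (rule element_poincare[OF d K sK[OF Lq] _ e]) (unfold q_def, rule residual_mean_zero[OF K])
    have 2: "\<bar>ip (?I K) t ?G\<bar> \<le> L2norm (?I K) t * L2norm (?I K) ?G" by (rule ip_cauchy[OF sK[OF Lt] sK[OF LG]])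
    have "L2norm (?I K) q = L2norm (?I K) (\<lambda>x. f x + weak_div (?I K) (glue sa) x)"
    proof (rule L2norm_cong_AE[OF sK[OF Lq] L2_add[OF sK[OF f] weak_div_element(1)[OF K]]])
      show "AE x in lebesgue_on (?I K). q x = f x + weak_div (?I K) (glue sa) x"
        using weak_div_element(2)[OF K] by eventually_elim (simp add: q_def)
    qed
    moreover have "L2norm (convex hull K) t = L2norm (?I K) t" by (rule L2norm_hull[OF K sK[OF Lt]])
    ultimately have "\<eta> K = diameter (convex hull K) / pi * L2norm (?I K) q + L2norm (?I K) t"
      by (simp add: \<eta>_def t_def)
    then have "ip (?I K) q e + ip (?I K) t ?G \<le> \<eta> K * L2norm (?I K) ?G"
      using 1 2 by (simp add: distrib_right)
    also have "\<dots> \<le> \<bar>\<eta> K * L2norm (?I K) ?G\<bar>" by (rule abs_ge_self)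
    finally show "ip (?I K) q e + ip (?I K) t ?G \<le> \<bar>\<eta> K\<bar> * \<bar>L2norm (?I K) ?G\<bar>" unfolding abs_mult .
  qed
  also have "\<dots> \<le> L2_set \<eta> Th * L2_set (\<lambda>K. L2norm (?I K) ?G) Th" by (rule L2_set_mult_ineq)
  also have "L2_set (\<lambda>K. L2norm (?I K) ?G) Th = L2norm \<Omega> ?G"
  proof -
    have "(\<Sum>K\<in>Th. (L2norm (?I K) ?G)\<^sup>2) = (L2norm \<Omega> ?G)\<^sup>2"
      unfolding L2norm_sq ip_split[OF LG LG] ..
    then show ?thesis by (simp add: L2_set_def L2norm_nonneg)
  qed
  finally show ?thesis unfolding L2_set_def \<eta>_def .
qed

theorem theorem4p1:
  fixes \<Omega> :: "(real^'n) set"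
    and Th :: "(real^'n) set set"
    and p :: nat
    and f :: "real^'n \<Rightarrow> real^'n"
    and \<sigma> :: "real^'n^'n \<Rightarrow> real^'n^'n"
    and Cgro Cmon :: real
    and u uh :: "real^'n \<Rightarrow> real^'n"
    and sa :: "real^'n \<Rightarrow> real^'n \<Rightarrow> real^'n^'n"
    and ra :: "real^'n \<Rightarrow> real^'n \<Rightarrow> real^'n"
    and la :: "real^'n \<Rightarrow> real^'n \<Rightarrow> real^'n^'n"
  assumes dim: "CARD('n) = 2 \<or> CARD('n) = 3"
    and dom: "\<Omega> \<noteq> {}" "open \<Omega>" "bounded \<Omega>" "simply_connected \<Omega>"
    and mesh: "simplicial_mesh \<Omega> Th"
    and p: "p \<ge> 2"
    and f: "L2 \<Omega> f"
    and sigma_cont: "continuous_on {\<tau>. transpose \<tau> = \<tau>} \<sigma>"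
    and sigma_zero: "\<sigma> 0 = 0"
    and sigma_sym: "\<And>\<tau>. transpose \<tau> = \<tau> \<Longrightarrow> transpose (\<sigma> \<tau>) = \<sigma> \<tau>"
    and Cpos: "Cgro > 0" "Cmon > 0"
    and gro: "\<And>\<tau>. transpose \<tau> = \<tau> \<Longrightarrow> norm (\<sigma> \<tau>) \<le> Cgro * norm \<tau>"
    and mon: "\<And>\<tau> \<eta>. transpose \<tau> = \<tau> \<Longrightarrow> transpose \<eta> = \<eta> \<Longrightarrow>
               (\<sigma> \<tau> - \<sigma> \<eta>) \<bullet> (\<tau> - \<eta>) \<ge> Cmon\<^sup>2 * (norm (\<tau> - \<eta>))\<^sup>2"
    and u: "H10 \<Omega> u"
    and u_eq: "\<And>v. H10 \<Omega> v \<Longrightarrow> ip \<Omega> (\<lambda>x. \<sigma> (eps \<Omega> u x)) (eps \<Omega> v) = ip \<Omega> f v"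
    and uh: "H10 \<Omega> uh" "pw_poly p Th uh"
    and uh_eq: "\<And>vh. H10 \<Omega> vh \<Longrightarrow> pw_poly p Th vh \<Longrightarrow>
                 ip \<Omega> (\<lambda>x. \<sigma> (eps \<Omega> uh x)) (eps \<Omega> vh) = ip \<Omega> f vh"
    and local: "\<And>a. a \<in> vertices Th \<Longrightarrow>
       patch_solution \<Omega> Th p a
         (\<lambda>x. hat Th a x *\<^sub>R \<sigma> (eps \<Omega> uh x))
         (\<lambda>x. - (hat Th a x *\<^sub>R f x) + \<sigma> (eps \<Omega> uh x) *v weak_grad_s (patch Th a) (hat Th a) x)
         (sa a) (ra a) (la a)"
  defines "\<sigma>h \<equiv> (\<lambda>x. \<Sum>a\<in>vertices Th. if x \<in> patch Th a then sa a x else 0)"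
  shows "sqrt (integral\<^sup>L (lebesgue_on \<Omega>) (\<lambda>x. \<sigma> (eps \<Omega> (\<lambda>y. u y - uh y) x) \<bullet> eps \<Omega> (\<lambda>y. u y - uh y) x))
     \<le> sqrt 2 * Cgro / Cmon ^ 3 *
        sqrt (\<Sum>K\<in>Th. (diameter (convex hull K) / pi
                 * L2norm (interior (convex hull K)) (\<lambda>x. f x + weak_div (interior (convex hull K)) \<sigma>h x)
               + L2norm (convex hull K) (\<lambda>x. \<sigma>h x - \<sigma> (eps \<Omega> uh x)))\<^sup>2)"
proof -
  interpret mesh \<Omega> Th using dom mesh by unfold_locales
  define S where "S = (\<lambda>x. \<sigma> (eps \<Omega> uh x))"
  have eps_sym: "transpose (eps \<Omega> w x) = eps \<Omega> w x" for w x by (simp add: eps_symm transpose_symm)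
  \<comment> \<open>\<open>\<sigma>\<close> is continuous on symmetric matrices; composing it with
    \<open>symm\<close> gives a function continuous everywhere, from which measurability of the
    stresses follows.\<close>
  have cont: "continuous_on UNIV (\<lambda>M. \<sigma> (symm M))"
    by (rule continuous_on_compose2[OF sigma_cont linear_continuous_on[OF bounded_linear_symm]]) (auto simp: transpose_symm)
  have L\<sigma>: "L2 \<Omega> (\<lambda>x. \<sigma> (eps \<Omega> w x))" if "H10 \<Omega> w" for w
  proof (rule L2_bound[OF korn(2)[OF that]])
    have "(\<lambda>x. \<sigma> (symm (eps \<Omega> w x))) \<in> borel_measurable (lebesgue_on \<Omega>)"
      by (rule measurable_compose[OF L2_measurable[OF korn(2)[OF that]] borel_measurable_continuous_onI[OF cont]])
    then show "(\<lambda>x. \<sigma> (eps \<Omega> w x)) \<in> borel_measurable (lebesgue_on \<Omega>)" by (simp add: symm_eq[OF eps_sym])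
    show "AE x in lebesgue_on \<Omega>. norm (\<sigma> (eps \<Omega> w x)) \<le> Cgro * norm (eps \<Omega> w x)"
      by (rule AE_I2) (rule gro[OF eps_sym])
  qed
  interpret E: equilibration \<Omega> Th p f S sa
  proof unfold_locales
    show "L2 \<Omega> S" unfolding S_def by (rule L\<sigma>[OF uh(1)])
    show "transpose (S x) = S x" for x unfolding S_def by (rule sigma_sym[OF eps_sym])
    show "ip \<Omega> S (eps \<Omega> v) = ip \<Omega> f v" if "H10 \<Omega> v" "pw_poly p Th v" for v
      unfolding S_def by (rule uh_eq[OF that])
    fix a assume "a \<in> vertices Th"
    note sol = local[OF this, unfolded patch_solution_def]
    show "Sigma_a \<Omega> Th p a (sa a)" using sol by blast
    show "ip (patch Th a) (weak_div (patch Th a) (sa a)) v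
       = ip (patch Th a) (\<lambda>x. - (hat Th a x *\<^sub>R f x) + S x *v weak_grad_s (patch Th a) (hat Th a) x) v"
      if "V_a \<Omega> Th p a v" for v using sol that unfolding S_def by blast
    show "ip (patch Th a) (sa a) \<mu> = 0" if "Lambda_a Th p a \<mu>" for \<mu> using sol that by blast
  qed (rule p, rule f)
  have \<sigma>h: "\<sigma>h = E.glue sa" unfolding \<sigma>h_def by (rule ext) (simp add: E.glue_def)
  define e where "e = (\<lambda>y. u y - uh y)"
  define \<eta> where "\<eta> = sqrt (\<Sum>K\<in>Th. (diameter (convex hull K) / pi
                 * L2norm (interior (convex hull K)) (\<lambda>x. f x + weak_div (interior (convex hull K)) \<sigma>h x)
               + L2norm (convex hull K) (\<lambda>x. \<sigma>h x - \<sigma> (eps \<Omega> uh x)))\<^sup>2)"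
  have \<eta>: "0 \<le> \<eta>" unfolding \<eta>_def by (intro real_sqrt_ge_zero sum_nonneg zero_le_power2)
  have e: "H10 \<Omega> e" unfolding e_def by (rule H10_diff(1)[OF u uh(1)])
  \<comment> \<open>Only almost everywhere, because \<open>weak_grad\<close> is chosen separately
    for each of the three functions.\<close>
  have eae: "AE x in lebesgue_on \<Omega>. eps \<Omega> u x - eps \<Omega> uh x = eps \<Omega> e x"
    using H10_diff(2)[OF u uh(1)] unfolding e_def[symmetric]
    by eventually_elim (simp add: eps_symm linear_diff[OF bounded_linear.linear[OF bounded_linear_symm]])
  have Lu: "L2 \<Omega> (eps \<Omega> u)" and Luh: "L2 \<Omega> (eps \<Omega> uh)" and Le: "L2 \<Omega> (eps \<Omega> e)"
    by (rule korn(2), fact)+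
  have Ld: "L2 \<Omega> (\<lambda>x. eps \<Omega> u x - eps \<Omega> uh x)" by (rule L2_diff[OF Lu Luh])
  have Lsd: "L2 \<Omega> (\<lambda>x. \<sigma> (eps \<Omega> u x) - S x)" by (rule L2_diff[OF L\<sigma>[OF u] E.S])
  let ?N = "L2norm \<Omega> (eps \<Omega> e)"
  have "Cmon\<^sup>2 * ?N\<^sup>2 = Cmon\<^sup>2 * (L2norm \<Omega> (\<lambda>x. eps \<Omega> u x - eps \<Omega> uh x))\<^sup>2"
    by (simp add: L2norm_cong_AE[OF Ld Le eae])
  also have "\<dots> = (\<integral>x. Cmon\<^sup>2 * (norm (eps \<Omega> u x - eps \<Omega> uh x))\<^sup>2 \<partial>lebesgue_on \<Omega>)"
    unfolding L2norm_sq ip_def by (simp add: power2_norm_eq_inner)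
  also have "\<dots> \<le> ip \<Omega> (\<lambda>x. \<sigma> (eps \<Omega> u x) - S x) (\<lambda>x. eps \<Omega> u x - eps \<Omega> uh x)"
    unfolding ip_def S_def
  proof (rule Bochner_Integration.integral_mono)
    show "integrable (lebesgue_on \<Omega>) (\<lambda>x. Cmon\<^sup>2 * (norm (eps \<Omega> u x - eps \<Omega> uh x))\<^sup>2)"
      by (rule Bochner_Integration.integrable_mult_right[OF L2_integrable[OF Ld]])
    show "integrable (lebesgue_on \<Omega>) (\<lambda>x. (\<sigma> (eps \<Omega> u x) - \<sigma> (eps \<Omega> uh x)) \<bullet> (eps \<Omega> u x - eps \<Omega> uh x))"
      using L2_ip_integrable[OF Lsd Ld] unfolding S_def .
  qed (rule mon[OF eps_sym eps_sym])
  also have "\<dots> = ip \<Omega> (\<lambda>x. \<sigma> (eps \<Omega> u x) - S x) (eps \<Omega> e)"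
    by (rule ip_cong_AE[OF Lsd Lsd Ld Le _ eae]) simp
  also have "\<dots> = ip \<Omega> f e - ip \<Omega> S (weak_grad \<Omega> e)"
  proof -
    have "ip \<Omega> S (eps \<Omega> e) = ip \<Omega> S (weak_grad \<Omega> e)" unfolding ip_def eps_symm inner_symm[OF E.S_sym] ..
    then show ?thesis unfolding ip_diff_left[OF Le L\<sigma>[OF u] E.S] u_eq[OF e] by simp
  qed
  also have "\<dots> \<le> \<eta> * L2norm \<Omega> (weak_grad \<Omega> e)"
    using E.residual_bound[OF dim e] unfolding \<eta>_def \<sigma>h S_def .
  also have "\<dots> \<le> \<eta> * (sqrt 2 * ?N)" by (rule mult_left_mono[OF korn(1)[OF e] \<eta>])
  finally have main: "(Cmon\<^sup>2 * ?N) * ?N \<le> (sqrt 2 * \<eta>) * ?N" by (simp add: power2_eq_square mult_ac)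
  have N: "?N \<le> sqrt 2 * \<eta> / Cmon\<^sup>2"
  proof (cases "?N = 0")
    case True
    then show ?thesis using \<eta> by simp
  next
    case False
    then have "?N > 0" using L2norm_nonneg[of \<Omega> "eps \<Omega> e"] by linarith
    then have "Cmon\<^sup>2 * ?N \<le> sqrt 2 * \<eta>" using main by (simp only: mult_le_cancel_right_pos)
    then show ?thesis using Cpos(2) by (simp add: pos_le_divide_eq mult.commute)
  qed
  \<comment> \<open>The growth bound estimates the energy norm by \<open>sqrt Cgro\<close> times the
    norm of the strain.\<close>
  have "(\<integral>x. \<sigma> (eps \<Omega> e x) \<bullet> eps \<Omega> e x \<partial>lebesgue_on \<Omega>) \<le> (\<integral>x. Cgro * (norm (eps \<Omega> e x))\<^sup>2 \<partial>lebesgue_on \<Omega>)"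
  proof (rule Bochner_Integration.integral_mono)
    show "integrable (lebesgue_on \<Omega>) (\<lambda>x. \<sigma> (eps \<Omega> e x) \<bullet> eps \<Omega> e x)" by (rule L2_ip_integrable[OF L\<sigma>[OF e] Le])
    show "integrable (lebesgue_on \<Omega>) (\<lambda>x. Cgro * (norm (eps \<Omega> e x))\<^sup>2)"
      by (rule Bochner_Integration.integrable_mult_right[OF L2_integrable[OF Le]])
    fix x
    have "\<sigma> (eps \<Omega> e x) \<bullet> eps \<Omega> e x \<le> norm (\<sigma> (eps \<Omega> e x)) * norm (eps \<Omega> e x)" by (rule norm_cauchy_schwarz)
    also have "\<dots> \<le> (Cgro * norm (eps \<Omega> e x)) * norm (eps \<Omega> e x)" by (rule mult_right_mono[OF gro[OF eps_sym] norm_ge_zero])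
    finally show "\<sigma> (eps \<Omega> e x) \<bullet> eps \<Omega> e x \<le> Cgro * (norm (eps \<Omega> e x))\<^sup>2" by (simp add: power2_eq_square mult.assoc)
  qed
  also have "\<dots> = Cgro * ?N\<^sup>2" unfolding L2norm_sq ip_def by (simp add: power2_norm_eq_inner)
  finally have "sqrt (\<integral>x. \<sigma> (eps \<Omega> e x) \<bullet> eps \<Omega> e x \<partial>lebesgue_on \<Omega>) \<le> sqrt (Cgro * ?N\<^sup>2)" by (rule real_sqrt_le_mono)
  also have "\<dots> = sqrt Cgro * ?N" by (simp add: real_sqrt_mult L2norm_nonneg)
  also have "\<dots> \<le> sqrt Cgro * (sqrt 2 * \<eta> / Cmon\<^sup>2)" using N Cpos(1) by (intro mult_left_mono) auto
  \<comment> \<open>Expanding the fraction by \<open>Cmon\<close> brings it to the denominator of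
    the claim.\<close>
  also have "\<dots> = sqrt 2 * \<eta> * (sqrt Cgro * Cmon) / Cmon ^ 3"
    using Cpos(2) by (simp add: power3_eq_cube power2_eq_square field_simps)
  also have "\<dots> \<le> sqrt 2 * \<eta> * Cgro / Cmon ^ 3"
  proof (intro divide_right_mono mult_left_mono)
    have sym1: "transpose (mat 1 :: real^'n^'n) = mat 1" by (rule transpose_mat)
    have sym0: "transpose (0 :: real^'n^'n) = 0" by (simp add: transpose_def vec_eq_iff)
    \<comment> \<open>Any nonzero symmetric matrix, compared with 0, relates the two constants; the
      identity is at hand.\<close>
    have "Cmon\<^sup>2 * (norm (mat 1 :: real^'n^'n))\<^sup>2 \<le> \<sigma> (mat 1) \<bullet> mat 1" using mon[OF sym1 sym0] by (simp add: sigma_zero)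
    also have "\<dots> \<le> norm (\<sigma> (mat 1)) * norm (mat 1 :: real^'n^'n)" by (rule norm_cauchy_schwarz)
    also have "\<dots> \<le> (Cgro * norm (mat 1 :: real^'n^'n)) * norm (mat 1 :: real^'n^'n)"
      by (rule mult_right_mono[OF gro[OF sym1] norm_ge_zero])
    finally have le: "Cmon\<^sup>2 * (norm (mat 1 :: real^'n^'n))\<^sup>2 \<le> Cgro * (norm (mat 1 :: real^'n^'n))\<^sup>2"
      by (simp add: power2_eq_square mult.assoc)
    have "(mat 1 :: real^'n^'n) \<noteq> 0"
    proof
      assume "(mat 1 :: real^'n^'n) = 0"
      then have "(mat 1 :: real^'n^'n) $ k $ k = 0" for k by simp
      then show False by (simp add: mat_def)
    qed
    then have "(norm (mat 1 :: real^'n^'n))\<^sup>2 > 0" by simp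
    then have "Cmon\<^sup>2 \<le> Cgro" using le by (simp only: mult_le_cancel_right_pos)
    then have "Cmon \<le> sqrt Cgro" by (rule real_le_rsqrt)
    then have "sqrt Cgro * Cmon \<le> sqrt Cgro * sqrt Cgro" using Cpos(1) by (intro mult_left_mono) auto
    then show "sqrt Cgro * Cmon \<le> Cgro" using Cpos(1) by simp
  qed (use \<eta> Cpos in auto)
  finally show ?thesis unfolding e_def \<eta>_def by (simp add: mult_ac)
qed

end
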